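(* Let $n\ge1$ be an integer, $r_0>0$, $p\in B_{r_0}(0)$, and let $u:B_{r_0}(0)\subseteq\mathbb{R}^2\to\mathbb{R}$ be a non-constant harmonic function with boundary value $u|_{S^1_{r_0}}\in L^1(S^1_{r_0})$ and $u(p)=0$. Assume that $u$ has only $n$ nodal curves in $B_{r_0}(0)$ and that they intersect at $p$. Then for every nodal curve $\gamma_k\subset Z(u)$, $$\Big|\kappa(u)|_{\gamma_k}(p)\Big|\le\frac{4(n+1)}{(r_0^2-|p|^2)\,n}\,r_0\cos n\alpha_0+\frac{2|p|}{r_0^2-|p|^2},$$ where $\alpha_0=0$ for odd $n$ and $\alpha_0=\frac{\pi}{2n(n+1)}$ for even $n$. Moreover, this inequality is sharp for all $n\ge1$.
   Context: $B_r(p)$ is the open disk of radius $r$ centered at $p$ in $\mathbb{R}^2\cong\mathbb{C}$, and $S^1_r=\partial B_r(0)$. The nodal set of $u$ is $Z(u)=\{u=0\}$; it is a union of maximal real-analytic curves, called nodal curves. The assumption "only $n$ nodal curves that intersect at $p$" means that $Z(u)\cap B_{r_0}(0)$ consists of exactly $n$ nodal curves, all passing through $p$ (so $u$ vanishes at $p$ to order $n$). "Boundary value $u|_{S^1_{r_0}}=g\in L^1$" means that $u$ is the Poisson integral of $g$ in $B_{r_0}(0)$. $\kappa(u)|_{\gamma_k}(p)$ is the curvature of the curve $\gamma_k$ at $p$. "Sharp" means that, for given $n$, $r_0$ and $p$, the right-hand side cannot be replaced by any smaller constant valid for all such $u$ and all nodal curves. *)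

theory Defs
  imports "HOL-Analysis.Analysis"
begin

text \<open>The plane is identified with \<^typ>\<open>complex\<close>.\<close>

text \<open>The functions \<open>ux, uy\<close> are the partial derivatives of \<open>u\<close>, and
  \<open>uxx, uxy, uyx, uyy\<close> those of \<open>ux\<close> and \<open>uy\<close>; so \<open>u\<close> is of class \<open>C\<^sup>2\<close>
  with vanishing Laplacian.\<close>

definition harmonic_on :: "(complex \<Rightarrow> real) \<Rightarrow> complex set \<Rightarrow> bool" where
  "harmonic_on u S \<longleftrightarrow> open S \<and>
    (\<exists>ux uy uxx uxy uyx uyy.
      (\<forall>z\<in>S. (u has_derivative (\<lambda>h. ux z * Re h + uy z * Im h)) (at z) \<and>
             (ux has_derivative (\<lambda>h. uxx z * Re h + uxy z * Im h)) (at z) \<and>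
             (uy has_derivative (\<lambda>h. uyx z * Re h + uyy z * Im h)) (at z) \<and>
             uxx z + uyy z = 0) \<and>
      continuous_on S uxx \<and> continuous_on S uxy \<and>
      continuous_on S uyx \<and> continuous_on S uyy)"

text \<open>Only the values of \<open>g\<close> on the circle of radius \<open>r\<close> about 0 matter below.\<close>

definition L1_circle :: "real \<Rightarrow> (complex \<Rightarrow> real) \<Rightarrow> bool" where
  "L1_circle r g \<longleftrightarrow> set_integrable lebesgue {0..2 * pi} (\<lambda>\<theta>. g (of_real r * cis \<theta>))"

definition poisson_integral :: "real \<Rightarrow> (complex \<Rightarrow> real) \<Rightarrow> complex \<Rightarrow> real" where
  "poisson_integral r g z =
    1 / (2 * pi) *
      (LINT \<theta>:{0..2 * pi}|lebesgue.
         (r\<^sup>2 - (norm z)\<^sup>2) / (norm (of_real r * cis \<theta> - z))\<^sup>2 * g (of_real r * cis \<theta>))"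

definition nodal_set :: "(complex \<Rightarrow> real) \<Rightarrow> complex set \<Rightarrow> complex set" where
  "nodal_set u D = {z \<in> D. u z = 0}"

definition real_analytic_curve_on :: "(real \<Rightarrow> complex) \<Rightarrow> real set \<Rightarrow> bool" where
  "real_analytic_curve_on \<gamma> I \<longleftrightarrow>
    (\<forall>t\<in>I. \<exists>a \<epsilon>. \<epsilon> > 0 \<and>
      (\<forall>s\<in>I. \<bar>s - t\<bar> < \<epsilon> \<longrightarrow> (\<lambda>k. a k * of_real (s - t) ^ k) sums \<gamma> s))"

definition regular_analytic_curve :: "real set \<Rightarrow> (real \<Rightarrow> complex) \<Rightarrow> bool" where
  "regular_analytic_curve I \<gamma> \<longleftrightarrow>
    open I \<and> is_interval I \<and> I \<noteq> {} \<and> real_analytic_curve_on \<gamma> I \<and>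
    (\<forall>t\<in>I. vector_derivative \<gamma> (at t) \<noteq> 0)"

text \<open>Regular analytic parametrizations of the nodal curves: maximality refers to the trace, so a
  nodal curve is a point set that does not depend on the parametrization. Regularity
  forces a curve to pass straight through a crossing point of the nodal set, instead of turning
  from one branch into another.\<close>

definition nodal_parametrization ::
    "(complex \<Rightarrow> real) \<Rightarrow> complex set \<Rightarrow> real set \<Rightarrow> (real \<Rightarrow> complex) \<Rightarrow> bool" where
  "nodal_parametrization u D I \<gamma> \<longleftrightarrow>
    regular_analytic_curve I \<gamma> \<and> \<gamma> ` I \<subseteq> nodal_set u D \<and>
    (\<forall>J \<delta>. regular_analytic_curve J \<delta> \<and> \<delta> ` J \<subseteq> nodal_set u D \<and> \<gamma> ` I \<subseteq> \<delta> ` J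
       \<longrightarrow> \<delta> ` J = \<gamma> ` I)"

definition nodal_curves :: "(complex \<Rightarrow> real) \<Rightarrow> complex set \<Rightarrow> complex set set" where
  "nodal_curves u D = {\<gamma> ` I | I \<gamma>. nodal_parametrization u D I \<gamma>}"

definition only_nodal_curves_through ::
    "(complex \<Rightarrow> real) \<Rightarrow> complex set \<Rightarrow> nat \<Rightarrow> complex \<Rightarrow> bool" where
  "only_nodal_curves_through u D n p \<longleftrightarrow>
    nodal_set u D = \<Union> (nodal_curves u D) \<and>
    finite (nodal_curves u D) \<and> card (nodal_curves u D) = n \<and>
    (\<forall>C\<in>nodal_curves u D. p \<in> C)"

text \<open>Signed curvature \<open>(x' y'' - y' x'') / |\<gamma>'|\<^sup>3\<close> for \<open>\<gamma> = x + \<i> y\<close>; its absolute value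
  does not depend on the parametrization.\<close>

definition curvature :: "(real \<Rightarrow> complex) \<Rightarrow> real \<Rightarrow> real" where
  "curvature \<gamma> t =
    (let v = vector_derivative \<gamma> (at t);
         w = vector_derivative (\<lambda>s. vector_derivative \<gamma> (at s)) (at t)
     in Im (cnj v * w) / norm v ^ 3)"

definition admissible :: "nat \<Rightarrow> real \<Rightarrow> complex \<Rightarrow> (complex \<Rightarrow> real) \<Rightarrow> bool" where
  "admissible n r p u \<longleftrightarrow>
    harmonic_on u (ball 0 r) \<and> \<not> u constant_on ball 0 r \<and>
    (\<exists>g. L1_circle r g \<and> (\<forall>z\<in>ball 0 r. u z = poisson_integral r g z)) \<and>
    u p = 0 \<and> only_nodal_curves_through u (ball 0 r) n p"

definition alpha0 :: "nat \<Rightarrow> real" where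
  "alpha0 n = (if odd n then 0 else pi / (2 * real n * (real n + 1)))"

definition curvature_bound :: "nat \<Rightarrow> real \<Rightarrow> complex \<Rightarrow> real" where
  "curvature_bound n r p =
    4 * (real n + 1) / ((r\<^sup>2 - (norm p)\<^sup>2) * real n) * r * cos (real n * alpha0 n)
    + 2 * norm p / (r\<^sup>2 - (norm p)\<^sup>2)"

end

theory Submission
  imports Defs "HOL-Complex_Analysis.Complex_Analysis"
begin

text \<open>Move \<open>p\<close> to the centre by a disc automorphism \<open>W\<close> and write \<open>u = Re F(W)\<close>; the coefficients of
  \<open>F\<close> are moments of the boundary density. No nodal curve closes up (maximum principle), so \<open>F\<close> vanishes
  at 0 to order \<open>n\<close> and every component of \<open>{u \<noteq> 0}\<close> reaches \<open>p\<close>; hence there are at most \<open>2n\<close> components, and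
  disjointness of paths in a disc shows that the boundary density changes sign at most \<open>2n\<close> times.
  Integrating the density against the trigonometric polynomial with these sign changes bounds the
  coefficient of order \<open>n + 1\<close> by that of order \<open>n\<close>, and the curvature at \<open>p\<close> is the imaginary part of their quotient
  in the direction of the curve. Equality holds in the limit for
  \<open>F(w) = w\<^sup>n (1 - w)\<^sup>-\<^sup>2\<^sup>n ((1 + w) / (1 - w) - \<i> tan (n \<alpha>\<^sub>0))\<close>, evaluated at \<open>\<lambda> W\<close> with \<open>\<lambda> \<rightarrow> 1\<close>.\<close>

text \<open>The first summand of the bound is an extremal value: the moment inequality leaves the
  maximum of \<open>\<bar>Re S\<bar> + cmod (1 + (-1) ^ Suc n * P)\<close>, where \<open>S\<close>
  and \<open>P\<close> are the sum and the product of \<open>2 * n\<close> unit numbers. For odd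
  \<open>n\<close> it is attained when all of them are 1. For even \<open>n\<close> the second term
  vanishes there, and the best compromise turns each of them by \<open>pi / (2 * (n + 1))\<close>,
  which is \<open>n * alpha0 n\<close>. The second summand is the modulus of the quotient of the
  first two derivatives of the disc automorphism at \<open>p\<close>. Two obstacles shape the proof.
  Nodal curves are given only through maximality of their traces, so neither the order of vanishing
  at \<open>p\<close> nor regularity of the nodal set elsewhere is known; both come from uniqueness
  of arcs in the nodal set. The boundary data are merely integrable, so signs make sense only up to
  null sets, and each sign has to be witnessed by a radius along which \<open>u\<close> has it. For
  sharpness, the nodal curves of explicit functions must be counted exactly; this rests on
  monotonicity of the modulus along the nodal set, which trigonometric inequalities provide.\<close>

section \<open>The trigonometric extremal problem behind the constant\<close>

text \<open>The difference between the tangent of \<open>cos\<close> at \<open>a\<close> and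
  \<open>cos\<close> itself falls, rises and falls again on \<open>[-pi, pi]\<close>, so its minimum
  is at \<open>a\<close> or at \<open>pi\<close>. The restriction on \<open>a\<close> makes the
  value at \<open>pi\<close> nonnegative.\<close>

lemma cos_le_tangent:
  fixes a t :: real
  assumes "-pi \<le> t" "t \<le> pi" "0 \<le> a" "a \<le> pi / 6"
  shows "cos t \<le> cos a + sin a * (a - t)"
proof -
  define g where "g = (\<lambda>t. cos a + sin a * (a - t) - cos t)"
  have D: "(g has_real_derivative (sin t - sin a)) (at t)" for t
    unfolding g_def by (auto intro!: derivative_eq_intros)
  have sa: "0 \<le> sin a" using assms pi_gt_zero by (intro sin_ge_zero) linarith+
  have ga: "g a = 0" by (simp add: g_def)
  consider "t \<le> a" | "a \<le> t" "t \<le> pi - a" | "pi - a \<le> t" by linarith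
  hence "0 \<le> g t"
  proof cases
    case 1
    have "g a \<le> g t"
    proof (rule DERIV_nonpos_imp_nonincreasing[OF 1])
      fix s assume s: "t \<le> s" "s \<le> a"
      have "sin s \<le> sin a"
      proof (cases "s \<le> 0")
        case True
        have "0 \<le> sin (-s)" using True s assms by (intro sin_ge_zero) linarith+
        thus ?thesis using sa by simp
      next
        case False
        thus ?thesis using s assms pi_gt_zero by (subst sin_mono_le_eq) linarith+
      qed
      thus "\<exists>y. (g has_real_derivative y) (at s) \<and> y \<le> 0" using D[of s] by (intro exI[of _ "sin s - sin a"]) simp
    qed
    thus ?thesis by (simp add: ga)
  next
    case 2
    have "g a \<le> g t"
    proof (rule DERIV_nonneg_imp_nondecreasing[OF 2(1)])
      fix s assume s: "a \<le> s" "s \<le> t"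
      have "sin a \<le> sin s"
      proof (cases "s \<le> pi/2")
        case True
        thus ?thesis using s assms pi_gt_zero by (subst sin_mono_le_eq) linarith+
      next
        case False
        have "sin a \<le> sin (pi - s)" using False s 2 assms pi_gt_zero by (subst sin_mono_le_eq) linarith+
        thus ?thesis by simp
      qed
      thus "\<exists>y. (g has_real_derivative y) (at s) \<and> 0 \<le> y" using D[of s] by (intro exI[of _ "sin s - sin a"]) simp
    qed
    thus ?thesis by (simp add: ga)
  next
    case 3
    have "g pi \<le> g t"
    proof (rule DERIV_nonpos_imp_nonincreasing[OF assms(2)])
      fix s assume s: "t \<le> s" "s \<le> pi"
      have "sin (pi - s) \<le> sin a" using s 3 assms pi_gt_zero by (subst sin_mono_le_eq) linarith+
      thus "\<exists>y. (g has_real_derivative y) (at s) \<and> y \<le> 0" using D[of s] by (intro exI[of _ "sin s - sin a"]) simp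
    qed
    \<comment> \<open>The other candidate for the minimum. Numerically
      \<open>5 * pi^2 / 36 < 3/2 \<le> 1 + cos a\<close>.\<close>
    moreover have "0 \<le> g pi"
    proof -
      have "sin a \<le> a" using assms by (simp add: sin_x_le_x)
      hence "sin a * (pi - a) \<le> a * (pi - a)" using assms pi_gt_zero by (intro mult_right_mono) linarith+
      also have "\<dots> \<le> (pi/6) * (5 * pi / 6)"
      proof -
        have "0 \<le> (pi/6 - a) * (5 * pi / 6 - a)" using assms pi_gt_zero by (intro mult_nonneg_nonneg) linarith+
        also have "\<dots> = (pi/6) * (5 * pi / 6) - a * (pi - a)" by (simp add: field_simps)
        finally show ?thesis by simp
      qed
      also have "\<dots> \<le> 3/2"
      proof -
        have "pi * pi \<le> 3.15 * 3.15" using pi_approx by (intro mult_mono) auto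
        thus ?thesis by simp
      qed
      also have "\<dots> \<le> 1 + cos a"
      proof -
        have "cos (pi/3) \<le> cos a" using assms pi_gt_zero by (intro cos_monotone_0_pi_le) linarith+
        thus ?thesis by (simp add: cos_60)
      qed
      finally show ?thesis by (simp add: g_def algebra_simps)
    qed
    ultimately show ?thesis by linarith
  qed
  thus ?thesis by (simp add: g_def)
qed

text \<open>The tangent of \<open>cos\<close> at \<open>a\<close>, read at
  \<open>pi / 2 - y\<close>. Past \<open>y = pi\<close> the right side is at least
  \<open>cos a + sin a\<close>, hence at least 1.\<close>

lemma abs_sin_le_tangent:
  fixes a y :: real
  assumes "0 \<le> y" "0 \<le> a" "a \<le> pi / 6"
  shows "\<bar>sin y\<bar> \<le> cos a + sin a * (a - pi / 2 + y)"
proof (cases "y \<le> pi")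
  case True
  have "cos (pi/2 - y) \<le> cos a + sin a * (a - (pi/2 - y))"
    using assms True pi_gt_zero by (intro cos_le_tangent) linarith+
  moreover have "0 \<le> sin y" using assms True by (intro sin_ge_zero) auto
  ultimately show ?thesis by (simp add: cos_diff algebra_simps)
next
  case False
  have sa: "0 \<le> sin a" using assms pi_gt_zero by (intro sin_ge_zero) linarith+
  have ca: "0 \<le> cos a" using assms pi_gt_zero by (intro cos_ge_zero) linarith+
  have "1 = (sin a)\<^sup>2 + (cos a)\<^sup>2" by simp
  also have "\<dots> \<le> sin a * 1 + cos a * 1"
    unfolding power2_eq_square using sa ca by (intro add_mono mult_left_mono) auto
  also have "\<dots> \<le> sin a * (a - pi/2 + y) + cos a"
    using False assms pi_approx sa by (intro add_mono mult_left_mono) (auto simp: field_simps)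
  finally show ?thesis using abs_sin_le_one[of y] by linarith
qed

text \<open>Every cosine, and the sine as well, is replaced by its tangent at the maximizer, where
  all \<open>t i\<close> equal \<open>a\<close>. The slopes in the sum of the \<open>t i\<close>
  cancel, and \<open>2 * (n + 1) * a = pi\<close> removes what is left of the constants. From
  \<open>n \<ge> 2\<close> one gets \<open>a \<le> pi / 6\<close>.\<close>

lemma unit_sum_bound_nonneg:
  fixes t :: "'i \<Rightarrow> real"
  assumes "finite I" "card I = 2 * n" "n \<ge> 2" "\<And>i. i \<in> I \<Longrightarrow> -pi \<le> t i \<and> t i \<le> pi" "0 \<le> (\<Sum>i\<in>I. t i)"
  shows "(\<Sum>i\<in>I. cos (t i)) + 2 * \<bar>sin ((\<Sum>i\<in>I. t i) / 2)\<bar> \<le> 2 * (real n + 1) * cos (pi / (2 * (real n + 1)))"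
proof -
  define a where "a = pi / (2 * (real n + 1))"
  have n: "real n \<ge> 2" using assms(3) by simp
  have a: "0 \<le> a" by (simp add: a_def)
  have "a \<le> pi / 6" unfolding a_def using n by (intro divide_left_mono) auto
  have Na: "2 * (real n + 1) * a = pi" using n by (simp add: a_def)
  define T where "T = (\<Sum>i\<in>I. t i)"
  have "(\<Sum>i\<in>I. cos (t i)) \<le> (\<Sum>i\<in>I. cos a + sin a * (a - t i))"
    using assms(4) a \<open>a \<le> pi/6\<close> by (intro sum_mono cos_le_tangent) auto
  also have "\<dots> = 2 * n * (cos a + sin a * a) - sin a * T"
    using assms(2) by (simp add: T_def algebra_simps sum.distrib sum_subtractf sum_distrib_left)
  finally have 1: "(\<Sum>i\<in>I. cos (t i)) \<le> 2 * n * (cos a + sin a * a) - sin a * T" .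
  have "\<bar>sin (T/2)\<bar> \<le> cos a + sin a * (a - pi / 2 + T/2)"
    using assms(5) a \<open>a \<le> pi/6\<close> by (intro abs_sin_le_tangent) (auto simp: T_def)
  hence "(\<Sum>i\<in>I. cos (t i)) + 2 * \<bar>sin (T/2)\<bar> \<le> 2 * n * (cos a + sin a * a) - sin a * T + 2 * (cos a + sin a * (a - pi / 2 + T/2))"
    by (intro add_mono 1 mult_left_mono) auto
  also have "\<dots> = 2 * (real n + 1) * cos a + sin a * (2 * (real n + 1) * a - pi)" by (simp add: algebra_simps)
  also have "\<dots> = 2 * (real n + 1) * cos a" unfolding Na by simp
  finally show ?thesis by (simp add: T_def a_def)
qed

lemma unit_sum_bound_even:
  fixes t :: "'i \<Rightarrow> real"
  assumes "finite I" "card I = 2 * n" "n \<ge> 2" "\<And>i. i \<in> I \<Longrightarrow> -pi \<le> t i \<and> t i \<le> pi"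
  shows "(\<Sum>i\<in>I. cos (t i)) + 2 * \<bar>sin ((\<Sum>i\<in>I. t i) / 2)\<bar> \<le> 2 * (real n + 1) * cos (pi / (2 * (real n + 1)))"
proof (cases "0 \<le> (\<Sum>i\<in>I. t i)")
  case True
  thus ?thesis using unit_sum_bound_nonneg[OF assms] by simp
next
  case False
  have "(\<Sum>i\<in>I. cos (- t i)) + 2 * \<bar>sin ((\<Sum>i\<in>I. - t i) / 2)\<bar> \<le> 2 * (real n + 1) * cos (pi / (2 * (real n + 1)))"
    by (rule unit_sum_bound_nonneg) (use assms False in \<open>force simp: sum_negf\<close>)+
  thus ?thesis by (simp add: sum_negf)
qed

lemma cmod_one_minus_cis: "cmod (1 - cis t) = 2 * \<bar>sin (t / 2)\<bar>"
proof -
  have "1 - cis t = cis (t/2) * (- 2 * \<i> * sin (t/2))"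
  proof -
    have "cis t = cis (t/2) * cis (t/2)" by (simp add: cis_mult)
    moreover have "(1::complex) = cis (t/2) * cis (-(t/2))" by (simp add: cis_mult)
    ultimately have "1 - cis t = cis (t/2) * (cis (-(t/2)) - cis (t/2))" by (simp add: algebra_simps)
    also have "cis (-(t/2)) - cis (t/2) = - 2 * \<i> * sin (t/2)" by (simp add: complex_eq_iff)
    finally show ?thesis .
  qed
  thus ?thesis by (simp add: norm_mult)
qed

text \<open>The origin of \<open>alpha0\<close>. For odd \<open>n\<close> this is the triangle
  inequality, with equality when all \<open>y i\<close> are 1. For even \<open>n\<close> the angles
  of the \<open>y i\<close> turn the second term into twice the sine of half their sum. Passing to
  \<open>- y i\<close> takes care of the absolute value, because a product of \<open>2 * n\<close>
  factors does not notice the sign.\<close>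

lemma unit_sum_bound:
  fixes y :: "'i \<Rightarrow> complex"
  assumes "finite I" "card I = 2 * n" "n \<ge> 1" "\<And>i. i \<in> I \<Longrightarrow> norm (y i) = 1"
  shows "\<bar>Re (\<Sum>i\<in>I. y i)\<bar> + norm (1 + (-1) ^ Suc n * (\<Prod>i\<in>I. y i)) \<le> 2 * (real n + 1) * cos (real n * alpha0 n)"
proof (cases "odd n")
  case True
  have "norm (\<Sum>i\<in>I. y i) \<le> (\<Sum>i\<in>I. 1)" using assms(4) by (intro sum_norm_le) auto
  hence "\<bar>Re (\<Sum>i\<in>I. y i)\<bar> \<le> 2 * n" using assms(2) abs_Re_le_cmod[of "\<Sum>i\<in>I. y i"] by simp
  moreover have "norm (1 + (-1) ^ Suc n * (\<Prod>i\<in>I. y i)) \<le> 1 + norm ((-1) ^ Suc n * (\<Prod>i\<in>I. y i))"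
    by (rule norm_triangle_le) simp
  moreover have "norm ((-1) ^ Suc n * (\<Prod>i\<in>I. y i)) = 1"
    using assms(4) by (simp add: norm_mult norm_power flip: prod_norm)
  ultimately show ?thesis using True by (simp add: alpha0_def)
next
  case False
  hence n2: "n \<ge> 2" using assms(3) by presburger
  have A: "real n * alpha0 n = pi / (2 * (real n + 1))" using False n2 by (simp add: alpha0_def)
  have bd: "Re (\<Sum>i\<in>I. z i) + norm (1 - (\<Prod>i\<in>I. z i)) \<le> 2 * (real n + 1) * cos (real n * alpha0 n)"
    if z: "\<And>i. i \<in> I \<Longrightarrow> norm (z i) = 1" for z :: "'i \<Rightarrow> complex"
  proof -
    define t where "t = (\<lambda>i. Arg (z i))"
    have zc: "z i = cis (t i)" if "i \<in> I" for i
      using z[OF that] cis_Arg[of "z i"] by (cases "z i = 0") (auto simp: t_def sgn_div_norm)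
    have "(\<Prod>i\<in>I. z i) = (\<Prod>i\<in>I. cis (t i))" using zc by (intro prod.cong) auto
    also have "\<dots> = cis (\<Sum>i\<in>I. t i)" using assms(1) by (induction I rule: finite_induct) (auto simp: cis_mult)
    finally have "norm (1 - (\<Prod>i\<in>I. z i)) = 2 * \<bar>sin ((\<Sum>i\<in>I. t i) / 2)\<bar>" by (simp add: cmod_one_minus_cis)
    moreover have "Re (\<Sum>i\<in>I. z i) = (\<Sum>i\<in>I. cos (t i))" using zc by (auto intro!: sum.cong)
    moreover have "-pi \<le> t i \<and> t i \<le> pi" for i using Arg_bounded[of "z i"] by (simp add: t_def)
    ultimately show ?thesis using unit_sum_bound_even[OF assms(1,2) n2, of t] by (simp add: A)
  qed
  have "(\<Prod>i\<in>I. - y i) = (\<Prod>i\<in>I. y i)" using assms(2) by (simp add: prod_uminus)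
  hence "Re (\<Sum>i\<in>I. - y i) + norm (1 - (\<Prod>i\<in>I. y i)) \<le> 2 * (real n + 1) * cos (real n * alpha0 n)"
    using bd[of "\<lambda>i. - y i"] assms(4) by simp
  moreover have "Re (\<Sum>i\<in>I. - y i) = - Re (\<Sum>i\<in>I. y i)" by (simp add: sum_negf)
  ultimately show ?thesis using False bd[of y] assms(4) by (simp add: abs_if)
qed

section \<open>Trigonometric inequalities for the nodal set of the extremal function\<close>

lemma abs_sin_mult_le: "\<bar>sin (real m * t)\<bar> \<le> real m * \<bar>sin t\<bar>"
proof (induction m)
  case (Suc m)
  have "\<bar>sin (real (Suc m) * t)\<bar> = \<bar>sin (real m * t) * cos t + cos (real m * t) * sin t\<bar>"
    by (simp add: distrib_right sin_add algebra_simps)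
  also have "\<dots> \<le> \<bar>sin (real m * t)\<bar> * \<bar>cos t\<bar> + \<bar>cos (real m * t)\<bar> * \<bar>sin t\<bar>"
    unfolding abs_mult[symmetric] by (rule abs_triangle_ineq)
  also have "\<dots> \<le> \<bar>sin (real m * t)\<bar> * 1 + 1 * \<bar>sin t\<bar>"
    by (intro add_mono mult_mono) auto
  finally show ?case using Suc by (simp add: algebra_simps)
qed simp

text \<open>The quotient \<open>R\<close> increases up to \<open>x\<close>, where
  \<open>(n + 1) * x = pi / 2\<close> makes its value \<open>cos x\<close>. The numerator of its
  derivative is \<open>n * sin s - sin (n * s) * cos ((n + 1) * s)\<close>, which is positive since
  \<open>sin (n * s) \<le> n * sin s\<close>.\<close>

lemma sin_ratio_less:
  fixes t x :: real
  assumes n: "n \<ge> 1" and t: "0 < t" "t < x" and x: "x = pi / (2 * (real n + 1))"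
  shows "sin (real n * t) < cos x * sin ((real n + 1) * t)"
proof -
  define R where "R = (\<lambda>t. sin (real n * t) / sin ((real n + 1) * t))"
  have nx: "(real n + 1) * x = pi / 2" by (simp add: x field_simps)
  have pos: "0 < sin ((real n + 1) * s)" "0 < sin (real n * s)" "0 < sin s" if "0 < s" "s \<le> x" for s
  proof -
    have a: "(real n + 1) * s \<le> pi / 2" unfolding nx[symmetric] using that by (intro mult_left_mono) auto
    have b: "real n * s \<le> (real n + 1) * s" "s \<le> (real n + 1) * s" using that n by (auto simp: algebra_simps)
    show "0 < sin ((real n + 1) * s)" using a that pi_gt_zero by (intro sin_gt_zero) (simp, linarith)
    show "0 < sin (real n * s)" using a b that n pi_gt_zero by (intro sin_gt_zero) (simp, linarith)
    show "0 < sin s" using a b that n pi_gt_zero by (intro sin_gt_zero) (simp, linarith)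
  qed
  have "R t < R x"
  proof (rule DERIV_pos_imp_increasing[OF t(2)])
    fix s assume "t \<le> s" "s \<le> x"
    hence s: "0 < s" "s \<le> x" using t by auto
    note p = pos[OF s]
    have "(R has_real_derivative (real n * cos (real n * s) * sin ((real n + 1) * s) - sin (real n * s) * ((real n + 1) * cos ((real n + 1) * s))) / (sin ((real n + 1) * s))\<^sup>2) (at s)"
      unfolding R_def using p(1) by (auto intro!: derivative_eq_intros simp: power2_eq_square algebra_simps)
    moreover have "0 < real n * cos (real n * s) * sin ((real n + 1) * s) - sin (real n * s) * ((real n + 1) * cos ((real n + 1) * s))"
    proof -
      have "sin s = sin ((real n + 1) * s - real n * s)" by (simp add: algebra_simps)
      also have "\<dots> = sin ((real n + 1) * s) * cos (real n * s) - cos ((real n + 1) * s) * sin (real n * s)"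
        by (rule sin_diff)
      finally have "real n * cos (real n * s) * sin ((real n + 1) * s) - sin (real n * s) * ((real n + 1) * cos ((real n + 1) * s))
         = real n * sin s - sin (real n * s) * cos ((real n + 1) * s)" by (simp only:) (simp add: algebra_simps)
      moreover have "sin (real n * s) \<le> real n * sin s" using abs_sin_mult_le[of n s] p by simp
      moreover have "sin (real n * s) * cos ((real n + 1) * s) < sin (real n * s) * 1"
      proof (intro mult_strict_left_mono)
        have "cos ((real n + 1) * s) < cos 0"
        proof (rule cos_monotone_0_pi)
          have "(real n + 1) * s \<le> (real n + 1) * x" using s by (intro mult_left_mono) auto
          thus "(real n + 1) * s \<le> pi" using nx pi_gt_zero by linarith
        qed (use s in auto)
        thus "cos ((real n + 1) * s) < 1" by simp
      qed (use p in auto)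
      ultimately show ?thesis by linarith
    qed
    moreover have "0 < (sin ((real n + 1) * s))\<^sup>2" using p(1) by simp
    ultimately show "\<exists>y. (R has_real_derivative y) (at s) \<and> 0 < y"
      using divide_pos_pos by blast
  qed
  moreover have "R x = cos x"
  proof -
    have "real n * x = pi / 2 - x" using nx by (simp add: algebra_simps)
    hence "sin (real n * x) = cos x" by (simp add: cos_sin_eq)
    thus ?thesis by (simp add: R_def nx)
  qed
  ultimately show ?thesis using pos[of t] t by (simp add: R_def field_simps)
qed

text \<open>With \<open>k = 2 * n + 1\<close>, the estimate of \<open>sin (k * t)\<close> by
  \<open>k * sin t\<close> is strict on this interval, and \<open>rho^2\<close> is at most
  \<open>1 / k\<close>.\<close>

lemma trig_quadratic_pos_odd:
  fixes t rho :: real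
  assumes n: "n \<ge> 1" and t: "0 < t" "t < pi / (real n + 1)"
    and rho: "(2 * real n + 1) * rho\<^sup>2 \<le> 1"
  shows "0 < sin t + rho\<^sup>2 * sin ((2 * real n + 1) * t)"
proof -
  have "pi / (real n + 1) < pi" using n by (simp add: field_simps)
  hence s: "0 < sin t" using t by (intro sin_gt_zero) linarith+
  have c: "\<bar>cos t\<bar> < 1"
  proof -
    have "(sin t)\<^sup>2 > 0" using s by simp
    hence "(cos t)\<^sup>2 < 1" using sin_cos_squared_add[of t] by linarith
    thus ?thesis by (simp add: abs_square_less_1)
  qed
  have e: "sin ((2 * real n + 1) * t) = sin (real (2 * n) * t) * cos t + cos (real (2 * n) * t) * sin t"
    by (simp add: distrib_right sin_add)
  have "\<bar>sin ((2 * real n + 1) * t)\<bar> \<le> \<bar>sin (real (2 * n) * t)\<bar> * \<bar>cos t\<bar> + \<bar>cos (real (2 * n) * t)\<bar> * \<bar>sin t\<bar>"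
    unfolding e abs_mult[symmetric] by (rule abs_triangle_ineq)
  also have "\<dots> \<le> (real (2 * n) * \<bar>sin t\<bar>) * \<bar>cos t\<bar> + 1 * \<bar>sin t\<bar>"
    by (intro add_mono mult_right_mono abs_sin_mult_le) auto
  also have "\<dots> < (real (2 * n) * \<bar>sin t\<bar>) * 1 + 1 * \<bar>sin t\<bar>"
    using s c n by (intro add_strict_right_mono mult_strict_left_mono) auto
  finally have l: "\<bar>sin ((2 * real n + 1) * t)\<bar> < (2 * real n + 1) * sin t" using s by (simp add: algebra_simps)
  show ?thesis
  proof (cases "rho = 0")
    case False
    have "rho\<^sup>2 * \<bar>sin ((2 * real n + 1) * t)\<bar> < rho\<^sup>2 * ((2 * real n + 1) * sin t)"
      using l False by (intro mult_strict_left_mono) auto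
    also have "\<dots> \<le> 1 * sin t" using mult_right_mono[OF rho, of "sin t"] s by (simp add: algebra_simps)
    finally have "rho\<^sup>2 * \<bar>sin ((2 * real n + 1) * t)\<bar> < sin t" by simp
    moreover have "- (rho\<^sup>2 * \<bar>sin ((2 * real n + 1) * t)\<bar>) \<le> rho\<^sup>2 * sin ((2 * real n + 1) * t)"
      unfolding mult_minus_right[symmetric] by (intro mult_left_mono) auto
    ultimately show ?thesis by linarith
  qed (use s in auto)
qed

text \<open>A quadratic polynomial in \<open>rho\<close>. For \<open>t < x\<close> its leading
  coefficient is positive and its discriminant negative. For \<open>t \<ge> x\<close> the leading
  coefficient may be negative; there \<open>sg \<ge> - sin t\<close> and the smallness of
  \<open>rho\<close> suffice.\<close>

lemma trig_quadratic_pos_even: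
  fixes t rho sg x :: real
  assumes n: "n \<ge> 2" and t: "0 < t" "t < pi / (real n + 1)"
    and rho: "0 \<le> rho" "(2 * real n + 1) * rho\<^sup>2 \<le> 1"
    and x: "x = pi / (2 * (real n + 1))" and sg: "\<bar>sg\<bar> \<le> sin x"
  shows "0 < sin t + rho\<^sup>2 * sin ((2 * real n + 1) * t) + 2 * sg * rho * sin ((real n + 1) * t)"
proof -
  define N where "N = real n + 1"
  define S where "S = sin (N * t)"
  define K where "K = sin ((2 * real n + 1) * t)"
  have N3: "N \<ge> 3" using n by (simp add: N_def)
  have Nx: "N * x = pi / 2" and x0: "x > 0" using N3 by (simp_all add: x N_def field_simps)
  have Nt: "N * t < pi" using t N3 by (simp add: N_def field_simps)
  have S: "0 < S" unfolding S_def using t N3 Nt by (intro sin_gt_zero) auto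
  have tpi: "t < pi / 3"
  proof -
    have "pi / N \<le> pi / 3" using N3 by (intro divide_left_mono) auto
    thus ?thesis using t unfolding N_def by linarith
  qed
  have st: "0 < sin t" using t tpi pi_gt_zero by (intro sin_gt_zero) linarith+
  have Kt: "(2 * real n + 1) * t = 2 * (N * t) - t" by (simp add: N_def algebra_simps)
  have N1: "real n + 1 = N" by (simp add: N_def)
  show ?thesis
  proof (cases "t < x")
    case True
    have K: "0 < K" unfolding K_def
    proof (rule sin_gt_zero)
      have "N * t < N * x" using True N3 by simp
      thus "(2 * real n + 1) * t < pi" using Nx t Kt by linarith
    qed (use t in auto)
    have "sin (real n * t) < cos x * S" unfolding S_def N_def
      using sin_ratio_less[of n t x] True t x n by auto
    moreover have "0 \<le> sin (real n * t)"
      using t Nt N3 by (intro sin_ge_zero) (auto simp: N_def algebra_simps)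
    ultimately have "(sin (real n * t))\<^sup>2 < (cos x * S)\<^sup>2" by (intro power_strict_mono) auto
    \<comment> \<open>Together with \<open>sin (n * t) < cos x * S\<close> this identity gives
      \<open>sin t * K > (sin x * S)^2\<close>: the discriminant is negative.\<close>
    moreover have "sin t * K = S\<^sup>2 - (sin (real n * t))\<^sup>2"
    proof -
      have a: "t = N * t - real n * t" "(2 * real n + 1) * t = N * t + real n * t" by (simp_all add: N_def algebra_simps)
      have "sin t * K = sin (N * t - real n * t) * sin (N * t + real n * t)" using a by (simp add: K_def)
      also have "\<dots> = (sin (N*t) * cos (real n * t))\<^sup>2 - (cos (N * t) * sin (real n * t))\<^sup>2"
        by (simp add: sin_diff sin_add power2_eq_square algebra_simps)
      also have "\<dots> = S\<^sup>2 - (sin (real n * t))\<^sup>2"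
        by (simp add: power_mult_distrib cos_squared_eq S_def algebra_simps)
      finally show ?thesis .
    qed
    moreover have "(cos x * S)\<^sup>2 + (sin x * S)\<^sup>2 = S\<^sup>2"
      by (simp add: power_mult_distrib cos_squared_eq algebra_simps)
    moreover have "(sg * S)\<^sup>2 \<le> (sin x * S)\<^sup>2"
      using sg S by (simp add: power_mult_distrib abs_le_square_iff[symmetric])
    ultimately have "0 < K * sin t - (sg * S)\<^sup>2" by (simp add: mult.commute)
    hence "0 < (K * rho + sg * S)\<^sup>2 + (K * sin t - (sg * S)\<^sup>2)" by (intro add_nonneg_pos) auto
    also have "\<dots> = K * (sin t + rho\<^sup>2 * K + 2 * sg * rho * S)"
      by (simp add: power2_eq_square algebra_simps)
    finally show ?thesis using K by (simp add: zero_less_mult_iff K_def S_def N_def)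
  next
    case False
    hence tx: "x \<le> t" by simp
    define m where "m = N * t - pi / 2"
    have m: "0 \<le> m" "m < pi / 2"
      using mult_left_mono[OF tx, of N] N3 Nx Nt by (auto simp: m_def)
    define c where "c = cos m"
    have Nm: "N * t = pi / 2 + m" by (simp add: m_def)
    have Sc: "S = c" by (simp add: S_def Nm c_def sin_add)
    have c: "0 \<le> c" "c \<le> 1" using m by (auto simp: c_def intro!: cos_ge_zero)
    have K: "K = - sin (2 * m) * cos t + cos (2 * m) * sin t"
    proof -
      have e: "(2 * real n + 1) * t = pi + (2 * m - t)" unfolding Kt m_def right_diff_distrib by simp
      have "K = - sin (2 * m - t)" unfolding K_def e by simp
      thus ?thesis by (simp add: sin_diff)
    qed
    have sx: "sin x \<le> sin t" using tx x0 tpi pi_gt_zero by (subst sin_mono_le_eq) linarith+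
    have r5: "rho\<^sup>2 \<le> 1/5"
    proof -
      have "5 * rho\<^sup>2 \<le> (2 * real n + 1) * rho\<^sup>2" using n by (intro mult_right_mono) auto
      thus ?thesis using rho by linarith
    qed
    \<comment> \<open>The number is slightly larger than \<open>1 / sqrt 5\<close>, the bound that
      \<open>n \<ge> 2\<close> provides.\<close>
    have "rho \<le> 0.4473" by (rule power2_le_imp_le[of rho "0.4473"]) (use r5 in \<open>simp_all add: power2_eq_square\<close>)
    hence rc: "0 \<le> rho * c" "rho * c \<le> 0.4473" using c rho mult_mono[of rho "0.4473" c 1] by auto
    \<comment> \<open>For \<open>y = rho * c < 1/2\<close> the polynomial
      \<open>1 - 2 * y + 2 * y^2\<close> decreases, so its value at \<open>0.4473\<close> bounds it
      from below.\<close>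
    have A: "3/10 < 1 - 2 * rho * c + rho\<^sup>2 * cos (2 * m)"
    proof -
      have "1 - 2 * rho * c + rho\<^sup>2 * cos (2 * m) = 1 - 2 * (rho * c) + 2 * (rho * c)\<^sup>2 - rho\<^sup>2"
        unfolding cos_double_cos c_def[symmetric] by (simp add: power2_eq_square algebra_simps)
      moreover have "1 - 2 * (rho * c) + 2 * (rho * c)\<^sup>2 \<ge> 101/200"
      proof -
        have "0 \<le> (0.4473 - rho * c) * (1 - 0.4473 - rho * c)" using rc by (intro mult_nonneg_nonneg) auto
        thus ?thesis by (simp add: power2_eq_square algebra_simps)
      qed
      ultimately show ?thesis using r5 by linarith
    qed
    \<comment> \<open>Since \<open>N * t = pi / 2 + m\<close>, it is enough that
      \<open>rho^2 * N \<le> 3/5\<close> and that \<open>sin (2 * m)\<close> is at most half of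
      \<open>pi / 2 + m\<close>.\<close>
    have B: "rho\<^sup>2 * sin (2 * m) \<le> 3/10 * t"
    proof -
      have s2: "0 \<le> sin (2 * m)" using m by (intro sin_ge_zero) auto
      have "rho\<^sup>2 * N \<le> 3/5"
      proof -
        have "5 * (rho\<^sup>2 * N) \<le> 3 * ((2 * real n + 1) * rho\<^sup>2)"
          using mult_right_mono[of "5 * N" "3 * (2 * real n + 1)" "rho\<^sup>2"] n by (simp add: N_def algebra_simps)
        thus ?thesis using rho by linarith
      qed
      hence "rho\<^sup>2 * N * sin (2*m) \<le> 3/5 * sin (2 * m)" using s2 by (rule mult_right_mono)
      also have "\<dots> \<le> 3/10 * (pi / 2 + m)"
      proof (cases "m \<le> 1/2")
        case True
        have "sin (2 * m) \<le> 2 * m" using m by (intro sin_x_le_x) auto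
        thus ?thesis using True m pi_approx by simp
      next
        case False
        have "3/5 * sin (2 * m) \<le> 3/5 * 1" by (intro mult_left_mono) auto
        also have "\<dots> \<le> 3/10 * (pi / 2 + m)" using False pi_approx by simp
        finally show ?thesis .
      qed
      also have "\<dots> = 3/10 * t * N" unfolding Nm[symmetric] by simp
      finally have "rho\<^sup>2 * sin (2 * m) * N \<le> 3/10 * t * N" by (simp add: mult_ac)
      thus ?thesis by (rule mult_right_le_imp_le) (use N3 in auto)
    qed
    have ct: "0 < cos t" using t tpi pi_gt_zero by (intro cos_gt_zero_pi) linarith+
    have C: "t * cos t \<le> sin t"
    proof -
      have "sin 0 - 0 * cos 0 \<le> sin t - t * cos t"
      proof (rule DERIV_nonneg_imp_nondecreasing[of 0 t])
        fix s assume s: "0 \<le> s" "s \<le> t"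
        have "((\<lambda>t. sin t - t * cos t) has_real_derivative s * sin s) (at s)"
          by (auto intro!: derivative_eq_intros)
        moreover have "0 \<le> s * sin s" using s tpi pi_gt_zero by (intro mult_nonneg_nonneg sin_ge_zero) linarith+
        ultimately show "\<exists>y. ((\<lambda>t. sin t - t * cos t) has_real_derivative y) (at s) \<and> 0 \<le> y" by blast
      qed (use t in auto)
      thus ?thesis by simp
    qed
    have "rho\<^sup>2 * sin (2 * m) * cos t \<le> 3/10 * t * cos t" using B ct by (intro mult_right_mono) auto
    also have "\<dots> \<le> 3/10 * sin t" using C by simp
    also have "\<dots> < (1 - 2 * rho * c + rho\<^sup>2 * cos (2 * m)) * sin t" using A st by (intro mult_strict_right_mono) auto
    also have "\<dots> = sin t + rho\<^sup>2 * cos (2 * m) * sin t + 2 * rho * c * (- sin t)" by (simp add: algebra_simps)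
    also have "\<dots> \<le> sin t + rho\<^sup>2 * cos (2 * m) * sin t + 2 * rho * c * sg"
      using sg sx rho c by (intro add_left_mono mult_left_mono) auto
    finally show ?thesis unfolding N1 K_def[symmetric] S_def[symmetric] Sc K by (simp add: algebra_simps)
  qed
qed

lemma alpha0_range:
  assumes "n \<ge> 1"
  shows "0 \<le> real n * alpha0 n" "real n * alpha0 n < pi / 2"
proof -
  have *: "real n * alpha0 n = (if odd n then 0 else pi / (2 * (real n + 1)))" using assms by (simp add: alpha0_def)
  have "pi / (2 * (real n + 1)) < pi / 2" using assms by (intro divide_strict_left_mono) auto
  thus "0 \<le> real n * alpha0 n" "real n * alpha0 n < pi / 2" unfolding * by auto
qed

lemma trig_quadratic_pos:
  fixes t rho sg :: real
  assumes n: "n \<ge> 1" and t: "0 < t" "t < pi / (real n + 1)"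
    and rho: "0 \<le> rho" "(2 * real n + 1) * rho\<^sup>2 \<le> 1"
    and sg: "\<bar>sg\<bar> \<le> sin (real n * alpha0 n)"
  shows "0 < sin t + rho\<^sup>2 * sin ((2 * real n + 1) * t) + 2 * sg * rho * sin ((real n + 1) * t)"
proof (cases "odd n")
  case True
  hence "sg = 0" using sg by (simp add: alpha0_def)
  thus ?thesis using trig_quadratic_pos_odd[OF n t rho(2)] by simp
next
  case False
  hence n2: "n \<ge> 2" using n by presburger
  have "real n * alpha0 n = pi / (2 * (real n + 1))" using False n2 by (simp add: alpha0_def)
  thus ?thesis using trig_quadratic_pos_even[OF n2 t rho] sg by simp
qed

text \<open>If the inequality failed, \<open>t = e / n\<close> would satisfy
  \<open>(n + 1) * t \<le> L\<close>; but \<open>A * sin (L - (n + 1) * t)\<close> expands to minus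
  the quadratic of \<open>trig_quadratic_pos\<close>. The point with polar coordinates
  \<open>A\<close>, \<open>L\<close> runs on an ellipse with semi-axes \<open>1 + rho^2\<close> and
  \<open>1 - rho^2\<close>, shifted by \<open>2 * sg * rho\<close>.\<close>

lemma Arg_ellipse_less:
  fixes L e rho sg :: real
  assumes n: "n \<ge> 1" and e: "0 < e" "e < pi"
    and rho: "0 \<le> rho" "(2 * real n + 1) * rho\<^sup>2 \<le> 1"
    and sg: "\<bar>sg\<bar> \<le> sin (real n * alpha0 n)"
    and L: "0 < L" "L < pi" and A: "A > 0"
    and eq: "A * cos L = (1 + rho\<^sup>2) * cos e + 2 * sg * rho" "A * sin L = (1 - rho\<^sup>2) * sin e"
  shows "real n * L < (real n + 1) * e"
proof (rule ccontr)
  assume neg: "\<not> real n * L < (real n + 1) * e"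
  define t where "t = e / real n"
  have et: "e = real n * t" and t0: "0 < t" using n e by (auto simp: t_def)
  have Lt: "(real n + 1) * t \<le> L"
  proof -
    have "real n * ((real n + 1) * t) \<le> real n * L" using neg et by (simp add: algebra_simps)
    thus ?thesis using n by simp
  qed
  have tl: "t < pi / (real n + 1)" using Lt L n by (simp add: field_simps)
  have "0 \<le> A * sin (L - (real n + 1) * t)"
  proof (intro mult_nonneg_nonneg sin_ge_zero)
    have "0 \<le> (real n + 1) * t" using t0 by simp
    thus "L - (real n + 1) * t \<le> pi" using L by linarith
  qed (use Lt A in auto)
  also have "\<dots> = (A * sin L) * cos ((real n + 1) * t) - (A * cos L) * sin ((real n + 1) * t)"
    by (simp add: sin_diff algebra_simps)
  also have "\<dots> = (sin e * cos ((real n + 1) * t) - cos e * sin ((real n + 1) * t))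
      - rho\<^sup>2 * (sin e * cos ((real n + 1) * t) + cos e * sin ((real n + 1) * t))
      - 2 * sg * rho * sin ((real n + 1) * t)"
    unfolding eq by (simp add: algebra_simps)
  also have "\<dots> = sin (e - (real n + 1) * t) - rho\<^sup>2 * sin (e + (real n + 1) * t) - 2 * sg * rho * sin ((real n + 1) * t)"
    by (simp only: sin_diff sin_add)
  also have "e - (real n + 1) * t = - t" by (simp add: et algebra_simps)
  also have "e + (real n + 1) * t = (2 * real n + 1) * t" by (simp add: et algebra_simps)
  finally show False using trig_quadratic_pos[OF n t0 tl rho sg] by simp
qed

text \<open>In the half-plane coordinate the extremal function is \<open>(\<zeta>\<^sup>2 - 1)\<^sup>n (\<zeta> - \<i> s)\<close>; its radial
  logarithmic derivative is negative only in a half-disc about \<open>\<i> s\<close>, which the nodal set has to avoid.\<close>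

lemma extremal_nodal_set_avoids_halfdisc:
  fixes z :: complex and n :: nat
  defines "x \<equiv> real n * alpha0 n"
  assumes n: "n \<ge> 1" and z: "Re z > 0" and u: "Re ((z\<^sup>2 - 1) ^ n * (z - \<i> * tan x)) = 0"
  shows "1 + (tan x)\<^sup>2 < (2 * real n + 1) * (cmod (z - \<i> * tan x))\<^sup>2"
proof (rule ccontr)
  assume neg: "\<not> ?thesis"
  have cx: "cos x > 0" unfolding x_def using alpha0_range[OF n] by (intro cos_gt_zero_pi) linarith+
  define ch where "ch = z - \<i> * tan x"
  \<comment> \<open>Polar coordinates of \<open>ch\<close>, scaled by \<open>cos x\<close> so that
    the disc becomes \<open>(2 * n + 1) * rho^2 \<le> 1\<close>, and turned so that the half-plane
    becomes \<open>0 < e < pi\<close>.\<close>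
  define rho where "rho = cos x * cmod ch"
  define e where "e = pi / 2 - Arg ch"
  define sg where "sg = sin x"
  have Rch: "Re ch > 0" using z by (simp add: ch_def)
  hence ch0: "ch \<noteq> 0" by auto
  have "\<bar>Arg ch\<bar> < pi / 2" using Rch Arg_Re_pos [of ch] by simp
  hence e: "0 < e" "e < pi" by (auto simp: e_def abs_if split: if_splits)
  have rho0: "rho > 0" using cx ch0 by (simp add: rho_def)
  have rho1: "(2 * real n + 1) * rho\<^sup>2 \<le> 1"
  proof -
    have "(cos x)\<^sup>2 * ((2 * real n + 1) * (cmod ch)\<^sup>2) \<le> (cos x)\<^sup>2 * (1 + (tan x)\<^sup>2)"
      using neg by (intro mult_left_mono) (auto simp: ch_def)
    also have "\<dots> = 1" using cx by (simp add: tan_def power_divide distrib_left)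
    finally show ?thesis by (simp add: rho_def power_mult_distrib mult_ac)
  qed
  have rho2: "rho\<^sup>2 < 1"
  proof -
    have "1 * rho\<^sup>2 < (2 * real n + 1) * rho\<^sup>2" using n rho0 by (intro mult_strict_right_mono) auto
    thus ?thesis using rho1 by linarith
  qed
  have cch: "cos x * ch = rho * (\<i> * cis (-e))"
  proof -
    have "ch = cmod ch * cis (Arg ch)" using rcis_cmod_Arg[of ch] by (simp add: rcis_def)
    moreover have "cis (Arg ch) = \<i> * cis (-e)" by (auto simp: e_def complex_eq_iff sin_diff cos_diff)
    ultimately show ?thesis by (simp add: rho_def mult_ac)
  qed
  define l where "l = Complex ((1 + rho\<^sup>2) * cos e + 2 * sg * rho) ((1 - rho\<^sup>2) * sin e)"
  have Iml: "Im l > 0" using rho2 e by (simp add: l_def sin_gt_zero)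
  hence l0: "l \<noteq> 0" by auto
  define L where "L = Arg l"
  have L: "0 < L" "L < pi" unfolding L_def using Iml Arg_lt_pi[of l] by auto
  have ll: "l = cmod l * cis L" using rcis_cmod_Arg[of l] by (simp add: rcis_def L_def)
  have lc: "cmod l * cos L = (1 + rho\<^sup>2) * cos e + 2 * sg * rho" "cmod l * sin L = (1 - rho\<^sup>2) * sin e"
    using arg_cong[OF ll, of Re] arg_cong[OF ll, of Im] by (auto simp: l_def)
  \<comment> \<open>Up to scaling, \<open>z^2 - 1\<close> is a quadratic polynomial in
    \<open>rho * cis (-e)\<close>; pulling out one factor \<open>cis (-e)\<close> leaves the ellipse
    point \<open>l\<close>.\<close>
  have key: "(complex_of_real (cos x))\<^sup>2 * (z\<^sup>2 - 1) = - (cis (-e) * l)"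
  proof -
    define C T G R where "C = complex_of_real (cos x)" and "T = complex_of_real (tan x)"
      and "G = complex_of_real sg" and "R = complex_of_real rho"
    have CT: "C * T = G" using cx by (simp add: tan_def sg_def C_def T_def G_def)
    have GC: "G\<^sup>2 + C\<^sup>2 = 1" by (simp add: sg_def G_def C_def flip: of_real_power of_real_add)
    have zc: "z = ch + \<i> * T" by (simp add: ch_def T_def)
    have cc: "C * ch = R * (\<i> * cis (-e))" using cch by (simp add: C_def R_def)
    have "C\<^sup>2 * (z\<^sup>2 - 1) = (C * ch)\<^sup>2 + 2 * \<i> * (C * T) * (C * ch) - ((C * T)\<^sup>2 + C\<^sup>2)"
      unfolding zc by (simp add: power2_eq_square algebra_simps)
    also have "\<dots> = (C * ch)\<^sup>2 + 2 * \<i> * G * (C * ch) - 1" unfolding CT GC ..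
    also have "\<dots> = - (1 + 2 * G * R * cis (-e) + R\<^sup>2 * (cis (-e))\<^sup>2)"
      unfolding cc by (simp add: power2_eq_square algebra_simps)
    also have "1 + 2 * G * R * cis (-e) + R\<^sup>2 * (cis (-e))\<^sup>2 = cis (-e) * (cis e + 2 * G * R + R\<^sup>2 * cis (-e))"
    proof -
      have "cis (-e) * cis e = 1" by (simp add: cis_mult)
      thus ?thesis by (simp add: power2_eq_square distrib_left mult_ac)
    qed
    also have "cis e + 2 * G * R + R\<^sup>2 * cis (-e) = l"
      by (simp add: l_def G_def R_def complex_eq_iff algebra_simps flip: of_real_power)
    finally show ?thesis by (simp add: C_def)
  qed
  have ln: "l ^ n = complex_of_real (cmod l ^ n) * cis (real n * L)"
    by (subst ll) (simp only: power_mult_distrib Complex.DeMoivre of_real_power)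
  have en: "cis (-e) ^ n = cis (- (real n * e))" by (simp only: Complex.DeMoivre mult_minus_right)
  have cc: "cis (- (real n * e)) * cis (real n * L) * cis (-e) = cis (real n * L - (real n + 1) * e)"
    unfolding cis_mult by (rule arg_cong[where f = cis]) (simp add: algebra_simps)
  define a where "a = (-1)^n * cmod l ^ n * rho"
  define X where "X = (z\<^sup>2 - 1) ^ n * ch"
  have "complex_of_real ((cos x)^(2 * n + 1)) * X = ((complex_of_real (cos x))\<^sup>2 * (z\<^sup>2 - 1)) ^ n * (cos x * ch)"
    unfolding X_def of_real_power power_add power_mult power_one_right power_mult_distrib by (simp only: of_real_mult of_real_power mult_ac)
  also have "\<dots> = (-1) ^ n * (cis (-e) ^ n * l ^ n) * (rho * (\<i> * cis (-e)))"
    using key unfolding cch by (simp only: of_real_power power_minus[of "cis (-e) * l"] power_mult_distrib)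
  also have "\<dots> = a * (\<i> * (cis (- (real n * e)) * cis (real n * L) * cis (-e)))"
    unfolding ln en a_def by (simp only: of_real_mult of_real_power of_real_minus of_real_1 mult_ac)
  also have "\<dots> = a * (\<i> * cis (real n * L - (real n + 1) * e))" unfolding cc ..
  finally have "Re (complex_of_real ((cos x)^(2 * n + 1)) * X) = Re (a * (\<i> * cis (real n * L - (real n + 1) * e)))"
    by (rule arg_cong)
  moreover have "Re X = 0" using u by (simp add: ch_def X_def)
  ultimately have "Re (complex_of_real a * (\<i> * cis (real n * L - (real n + 1) * e))) = 0"
    by simp
  hence "a * sin (real n * L - (real n + 1) * e) = 0" by simp
  moreover have "a \<noteq> 0" using l0 rho0 by (simp add: a_def)
  ultimately have s0: "sin (real n * L - (real n + 1) * e) = 0" by simp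
  have sgx: "\<bar>sg\<bar> \<le> sin (real n * alpha0 n)" "\<bar>- sg\<bar> \<le> sin (real n * alpha0 n)"
  proof -
    have "0 \<le> sin x" unfolding x_def using alpha0_range[OF n] by (intro sin_ge_zero) linarith+
    thus "\<bar>sg\<bar> \<le> sin (real n * alpha0 n)" "\<bar>- sg\<bar> \<le> sin (real n * alpha0 n)" by (auto simp: sg_def x_def)
  qed
  \<comment> \<open>The second bound is the first one after the reflection of \<open>e\<close> to
    \<open>pi - e\<close>, of \<open>L\<close> to \<open>pi - L\<close> and of \<open>sg\<close> to
    \<open>- sg\<close>. Together they place the phase strictly between 0 and \<open>pi\<close>,
    where its sine cannot vanish.\<close>
  have "real n * L < (real n + 1) * e"
    by (rule Arg_ellipse_less[OF n e less_imp_le[OF rho0] rho1 sgx(1) L _ lc]) (use l0 in auto)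
  moreover have "real n * (pi - L) < (real n + 1) * (pi - e)"
    by (rule Arg_ellipse_less[OF n _ _ less_imp_le[OF rho0] rho1 sgx(2), where A = "cmod l"]) (use l0 e L lc in auto)
  ultimately have "0 < (real n + 1) * e - real n * L" "(real n + 1) * e - real n * L < pi"
    by (auto simp: algebra_simps)
  hence "0 < sin ((real n + 1) * e - real n * L)" by (rule sin_gt_zero)
  moreover have "sin ((real n + 1) * e - real n * L) = - sin (real n * L - (real n + 1) * e)"
    by (metis minus_diff_eq sin_minus)
  ultimately show False using s0 by simp
qed

text \<open>If the \<open>k\<close>-th power is real, \<open>k * Arg x\<close> is a multiple of
  \<open>pi\<close>, and near 1 it is smaller than \<open>pi\<close> in modulus. This is what holds
  a curve on the line to which it is tangent.\<close>

lemma real_powers_near_1: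
  fixes k :: nat
  assumes "k \<ge> 1"
  obtains d where "d > 0" "\<And>x. cmod (x - 1) < d \<Longrightarrow> Im (x ^ k) = 0 \<Longrightarrow> Im x = 0 \<and> Re x > 0"
proof -
  have "isCont Arg 1" by (rule continuous_at_Arg) auto
  moreover have "pi / k > 0" using assms by simp
  ultimately obtain d where d: "d > 0" "\<And>x. dist x 1 < d \<Longrightarrow> dist (Arg x) (Arg 1) < pi / k"
    unfolding continuous_at_eps_delta by blast
  show ?thesis
  proof (rule that[of "min d 1"])
    fix x assume x: "cmod (x - 1) < min d 1" and I: "Im (x ^ k) = 0"
    have x0: "x \<noteq> 0" using x by auto
    have "\<bar>Arg x\<bar> < pi / k" using d(2)[of x] x by (simp add: dist_norm)
    hence A: "\<bar>real k * Arg x\<bar> < pi" using assms by (simp add: abs_mult field_simps)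
    have x': "x = rcis (cmod x) (Arg x)" by (rule rcis_cmod_Arg[symmetric])
    have "x ^ k = rcis (cmod x ^ k) (real k * Arg x)" by (subst x') (simp only: DeMoivre2)
    hence "sin (real k * Arg x) = 0" using I x0 by (auto simp: rcis_def)
    hence "real k * Arg x = 0" using A sin_eq_0_pi by (metis abs_less_iff neg_less_iff_less minus_minus)
    hence "Arg x = 0" using assms by simp
    hence "x = of_real (cmod x)" using rcis_cmod_Arg[of x] by (simp add: rcis_def)
    thus "Im x = 0 \<and> Re x > 0" using x0 by (metis Im_complex_of_real Re_complex_of_real zero_less_norm_iff)
  qed (use d in auto)
qed

subsection \<open>Real analytic curves\<close>

text \<open>A power series that converges on a real interval about its centre converges on the
  complex disc of the same radius. So the curve is locally the restriction of a holomorphic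
  \<open>F\<close>, from which its derivatives are read off.\<close>

lemma regular_analytic_curveD:
  assumes "regular_analytic_curve I \<gamma>" "t \<in> I"
  obtains e F where "e > 0" "ball t e \<subseteq> I" "F holomorphic_on ball (of_real t) e"
    "\<And>s. s \<in> ball t e \<Longrightarrow> \<gamma> s = F (of_real s)"
    "\<And>s. s \<in> ball t e \<Longrightarrow> (\<gamma> has_vector_derivative deriv F (of_real s)) (at s)"
    "\<And>s. s \<in> ball t e \<Longrightarrow> vector_derivative \<gamma> (at s) = deriv F (of_real s)"
    "((\<lambda>s. vector_derivative \<gamma> (at s)) has_vector_derivative deriv (deriv F) (of_real t)) (at t)"
proof -
  have I: "open I" and an: "real_analytic_curve_on \<gamma> I" using assms by (auto simp: regular_analytic_curve_def)
  obtain a e1 where e1: "e1 > 0" "\<And>s. s \<in> I \<Longrightarrow> \<bar>s - t\<bar> < e1 \<Longrightarrow> (\<lambda>k. a k * of_real (s - t) ^ k) sums \<gamma> s"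
    using an assms(2) unfolding real_analytic_curve_on_def by meson
  obtain e2 where e2: "e2 > 0" "ball t e2 \<subseteq> I" using I assms(2) openE by blast
  define e where "e = min e1 e2"
  have e: "e > 0" "ball t e \<subseteq> I" using e1 e2 by (auto simp: e_def)
  define F where "F = (\<lambda>z. \<Sum>k. a k * (z - of_real t) ^ k)"
  have sm: "(\<lambda>k. a k * of_real (s - t) ^ k) sums \<gamma> s" if "s \<in> ball t e" for s
    using e1(2)[of s] subsetD[OF e(2) that] that by (auto simp: e_def dist_real_def abs_minus_commute)
  have holF: "F holomorphic_on ball (of_real t) e"
  proof (rule power_series_holomorphic[where a = a])
    fix w :: complex assume w: "w \<in> ball (of_real t) e"
    \<comment> \<open>A real point \<open>t + s\<close> farther from the centre than
      \<open>w\<close>: there the series converges by assumption.\<close>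
    obtain s where s: "cmod (w - of_real t) < s" "s < e" using w dense by (auto simp: dist_norm norm_minus_commute)
    have "0 < s" using s(1) norm_ge_zero by (rule le_less_trans[rotated])
    hence "t + s \<in> ball t e" using s(2) by (simp add: dist_real_def)
    hence "summable (\<lambda>k. a k * of_real s ^ k)" using sm[of "t + s"] by (auto simp: sums_iff)
    hence "summable (\<lambda>k. a k * (w - of_real t) ^ k)"
      by (rule powser_inside) (use s norm_ge_zero[of "w - of_real t"] in auto)
    thus "(\<lambda>k. a k * (w - of_real t) ^ k) sums F w" by (simp add: F_def summable_sums)
  qed
  have gF: "\<gamma> s = F (of_real s)" if "s \<in> ball t e" for s
    using sm[OF that] by (simp add: F_def sums_iff)
  have inb: "complex_of_real s \<in> ball (of_real t) e" if "s \<in> ball t e" for s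
    using that by (simp add: dist_norm flip: of_real_diff)
  have vd: "((\<lambda>s. G (complex_of_real s)) has_vector_derivative deriv G (of_real s)) (at s)"
    if "G holomorphic_on ball (of_real t) e" "s \<in> ball t e" for G s
  proof -
    have "(G has_field_derivative deriv G (of_real s)) (at (of_real s))"
      by (rule holomorphic_derivI[OF that(1) open_ball inb[OF that(2)]])
    thus ?thesis by (rule has_vector_derivative_real_field)
  qed
  have v1: "(\<gamma> has_vector_derivative deriv F (of_real s)) (at s)" if "s \<in> ball t e" for s
    by (rule has_vector_derivative_transform_within_open[OF vd[OF holF that] open_ball that]) (simp add: gF)
  have v2: "vector_derivative \<gamma> (at s) = deriv F (of_real s)" if "s \<in> ball t e" for s
    using v1[OF that] by (rule vector_derivative_at)
  have "((\<lambda>s. vector_derivative \<gamma> (at s)) has_vector_derivative deriv (deriv F) (of_real t)) (at t)"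
    by (rule has_vector_derivative_transform_within_open[OF vd[OF holomorphic_deriv[OF holF open_ball]] open_ball, of t])
       (use e v2 in auto)
  from that[OF e holF gF v1 v2 this] show ?thesis by blast
qed

lemma regular_analytic_curve_continuous:
  assumes "regular_analytic_curve I \<gamma>"
  shows "continuous_on I \<gamma>"
proof -
  have "open I" using assms by (simp add: regular_analytic_curve_def)
  moreover have "isCont \<gamma> t" if "t \<in> I" for t
    by (rule regular_analytic_curveD[OF assms that]) (meson centre_in_ball has_vector_derivative_continuous)
  ultimately show ?thesis by (simp add: continuous_on_eq_continuous_at)
qed

lemma regular_analytic_curveI:
  assumes "open I" "is_interval I" "I \<noteq> {}"
    and "\<And>t. t \<in> I \<Longrightarrow> \<exists>F e. e > 0 \<and> F holomorphic_on ball (of_real t) e \<and> deriv F (of_real t) \<noteq> 0 \<and>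
           (\<forall>s\<in>I. \<bar>s - t\<bar> < e \<longrightarrow> \<gamma> s = F (of_real s))"
  shows "regular_analytic_curve I \<gamma>"
  unfolding regular_analytic_curve_def real_analytic_curve_on_def
proof (intro conjI ballI)
  fix t assume t: "t \<in> I"
  from assms(4)[OF this] obtain F e where F: "e > 0" "F holomorphic_on ball (of_real t) e" "deriv F (of_real t) \<noteq> 0"
     "\<And>s. s \<in> I \<Longrightarrow> \<bar>s - t\<bar> < e \<Longrightarrow> \<gamma> s = F (of_real s)" by blast
  have "(\<lambda>k. ((deriv ^^ k) F (of_real t) / fact k) * of_real (s - t) ^ k) sums \<gamma> s" if "s \<in> I" "\<bar>s - t\<bar> < e" for s
  proof -
    have "(\<lambda>k. (deriv ^^ k) F (of_real t) / fact k * (of_real s - of_real t) ^ k) sums F (of_real s)"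
      by (rule holomorphic_power_series[OF F(2)]) (use that in \<open>simp add: dist_norm norm_minus_commute flip: of_real_diff\<close>)
    thus ?thesis using F(4)[OF that] by simp
  qed
  thus "\<exists>a \<epsilon>. \<epsilon> > 0 \<and> (\<forall>s\<in>I. \<bar>s - t\<bar> < \<epsilon> \<longrightarrow> (\<lambda>k. a k * of_real (s - t) ^ k) sums \<gamma> s)"
    using F(1) by (intro exI[of _ "\<lambda>k. (deriv ^^ k) F (of_real t) / fact k"] exI[of _ e]) simp
  obtain e2 where e2: "e2 > 0" "ball t e2 \<subseteq> I" using assms(1) t openE by blast
  have "(F has_field_derivative deriv F (of_real t)) (at (of_real t))"
    by (rule holomorphic_derivI[OF F(2) open_ball]) (use F in auto)
  hence v: "((\<lambda>s. F (of_real s)) has_vector_derivative deriv F (of_real t)) (at t)"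
    by (rule has_vector_derivative_real_field)
  have "(\<gamma> has_vector_derivative deriv F (of_real t)) (at t)"
    by (rule has_vector_derivative_transform_within_open[OF v open_ball[of t "min e e2"]])
       (use F e2 in \<open>auto simp: dist_real_def abs_minus_commute subset_iff\<close>)
  thus "vector_derivative \<gamma> (at t) \<noteq> 0" using F(3) by (simp add: vector_derivative_at)
qed (use assms in auto)

text \<open>Differentiating \<open>Im (cnj c * g (\<gamma> s)) = 0\<close> once gives the direction,
  and twice the curvature. It reduces the curvature to the first two derivatives of any coordinate
  in which the curve is straight.\<close>

lemma curvature_level_line:
  assumes reg: "regular_analytic_curve I \<gamma>" and t: "t \<in> I" and N: "open N" "\<gamma> t \<in> N"
    and g: "g holomorphic_on N" "deriv g (\<gamma> t) \<noteq> 0" and e: "e > 0"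
    and line: "\<And>s. \<bar>s - t\<bar> < e \<Longrightarrow> Im (cnj c * g (\<gamma> s)) = 0" and c: "c \<noteq> 0"
  shows "vector_derivative \<gamma> (at t) \<noteq> 0"
    and "Im (cnj c * deriv g (\<gamma> t) * vector_derivative \<gamma> (at t)) = 0"
    and "curvature \<gamma> t = - Im (deriv (deriv g) (\<gamma> t) / deriv g (\<gamma> t) * sgn (vector_derivative \<gamma> (at t)))"
proof -
  obtain e1 F where F: "e1 > 0" "ball t e1 \<subseteq> I" "F holomorphic_on ball (of_real t) e1"
    "\<And>s. s \<in> ball t e1 \<Longrightarrow> \<gamma> s = F (of_real s)"
    "\<And>s. s \<in> ball t e1 \<Longrightarrow> (\<gamma> has_vector_derivative deriv F (of_real s)) (at s)"
    "\<And>s. s \<in> ball t e1 \<Longrightarrow> vector_derivative \<gamma> (at s) = deriv F (of_real s)"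
    "((\<lambda>s. vector_derivative \<gamma> (at s)) has_vector_derivative deriv (deriv F) (of_real t)) (at t)"
    by (rule regular_analytic_curveD[OF reg t]) blast
  define v where "v = vector_derivative \<gamma> (at t)"
  define w where "w = deriv (deriv F) (of_real t)"
  define q where "q = \<gamma> t"
  have v0: "v \<noteq> 0" using reg t by (simp add: v_def regular_analytic_curve_def)
  thus "vector_derivative \<gamma> (at t) \<noteq> 0" by (simp add: v_def)
  have gt: "(\<gamma> has_vector_derivative v) (at t)" using F(5)[of t] F(6)[of t] F(1) by (simp add: v_def)
  have cont: "isCont \<gamma> t" using gt by (rule has_vector_derivative_continuous)
  obtain e2 where e2: "e2 > 0" "\<And>s. dist s t < e2 \<Longrightarrow> \<gamma> s \<in> N"
    using cont N unfolding continuous_at_open by (metis open_dist dist_commute)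
  define e3 where "e3 = min e (min e1 e2)"
  have e3: "e3 > 0" using e F(1) e2(1) by (simp add: e3_def)
  have D1: "((\<lambda>s. cnj c * g (\<gamma> s)) has_vector_derivative cnj c * (deriv g (\<gamma> s) * vector_derivative \<gamma> (at s))) (at s)"
    if "s \<in> ball t e3" for s
  proof -
    have "(g has_field_derivative deriv g (\<gamma> s)) (at (\<gamma> s))"
      by (rule holomorphic_derivI[OF g(1) N(1)]) (use that e2 in \<open>auto simp: e3_def dist_commute\<close>)
    moreover have "(\<gamma> has_vector_derivative vector_derivative \<gamma> (at s)) (at s)"
      using F(5,6)[of s] that by (auto simp: e3_def)
    ultimately have "(g \<circ> \<gamma> has_vector_derivative vector_derivative \<gamma> (at s) * deriv g (\<gamma> s)) (at s)"
      by (rule field_vector_diff_chain_at[rotated])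
    hence "((\<lambda>s. g (\<gamma> s)) has_vector_derivative deriv g (\<gamma> s) * vector_derivative \<gamma> (at s)) (at s)"
      by (simp add: o_def mult.commute)
    thus ?thesis by (rule has_vector_derivative_mult_right)
  qed
  have Imd: "Im G' = 0" if "(G has_vector_derivative G') (at s)" "s \<in> ball t e3" "\<And>s. s \<in> ball t e3 \<Longrightarrow> Im (G s) = 0"
    for G G' s
  proof -
    have "((\<lambda>s. Im (G s)) has_vector_derivative Im G') (at s)"
      using that(1) by (rule bounded_linear.has_vector_derivative[OF bounded_linear_Im])
    moreover have "((\<lambda>s. Im (G s)) has_vector_derivative 0) (at s)"
      by (rule has_vector_derivative_transform_within_open[OF has_vector_derivative_const[of 0] open_ball that(2)])
         (use that(3) in auto)
    ultimately show ?thesis using vector_derivative_unique_at by blast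
  qed
  have I1: "Im (cnj c * (deriv g (\<gamma> s) * vector_derivative \<gamma> (at s))) = 0" if "s \<in> ball t e3" for s
    by (rule Imd[OF D1[OF that] that]) (use line in \<open>auto simp: e3_def dist_real_def abs_minus_commute\<close>)
  have av: "Im (cnj c * deriv g q * v) = 0" using I1[of t] e3 by (simp add: v_def q_def mult.assoc)
  thus "Im (cnj c * deriv g (\<gamma> t) * vector_derivative \<gamma> (at t)) = 0" by (simp add: v_def q_def)
  have "(deriv g has_field_derivative deriv (deriv g) q) (at q)"
    unfolding q_def by (rule holomorphic_derivI[OF holomorphic_deriv[OF g(1) N(1)] N])
  hence "(deriv g \<circ> \<gamma> has_vector_derivative v * deriv (deriv g) q) (at t)"
    unfolding q_def by (rule field_vector_diff_chain_at[OF gt])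
  hence "((\<lambda>s. deriv g (\<gamma> s)) has_vector_derivative v * deriv (deriv g) q) (at t)" by (simp add: o_def)
  moreover have "((\<lambda>s. vector_derivative \<gamma> (at s)) has_vector_derivative w) (at t)" using F(7) by (simp add: w_def)
  ultimately have "((\<lambda>s. deriv g (\<gamma> s) * vector_derivative \<gamma> (at s)) has_vector_derivative deriv g q * w + v * deriv (deriv g) q * v) (at t)"
    unfolding q_def v_def by (rule has_vector_derivative_mult)
  hence "((\<lambda>s. cnj c * (deriv g (\<gamma> s) * vector_derivative \<gamma> (at s))) has_vector_derivative cnj c * (deriv g q * w + v * deriv (deriv g) q * v)) (at t)"
    by (rule has_vector_derivative_mult_right)
  from Imd[OF this _ I1] have I2: "Im (cnj c * (deriv g q * w + v * deriv (deriv g) q * v)) = 0" using e3 by simp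
  define a where "a = cnj c * deriv g q"
  define R where "R = Re (a * v)"
  have aR: "a * v = of_real R" using av by (simp add: R_def a_def complex_eq_iff)
  have g0: "deriv g q \<noteq> 0" using g by (simp add: q_def)
  have a0: "a \<noteq> 0" using g0 c by (simp add: a_def)
  have R0: "R \<noteq> 0" using aR a0 v0 by auto
  define b where "b = deriv (deriv g) q / deriv g q"
  have "cnj c * (deriv g q * w + v * deriv (deriv g) q * v) = a * w + (a * v) * (b * v)"
    using g0 by (simp add: a_def b_def field_simps)
  hence I3: "Im (a * w) = - (R * Im (b * v))" using I2 by (simp add: aR)
  \<comment> \<open>Multiplication by the real number \<open>R = a * v\<close> turns
    \<open>cnj v * w\<close>, which enters the curvature, into a multiple of \<open>a * w\<close>,
    whose imaginary part is known from \<open>I3\<close>.\<close>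
  have "of_real R * (cnj v * w) = (cnj v * v) * (a * w)" by (simp add: aR[symmetric])
  also have "cnj v * v = of_real ((cmod v)\<^sup>2)" by (simp only: complex_norm_square mult.commute)
  finally have "R * Im (cnj v * w) = (cmod v)\<^sup>2 * Im (a * w)"
    by (metis Im_complex_of_real Re_complex_of_real add.right_neutral mult_zero_left times_complex.simps(2))
  also have "\<dots> = R * (- ((cmod v)\<^sup>2 * Im (b * v)))" unfolding I3 by simp
  finally have "Im (cnj v * w) = - ((cmod v)\<^sup>2 * Im (b * v))" using R0 by (metis mult_left_cancel)
  hence "curvature \<gamma> t = - ((cmod v)\<^sup>2 * Im (b * v)) / cmod v ^ 3"
    unfolding curvature_def Let_def v_def[symmetric] using vector_derivative_at[OF F(7)] by (simp add: w_def)
  also have "\<dots> = - (Im (b * v) / cmod v)" using v0 by (simp add: power2_eq_square power3_eq_cube)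
  also have "\<dots> = - Im (b * sgn v)"
    by (simp only: sgn_eq times_divide_eq_right Im_divide_of_real)
  finally show "curvature \<gamma> t = - Im (deriv (deriv g) (\<gamma> t) / deriv g (\<gamma> t) * sgn (vector_derivative \<gamma> (at t)))"
    by (simp add: b_def q_def v_def)
qed

text \<open>A \<open>power_chart\<close> is a conformal coordinate \<open>\<phi>\<close> about \<open>q\<close> (with inverse \<open>\<psi>\<close>) in which
  \<open>f - f q\<close> is the \<open>k\<close>-th power; the nodal set of \<open>Re f\<close> becomes \<open>k\<close> lines.\<close>

definition power_chart ::
    "(complex \<Rightarrow> complex) \<Rightarrow> complex \<Rightarrow> nat \<Rightarrow> (complex \<Rightarrow> complex) \<Rightarrow> (complex \<Rightarrow> complex) \<Rightarrow> complex set \<Rightarrow> real \<Rightarrow> bool" where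
  "power_chart f q k \<phi> \<psi> N d \<longleftrightarrow>
     k \<ge> 1 \<and> d > 0 \<and> open N \<and> q \<in> N \<and> \<phi> holomorphic_on N \<and> \<psi> holomorphic_on ball 0 d \<and>
     \<phi> q = 0 \<and> \<phi> ` N = ball 0 d \<and> \<psi> ` ball 0 d = N \<and>
     (\<forall>z\<in>N. \<psi> (\<phi> z) = z) \<and> (\<forall>w\<in>ball 0 d. \<phi> (\<psi> w) = w) \<and>
     (\<forall>z\<in>N. deriv \<phi> z \<noteq> 0) \<and> (\<forall>w\<in>ball 0 d. deriv \<psi> w \<noteq> 0) \<and>
     (\<forall>z\<in>N. f z = f q + \<phi> z ^ k)"

text \<open>The inverse function theorem. \<open>N\<close> is cut down to the preimage of a disc, so
  that whole diameters are available in the chart.\<close>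

lemma power_chartI:
  assumes hol: "\<phi> holomorphic_on B" and B: "open B" "q \<in> B" and q0: "\<phi> q = 0" and dq: "deriv \<phi> q \<noteq> 0" and k: "k \<ge> 1"
    and f: "\<And>z. z \<in> B \<Longrightarrow> f z = f q + \<phi> z ^ k"
  obtains \<psi> N d where "power_chart f q k \<phi> \<psi> N d" "N \<subseteq> B"
proof -
  obtain r2 where r2: "r2 > 0" "ball q r2 \<subseteq> B" "inj_on \<phi> (ball q r2)"
    by (rule has_complex_derivative_locally_injective[OF hol B(2,1) dq])
  have hol2: "\<phi> holomorphic_on ball q r2" using hol r2 holomorphic_on_subset by blast
  obtain \<psi> where psi: "\<psi> holomorphic_on (\<phi> ` ball q r2)" "\<And>z. z \<in> ball q r2 \<Longrightarrow> deriv \<phi> z * deriv \<psi> (\<phi> z) = 1"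
     "\<And>z. z \<in> ball q r2 \<Longrightarrow> \<psi> (\<phi> z) = z"
    by (rule holomorphic_has_inverse[OF hol2 open_ball r2(3)]) blast
  have "open (\<phi> ` ball q r2)" by (rule open_mapping_thm3[OF hol2 open_ball r2(3)])
  moreover have "0 \<in> \<phi> ` ball q r2" using r2(1) by (intro image_eqI[of _ _ q]) (auto simp: q0)
  ultimately obtain d where d: "d > 0" "ball 0 d \<subseteq> \<phi> ` ball q r2" using openE by blast
  define N where "N = ball q r2 \<inter> \<phi> -` ball 0 d"
  have N: "open N" unfolding N_def
    by (rule continuous_open_preimage[OF holomorphic_on_imp_continuous_on[OF hol2]]) auto
  have NB: "N \<subseteq> ball q r2" by (auto simp: N_def)
  have im: "\<phi> ` N = ball 0 d" using d(2) by (auto simp: N_def)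
  have "power_chart f q k \<phi> \<psi> N d"
    unfolding power_chart_def
  proof (intro conjI ballI)
    show "q \<in> N" using r2(1) d(1) by (simp add: N_def q0)
    show "\<phi> holomorphic_on N" using hol2 NB holomorphic_on_subset by blast
    show "\<psi> holomorphic_on ball 0 d" using psi(1) d(2) holomorphic_on_subset by blast
    show inv: "\<psi> (\<phi> z) = z" if "z \<in> N" for z using psi(3) NB that by blast
    show "\<psi> ` ball 0 d = N" using im inv by force
    show "\<phi> (\<psi> w) = w" if "w \<in> ball 0 d" for w using that im inv by force
    show "deriv \<phi> z \<noteq> 0" if "z \<in> N" for z using psi(2)[of z] NB that by auto
    show "deriv \<psi> w \<noteq> 0" if "w \<in> ball 0 d" for w
    proof -
      have "w \<in> \<phi> ` N" using that im by simp
      then obtain z where z: "z \<in> N" "w = \<phi> z" by blast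
      thus ?thesis using psi(2)[of z] NB by auto
    qed
    show "f z = f q + \<phi> z ^ k" if "z \<in> N" for z
      using that NB r2(2) by (intro f) blast
  qed (use k d N im in \<open>auto simp: q0\<close>)
  moreover have "N \<subseteq> B" using NB r2(2) by blast
  ultimately show ?thesis using that by blast
qed

text \<open>\<open>k\<close> is the order of the zero of \<open>f - f q\<close> at \<open>q\<close>;
  there \<open>f - f q\<close> has a holomorphic \<open>k\<close>-th root with a simple
  zero.\<close>

lemma power_chart_exists:
  assumes f: "f holomorphic_on D" "open D" "connected D" "\<not> f constant_on D" and q: "q \<in> D" and U: "open U" "q \<in> U"
  obtains k \<phi> \<psi> N d where "power_chart f q k \<phi> \<psi> N d" "N \<subseteq> D" "N \<subseteq> U" "deriv f q \<noteq> 0 \<longrightarrow> k = 1"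
proof -
  have ex: "\<exists>n>0. (deriv ^^ n) f q \<noteq> 0"
  proof (rule ccontr)
    assume "\<not> ?thesis"
    hence "f w = f q" if "w \<in> D" for w
      using holomorphic_fun_eq_const_on_connected[OF f(1-3) _ q that] by blast
    thus False using f(4) by (auto simp: constant_on_def)
  qed
  define k where "k = (LEAST n. n > 0 \<and> (deriv ^^ n) f q \<noteq> 0)"
  have k: "k > 0" "(deriv ^^ k) f q \<noteq> 0" using LeastI_ex[OF ex] by (auto simp: k_def)
  have kl: "(deriv ^^ i) f q = 0" if "0 < i" "i < k" for i
    using not_less_Least[of i "\<lambda>n. n > 0 \<and> (deriv ^^ n) f q \<noteq> 0"] that by (auto simp: k_def)
  have k1: "deriv f q \<noteq> 0 \<longrightarrow> k = 1"
  proof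
    assume "deriv f q \<noteq> 0"
    hence "k \<le> 1" unfolding k_def by (intro Least_le) auto
    thus "k = 1" using k by simp
  qed
  obtain g r where g: "0 < r" "g holomorphic_on ball q r" "\<And>w. w \<in> ball q r \<Longrightarrow> f w - f q = ((w - q) * g w) ^ k"
      "\<And>w. w \<in> ball q r \<Longrightarrow> g w \<noteq> 0"
    by (rule holomorphic_factor_order_of_zero_strong[OF f(1,2) q k kl]) auto
  obtain r1 where r1: "r1 > 0" "ball q r1 \<subseteq> D \<inter> U"
    using f(2) q U by (metis IntI open_Int openE)
  define \<phi> where "\<phi> = (\<lambda>w. (w - q) * g w)"
  define B where "B = ball q (min r r1)"
  have B: "open B" "q \<in> B" "B \<subseteq> D" "B \<subseteq> U" "B \<subseteq> ball q r" using g(1) r1 by (auto simp: B_def)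
  have hol: "\<phi> holomorphic_on B" unfolding \<phi>_def
    using holomorphic_on_subset[OF g(2) B(5)] by (intro holomorphic_intros) auto
  have "(g has_field_derivative deriv g q) (at q)"
    by (rule holomorphic_derivI[OF g(2) open_ball]) (use g in auto)
  hence "(\<phi> has_field_derivative g q) (at q)" unfolding \<phi>_def
    by (auto intro!: derivative_eq_intros)
  hence dq: "deriv \<phi> q \<noteq> 0" using g(4)[of q] g(1) by (simp add: DERIV_imp_deriv)
  obtain \<psi> N d where "power_chart f q k \<phi> \<psi> N d" "N \<subseteq> B"
  proof (rule power_chartI[OF hol B(1,2) _ dq])
    show "f z = f q + \<phi> z ^ k" if "z \<in> B" for z
      using g(3)[of z] B(5) that by (simp add: \<phi>_def subset_iff algebra_simps)
  qed (use k in \<open>auto simp: \<phi>_def\<close>)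
  thus ?thesis using that k1 B by blast
qed

text \<open>Along the curve the \<open>k\<close>-th power of \<open>\<phi>\<close> has real part 0.
  The difference quotient \<open>A\<close> tends to the derivative \<open>b\<close>, so
  \<open>A / b\<close> is close to 1 and has a real \<open>k\<close>-th power; hence it is real and
  positive, and the curve cannot leave the line through \<open>b\<close>.\<close>

lemma curve_in_chart_line:
  assumes reg: "regular_analytic_curve I \<gamma>" and t: "t \<in> I" and ch: "power_chart f (\<gamma> t) k \<phi> \<psi> N d"
    and Z: "\<And>s. s \<in> I \<Longrightarrow> Re (f (\<gamma> s)) = 0"
  obtains c e \<rho> where "cmod c = 1" "Re (c ^ k) = 0" "e > 0" "ball t e \<subseteq> I"
    "\<And>s. s \<in> ball t e \<Longrightarrow> \<gamma> s \<in> N" "\<And>s. s \<in> ball t e \<Longrightarrow> \<phi> (\<gamma> s) = of_real (\<rho> s) * c"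
    "\<rho> t = 0" "strict_mono_on (ball t e) \<rho>" "continuous_on (ball t e) \<rho>"
    "c = sgn (deriv \<phi> (\<gamma> t) * vector_derivative \<gamma> (at t))"
proof -
  have C: "k \<ge> 1" "open N" "\<gamma> t \<in> N" "\<phi> holomorphic_on N" "\<phi> (\<gamma> t) = 0" "deriv \<phi> (\<gamma> t) \<noteq> 0"
    and Cf: "\<And>z. z \<in> N \<Longrightarrow> f z = f (\<gamma> t) + \<phi> z ^ k"
    using ch unfolding power_chart_def by blast+
  obtain e1 F where F: "e1 > 0" "ball t e1 \<subseteq> I" "F holomorphic_on ball (of_real t) e1"
    "\<And>s. s \<in> ball t e1 \<Longrightarrow> \<gamma> s = F (of_real s)"
    "\<And>s. s \<in> ball t e1 \<Longrightarrow> (\<gamma> has_vector_derivative deriv F (of_real s)) (at s)"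
    "\<And>s. s \<in> ball t e1 \<Longrightarrow> vector_derivative \<gamma> (at s) = deriv F (of_real s)"
    by (rule regular_analytic_curveD[OF reg t]) blast
  have v0: "deriv F (of_real t) \<noteq> 0" using reg t F(1) F(6)[of t] by (auto simp: regular_analytic_curve_def)
  have Ft: "F (of_real t) = \<gamma> t" using F(1) F(4)[of t] by simp
  have "open (ball (of_real t) e1 \<inter> F -` N)"
    by (rule continuous_open_preimage[OF holomorphic_on_imp_continuous_on[OF F(3)] open_ball]) (use C in auto)
  moreover have "of_real t \<in> ball (of_real t) e1 \<inter> F -` N" using F(1) C by (simp add: Ft)
  ultimately obtain e2 where e2: "e2 > 0" "ball (of_real t) e2 \<subseteq> ball (of_real t) e1 \<inter> F -` N" using openE by blast
  define B where "B = ball (complex_of_real t) e2"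
  define H where "H = (\<lambda>z. \<phi> (F z))"
  have FB: "F holomorphic_on B" "F ` B \<subseteq> N" using F(3) e2 holomorphic_on_subset by (auto simp: B_def)
  have H: "H holomorphic_on B"
    unfolding H_def using holomorphic_on_compose_gen[OF FB(1) _ FB(2), of \<phi>] C by (simp add: o_def)
  define b where "b = deriv H (of_real t)"
  have tB: "of_real t \<in> B" using e2 by (simp add: B_def)
  have Hb: "(H has_field_derivative b) (at (of_real t))" unfolding b_def
    by (rule holomorphic_derivI[OF H _ tB]) (simp add: B_def)
  have b: "b = deriv \<phi> (\<gamma> t) * vector_derivative \<gamma> (at t)"
  proof -
    have "(\<phi> has_field_derivative deriv \<phi> (\<gamma> t)) (at (F (of_real t)))"
      unfolding Ft by (rule holomorphic_derivI[of _ N]) (use C in auto)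
    moreover have "(F has_field_derivative deriv F (of_real t)) (at (of_real t))"
      by (rule holomorphic_derivI[OF F(3)]) (use F(1) in auto)
    ultimately have "(H has_field_derivative deriv \<phi> (\<gamma> t) * deriv F (of_real t)) (at (of_real t))"
      unfolding H_def by (rule DERIV_chain2)
    hence "b = deriv \<phi> (\<gamma> t) * deriv F (of_real t)" using Hb DERIV_unique by blast
    thus ?thesis using F(1) F(6)[of t] by simp
  qed
  have b0: "b \<noteq> 0" using C v0 F(1) F(6)[of t] by (auto simp: b)
  define c where "c = sgn b"
  have c1: "cmod c = 1" using b0 by (simp add: c_def norm_sgn)
  have inB: "complex_of_real s \<in> B" "s \<in> ball t e1" if "s \<in> ball t e2" for s
  proof -
    show B: "complex_of_real s \<in> B" using that by (simp add: B_def dist_norm flip: of_real_diff)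
    hence "complex_of_real s \<in> ball (of_real t) e1" using e2(2) unfolding B_def by blast
    thus "s \<in> ball t e1" by (simp add: dist_norm flip: of_real_diff)
  qed
  have hH: "\<phi> (\<gamma> s) = H (of_real s)" "\<gamma> s \<in> N" "s \<in> I" if "s \<in> ball t e2" for s
    using F(4)[OF inB(2)[OF that]] inB(1)[OF that] inB(2)[OF that] FB(2) F(2) by (auto simp: H_def)
  have ReH: "Re (H (of_real s) ^ k) = 0" if "s \<in> ball t e2" for s
  proof -
    have "f (\<gamma> s) = f (\<gamma> t) + H (of_real s) ^ k" using Cf[OF hH(2)[OF that]] hH(1)[OF that] by simp
    thus ?thesis using Z[OF hH(3)[OF that]] Z[OF t] by simp
  qed
  have Ht: "H (of_real t) = 0" using C by (simp add: H_def Ft)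
  define A where "A = (\<lambda>s. H (of_real s) / of_real (s - t))"
  have Alim: "(A \<longlongrightarrow> b) (at t)"
  proof -
    have "((\<lambda>z. (H z - H (of_real t)) / (z - of_real t)) \<longlongrightarrow> b) (at (of_real t))"
      using Hb by (simp add: has_field_derivative_iff)
    moreover have "filterlim (complex_of_real) (at (of_real t)) (at t)"
      unfolding filterlim_at by (auto simp: eventually_at_filter intro!: tendsto_intros)
    ultimately have "((\<lambda>s. (H (of_real s) - H (of_real t)) / (of_real s - of_real t)) \<longlongrightarrow> b) (at t)"
      by (rule filterlim_compose)
    thus ?thesis by (simp add: A_def Ht)
  qed
  have RA: "Re (A s ^ k) = 0" if "s \<in> ball t e2" for s
  proof -
    have "A s ^ k = H (of_real s) ^ k / of_real ((s - t) ^ k)" by (simp add: A_def power_divide)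
    thus ?thesis using ReH[OF that] by (simp del: of_real_power)
  qed
  have Rb: "Re (b ^ k) = 0"
  proof -
    have "((\<lambda>s. Re (A s ^ k)) \<longlongrightarrow> Re (b ^ k)) (at t)" by (intro tendsto_intros Alim)
    moreover have "((\<lambda>s. Re (A s ^ k)) \<longlongrightarrow> 0) (at t)"
    proof (rule tendsto_eventually)
      show "\<forall>\<^sub>F s in at t. Re (A s ^ k) = 0"
        unfolding eventually_at using e2(1) RA by (intro exI[of _ e2]) (auto simp: dist_commute)
    qed
    ultimately show ?thesis using LIM_unique by blast
  qed
  have Rc: "Re (c ^ k) = 0"
  proof -
    have "c = b / of_real (cmod b)" by (simp add: c_def sgn_eq)
    hence "c ^ k = b ^ k / of_real (cmod b ^ k)" by (simp add: power_divide)
    thus ?thesis using Rb by (simp del: of_real_power)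
  qed
  obtain dl where dl: "dl > 0" "\<And>x. cmod (x - 1) < dl \<Longrightarrow> Im (x ^ k) = 0 \<Longrightarrow> Im x = 0 \<and> Re x > 0"
    using real_powers_near_1 C by blast
  have "((\<lambda>s. A s / b) \<longlongrightarrow> b / b) (at t)" using b0 by (intro tendsto_intros Alim)
  hence "\<forall>\<^sub>F s in at t. dist (A s / b) 1 < dl" using b0 dl(1) by (simp add: tendsto_iff)
  then obtain e3 where e3: "e3 > 0" "\<And>s. s \<noteq> t \<Longrightarrow> dist s t < e3 \<Longrightarrow> dist (A s / b) 1 < dl"
    unfolding eventually_at by blast
  define \<rho> where "\<rho> = (\<lambda>s. Re (cnj c * H (of_real s)))"
  define \<rho>' where "\<rho>' = (\<lambda>s. Re (cnj c * deriv H (of_real s)))"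
  have rho': "(\<rho> has_real_derivative \<rho>' s) (at s)" if "s \<in> ball t e2" for s
  proof -
    have "(H has_field_derivative deriv H (of_real s)) (at (of_real s))"
      by (rule holomorphic_derivI[OF H _ inB(1)[OF that]]) (simp add: B_def)
    hence "((\<lambda>s. cnj c * H (of_real s)) has_vector_derivative cnj c * deriv H (of_real s)) (at s)"
      by (intro has_vector_derivative_mult_right has_vector_derivative_real_field)
    hence "(\<rho> has_vector_derivative \<rho>' s) (at s)" unfolding \<rho>_def \<rho>'_def
      by (rule bounded_linear.has_vector_derivative[OF bounded_linear_Re])
    thus ?thesis by (simp add: has_real_derivative_iff_has_vector_derivative)
  qed
  have "continuous_on B (deriv H)"
    by (rule holomorphic_on_imp_continuous_on[OF holomorphic_deriv[OF H]]) (simp add: B_def)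
  hence "isCont (deriv H) (of_real t)" using tB by (simp add: continuous_on_eq_continuous_at B_def)
  moreover have "isCont complex_of_real t" by (intro continuous_intros)
  ultimately have "isCont (\<lambda>s. deriv H (complex_of_real s)) t" by (rule isCont_o2[rotated])
  hence "isCont \<rho>' t" unfolding \<rho>'_def by (rule isCont_Re[OF isCont_mult[OF continuous_const]])
  moreover have "\<rho>' t > 0"
  proof -
    have "cnj c * b = of_real (cmod b)"
      using b0 by (simp add: c_def sgn_eq complex_norm_square[symmetric] power2_eq_square mult.commute)
    thus ?thesis using b0 unfolding \<rho>'_def b_def[symmetric] by (simp only: Re_complex_of_real zero_less_norm_iff not_False_eq_True)
  qed
  ultimately have "\<forall>\<^sub>F s in nhds t. \<rho>' s > 0"
    using order_tendstoD(1)[of \<rho>' "\<rho>' t" "nhds t" 0] by (simp add: isCont_def tendsto_at_iff_tendsto_nhds)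
  then obtain e4 where e4: "e4 > 0" "\<And>s. dist s t < e4 \<Longrightarrow> \<rho>' s > 0"
    unfolding eventually_nhds_metric by blast
  define e where "e = min e2 (min e3 e4)"
  have e: "e > 0" using e2 e3 e4 by (simp add: e_def)
  have be: "s \<in> ball t e2" "dist s t < e3" "dist s t < e4" if "s \<in> ball t e" for s
    using that by (auto simp: e_def dist_commute)
  show ?thesis
  proof (rule that[of c e \<rho>])
    show "ball t e \<subseteq> I" using be(1) hH(3) by blast
    show "\<gamma> s \<in> N" if "s \<in> ball t e" for s using be(1)[OF that] hH(2) by blast
    show "\<rho> t = 0" by (simp add: \<rho>_def Ht)
    show "strict_mono_on (ball t e) \<rho>"
    proof (rule strict_mono_onI)
      fix r s assume rs: "r \<in> ball t e" "s \<in> ball t e" "r < s"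
      have x: "x \<in> ball t e" if "r \<le> x" "x \<le> s" for x using that rs by (auto simp: dist_real_def)
      show "\<rho> r < \<rho> s"
        by (rule DERIV_pos_imp_increasing[OF rs(3)]) (use x be rho' e4 in blast)
    qed
    show "continuous_on (ball t e) \<rho>"
      by (intro continuous_at_imp_continuous_on ballI DERIV_isCont[OF rho'] be(1))
    show "\<phi> (\<gamma> s) = of_real (\<rho> s) * c" if s: "s \<in> ball t e" for s
    proof (cases "s = t")
      case False
      have Rk: "Re (A s ^ k) = 0" by (rule RA[OF be(1)[OF s]])
      have "(A s / b) ^ k = A s ^ k / b ^ k" by (simp add: power_divide)
      also have "Im \<dots> = 0" using Rk Rb by (simp add: Im_divide)
      finally have "Im (A s / b) = 0" using dl(2)[of "A s / b"] e3(2)[of s] False be(2)[OF s] by (simp add: dist_norm)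
      hence "A s / b = of_real (Re (A s / b))" by (simp add: complex_eq_iff)
      hence "A s = of_real (Re (A s / b)) * b" using b0 by (simp add: field_simps)
      hence "H (of_real s) = of_real ((s - t) * Re (A s / b)) * b" using False by (simp add: A_def field_simps)
      then obtain y where y: "H (of_real s) = of_real y * b" by blast
      have "b = of_real (cmod b) * c" using b0 by (simp add: c_def sgn_eq)
      hence "H (of_real s) = of_real (y * cmod b) * c" using y by (metis mult.assoc of_real_mult)
      then obtain x where x: "H (of_real s) = of_real x * c" by blast
      have "cnj c * c = 1" using c1 complex_norm_square[of c] by (simp add: mult.commute)
      hence "cnj c * H (of_real s) = of_real x" unfolding x by (metis mult.commute mult.left_commute mult.right_neutral)
      hence "\<rho> s = x" by (simp only: \<rho>_def Re_complex_of_real)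
      thus ?thesis using hH(1)[OF be(1)[OF s]] x by simp
    qed (use Ht hH(1)[of t] e2 in \<open>simp add: \<rho>_def\<close>)
  qed (use c1 Rc e in \<open>auto simp: c_def b\<close>)
qed

lemma power_chartD:
  assumes "power_chart f q k \<phi> \<psi> N d"
  shows "k \<ge> 1" "d > 0" "open N" "q \<in> N" "\<phi> holomorphic_on N" "\<psi> holomorphic_on ball 0 d" "\<phi> q = 0"
    "\<And>z. z \<in> N \<Longrightarrow> \<phi> z \<in> ball 0 d" "\<And>w. w \<in> ball 0 d \<Longrightarrow> \<psi> w \<in> N" "\<And>z. z \<in> N \<Longrightarrow> \<psi> (\<phi> z) = z"
    "\<And>w. w \<in> ball 0 d \<Longrightarrow> \<phi> (\<psi> w) = w" "\<And>z. z \<in> N \<Longrightarrow> deriv \<phi> z \<noteq> 0" "\<And>w. w \<in> ball 0 d \<Longrightarrow> deriv \<psi> w \<noteq> 0"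
    "\<And>z. z \<in> N \<Longrightarrow> f z = f q + \<phi> z ^ k" "\<psi> 0 = q"
proof -
  show "\<psi> 0 = q" using assms unfolding power_chart_def by metis
qed (use assms in \<open>unfold power_chart_def, blast+\<close>)

text \<open>The part of \<open>K\<close> outside \<open>ball t e\<close> has a compact image, which
  misses \<open>\<gamma> t\<close> and therefore has positive distance from it.\<close>

lemma inj_curve_near:
  fixes \<gamma> :: "real \<Rightarrow> complex"
  assumes "compact K" "continuous_on K \<gamma>" "inj_on \<gamma> K" "t \<in> K" "e > 0"
  obtains \<eta> where "\<eta> > 0" "\<And>s. s \<in> K \<Longrightarrow> dist (\<gamma> s) (\<gamma> t) < \<eta> \<Longrightarrow> s \<in> ball t e"
proof -
  have "compact (K - ball t e)" using assms(1) by (simp add: compact_diff)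
  hence "compact (\<gamma> ` (K - ball t e))"
    by (intro compact_continuous_image continuous_on_subset[OF assms(2)]) auto
  moreover have "\<gamma> t \<notin> \<gamma> ` (K - ball t e)"
  proof
    assume "\<gamma> t \<in> \<gamma> ` (K - ball t e)"
    then obtain s where s: "s \<in> K" "s \<notin> ball t e" "\<gamma> t = \<gamma> s" by blast
    have "t = s" by (rule inj_onD[OF assms(3) s(3) assms(4) s(1)])
    thus False using s(2) assms(5) by simp
  qed
  ultimately have "open (- \<gamma> ` (K - ball t e))" "\<gamma> t \<in> - \<gamma> ` (K - ball t e)"
    by (blast intro: open_Compl compact_imp_closed)+
  then obtain \<eta> where \<eta>: "\<eta> > 0" "ball (\<gamma> t) \<eta> \<subseteq> - \<gamma> ` (K - ball t e)" using openE by blast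
  show ?thesis
  proof (rule that[OF \<eta>(1)])
    fix s assume s: "s \<in> K" "dist (\<gamma> s) (\<gamma> t) < \<eta>"
    hence "\<gamma> s \<in> ball (\<gamma> t) \<eta>" by (simp add: dist_commute)
    thus "s \<in> ball t e" using \<eta>(2) s(1) by blast
  qed
qed

text \<open>Rotation by \<open>pi / k\<close> changes the sign of the \<open>k\<close>-th power; for
  \<open>k \<ge> 2\<close> it yields a second nodal line.\<close>

lemma cis_root_direction:
  assumes "cmod c = 1" "Re (c ^ k) = 0" "k \<ge> 2"
  obtains c' where "cmod c' = 1" "Re (c' ^ k) = 0" "\<And>x y. of_real x * c = of_real y * c' \<Longrightarrow> y = 0"
proof -
  define w where "w = cis (pi / k)"
  have wk: "w ^ k = -1" using assms(3) by (simp add: w_def Complex.DeMoivre)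
  have Iw: "Im w > 0" unfolding w_def using assms(3) by (auto intro!: sin_gt_zero simp: field_simps)
  show ?thesis
  proof (rule that[of "c * w"])
    show "cmod (c * w) = 1" using assms(1) by (simp add: norm_mult w_def)
    show "Re ((c * w) ^ k) = 0" using assms(2) by (simp add: power_mult_distrib wk)
    fix x y :: real assume "of_real x * c = of_real y * (c * w)"
    hence "c * (of_real x - of_real y * w) = 0" by (simp add: algebra_simps)
    hence "of_real x = of_real y * w" using assms(1) by auto
    hence "Im (of_real y * w) = 0" by (metis Im_complex_of_real)
    thus "y = 0" using Iw by simp
  qed
qed

section \<open>Topology of the nodal set: no loops, unique arcs\<close>

text \<open>Convexity of \<open>D\<close> keeps whatever a compact subset of \<open>D\<close>
  encloses inside \<open>D\<close>, as the maximum principle requires.\<close>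

locale nodal =
  fixes f :: "complex \<Rightarrow> complex" and D :: "complex set" and u :: "complex \<Rightarrow> real"
  assumes hol: "f holomorphic_on D" and open_D: "open D" and convex_D: "convex D"
    and nonconst: "\<not> f constant_on D" and u_eq: "\<And>z. z \<in> D \<Longrightarrow> u z = Re (f z)"
begin

abbreviation "Z \<equiv> nodal_set u D"

lemma Z_iff: "z \<in> Z \<longleftrightarrow> z \<in> D \<and> Re (f z) = 0"
  using u_eq by (auto simp: nodal_set_def)

lemma connected_D: "connected D"
  using convex_D by (rule convex_connected)

lemma chart_ex:
  assumes "q \<in> D"
  shows "\<exists>k \<phi> \<psi> N d. power_chart f q k \<phi> \<psi> N d \<and> N \<subseteq> D \<and> (deriv f q \<noteq> 0 \<longrightarrow> k = 1)"
  by (rule power_chart_exists[OF hol open_D connected_D nonconst assms open_UNIV UNIV_I]) blast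

text \<open>By the maximum principle a compact piece of the nodal set encloses nothing.\<close>

lemma connected_Compl_nodal:
  assumes K: "compact K" "K \<subseteq> Z"
  shows "connected (- K)"
proof -
  have KD: "K \<subseteq> D" using K by (auto simp: Z_iff)
  have insD: "inside K \<subseteq> D"
  proof -
    have "- D \<subseteq> outside K" using outside_mono[OF KD] outside_convex[OF convex_D] by simp
    thus ?thesis by (auto simp: inside_outside)
  qed
  have "inside K = {}"
  proof (rule ccontr)
    assume "inside K \<noteq> {}"
    then obtain x where x: "x \<in> inside K" by blast
    have cl: "closed K" using K compact_imp_closed by blast
    have op: "open (inside K)" by (rule open_inside[OF cl])
    have clo: "closure (inside K) \<subseteq> D" using closure_inside_subset[OF cl] insD KD by blast
    have fr: "frontier (inside K) \<subseteq> K" by (rule frontier_inside_subset[OF cl])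
    have bd: "bounded (inside K)" by (rule bounded_inside) (use K compact_imp_bounded in blast)
    have h: "g holomorphic_on interior (inside K)" "continuous_on (closure (inside K)) g" if "g holomorphic_on D" for g
      using that insD clo op by (auto simp: interior_open intro: holomorphic_on_subset continuous_on_subset holomorphic_on_imp_continuous_on)
    have R0: "Re (f z) = 0" if "z \<in> inside K" for z
    proof -
      have "Re (f z) \<le> 0"
        by (rule maximum_real_frontier[OF h[OF hol] bd _ that]) (use fr K Z_iff in auto)
      moreover have "Re (- f z) \<le> 0"
        by (rule maximum_real_frontier[OF h[of "\<lambda>z. - f z"] bd _ that]) (use fr K Z_iff hol in \<open>auto intro!: holomorphic_intros\<close>)
      ultimately show ?thesis by simp
    qed
    \<comment> \<open>\<open>Re f = 0\<close> on an open set contradicts the open mapping theorem: a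
      small real shift of \<open>f x\<close> is again a value.\<close>
    have "open (f ` inside K)"
      by (rule open_mapping_thm[OF hol open_D connected_D op insD nonconst])
    then obtain e where e: "e > 0" "ball (f x) e \<subseteq> f ` inside K" using x by (metis imageI openE)
    have "f x + of_real (e/2) \<in> ball (f x) e" using e(1) by (simp add: dist_norm)
    then obtain y where "y \<in> inside K" "f x + of_real (e/2) = f y" using e(2) by auto
    hence "e / 2 = 0" using R0[of x] R0[of y] x by (metis Re_complex_of_real plus_complex.sel(1) add_0)
    thus False using e(1) by simp
  qed
  hence "- K = outside K" by (metis inside_Un_outside sup_bot_left)
  thus ?thesis using connected_outside[of K] K compact_imp_bounded by auto
qed

text \<open>Janiszewski's theorem: compact connected sets whose union does not separate the plane
  meet in a connected set. In this form the maximum principle enters all later arguments about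
  arcs.\<close>

lemma connected_Int_nodal:
  assumes "compact S" "compact T" "connected S" "connected T" "S \<subseteq> Z" "T \<subseteq> Z"
  shows "connected (S \<inter> T)"
  by (rule Janiszewski_dual) (use assms connected_Compl_nodal[of "S \<union> T"] in auto)

lemma curve_locally_inj:
  assumes reg: "regular_analytic_curve I \<gamma>" and im: "\<gamma> ` I \<subseteq> Z" and t: "t \<in> I"
  obtains e where "e > 0" "ball t e \<subseteq> I" "inj_on \<gamma> (ball t e)"
proof -
  have "\<gamma> t \<in> D" using im t by (auto simp: Z_iff)
  then obtain k \<phi> \<psi> N d where ch: "power_chart f (\<gamma> t) k \<phi> \<psi> N d"
    using chart_ex by blast
  obtain c e \<rho> where e: "cmod c = 1" "e > 0" "ball t e \<subseteq> I" "\<And>s. s \<in> ball t e \<Longrightarrow> \<phi> (\<gamma> s) = of_real (\<rho> s) * c"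
    "strict_mono_on (ball t e) \<rho>"
    by (rule curve_in_chart_line[OF reg t ch]) (use im Z_iff in auto)
  have "inj_on \<gamma> (ball t e)"
  proof (rule inj_onI)
    fix x y assume xy: "x \<in> ball t e" "y \<in> ball t e" "\<gamma> x = \<gamma> y"
    hence "of_real (\<rho> x) * c = of_real (\<rho> y) * c" using e(4)[of x] e(4)[of y] by metis
    hence "\<rho> x = \<rho> y" using e(1) by auto
    thus "x = y" using strict_mono_on_eqD[OF e(5)] xy by blast
  qed
  with e that show ?thesis by blast
qed

text \<open>Of all pairs of parameters with the same image, a closest one bounds a simple loop. Cut
  at the middle parameter, the two halves of the loop meet in exactly two points, which do not form
  a connected set.\<close>

lemma curve_inj:
  assumes reg: "regular_analytic_curve I \<gamma>" and im: "\<gamma> ` I \<subseteq> Z"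
  shows "inj_on \<gamma> I"
proof (rule ccontr)
  assume "\<not> inj_on \<gamma> I"
  then obtain t1 t2 where t: "t1 \<in> I" "t2 \<in> I" "t1 < t2" "\<gamma> t1 = \<gamma> t2"
    unfolding inj_on_def by (metis linorder_neqE_linordered_idom)
  define K where "K = {t1..t2}"
  have "convex I" using reg by (simp add: regular_analytic_curve_def is_interval_convex)
  hence "closed_segment t1 t2 \<subseteq> I" using t closed_segment_subset by blast
  hence KI: "K \<subseteq> I" using t by (simp add: K_def closed_segment_eq_real_ivl)
  have cont: "continuous_on K \<gamma>" using regular_analytic_curve_continuous[OF reg] KI continuous_on_subset by blast
  define CC where "CC = {B. open B \<and> inj_on \<gamma> B}"
  have K1: "K \<subseteq> \<Union> CC"
  proof
    fix x assume "x \<in> K"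
    hence "x \<in> I" using KI by blast
    then obtain e where "e > 0" "inj_on \<gamma> (ball x e)" using curve_locally_inj[OF reg im] by metis
    thus "x \<in> \<Union> CC" unfolding CC_def by (intro UnionI[of "ball x e"]) auto
  qed
  have K2: "compact K" by (simp add: K_def)
  have K3: "CC \<noteq> {}" unfolding CC_def by (metis (mono_tags) empty_iff inj_on_empty mem_Collect_eq open_empty)
  \<comment> \<open>A Lebesgue number for the cover by open sets on which \<open>\<gamma>\<close> is
    injective. It keeps the two parameters of such a pair a fixed distance apart, so that the set
    \<open>P\<close> of pairs is compact and a closest pair exists.\<close>
  obtain dl where dl: "dl > 0" "\<And>T. T \<subseteq> K \<Longrightarrow> diameter T < dl \<Longrightarrow> \<exists>B\<in>CC. T \<subseteq> B"
    by (rule Lebesgue_number_lemma[OF K2 K3 K1]) (auto simp: CC_def)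
  have sep: "dl \<le> b - a" if "a \<in> K" "b \<in> K" "a < b" "\<gamma> a = \<gamma> b" for a b
  proof (rule ccontr)
    assume "\<not> dl \<le> b - a"
    hence "diameter {a..b} < dl" using that by (simp add: diameter_closed_interval)
    moreover have "{a..b} \<subseteq> K" using that by (auto simp: K_def)
    ultimately obtain B where B: "B \<in> CC" "{a..b} \<subseteq> B" using dl(2) by blast
    have "a \<in> B" "b \<in> B" using B(2) that by auto
    moreover have "inj_on \<gamma> B" using B(1) by (simp add: CC_def)
    ultimately show False using that by (auto dest: inj_onD)
  qed
  define P where "P = {x \<in> K \<times> K. dl \<le> snd x - fst x \<and> dist (\<gamma> (fst x)) (\<gamma> (snd x)) = 0}"
  have cf: "continuous_on (K \<times> K) (\<lambda>x. \<gamma> (fst x))" "continuous_on (K \<times> K) (\<lambda>x. \<gamma> (snd x))"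
    by (rule continuous_on_compose2[OF cont] continuous_intros | force)+
  have "closed P"
  proof -
    have "closed {x \<in> K \<times> K. dist (\<gamma> (fst x)) (\<gamma> (snd x)) = 0}"
      by (rule continuous_closed_preimage_constant[OF continuous_on_dist[OF cf]]) (simp add: K_def closed_Times)
    moreover have "closed {x::real \<times> real. dl \<le> snd x - fst x}"
      by (intro closed_Collect_le continuous_intros)
    moreover have "P = {x \<in> K \<times> K. dist (\<gamma> (fst x)) (\<gamma> (snd x)) = 0} \<inter> {x. dl \<le> snd x - fst x}"
      by (auto simp: P_def)
    ultimately show ?thesis by auto
  qed
  moreover have "bounded P"
    by (rule bounded_subset[OF compact_imp_bounded[OF compact_Times[of K K]]]) (auto simp: P_def K_def)
  ultimately have "compact P" by (simp add: compact_eq_bounded_closed)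
  moreover have "(t1, t2) \<in> P" using t sep[of t1 t2] by (simp add: P_def K_def)
  ultimately obtain m where m: "m \<in> P" "\<And>x. x \<in> P \<Longrightarrow> snd m - fst m \<le> snd x - fst x"
    using continuous_attains_inf[of P "\<lambda>x. snd x - fst x"] by (force intro: continuous_intros)
  define a b where "a = fst m" and "b = snd m"
  have ab: "a \<in> K" "b \<in> K" "a < b" "\<gamma> a = \<gamma> b" using m(1) dl(1) by (auto simp: P_def a_def b_def)
  have abK: "{a..b} \<subseteq> K" using ab by (auto simp: K_def)
  have uniq: "x = a \<and> y = b" if "a \<le> x" "x < y" "y \<le> b" "\<gamma> x = \<gamma> y" for x y
  proof -
    have xy: "x \<in> K" "y \<in> K" using that abK by auto
    have "(x, y) \<in> P" using sep[OF xy that(2,4)] xy that(4) by (simp add: P_def)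
    hence "b - a \<le> y - x" using m(2)[of "(x,y)"] by (simp add: a_def b_def)
    thus ?thesis using that by linarith
  qed
  define s where "s = (a + b) / 2"
  have s: "a < s" "s < b" using ab by (auto simp: s_def)
  have subs: "{a..s} \<subseteq> K" "{s..b} \<subseteq> K" using abK s by auto
  have ns: "\<gamma> a \<noteq> \<gamma> s" using uniq[of a s] s by auto
  have "\<gamma> ` {a..s} \<inter> \<gamma> ` {s..b} = {\<gamma> a, \<gamma> s}"
  proof
    show "\<gamma> ` {a..s} \<inter> \<gamma> ` {s..b} \<subseteq> {\<gamma> a, \<gamma> s}"
    proof
      fix z assume "z \<in> \<gamma> ` {a..s} \<inter> \<gamma> ` {s..b}"
      then obtain x y where xy: "a \<le> x" "x \<le> s" "s \<le> y" "y \<le> b" "z = \<gamma> x" "z = \<gamma> y" by auto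
      show "z \<in> {\<gamma> a, \<gamma> s}"
      proof (cases "x < y")
        case True
        thus ?thesis using uniq[of x y] xy by auto
      next
        case False
        hence "x = s" using xy by auto
        thus ?thesis using xy by auto
      qed
    qed
    show "{\<gamma> a, \<gamma> s} \<subseteq> \<gamma> ` {a..s} \<inter> \<gamma> ` {s..b}"
    proof -
      have "\<gamma> a \<in> \<gamma> ` {a..s}" "\<gamma> s \<in> \<gamma> ` {a..s}" "\<gamma> s \<in> \<gamma> ` {s..b}" "\<gamma> b \<in> \<gamma> ` {s..b}" using s by auto
      thus ?thesis using ab(4) by simp
    qed
  qed
  moreover have "connected (\<gamma> ` {a..s} \<inter> \<gamma> ` {s..b})"
  proof -
    have "\<gamma> ` {a..s} \<subseteq> Z" "\<gamma> ` {s..b} \<subseteq> Z" using subs KI im by blast+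
    thus ?thesis using subs
      by (intro connected_Int_nodal compact_continuous_image connected_continuous_image continuous_on_subset[OF cont]) auto
  qed
  ultimately have "connected {\<gamma> a, \<gamma> s}" by simp
  hence "{\<gamma> a, \<gamma> s} = {} \<or> (\<exists>x. {\<gamma> a, \<gamma> s} = {x})" using connected_finite_iff_sing by blast
  thus False using ns by (metis insertI1 insert_commute insert_not_empty singletonD)
qed

lemma curve_segment:
  assumes reg: "regular_analytic_curve I \<gamma>" and im: "\<gamma> ` I \<subseteq> Z" and ab: "a \<in> I" "b \<in> I"
  shows "closed_segment a b \<subseteq> I" "compact (\<gamma> ` closed_segment a b)" "connected (\<gamma> ` closed_segment a b)"
    "\<gamma> ` closed_segment a b \<subseteq> Z"
proof -
  show s: "closed_segment a b \<subseteq> I"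
    using reg ab by (metis closed_segment_subset is_interval_convex regular_analytic_curve_def)
  have c: "continuous_on (closed_segment a b) \<gamma>"
    using regular_analytic_curve_continuous[OF reg] s continuous_on_subset by blast
  show "compact (\<gamma> ` closed_segment a b)" "connected (\<gamma> ` closed_segment a b)"
    using c by (auto intro: compact_continuous_image connected_continuous_image)
  show "\<gamma> ` closed_segment a b \<subseteq> Z" using s im by blast
qed

text \<open>The nodal set contains no loops, so arcs in it are determined by their end points.\<close>

lemma arc_subset:
  assumes reg: "regular_analytic_curve I \<gamma>" and im: "\<gamma> ` I \<subseteq> Z" and ab: "a \<in> I" "b \<in> I"
    and S: "compact S" "connected S" "S \<subseteq> Z" "\<gamma> a \<in> S" "\<gamma> b \<in> S"
  shows "\<gamma> ` closed_segment a b \<subseteq> S"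
proof (rule ccontr)
  assume "\<not> ?thesis"
  then obtain m where m: "m \<in> closed_segment a b" "\<gamma> m \<notin> S" by blast
  note seg = curve_segment[OF reg im ab]
  have mI: "m \<in> I" using m seg by blast
  note seg1 = curve_segment[OF reg im ab(1) mI] and seg2 = curve_segment[OF reg im mI ab(2)]
  have inj: "inj_on \<gamma> I" by (rule curve_inj[OF reg im])
  have un: "closed_segment a b = closed_segment a m \<union> closed_segment m b"
    using Un_closed_segment[OF m(1)] by simp
  have int: "closed_segment a m \<inter> closed_segment m b = {m}"
    using Int_closed_segment[of m a b] m(1) by simp
  \<comment> \<open>\<open>T\<close> is connected, yet without \<open>\<gamma> m\<close> it falls
    into the parts before and after \<open>m\<close>.\<close>
  define T where "T = \<gamma> ` closed_segment a b \<inter> S"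
  have T: "connected T" unfolding T_def by (rule connected_Int_nodal) (use seg S in auto)
  have "T \<subseteq> \<gamma> ` closed_segment a m \<union> \<gamma> ` closed_segment m b" unfolding T_def un by auto
  moreover have "\<gamma> ` closed_segment a m \<inter> \<gamma> ` closed_segment m b \<inter> T = {}"
  proof -
    have "\<gamma> ` closed_segment a m \<inter> \<gamma> ` closed_segment m b = \<gamma> ` {m}"
      unfolding int[symmetric] using inj_on_image_Int[OF inj seg1(1) seg2(1)] by simp
    thus ?thesis using m(2) by (auto simp: T_def)
  qed
  moreover have "\<gamma> a \<in> \<gamma> ` closed_segment a m \<inter> T" "\<gamma> b \<in> \<gamma> ` closed_segment m b \<inter> T"
    using S by (auto simp: T_def)
  moreover have "closed (\<gamma> ` closed_segment a m)" "closed (\<gamma> ` closed_segment m b)"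
    using seg1(2) seg2(2) compact_imp_closed by auto
  ultimately show False using T unfolding connected_closed by blast
qed

text \<open>Supplies test curves: each diameter of the chart on which the \<open>k\<close>-th power
  is imaginary is the image of a regular nodal curve.\<close>

lemma chart_line_curve:
  assumes ch: "power_chart f q k \<phi> \<psi> N d" and ND: "N \<subseteq> D" and q: "q \<in> Z" and c: "cmod c = 1" "Re (c ^ k) = 0"
  shows "regular_analytic_curve {-d<..<d} (\<lambda>r. \<psi> (of_real r * c))"
    and "(\<lambda>r. \<psi> (of_real r * c)) ` {-d<..<d} \<subseteq> Z"
    and "\<And>r. r \<in> {-d<..<d} \<Longrightarrow> \<psi> (of_real r * c) \<in> N \<and> \<phi> (\<psi> (of_real r * c)) = of_real r * c"
proof -
  note C = power_chartD[OF ch]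
  have inb: "of_real r * c \<in> ball 0 d" if "r \<in> {-d<..<d}" for r using that c by (auto simp: norm_mult abs_less_iff)
  show *: "\<psi> (of_real r * c) \<in> N \<and> \<phi> (\<psi> (of_real r * c)) = of_real r * c" if "r \<in> {-d<..<d}" for r
    using C inb[OF that] by blast
  show "(\<lambda>r. \<psi> (of_real r * c)) ` {-d<..<d} \<subseteq> Z"
  proof safe
    fix r assume r: "r \<in> {-d<..<d}"
    note * = *[OF r]
    have "f (\<psi> (of_real r * c)) = f q + of_real (r ^ k) * c ^ k" using C(14)[of "\<psi> (of_real r * c)"] * by (simp add: power_mult_distrib)
    thus "\<psi> (of_real r * c) \<in> Z" using * ND q c(2) by (auto simp: Z_iff simp del: of_real_power)
  qed
  show "regular_analytic_curve {-d<..<d} (\<lambda>r. \<psi> (of_real r * c))"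
  proof (rule regular_analytic_curveI)
    show "{-d<..<d} \<noteq> {}" using C(2) by auto
    fix t assume t: "t \<in> {-d<..<d}"
    define e where "e = d - \<bar>t\<bar>"
    have e: "e > 0" using t by (auto simp: e_def)
    have zin: "z * c \<in> ball 0 d" if "z \<in> ball (of_real t) e" for z
    proof -
      have "cmod z \<le> cmod (z - of_real t) + \<bar>t\<bar>" using norm_triangle_ineq[of "z - of_real t" "of_real t"] by simp
      thus ?thesis using that c by (simp add: e_def norm_mult dist_norm norm_minus_commute)
    qed
    have "(\<psi> has_field_derivative deriv \<psi> (of_real t * c)) (at (of_real t * c))"
      by (rule holomorphic_derivI[OF C(6) open_ball inb[OF t]])
    hence "((\<lambda>z. \<psi> (z * c)) has_field_derivative deriv \<psi> (of_real t * c) * c) (at (of_real t))"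
      by (rule DERIV_chain2) (auto intro!: derivative_eq_intros)
    hence "deriv (\<lambda>z. \<psi> (z * c)) (of_real t) \<noteq> 0" using C(13)[OF inb[OF t]] c by (auto simp: DERIV_imp_deriv)
    moreover have "(\<lambda>z. \<psi> (z * c)) holomorphic_on ball (of_real t) e"
    proof -
      have "(\<lambda>z. z * c) holomorphic_on ball (of_real t) e" by (intro holomorphic_intros)
      moreover have "(\<lambda>z. z * c) ` ball (of_real t) e \<subseteq> ball 0 d" using zin by blast
      ultimately have "(\<psi> \<circ> (\<lambda>z. z * c)) holomorphic_on ball (of_real t) e"
        using C(6) holomorphic_on_compose_gen by blast
      thus ?thesis by (simp add: o_def)
    qed
    ultimately show "\<exists>F e. e > 0 \<and> F holomorphic_on ball (of_real t) e \<and> deriv F (of_real t) \<noteq> 0 \<and>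
           (\<forall>s\<in>{-d<..<d}. \<bar>s - t\<bar> < e \<longrightarrow> \<psi> (of_real s * c) = F (of_real s))"
      using e by blast
  qed (auto simp: is_interval_oo)
qed

text \<open>Close to a point of it, a compact piece of a nodal curve lies on a single line of the chart.\<close>

lemma curve_segment_near_line:
  assumes reg: "regular_analytic_curve I \<gamma>" and im: "\<gamma> ` I \<subseteq> Z" and ab: "a \<in> I" "b \<in> I" and t: "t \<in> closed_segment a b"
    and ch: "power_chart f (\<gamma> t) k \<phi> \<psi> N d"
  obtains \<eta> where "\<eta> > 0" "\<And>z. z \<in> \<gamma> ` closed_segment a b \<Longrightarrow> dist z (\<gamma> t) < \<eta> \<Longrightarrow>
     z \<in> N \<and> (\<exists>x. \<phi> z = of_real x * sgn (deriv \<phi> (\<gamma> t) * vector_derivative \<gamma> (at t)))"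
proof -
  note seg = curve_segment[OF reg im ab]
  have tI: "t \<in> I" using seg t by blast
  obtain c e \<rho> where e: "e > 0" "\<And>s. s \<in> ball t e \<Longrightarrow> \<gamma> s \<in> N" "\<And>s. s \<in> ball t e \<Longrightarrow> \<phi> (\<gamma> s) = of_real (\<rho> s) * c"
    "c = sgn (deriv \<phi> (\<gamma> t) * vector_derivative \<gamma> (at t))"
    by (rule curve_in_chart_line[OF reg tI ch]) (use im Z_iff in auto)
  obtain \<eta> where \<eta>: "\<eta> > 0" "\<And>s. s \<in> closed_segment a b \<Longrightarrow> dist (\<gamma> s) (\<gamma> t) < \<eta> \<Longrightarrow> s \<in> ball t e"
    by (rule inj_curve_near[of "closed_segment a b" \<gamma> t e])
       (use regular_analytic_curve_continuous[OF reg] seg curve_inj[OF reg im] t e(1) in \<open>auto intro: continuous_on_subset inj_on_subset\<close>)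
  show ?thesis
  proof (rule that[OF \<eta>(1)])
    fix z assume "z \<in> \<gamma> ` closed_segment a b" "dist z (\<gamma> t) < \<eta>"
    then obtain s where s: "z = \<gamma> s" "s \<in> ball t e" using \<eta>(2) by blast
    show "z \<in> N \<and> (\<exists>x. \<phi> z = of_real x * sgn (deriv \<phi> (\<gamma> t) * vector_derivative \<gamma> (at t)))"
      using e(2-4) s by blast
  qed
qed

text \<open>At a critical zero \<open>q\<close> a second nodal line would pass through
  \<open>q\<close>. A point \<open>x\<close> on it is joined to \<open>p\<close> by a regular curve.
  By uniqueness of arcs this curve passes through \<open>q\<close>, where it would have to turn from
  the second line into the arc from \<open>q\<close> to \<open>p\<close>; but near \<open>q\<close>
  a regular curve stays on one line.\<close>

lemma deriv_nonzero_nodal: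
  assumes p: "p \<in> Z" and cov: "\<And>z. z \<in> Z \<Longrightarrow> \<exists>I \<gamma>. regular_analytic_curve I \<gamma> \<and> \<gamma> ` I \<subseteq> Z \<and> z \<in> \<gamma> ` I \<and> p \<in> \<gamma> ` I"
    and q: "q \<in> Z" "q \<noteq> p"
  shows "deriv f q \<noteq> 0"
proof
  assume dq: "deriv f q = 0"
  obtain k \<phi> \<psi> N d where ch: "power_chart f q k \<phi> \<psi> N d" and ND: "N \<subseteq> D"
    using chart_ex q(1) by (metis Z_iff)
  note C = power_chartD[OF ch]
  \<comment> \<open>For \<open>k = 1\<close> the derivatives of \<open>f\<close> and of
    \<open>\<phi>\<close> at \<open>q\<close> coincide, and the latter is nonzero.\<close>
  have k2: "k \<ge> 2"
  proof (rule ccontr)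
    assume "\<not> k \<ge> 2"
    hence k1: "k = 1" using C(1) by simp
    have "(\<phi> has_field_derivative deriv \<phi> q) (at q)" by (rule holomorphic_derivI[OF C(5,3,4)])
    hence "((\<lambda>z. f q + \<phi> z) has_field_derivative deriv \<phi> q) (at q)" by (auto intro!: derivative_eq_intros)
    hence "(f has_field_derivative deriv \<phi> q) (at q)"
      by (rule has_field_derivative_transform_within_open[OF _ C(3,4)]) (use C(14) k1 in auto)
    thus False using dq C(12)[OF C(4)] by (simp add: DERIV_imp_deriv)
  qed
  obtain I1 \<gamma>1 tq tp where g1: "regular_analytic_curve I1 \<gamma>1" "\<gamma>1 ` I1 \<subseteq> Z" "tq \<in> I1" "tp \<in> I1" "\<gamma>1 tq = q" "\<gamma>1 tp = p"
    using cov[OF q(1)] by blast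
  note seg1 = curve_segment[OF g1(1-4)]
  define S0 where "S0 = \<gamma>1 ` closed_segment tq tp"
  define c1 where "c1 = sgn (deriv \<phi> q * vector_derivative \<gamma>1 (at tq))"
  have c1: "cmod c1 = 1" "Re (c1 ^ k) = 0"
    using curve_in_chart_line[OF g1(1,3) ch[folded g1(5)], of thesis for thesis] g1(2,5) by (auto simp: Z_iff c1_def subset_iff)
  \<comment> \<open>\<open>c1\<close> is the direction in which the arc \<open>S0\<close> from
    \<open>q\<close> to \<open>p\<close> leaves \<open>q\<close>; \<open>c2\<close> spans another
    nodal line.\<close>
  obtain c2 where c2: "cmod c2 = 1" "Re (c2 ^ k) = 0" "\<And>x y. of_real x * c1 = of_real y * c2 \<Longrightarrow> y = 0"
    by (rule cis_root_direction[OF c1 k2]) blast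
  obtain \<eta>1 where \<eta>1: "\<eta>1 > 0" "\<And>z. z \<in> S0 \<Longrightarrow> dist z q < \<eta>1 \<Longrightarrow> z \<in> N \<and> (\<exists>x. \<phi> z = of_real x * c1)"
    using curve_segment_near_line[OF g1(1-4) _ ch[folded g1(5)]] unfolding S0_def c1_def g1(5) by (metis ends_in_segment(1))
  define \<beta> where "\<beta> = (\<lambda>r. \<psi> (of_real r * c2))"
  note be = chart_line_curve[OF ch ND q(1) c2(1,2), folded \<beta>_def]
  have b0: "\<beta> 0 = q" by (simp add: \<beta>_def C(15))
  have "isCont \<beta> 0" using regular_analytic_curve_continuous[OF be(1)] C(2) by (auto simp: continuous_on_eq_continuous_at)
  then obtain r1 where r1: "r1 > 0" "\<And>r. dist r 0 < r1 \<Longrightarrow> dist (\<beta> r) q < \<eta>1"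
    unfolding continuous_at_eps_delta b0 using \<eta>1(1) by blast
  define r0 where "r0 = min r1 d / 2"
  have r0: "0 < r0" "r0 < r1" "r0 < d" using r1 C(2) by (auto simp: r0_def)
  have r0I: "0 \<in> {-d<..<d}" "r0 \<in> {-d<..<d}" using r0 C(2) by auto
  define Bs where "Bs = \<beta> ` closed_segment 0 r0"
  note segb = curve_segment[OF be(1,2) r0I, folded Bs_def]
  have int: "S0 \<inter> Bs \<subseteq> {q}"
  proof
    fix z assume z: "z \<in> S0 \<inter> Bs"
    then obtain r where r: "z = \<beta> r" "0 \<le> r" "r \<le> r0" using r0 by (auto simp: Bs_def closed_segment_eq_real_ivl)
    have "dist z q < \<eta>1" using r1(2)[of r] r r0 by simp
    then obtain x where "\<phi> z = of_real x * c1" using \<eta>1(2)[of z] z by blast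
    moreover have "\<phi> z = of_real r * c2" using be(3)[of r] r r0 by (auto simp: \<beta>_def)
    ultimately have "r = 0" using c2(3) by metis
    thus "z \<in> {q}" using r b0 by simp
  qed
  define x where "x = \<beta> r0"
  have phx: "\<phi> x = of_real r0 * c2" using be(3)[of r0] r0 by (auto simp: x_def \<beta>_def)
  have xq: "x \<noteq> q" using phx C(7) r0 c2(1) by auto
  have xZ: "x \<in> Z" using be(2) r0I by (auto simp: x_def)
  obtain I3 \<gamma>3 a b where g3: "regular_analytic_curve I3 \<gamma>3" "\<gamma>3 ` I3 \<subseteq> Z" "a \<in> I3" "b \<in> I3" "\<gamma>3 a = x" "\<gamma>3 b = p"
    using cov[OF xZ] by blast
  define T where "T = \<gamma>3 ` closed_segment a b"
  note seg3 = curve_segment[OF g3(1-4), folded T_def]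
  have xT: "x \<in> T" "p \<in> T" using g3 by (auto simp: T_def)
  have qS: "q \<in> S0" "q \<in> Bs" "p \<in> S0" "x \<in> Bs"
  proof -
    show "q \<in> S0" "p \<in> S0" using g1(5,6) by (auto simp: S0_def)
    show "q \<in> Bs" "x \<in> Bs" unfolding Bs_def x_def using b0 by (metis ends_in_segment image_eqI)+
  qed
  have TS: "T \<subseteq> S0 \<union> Bs"
    unfolding T_def
  proof (rule arc_subset[OF g3(1-4)])
    show "compact (S0 \<union> Bs)" using seg1 segb by (auto simp: S0_def)
    show "connected (S0 \<union> Bs)" using seg1 segb qS by (intro connected_Un) (auto simp: S0_def)
    show "S0 \<union> Bs \<subseteq> Z" using seg1 segb by (auto simp: S0_def)
  qed (use qS g3 in auto)
  \<comment> \<open>Otherwise the closed sets \<open>S0\<close> and \<open>Bs\<close> would separate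
    the connected arc \<open>T\<close>.\<close>
  have qT: "q \<in> T"
  proof (rule ccontr)
    assume "q \<notin> T"
    hence "S0 \<inter> Bs \<inter> T = {}" using int by blast
    moreover have "closed S0" "closed Bs" using seg1 segb compact_imp_closed by (auto simp: S0_def)
    ultimately show False using seg3(3) TS qS xT unfolding connected_closed by blast
  qed
  have BT: "Bs \<subseteq> T" unfolding Bs_def
    by (rule arc_subset[OF be(1,2) r0I seg3(2-4)]) (use qT xT b0 in \<open>auto simp: x_def\<close>)
  have ST: "S0 \<subseteq> T" unfolding S0_def
    by (rule arc_subset[OF g1(1-4) seg3(2-4)]) (use qT xT g1 in auto)
  obtain tq3 where tq3: "tq3 \<in> closed_segment a b" "\<gamma>3 tq3 = q" using qT by (auto simp: T_def)
  define c3 where "c3 = sgn (deriv \<phi> q * vector_derivative \<gamma>3 (at tq3))"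
  obtain \<eta>3 where \<eta>3: "\<eta>3 > 0" "\<And>z. z \<in> T \<Longrightarrow> dist z q < \<eta>3 \<Longrightarrow> z \<in> N \<and> (\<exists>x. \<phi> z = of_real x * c3)"
    using curve_segment_near_line[OF g3(1-4) tq3(1) ch[folded tq3(2)]] unfolding T_def c3_def tq3(2) by metis
  have "\<exists>r. 0 < r \<and> r < r0 \<and> dist (\<beta> r) q < \<eta>3"
  proof -
    obtain r2 where r2: "r2 > 0" "\<And>r. dist r 0 < r2 \<Longrightarrow> dist (\<beta> r) q < \<eta>3"
      using \<open>isCont \<beta> 0\<close> unfolding continuous_at_eps_delta b0 using \<eta>3(1) by blast
    show ?thesis using r0 r2 by (intro exI[of _ "min r2 r0 / 2"]) auto
  qed
  then obtain r where r: "0 < r" "r < r0" "dist (\<beta> r) q < \<eta>3" by blast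
  have "\<beta> r \<in> Bs" using r by (auto simp: Bs_def closed_segment_eq_real_ivl)
  then obtain y where "\<phi> (\<beta> r) = of_real y * c3" using \<eta>3(2) BT r by blast
  moreover have "\<phi> (\<beta> r) = of_real r * c2" using be(3)[of r] r r0 by (auto simp: \<beta>_def)
  ultimately have e2: "of_real r * c2 = of_real y * c3" by simp
  \<comment> \<open>A point of \<open>Bs\<close> near \<open>q\<close> has shown that
    \<open>c3\<close> is parallel to \<open>c2\<close>; a point of \<open>S0\<close> near
    \<open>q\<close> shows that it is parallel to \<open>c1\<close>.\<close>
  have "\<exists>z\<in>S0. z \<noteq> q \<and> dist z q < min \<eta>1 \<eta>3"
  proof -
    have "q islimpt S0"
      by (rule connected_imp_perfect[OF seg1(3)[folded S0_def] qS(1)]) (use qS q in \<open>metis singletonD\<close>)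
    thus ?thesis using \<eta>1(1) \<eta>3(1) unfolding islimpt_approachable by (metis min_less_iff_conj)
  qed
  then obtain z where z: "z \<in> S0" "z \<noteq> q" "dist z q < \<eta>1" "dist z q < \<eta>3" by auto
  obtain x1 x3 where x13: "\<phi> z = of_real x1 * c1" "\<phi> z = of_real x3 * c3" and zN: "z \<in> N"
    using \<eta>1(2)[OF z(1,3)] \<eta>3(2)[OF _ z(4)] ST z(1) by blast
  have "\<phi> z \<noteq> 0" using C(10)[OF zN] C(15) z(2) by metis
  hence "x1 \<noteq> 0" "x3 \<noteq> 0" using x13 by auto
  have "of_real (y * x1) * c1 = of_real (x3 * r) * c2"
    using x13 e2 by (metis mult.assoc mult.commute of_real_mult)
  hence "x3 * r = 0" by (rule c2(3))
  thus False using \<open>x3 \<noteq> 0\<close> r by simp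
qed

end

section \<open>The root of \<open>f - f p\<close> as a parameter of the nodal curves\<close>

context nodal
begin

text \<open>Along a nodal curve through \<open>p\<close> the value \<open>f - f p\<close> is \<open>c\<^sup>m s\<^sup>m\<close> with a real parameter \<open>s\<close>;
  the curve is parametrized by \<open>s\<close>.\<close>

definition canonical_param ::
    "complex \<Rightarrow> nat \<Rightarrow> (complex \<Rightarrow> complex) \<Rightarrow> complex \<Rightarrow> real set \<Rightarrow> (real \<Rightarrow> complex) \<Rightarrow> bool" where
  "canonical_param p m \<psi> c J z \<longleftrightarrow>
     open J \<and> is_interval J \<and> continuous_on J z \<and> z ` J \<subseteq> Z \<and>
     (\<forall>s\<in>J. f (z s) = f p + of_real (s ^ m) * c ^ m) \<and>
     (\<exists>\<delta>>0. \<forall>s. \<bar>s\<bar> < \<delta> \<longrightarrow> s \<in> J \<and> z s = \<psi> (of_real s * c))"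

lemma canonical_paramD:
  assumes "canonical_param p m \<psi> c J z"
  shows "open J" "is_interval J" "continuous_on J z" "z ` J \<subseteq> Z" "\<And>s. s \<in> J \<Longrightarrow> f (z s) = f p + of_real (s ^ m) * c ^ m"
    "0 \<in> J" "\<exists>\<delta>>0. \<forall>s. \<bar>s\<bar> < \<delta> \<longrightarrow> s \<in> J \<and> z s = \<psi> (of_real s * c)"
proof -
  show "0 \<in> J" using assms unfolding canonical_param_def by (metis abs_zero)
qed (use assms in \<open>unfold canonical_param_def, blast+\<close>)

text \<open>A line determines its direction \<open>c\<close> only up to sign. Reversal allows curves
  with the same tangent line to be compared with the same \<open>c\<close>.\<close>

lemma canonical_param_reverse:
  assumes "canonical_param p m \<psi> c J z"
  shows "canonical_param p m \<psi> (-c) (uminus ` J) (\<lambda>s. z (-s))"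
  unfolding canonical_param_def
proof (intro conjI ballI)
  note C = canonical_paramD[OF assms]
  show "open (uminus ` J)" using C(1) by (simp add: open_negations)
  show "is_interval (uminus ` J)" using C(2) by simp
  show "continuous_on (uminus ` J) (\<lambda>s. z (-s))"
    by (rule continuous_on_compose2[OF C(3)]) (auto intro!: continuous_intros)
  show "(\<lambda>s. z (-s)) ` uminus ` J \<subseteq> Z" using C(4) by auto
  show "f (z (-s)) = f p + of_real (s ^ m) * (-c) ^ m" if "s \<in> uminus ` J" for s
  proof -
    have "-s \<in> J" using that by auto
    moreover have "of_real ((-s) ^ m) * c ^ m = of_real (s ^ m) * (-c) ^ m"
      by (simp add: power_mult_distrib[symmetric])
    ultimately show ?thesis using C(5) by metis
  qed
  obtain \<delta> where "\<delta> > 0" "\<And>s. \<bar>s\<bar> < \<delta> \<Longrightarrow> s \<in> J \<and> z s = \<psi> (of_real s * c)" using C(7) by blast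
  thus "\<exists>\<delta>>0. \<forall>s. \<bar>s\<bar> < \<delta> \<longrightarrow> s \<in> uminus ` J \<and> z (-s) = \<psi> (of_real s * -c)"
    by (intro exI[of _ \<delta>]) (metis (no_types, lifting) abs_minus_cancel image_eqI minus_minus mult_minus_left mult_minus_right of_real_minus)
qed

text \<open>A chart with exponent 1 means that \<open>f\<close> itself is a coordinate at
  \<open>q\<close>. As long as \<open>z\<close> stays in the chart, it is the holomorphic function
  \<open>\<psi> (h - f q)\<close>.\<close>

lemma locally_regular_curve:
  assumes ch: "power_chart f q 1 \<phi> \<psi> N d" and z: "\<And>s. s \<in> I \<Longrightarrow> \<bar>s - s0\<bar> < e0 \<Longrightarrow> z s \<in> N \<and> f (z s) = h (of_real s)"
    and e0: "e0 > 0" and h: "h holomorphic_on UNIV" "h (of_real s0) = f q" "deriv h (of_real s0) \<noteq> 0"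
  shows "\<exists>F e. e > 0 \<and> F holomorphic_on ball (of_real s0) e \<and> deriv F (of_real s0) \<noteq> 0 \<and>
           (\<forall>s\<in>I. \<bar>s - s0\<bar> < e \<longrightarrow> z s = F (of_real s))"
proof -
  note C = power_chartD[OF ch]
  have ch: "continuous_on UNIV h" using h(1) by (rule holomorphic_on_imp_continuous_on)
  have "open ((\<lambda>w. h w - f q) -` ball 0 d)"
    by (rule open_vimage) (auto intro!: continuous_intros ch)
  moreover have "of_real s0 \<in> (\<lambda>w. h w - f q) -` ball 0 d" using h(2) C(2) by simp
  ultimately obtain e1 where e1: "e1 > 0" "ball (of_real s0) e1 \<subseteq> (\<lambda>w. h w - f q) -` ball 0 d" using openE by blast
  define F where "F = (\<lambda>w. \<psi> (h w - f q))"
  define e where "e = min e0 e1"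
  have "F holomorphic_on ball (of_real s0) e"
  proof -
    have "(\<lambda>w. h w - f q) holomorphic_on ball (of_real s0) e" using h(1) by (auto intro!: holomorphic_intros intro: holomorphic_on_subset)
    moreover have "(\<lambda>w. h w - f q) ` ball (of_real s0) e \<subseteq> ball 0 d" using e1(2) by (auto simp: e_def subset_iff)
    ultimately have "(\<psi> \<circ> (\<lambda>w. h w - f q)) holomorphic_on ball (of_real s0) e"
      using C(6) holomorphic_on_compose_gen by blast
    thus ?thesis by (simp add: o_def F_def)
  qed
  moreover have "deriv F (of_real s0) \<noteq> 0"
  proof -
    have "(h has_field_derivative deriv h (of_real s0)) (at (of_real s0))"
      by (rule holomorphic_derivI[OF h(1)]) auto
    hence 1: "((\<lambda>w. h w - f q) has_field_derivative deriv h (of_real s0)) (at (of_real s0))"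
      by (auto intro!: derivative_eq_intros)
    have "(\<psi> has_field_derivative deriv \<psi> 0) (at (h (of_real s0) - f q))"
      unfolding h(2) using holomorphic_derivI[OF C(6) open_ball, of 0] C(2) by simp
    hence "(F has_field_derivative deriv \<psi> 0 * deriv h (of_real s0)) (at (of_real s0))"
      unfolding F_def using 1 by (rule DERIV_chain2)
    thus ?thesis using h(3) C(13)[of 0] C(2) by (simp add: DERIV_imp_deriv)
  qed
  moreover have "z s = F (of_real s)" if "s \<in> I" "\<bar>s - s0\<bar> < e" for s
  proof -
    have zs: "z s \<in> N" "f (z s) = h (of_real s)" using z[of s] that by (auto simp: e_def)
    have "\<phi> (z s) = h (of_real s) - f q" using C(14)[OF zs(1)] zs(2) by simp
    thus ?thesis using C(10)[OF zs(1)] by (simp add: F_def)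
  qed
  ultimately show ?thesis using e0 e1 by (intro exI[of _ F] exI[of _ e]) (auto simp: e_def)
qed

text \<open>At \<open>s = 0\<close> the curve is a line of the chart at \<open>p\<close>. Elsewhere
  \<open>f\<close> is locally invertible on the nodal set, and \<open>f (z s)\<close> is a
  polynomial in \<open>s\<close> whose derivative does not vanish off 0.\<close>

lemma canonical_param_regular:
  assumes ch: "power_chart f p m \<phi> \<psi> N d" and ND: "N \<subseteq> D" and p: "p \<in> Z" and c: "cmod c = 1" "Re (c ^ m) = 0"
    and nz: "\<And>q. q \<in> Z \<Longrightarrow> q \<noteq> p \<Longrightarrow> deriv f q \<noteq> 0"
    and can: "canonical_param p m \<psi> c J z"
  shows "regular_analytic_curve J z"
proof (rule regular_analytic_curveI)
  note P = power_chartD[OF ch]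
  note C = canonical_paramD[OF can]
  show "open J" "is_interval J" "J \<noteq> {}" using C by auto
  fix t assume t: "t \<in> J"
  have c0: "c \<noteq> 0" using c by auto
  show "\<exists>F e. e > 0 \<and> F holomorphic_on ball (of_real t) e \<and> deriv F (of_real t) \<noteq> 0 \<and>
           (\<forall>s\<in>J. \<bar>s - t\<bar> < e \<longrightarrow> z s = F (of_real s))"
  proof (cases "t = 0")
    case True
    obtain \<delta> where de: "\<delta> > 0" "\<And>s. \<bar>s\<bar> < \<delta> \<Longrightarrow> s \<in> J \<and> z s = \<psi> (of_real s * c)" using C(7) by blast
    define e where "e = min \<delta> d"
    have "0 \<in> {-d<..<d}" using P(2) by auto
    note reg = chart_line_curve(1)[OF ch ND p c]
    obtain e1 F where F: "e1 > 0" "ball 0 e1 \<subseteq> {-d<..<d}" "F holomorphic_on ball (of_real 0) e1"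
      "\<And>s. s \<in> ball 0 e1 \<Longrightarrow> \<psi> (of_real s * c) = F (of_real s)"
      "\<And>s. s \<in> ball 0 e1 \<Longrightarrow> vector_derivative (\<lambda>s. \<psi> (of_real s * c)) (at s) = deriv F (of_real s)"
      by (rule regular_analytic_curveD[OF reg \<open>0 \<in> {-d<..<d}\<close>]) blast
    have "vector_derivative (\<lambda>s. \<psi> (of_real s * c)) (at 0) \<noteq> 0"
      using reg \<open>0 \<in> {-d<..<d}\<close> unfolding regular_analytic_curve_def by blast
    hence "deriv F (of_real 0) \<noteq> 0" using F(5)[of 0] F(1) by simp
    moreover have "F holomorphic_on ball (of_real 0) (min e1 \<delta>)" using F(3) holomorphic_on_subset by fastforce
    moreover have "z s = F (of_real s)" if "\<bar>s\<bar> < min e1 \<delta>" for s using de(2)[of s] F(4)[of s] that by simp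
    ultimately show ?thesis using F(1) de(1) True by (intro exI[of _ F] exI[of _ "min e1 \<delta>"]) auto
  next
    case False
    define q where "q = z t"
    have fq: "f q = f p + of_real (t ^ m) * c ^ m" using C(5)[OF t] by (simp add: q_def)
    have qZ: "q \<in> Z" using C(4) t by (auto simp: q_def)
    have "q \<noteq> p" using fq False c0 by auto
    hence dq: "deriv f q \<noteq> 0" by (rule nz[OF qZ])
    obtain k \<phi>' \<psi>' N' d' where ch': "power_chart f q k \<phi>' \<psi>' N' d'" "deriv f q \<noteq> 0 \<longrightarrow> k = 1"
      using chart_ex qZ by (metis Z_iff)
    have ch1: "power_chart f q 1 \<phi>' \<psi>' N' d'" using ch' dq by simp
    have "isCont z t" using C(1,3) t by (simp add: continuous_on_eq_continuous_at)
    then obtain e0 where e0: "e0 > 0" "\<And>s. dist s t < e0 \<Longrightarrow> z s \<in> N'"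
      using power_chartD(3,4)[OF ch1] unfolding continuous_at_open q_def by (metis open_dist)
    define h where "h = (\<lambda>w. f p + w ^ m * c ^ m)"
    show ?thesis
    proof (rule locally_regular_curve[OF ch1 _ e0(1), where h = h])
      show "z s \<in> N' \<and> f (z s) = h (of_real s)" if "s \<in> J" "\<bar>s - t\<bar> < e0" for s
        using C(5)[OF that(1)] e0(2)[of s] that(2) by (simp add: h_def dist_real_def)
      show "h holomorphic_on UNIV" unfolding h_def by (intro holomorphic_intros)
      show "h (of_real t) = f q" by (simp add: h_def fq)
      have "(h has_field_derivative of_nat m * of_real t ^ (m - 1) * c ^ m) (at (of_real t))"
        unfolding h_def by (auto intro!: derivative_eq_intros)
      thus "deriv h (of_real t) \<noteq> 0" using False c0 P(1) by (simp add: DERIV_imp_deriv)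
    qed
  qed
qed

text \<open>The parameters of agreement form an open and closed set: near 0 both are the same line
  of the chart, and elsewhere \<open>f\<close> is locally injective while both have the same value
  of \<open>f\<close>.\<close>

lemma canonical_param_agree:
  assumes c: "cmod c = 1"
    and nz: "\<And>q. q \<in> Z \<Longrightarrow> q \<noteq> p \<Longrightarrow> deriv f q \<noteq> 0"
    and can1: "canonical_param p m \<psi> c J1 z1" and can2: "canonical_param p m \<psi> c J2 z2"
    and s: "s \<in> J1" "s \<in> J2"
  shows "z1 s = z2 s"
proof -
  note C1 = canonical_paramD[OF can1] and C2 = canonical_paramD[OF can2]
  define J where "J = J1 \<inter> J2"
  have J: "open J" "connected J" "0 \<in> J"
    using C1 C2 by (auto simp: J_def is_interval_Int is_interval_connected)
  have cont: "continuous_on J z1" "continuous_on J z2" using C1(3) C2(3) by (auto simp: J_def intro: continuous_on_subset)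
  define E where "E = {s \<in> J. z1 s - z2 s = 0}"
  have "closedin (top_of_set J) E" unfolding E_def
    by (rule continuous_closedin_preimage_constant) (intro continuous_intros cont)
  moreover have "openin (top_of_set J) E"
  proof -
    have "\<exists>e>0. \<forall>x. dist x t < e \<longrightarrow> x \<in> E" if "t \<in> E" for t
    proof (cases "t = 0")
      case True
      obtain d1 d2 where "d1 > 0" "\<And>s. \<bar>s\<bar> < d1 \<Longrightarrow> s \<in> J1 \<and> z1 s = \<psi> (of_real s * c)"
         "d2 > 0" "\<And>s. \<bar>s\<bar> < d2 \<Longrightarrow> s \<in> J2 \<and> z2 s = \<psi> (of_real s * c)" using C1(7) C2(7) by blast
      thus ?thesis using True by (intro exI[of _ "min d1 d2"]) (auto simp: E_def J_def)
    next
      case False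
      define q where "q = z1 t"
      have q2: "q = z2 t" and tJ: "t \<in> J" using that by (auto simp: E_def q_def)
      have fq: "f q = f p + of_real (t ^ m) * c ^ m" using C1(5) tJ by (auto simp: q_def J_def)
      have qZ: "q \<in> Z" using C1(4) tJ by (auto simp: q_def J_def)
      have "q \<noteq> p" using fq False c by auto
      hence dq: "deriv f q \<noteq> 0" by (rule nz[OF qZ])
      have qD: "q \<in> D" using qZ by (simp add: Z_iff)
      obtain r where r: "r > 0" "ball q r \<subseteq> D" "inj_on f (ball q r)"
        by (rule has_complex_derivative_locally_injective[OF hol qD open_D dq])
      have "isCont z1 t" "isCont z2 t" using cont J tJ by (auto simp: continuous_on_eq_continuous_at)
      then obtain e1 e2 where e: "e1 > 0" "\<And>x. dist x t < e1 \<Longrightarrow> dist (z1 x) q < r" "e2 > 0" "\<And>x. dist x t < e2 \<Longrightarrow> dist (z2 x) q < r"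
        unfolding continuous_at_eps_delta q_def[symmetric] q2[symmetric] using r(1) by metis
      obtain e3 where e3: "e3 > 0" "ball t e3 \<subseteq> J" using J(1) tJ openE by blast
      have "x \<in> E" if "dist x t < min e1 (min e2 e3)" for x
      proof -
        have xJ: "x \<in> J" using e3(2) that by (auto simp: dist_commute)
        have "f (z1 x) = f (z2 x)" using C1(5)[of x] C2(5)[of x] xJ by (simp add: J_def)
        moreover have "z1 x \<in> ball q r" "z2 x \<in> ball q r" using e(2,4)[of x] that by (auto simp: dist_commute)
        ultimately show ?thesis using inj_onD[OF r(3)] xJ by (auto simp: E_def)
      qed
      thus ?thesis using e(1,3) e3(1) by (intro exI[of _ "min e1 (min e2 e3)"]) auto
    qed
    hence "open E" by (simp add: open_dist)
    moreover have "E \<subseteq> J" by (auto simp: E_def)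
    ultimately show ?thesis using J(1) by (simp add: openin_open_eq)
  qed
  moreover have "0 \<in> E"
  proof -
    obtain d1 d2 where "d1 > 0" "\<And>s. \<bar>s\<bar> < d1 \<Longrightarrow> s \<in> J1 \<and> z1 s = \<psi> (of_real s * c)"
       "d2 > 0" "\<And>s. \<bar>s\<bar> < d2 \<Longrightarrow> s \<in> J2 \<and> z2 s = \<psi> (of_real s * c)" using C1(7) C2(7) by blast
    thus ?thesis using J(3) by (auto simp: E_def)
  qed
  ultimately have "E = J" using J(2) unfolding connected_clopen by blast
  thus ?thesis using s by (auto simp: E_def J_def)
qed

text \<open>Places two nodal curves with the same tangent line at \<open>p\<close> inside one
  regular curve; maximality then makes them equal.\<close>

lemma canonical_param_union:
  assumes c: "cmod c = 1"
    and nz: "\<And>q. q \<in> Z \<Longrightarrow> q \<noteq> p \<Longrightarrow> deriv f q \<noteq> 0"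
    and can1: "canonical_param p m \<psi> c J1 z1" and can2: "canonical_param p m \<psi> c J2 z2"
  obtains J z where "canonical_param p m \<psi> c J z" "z ` J = z1 ` J1 \<union> z2 ` J2"
proof -
  note C1 = canonical_paramD[OF can1] and C2 = canonical_paramD[OF can2]
  define J where "J = J1 \<union> J2"
  define z where "z = (\<lambda>s. if s \<in> J1 then z1 s else z2 s)"
  have z: "z s = z1 s" if "s \<in> J1" for s using that by (simp add: z_def)
  have z': "z s = z2 s" if "s \<in> J2" for s
    using that canonical_param_agree[OF c nz can1 can2] by (simp add: z_def)
  have im: "z ` J = z1 ` J1 \<union> z2 ` J2" using z z' by (auto simp: J_def image_Un)
  have "canonical_param p m \<psi> c J z"
    unfolding canonical_param_def
  proof (intro conjI ballI)
    show "open J" using C1 C2 by (auto simp: J_def)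
    have "connected J" unfolding J_def using C1 C2 by (intro connected_Un) (auto simp: is_interval_connected)
    thus "is_interval J" by (simp add: is_interval_connected_1)
    show "continuous_on J z" unfolding J_def
      using C1(1,3) C2(1,3) z z' by (intro continuous_on_open_Un) (auto cong: continuous_on_cong)
    show "z ` J \<subseteq> Z" using im C1 C2 by auto
    show "f (z s) = f p + of_real (s ^ m) * c ^ m" if "s \<in> J" for s
      using that C1(5)[of s] C2(5)[of s] z[of s] z'[of s] by (auto simp: J_def)
    show "\<exists>\<delta>>0. \<forall>s. \<bar>s\<bar> < \<delta> \<longrightarrow> s \<in> J \<and> z s = \<psi> (of_real s * c)"
      using C1(7) z unfolding J_def by (metis UnI1)
  qed
  thus ?thesis using that im by blast
qed

end

lemma connected_positive:
  fixes G :: "real \<Rightarrow> real"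
  assumes "connected C" "continuous_on C G" "\<And>x. x \<in> C \<Longrightarrow> G x \<noteq> 0" "x0 \<in> C" "G x0 > 0" "x \<in> C"
  shows "G x > 0"
proof (rule ccontr)
  assume "\<not> ?thesis"
  hence "G x < 0" using assms(3,6) by force
  moreover have "connected (G ` C)" using assms(1,2) by (intro connected_continuous_image)
  ultimately have "0 \<in> G ` C"
    using assms(4-6) connectedD_interval[of "G ` C" "G x" "G x0" 0] by auto
  thus False using assms(3) by auto
qed

context nodal
begin

text \<open>\<open>Y\<close>, the value of \<open>f - f p\<close> in units of \<open>c ^ m\<close>,
  is real along the curve and injective on either side of \<open>t\<close>, since neither
  \<open>deriv f\<close> nor the velocity vanishes there. Its signed \<open>m\<close>-th root is the
  new parameter.\<close>

lemma canonical_param_exists: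
  assumes ch: "power_chart f p m \<phi> \<psi> N d" and ND: "N \<subseteq> D" and p: "p \<in> Z"
    and nz: "\<And>q. q \<in> Z \<Longrightarrow> q \<noteq> p \<Longrightarrow> deriv f q \<noteq> 0"
    and reg: "regular_analytic_curve I \<gamma>" and im: "\<gamma> ` I \<subseteq> Z" and t: "t \<in> I" "\<gamma> t = p"
  obtains J z c where "c = sgn (deriv \<phi> p * vector_derivative \<gamma> (at t))" "cmod c = 1" "Re (c ^ m) = 0"
    "canonical_param p m \<psi> c J z" "z ` J = \<gamma> ` I"
proof -
  note P = power_chartD[OF ch]
  have opI: "open I" and convI: "convex I" using reg by (auto simp: regular_analytic_curve_def is_interval_convex)
  have contI: "continuous_on I \<gamma>" by (rule regular_analytic_curve_continuous[OF reg])
  have inj: "inj_on \<gamma> I" by (rule curve_inj[OF reg im])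
  obtain c e \<rho> where e: "cmod c = 1" "Re (c ^ m) = 0" "e > 0" "ball t e \<subseteq> I" "\<And>s. s \<in> ball t e \<Longrightarrow> \<gamma> s \<in> N"
    "\<And>s. s \<in> ball t e \<Longrightarrow> \<phi> (\<gamma> s) = of_real (\<rho> s) * c" "\<rho> t = 0" "strict_mono_on (ball t e) \<rho>"
    "continuous_on (ball t e) \<rho>" "c = sgn (deriv \<phi> p * vector_derivative \<gamma> (at t))"
    by (rule curve_in_chart_line[OF reg t(1) ch[folded t(2)]]) (use im Z_iff t(2) in auto)
  define b where "b = c ^ m"
  have b: "Re b = 0" "b \<noteq> 0" using e(1,2) by (auto simp: b_def)
  define Y where "Y = (\<lambda>s. Re ((f (\<gamma> s) - f p) / b))"
  have fY: "f (\<gamma> s) = f p + of_real (Y s) * b" if "s \<in> I" for s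
  proof -
    have "\<gamma> s \<in> Z" using that im by blast
    hence "Re (f (\<gamma> s) - f p) = 0" using p by (simp add: Z_iff)
    hence "Im ((f (\<gamma> s) - f p) / b) = 0" using b by (simp add: Im_divide)
    hence "(f (\<gamma> s) - f p) / b = of_real (Y s)" by (simp add: Y_def complex_eq_iff)
    thus ?thesis using b(2) by (simp add: field_simps)
  qed
  have Yrho: "Y s = \<rho> s ^ m" if "s \<in> ball t e" for s
  proof -
    have "f (\<gamma> s) = f p + of_real (\<rho> s ^ m) * b" using P(14)[OF e(5)[OF that]] e(6)[OF that] by (simp add: b_def power_mult_distrib)
    thus ?thesis using b(2) by (simp add: Y_def)
  qed
  have cont_f: "continuous_on I (\<lambda>s. f (\<gamma> s))"
    by (rule continuous_on_compose2[OF holomorphic_on_imp_continuous_on[OF hol] contI]) (use im Z_iff in auto)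
  have contY: "continuous_on I Y" unfolding Y_def
    by (intro continuous_intros cont_f) (use b in auto)
  have Yd: "\<exists>y. (Y has_real_derivative y) (at s) \<and> y \<noteq> 0" if s: "s \<in> I" "s \<noteq> t" for s
  proof -
    define w where "w = vector_derivative \<gamma> (at s) * deriv f (\<gamma> s)"
    have gZ: "\<gamma> s \<in> Z" using im s by blast
    hence gD: "\<gamma> s \<in> D" by (simp add: Z_iff)
    have "\<gamma> s \<noteq> p" using inj_onD[OF inj _ s(1) t(1)] s(2) t(2) by auto
    hence "deriv f (\<gamma> s) \<noteq> 0" by (rule nz[OF gZ])
    moreover have v: "vector_derivative \<gamma> (at s) \<noteq> 0" using reg s by (simp add: regular_analytic_curve_def)
    ultimately have w0: "w \<noteq> 0" by (simp add: w_def)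
    have "(\<gamma> has_vector_derivative vector_derivative \<gamma> (at s)) (at s)"
      by (rule regular_analytic_curveD[OF reg s(1)]) (metis centre_in_ball)
    hence "(f \<circ> \<gamma> has_vector_derivative w) (at s)" unfolding w_def
      by (rule field_vector_diff_chain_at) (rule holomorphic_derivI[OF hol open_D gD])
    hence fw: "((\<lambda>s. f (\<gamma> s)) has_vector_derivative w) (at s)" by (simp add: o_def)
    hence "((\<lambda>s. (f (\<gamma> s) - f p) / b) has_vector_derivative w / b) (at s)"
      by (auto intro!: derivative_eq_intros)
    hence Yv: "(Y has_vector_derivative Re (w / b)) (at s)" unfolding Y_def
      by (rule bounded_linear.has_vector_derivative[OF bounded_linear_Re])
    hence Yr: "(Y has_real_derivative Re (w / b)) (at s)" unfolding has_real_derivative_iff_has_vector_derivative .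
    hence "((\<lambda>s. complex_of_real (Y s)) has_vector_derivative of_real (Re (w / b))) (at s)"
      by (rule has_vector_derivative_of_real)
    hence "((\<lambda>s. of_real (Y s) * b) has_vector_derivative of_real (Re (w / b)) * b) (at s)"
      by (rule has_vector_derivative_mult_left)
    hence "((\<lambda>s. f p + of_real (Y s) * b) has_vector_derivative 0 + of_real (Re (w / b)) * b) (at s)"
      by (rule has_vector_derivative_add[OF has_vector_derivative_const])
    hence "((\<lambda>s. f p + of_real (Y s) * b) has_vector_derivative of_real (Re (w / b)) * b) (at s)" by simp
    moreover have "((\<lambda>s. f p + of_real (Y s) * b) has_vector_derivative w) (at s)"
      by (rule has_vector_derivative_transform_within_open[OF fw opI s(1)]) (simp add: fY)
    ultimately have "w = of_real (Re (w / b)) * b" using vector_derivative_unique_at by blast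
    hence "Re (w / b) \<noteq> 0" using w0 by auto
    thus ?thesis using Yr by blast
  qed
  \<comment> \<open>Rolle's theorem, as the derivative of \<open>Y\<close> can vanish only at
    \<open>t\<close>.\<close>
  have injY: "a = a'" if a: "a \<in> I" "a' \<in> I" "Y a = Y a'" "(t \<le> a \<and> t \<le> a') \<or> (a \<le> t \<and> a' \<le> t)" for a a'
  proof -
    have *: False if a: "a \<in> I" "a' \<in> I" "Y a = Y a'" "t \<le> a \<or> a' \<le> t" "a < a'" for a a'
    proof -
      have sub: "{a..a'} \<subseteq> I" using closed_segment_subset[OF a(1,2) convI] a(5) by (simp add: closed_segment_eq_real_ivl)
      have "\<exists>z. a < z \<and> z < a' \<and> (Y has_real_derivative 0) (at z)"
      proof (rule Rolle[OF a(5,3)])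
        show "continuous_on {a..a'} Y" using contY sub continuous_on_subset by blast
        fix x assume "a < x" "x < a'"
        hence "x \<in> I" "x \<noteq> t" using sub a by auto
        thus "Y differentiable at x" using Yd real_differentiable_def by blast
      qed
      then obtain z where z: "a < z" "z < a'" "(Y has_real_derivative 0) (at z)" by blast
      have "z \<in> I" "z \<noteq> t" using sub a z by auto
      thus False using Yd z(3) DERIV_unique by blast
    qed
    show ?thesis using *[of a a'] *[of a' a] a by (metis linorder_neqE_linordered_idom)
  qed
  have Yt: "Y t = 0" using Yrho[of t] e(3,7) P(1) by simp
  have m0: "m > 0" using P(1) by simp
  have right: "Y x > 0" if "x \<in> I" "x > t" for x
  proof (rule connected_positive[of "I \<inter> {t<..}" Y "t + e/2"])
    show "connected (I \<inter> {t<..})" using convI by (intro convex_connected convex_Int) auto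
    show "continuous_on (I \<inter> {t<..}) Y" using contY continuous_on_subset by blast
    show "Y x \<noteq> 0" if "x \<in> I \<inter> {t<..}" for x using injY[of t x] that t(1) Yt by auto
    have b2: "t + e/2 \<in> ball t e" using e(3) by (simp add: dist_real_def)
    thus "t + e/2 \<in> I \<inter> {t<..}" using e(3,4) by auto
    have "\<rho> t < \<rho> (t + e/2)" by (rule strict_mono_onD[OF e(8)]) (use e(3) b2 in auto)
    thus "0 < Y (t + e/2)" using Yrho[OF b2] e(7) by simp
  qed (use that in auto)
  have left: "(-1) ^ m * Y x > 0" if "x \<in> I" "x < t" for x
  proof (rule connected_positive[of "I \<inter> {..<t}" "\<lambda>x. (-1) ^ m * Y x" "t - e/2"])
    show "connected (I \<inter> {..<t})" using convI by (intro convex_connected convex_Int) auto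
    show "continuous_on (I \<inter> {..<t}) (\<lambda>x. (-1) ^ m * Y x)"
      by (intro continuous_intros continuous_on_subset[OF contY]) auto
    show "(-1) ^ m * Y x \<noteq> 0" if "x \<in> I \<inter> {..<t}" for x using injY[of t x] that t(1) Yt by auto
    have b2: "t - e/2 \<in> ball t e" using e(3) by (simp add: dist_real_def)
    thus "t - e/2 \<in> I \<inter> {..<t}" using e(3,4) by auto
    have "\<rho> (t - e/2) < \<rho> t" by (rule strict_mono_onD[OF e(8)]) (use e(3) b2 in auto)
    thus "0 < (-1) ^ m * Y (t - e/2)" using Yrho[OF b2] e(7) by (simp flip: power_mult_distrib)
  qed (use that in auto)
  \<comment> \<open>The sign makes \<open>W\<close> negative before \<open>t\<close> and positive
    after it. As \<open>root\<close> is an odd function for even \<open>m\<close> too,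
    \<open>\<sigma>\<close> passes injectively through 0 and still satisfies
    \<open>\<sigma> ^ m = Y\<close>.\<close>
  define W where "W = (\<lambda>x. if x \<le> t then - ((-1) ^ m * Y x) else Y x)"
  define \<sigma> where "\<sigma> = (\<lambda>x. root m (W x))"
  have contW: "continuous_on I W" unfolding W_def
    by (rule continuous_on_cases_le) (auto intro!: continuous_intros continuous_on_subset[OF contY] simp: Yt)
  have cont\<sigma>: "continuous_on I \<sigma>" unfolding \<sigma>_def by (intro continuous_intros contW)
  have Wpos: "W x > 0 \<longleftrightarrow> x > t" if "x \<in> I" for x
    using right[OF that] left[OF that] Yt by (cases x t rule: linorder_cases) (auto simp: W_def)
  have inj\<sigma>: "inj_on \<sigma> I"
  proof (rule inj_onI)
    fix x y assume xy: "x \<in> I" "y \<in> I" "\<sigma> x = \<sigma> y"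
    hence W: "W x = W y" using m0 by (simp add: \<sigma>_def)
    hence "x > t \<longleftrightarrow> y > t" using Wpos xy by metis
    thus "x = y" using injY[OF xy(1,2)] W by (cases "x > t") (auto simp: W_def)
  qed
  have sig_pow: "\<sigma> x ^ m = Y x" if "x \<in> I" for x
  proof (cases x t rule: linorder_cases)
    case less
    have "\<sigma> x = - root m ((-1) ^ m * Y x)" using less by (simp add: \<sigma>_def W_def real_root_minus)
    hence "\<sigma> x ^ m = (-1) ^ m * (root m ((-1) ^ m * Y x)) ^ m" by (simp add: power_minus[of "root m _"])
    also have "\<dots> = (-1) ^ m * ((-1) ^ m * Y x)" using left[OF that less] m0 by simp
    also have "\<dots> = Y x" by (simp flip: power_add mult.assoc)
    finally show ?thesis .
  next
    case greater
    thus ?thesis using right[OF that] m0 by (simp add: \<sigma>_def W_def)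
  qed (use Yt m0 in \<open>simp add: \<sigma>_def W_def\<close>)
  have sig_rho: "\<sigma> x = \<rho> x" if "x \<in> ball t e" for x
  proof -
    have tb: "t \<in> ball t e" using e(3) by simp
    have "W x = sgn (\<rho> x) * \<bar>\<rho> x\<bar> ^ m"
    proof (cases x t rule: linorder_cases)
      case less
      have "\<rho> x < 0" using strict_mono_onD[OF e(8) that tb less] e(7) by simp
      thus ?thesis using less Yrho[OF that] by (simp add: W_def flip: power_mult_distrib)
    next
      case greater
      have "\<rho> x > 0" using strict_mono_onD[OF e(8) tb that greater] e(7) by simp
      thus ?thesis using greater Yrho[OF that] by (simp add: W_def)
    qed (use Yt e(7) in \<open>simp add: W_def\<close>)
    thus ?thesis using m0 by (simp add: \<sigma>_def root_sgn_power)
  qed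
  define J where "J = \<sigma> ` I"
  have opJ: "open J" unfolding J_def by (rule invariance_of_domain[OF cont\<sigma> opI inj\<sigma>])
  obtain g where g: "homeomorphism I J \<sigma> g"
    unfolding J_def by (rule invariance_of_domain_homeomorphism[OF opI cont\<sigma> _ inj\<sigma>]) simp
  have gI: "g s \<in> I" "\<sigma> (g s) = s" if "s \<in> J" for s using g that unfolding homeomorphism_def by auto
  have gs: "g (\<sigma> x) = x" if "x \<in> I" for x using g that unfolding homeomorphism_def by auto
  have gim: "g ` J = I" using g unfolding homeomorphism_def by auto
  have contg: "continuous_on J g" using g unfolding homeomorphism_def by auto
  define z where "z = (\<lambda>s. \<gamma> (g s))"
  have "z ` J = \<gamma> ` (g ` J)" by (simp add: z_def image_image)
  hence zim: "z ` J = \<gamma> ` I" using gim by simp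
  have "canonical_param p m \<psi> c J z"
    unfolding canonical_param_def
  proof (intro conjI ballI)
    show "open J" by (rule opJ)
    have "connected J" unfolding J_def using cont\<sigma> convI by (intro connected_continuous_image convex_connected)
    thus "is_interval J" by (simp add: is_interval_connected_1)
    show "continuous_on J z" unfolding z_def
      by (rule continuous_on_compose2[OF contI contg]) (use gim in auto)
    show "z ` J \<subseteq> Z" using zim im by auto
    show "f (z s) = f p + of_real (s ^ m) * c ^ m" if "s \<in> J" for s
    proof -
      have "Y (g s) = s ^ m" using sig_pow[OF gI(1)[OF that]] gI(2)[OF that] by simp
      thus ?thesis using fY[OF gI(1)[OF that]] by (simp add: z_def b_def)
    qed
    have "open (\<sigma> ` ball t e)"
      by (rule invariance_of_domain) (use cont\<sigma> inj\<sigma> e(4) in \<open>auto intro: continuous_on_subset inj_on_subset\<close>)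
    moreover have "0 \<in> \<sigma> ` ball t e" using sig_rho[of t] e(3,7) by (intro image_eqI[of _ _ t]) auto
    ultimately obtain \<delta> where de: "\<delta> > 0" "ball 0 \<delta> \<subseteq> \<sigma> ` ball t e" using openE by blast
    have "s \<in> J \<and> z s = \<psi> (of_real s * c)" if "\<bar>s\<bar> < \<delta>" for s
    proof -
      have "s \<in> ball 0 \<delta>" using that by simp
      then obtain x where x: "x \<in> ball t e" "s = \<sigma> x" using de(2) by blast
      have xI: "x \<in> I" using x e(4) by blast
      have "z s = \<gamma> x" using gs[OF xI] x(2) by (simp add: z_def)
      also have "\<dots> = \<psi> (\<phi> (\<gamma> x))" using P(10)[OF e(5)[OF x(1)]] by simp
      also have "\<dots> = \<psi> (of_real s * c)" using e(6)[OF x(1)] sig_rho[OF x(1)] x(2) by simp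
      finally show ?thesis using xI x(2) by (auto simp: J_def)
    qed
    thus "\<exists>\<delta>>0. \<forall>s. \<bar>s\<bar> < \<delta> \<longrightarrow> s \<in> J \<and> z s = \<psi> (of_real s * c)" using de(1) by blast
  qed
  thus ?thesis using that e(1,2,10) zim by blast
qed

text \<open>The segment of the chart line from \<open>p\<close> to \<open>\<gamma> t1\<close> is an
  arc in the nodal set, hence part of the curve, which near \<open>p\<close> lies on its tangent
  line. Squares are compared because a line fixes its direction only up to sign.\<close>

lemma line_of_curve:
  assumes ch: "power_chart f p m \<phi> \<psi> N d" and ND: "N \<subseteq> D" and p: "p \<in> Z"
    and reg: "regular_analytic_curve I \<gamma>" and im: "\<gamma> ` I \<subseteq> Z" and t: "t \<in> I" "\<gamma> t = p" "t1 \<in> I"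
    and c': "cmod c' = 1" "Re (c' ^ m) = 0" and s0: "0 < s0" "s0 < d" "\<gamma> t1 = \<psi> (of_real s0 * c')"
  shows "c'\<^sup>2 = (sgn (deriv \<phi> p * vector_derivative \<gamma> (at t)))\<^sup>2"
proof -
  note P = power_chartD[OF ch]
  define \<beta> where "\<beta> = (\<lambda>r. \<psi> (of_real r * c'))"
  define c where "c = sgn (deriv \<phi> p * vector_derivative \<gamma> (at t))"
  note be = chart_line_curve[OF ch ND p c', folded \<beta>_def]
  note seg = curve_segment[OF reg im t(1,3)]
  have 0: "0 \<in> {-d<..<d}" "s0 \<in> {-d<..<d}" using s0 P(2) by auto
  have b0: "\<beta> 0 = p" using P(15) by (simp add: \<beta>_def)
  have sub: "\<beta> ` closed_segment 0 s0 \<subseteq> \<gamma> ` closed_segment t t1"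
  proof (rule arc_subset[OF be(1,2) 0 seg(2-4)])
    show "\<beta> 0 \<in> \<gamma> ` closed_segment t t1" using b0 t(2) by (metis ends_in_segment(1) imageI)
    show "\<beta> s0 \<in> \<gamma> ` closed_segment t t1" unfolding \<beta>_def s0(3)[symmetric] by simp
  qed
  obtain \<eta> where \<eta>: "\<eta> > 0" "\<And>z. z \<in> \<gamma> ` closed_segment t t1 \<Longrightarrow> dist z p < \<eta> \<Longrightarrow> z \<in> N \<and> (\<exists>x. \<phi> z = of_real x * c)"
    using curve_segment_near_line[OF reg im t(1,3) _ ch[folded t(2)]] unfolding c_def t(2) by (metis ends_in_segment(1))
  have "isCont \<beta> 0" using regular_analytic_curve_continuous[OF be(1)] 0(1) by (auto simp: continuous_on_eq_continuous_at)
  then obtain r1 where r1: "r1 > 0" "\<And>r. dist r 0 < r1 \<Longrightarrow> dist (\<beta> r) p < \<eta>"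
    unfolding continuous_at_eps_delta b0 using \<eta>(1) by blast
  define r where "r = min r1 s0 / 2"
  have r: "0 < r" "r < r1" "r < s0" using r1(1) s0(1) by (auto simp: r_def)
  have "r \<in> closed_segment 0 s0" using r by (simp add: closed_segment_eq_real_ivl)
  hence "\<beta> r \<in> \<gamma> ` closed_segment t t1" using sub by blast
  then obtain x where x: "\<phi> (\<beta> r) = of_real x * c" using \<eta>(2) r1(2)[of r] r by auto
  have "\<phi> (\<beta> r) = of_real r * c'" using be(3)[of r] r s0 by (auto simp: \<beta>_def)
  hence eq: "of_real r * c' = of_real x * c" using x by simp
  have c0: "cmod c = 1 \<or> c = 0" by (auto simp: c_def norm_sgn)
  have "r = \<bar>x\<bar> * cmod c" using arg_cong[OF eq, of cmod] c'(1) r(1) by (simp add: norm_mult)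
  hence xr: "\<bar>x\<bar> = r" using c0 r(1) by auto
  have "(of_real r * c')\<^sup>2 = (of_real x * c)\<^sup>2" using eq by simp
  hence "of_real (r\<^sup>2) * c'\<^sup>2 = of_real (r\<^sup>2) * c\<^sup>2" using xr by (metis of_real_power power2_abs power_mult_distrib)
  thus ?thesis using r(1) by (simp add: c_def)
qed

end

section \<open>Counting nodal curves by their tangent lines at \<open>p\<close>\<close>

text \<open>A line through 0 on which the \<open>m\<close>-th power is imaginary is encoded by the
  square of its direction. These squares are the \<open>m\<close>-th roots of -1.\<close>

lemma card_nodal_directions:
  assumes "(m::nat) > 0"
  shows "card {w::complex. w ^ m = -1} = m"
  using card_nth_roots[of "-1" m] assms by simp

lemma sq_direction:
  fixes c :: complex
  assumes "cmod c = 1" "Re (c ^ m) = 0"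
  shows "(c\<^sup>2) ^ m = -1"
proof -
  have "cmod (c ^ m) = 1" using assms(1) by (simp add: norm_power)
  hence "(Im (c ^ m))\<^sup>2 = 1" using assms(2) by (metis cmod_power2 add_0 power_one zero_power2)
  hence "(c ^ m)\<^sup>2 = -1" using assms(2) by (simp add: complex_eq_iff power2_eq_square)
  thus ?thesis by (simp add: power_mult[symmetric] mult.commute)
qed

lemma direction_of_sq:
  fixes w :: complex
  assumes "w ^ m = -1" "m > 0"
  obtains c where "cmod c = 1" "Re (c ^ m) = 0" "c\<^sup>2 = w"
proof -
  define c where "c = csqrt w"
  have c2: "c\<^sup>2 = w" by (simp add: c_def)
  have "cmod w ^ m = 1" using assms(1) by (metis norm_minus_cancel norm_one norm_power)
  hence "cmod w = 1" using power_eq_imp_eq_base[of "cmod w" m 1] assms(2) by simp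
  hence "cmod c = 1" unfolding c_def by simp
  moreover have "Re (c ^ m) = 0"
  proof -
    have "(c ^ m)\<^sup>2 = -1" using assms(1) c2 by (metis power_mult mult.commute)
    hence h: "Re (c^m) * Re (c^m) - Im (c^m) * Im (c^m) = -1" "Re (c^m) * Im (c^m) = 0"
      by (auto simp: complex_eq_iff power2_eq_square)
    show ?thesis
    proof (rule ccontr)
      assume "Re (c ^ m) \<noteq> 0"
      hence "Im (c ^ m) = 0" using h(2) by simp
      hence "Re (c^m) * Re (c^m) = -1" using h(1) by simp
      thus False using zero_le_square[of "Re (c^m)"] by linarith
    qed
  qed
  ultimately show ?thesis using that c2 by blast
qed

context nodal
begin

lemma only_nodal_curves_cover:
  assumes "only_nodal_curves_through u D n p" "z \<in> Z"
  shows "\<exists>I \<gamma>. nodal_parametrization u D I \<gamma> \<and> regular_analytic_curve I \<gamma> \<and> \<gamma> ` I \<subseteq> Z \<and> z \<in> \<gamma> ` I \<and> p \<in> \<gamma> ` I"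
proof -
  obtain C where C: "C \<in> nodal_curves u D" "z \<in> C" "p \<in> C"
    using assms unfolding only_nodal_curves_through_def by blast
  then obtain I \<gamma> where "C = \<gamma> ` I" "nodal_parametrization u D I \<gamma>" unfolding nodal_curves_def by blast
  thus ?thesis using C unfolding nodal_parametrization_def by blast
qed

text \<open>Nodal curves correspond to the squares of their tangent directions at \<open>p\<close>,
  hence to the \<open>m\<close>-th roots of -1. Injectivity (\<open>R3\<close>) is where maximality
  of nodal curves enters; surjectivity (\<open>R4\<close>) holds since a point on each chart line
  lies on some nodal curve.\<close>

theorem order_eq_number_of_nodal_curves:
  assumes only: "only_nodal_curves_through u D n p" and p: "p \<in> Z"
    and ch: "power_chart f p m \<phi> \<psi> N d" and ND: "N \<subseteq> D"
  shows "m = n"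
proof -
  note P = power_chartD[OF ch]
  have m0: "m > 0" using P(1) by simp
  have nz: "deriv f q \<noteq> 0" if "q \<in> Z" "q \<noteq> p" for q
    by (rule deriv_nonzero_nodal[OF p _ that]) (use only_nodal_curves_cover[OF only] in blast)
  \<comment> \<open>Only a relation at first: the direction might depend on the parametrization and
    on the parameter of \<open>p\<close>. \<open>R2\<close> excludes this.\<close>
  define R where "R = (\<lambda>C w. \<exists>I \<gamma> t. nodal_parametrization u D I \<gamma> \<and> C = \<gamma> ` I \<and> t \<in> I \<and> \<gamma> t = p \<and>
     w = (sgn (deriv \<phi> p * vector_derivative \<gamma> (at t)))\<^sup>2)"
  have nodD: "regular_analytic_curve I \<gamma>" "\<gamma> ` I \<subseteq> Z"
    "\<And>J \<delta>. regular_analytic_curve J \<delta> \<Longrightarrow> \<delta> ` J \<subseteq> Z \<Longrightarrow> \<gamma> ` I \<subseteq> \<delta> ` J \<Longrightarrow> \<delta> ` J = \<gamma> ` I"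
    if "nodal_parametrization u D I \<gamma>" for I \<gamma> using that unfolding nodal_parametrization_def by blast+
  have ex1: "\<exists>w. R C w" if C: "C \<in> nodal_curves u D" for C
  proof -
    obtain I \<gamma> where g: "C = \<gamma> ` I" "nodal_parametrization u D I \<gamma>" using C unfolding nodal_curves_def by blast
    have "p \<in> C" using only C unfolding only_nodal_curves_through_def by blast
    then obtain t where "t \<in> I" "\<gamma> t = p" using g(1) by auto
    thus ?thesis using g unfolding R_def by blast
  qed
  have R1: "w ^ m = -1" if "R C w" for C w
  proof -
    obtain I \<gamma> t where g: "nodal_parametrization u D I \<gamma>" "C = \<gamma> ` I" "t \<in> I" "\<gamma> t = p"
      "w = (sgn (deriv \<phi> p * vector_derivative \<gamma> (at t)))\<^sup>2" using \<open>R C w\<close> unfolding R_def by blast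
    obtain J z c where "c = sgn (deriv \<phi> p * vector_derivative \<gamma> (at t))" "cmod c = 1" "Re (c ^ m) = 0"
      by (rule canonical_param_exists[OF ch ND p nz nodD(1,2)[OF g(1)] g(3,4)])
    thus ?thesis using sq_direction g(5) by blast
  qed
  have R2: "w = w'" if "R C w" "R C w'" for C w w'
  proof -
    obtain I \<gamma> t where g: "nodal_parametrization u D I \<gamma>" "C = \<gamma> ` I" "t \<in> I" "\<gamma> t = p"
      "w = (sgn (deriv \<phi> p * vector_derivative \<gamma> (at t)))\<^sup>2" using \<open>R C w\<close> unfolding R_def by blast
    obtain I' \<gamma>' t' where g': "nodal_parametrization u D I' \<gamma>'" "C = \<gamma>' ` I'" "t' \<in> I'" "\<gamma>' t' = p"
      "w' = (sgn (deriv \<phi> p * vector_derivative \<gamma>' (at t')))\<^sup>2" using \<open>R C w'\<close> unfolding R_def by blast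
    obtain J z c where c: "c = sgn (deriv \<phi> p * vector_derivative \<gamma>' (at t'))" "cmod c = 1" "Re (c ^ m) = 0"
      "canonical_param p m \<psi> c J z" "z ` J = \<gamma>' ` I'"
      by (rule canonical_param_exists[OF ch ND p nz nodD(1,2)[OF g'(1)] g'(3,4)])
    obtain \<delta> where de: "\<delta> > 0" "\<And>s. \<bar>s\<bar> < \<delta> \<Longrightarrow> s \<in> J \<and> z s = \<psi> (of_real s * c)" using canonical_paramD(7)[OF c(4)] by blast
    define s0 where "s0 = min \<delta> d / 2"
    have s0: "0 < s0" "s0 < d" "\<bar>s0\<bar> < \<delta>" using de(1) P(2) by (auto simp: s0_def)
    have "\<psi> (of_real s0 * c) \<in> \<gamma> ` I" using de(2)[OF s0(3)] c(5) g(2) g'(2) by (metis imageI)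
    then obtain t1 where "t1 \<in> I" "\<gamma> t1 = \<psi> (of_real s0 * c)" by auto
    hence "c\<^sup>2 = w" unfolding g(5) using line_of_curve[OF ch ND p nodD(1,2)[OF g(1)] g(3,4) _ c(2,3) s0(1,2)] by blast
    thus ?thesis using g'(5) c(1) by simp
  qed
  have R3: "C = C'" if "R C w" "R C' w" for C C' w
  proof -
    obtain I \<gamma> t where g: "nodal_parametrization u D I \<gamma>" "C = \<gamma> ` I" "t \<in> I" "\<gamma> t = p"
      "w = (sgn (deriv \<phi> p * vector_derivative \<gamma> (at t)))\<^sup>2" using \<open>R C w\<close> unfolding R_def by blast
    obtain I' \<gamma>' t' where g': "nodal_parametrization u D I' \<gamma>'" "C' = \<gamma>' ` I'" "t' \<in> I'" "\<gamma>' t' = p"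
      "w = (sgn (deriv \<phi> p * vector_derivative \<gamma>' (at t')))\<^sup>2" using \<open>R C' w\<close> unfolding R_def by blast
    obtain J z c where c: "c = sgn (deriv \<phi> p * vector_derivative \<gamma> (at t))" "cmod c = 1" "Re (c ^ m) = 0"
      "canonical_param p m \<psi> c J z" "z ` J = \<gamma> ` I"
      by (rule canonical_param_exists[OF ch ND p nz nodD(1,2)[OF g(1)] g(3,4)])
    obtain J' z' c' where c': "c' = sgn (deriv \<phi> p * vector_derivative \<gamma>' (at t'))" "cmod c' = 1" "Re (c' ^ m) = 0"
      "canonical_param p m \<psi> c' J' z'" "z' ` J' = \<gamma>' ` I'"
      by (rule canonical_param_exists[OF ch ND p nz nodD(1,2)[OF g'(1)] g'(3,4)])
    have "c\<^sup>2 = c'\<^sup>2" using g(5) g'(5) c(1) c'(1) by simp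
    hence "c' = c \<or> c' = - c" by (simp add: power2_eq_iff) (metis minus_minus)
    moreover have "\<exists>J'' z''. canonical_param p m \<psi> (-c') J'' z'' \<and> z'' ` J'' = \<gamma>' ` I'"
    proof -
      have "(\<lambda>s. z' (-s)) ` uminus ` J' = z' ` J'" by (simp add: image_image)
      thus ?thesis using canonical_param_reverse[OF c'(4)] c'(5) by metis
    qed
    ultimately obtain J'' z'' where c'': "canonical_param p m \<psi> c J'' z''" "z'' ` J'' = \<gamma>' ` I'"
      using c'(4,5) by (metis minus_minus)
    obtain J3 z3 where 3: "canonical_param p m \<psi> c J3 z3" "z3 ` J3 = z ` J \<union> z'' ` J''"
      by (rule canonical_param_union[OF c(2) nz c(4) c''(1)])
    have reg: "regular_analytic_curve J3 z3" by (rule canonical_param_regular[OF ch ND p c(2,3) nz 3(1)])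
    have "z3 ` J3 \<subseteq> Z" by (rule canonical_paramD(4)[OF 3(1)])
    moreover have "\<gamma> ` I \<subseteq> z3 ` J3" "\<gamma>' ` I' \<subseteq> z3 ` J3" using 3(2) c(5) c''(2) by auto
    ultimately have "z3 ` J3 = \<gamma> ` I" "z3 ` J3 = \<gamma>' ` I'"
      using nodD(3)[OF g(1) reg] nodD(3)[OF g'(1) reg] by blast+
    thus ?thesis using g(2) g'(2) by simp
  qed
  have R4: "\<exists>C\<in>nodal_curves u D. R C w" if w: "w ^ m = -1" for w
  proof -
    obtain c where c: "cmod c = 1" "Re (c ^ m) = 0" "c\<^sup>2 = w" by (rule direction_of_sq[OF w m0])
    define s0 where "s0 = d / 2"
    have s0: "0 < s0" "s0 < d" using P(2) by (auto simp: s0_def)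
    have "\<psi> (of_real s0 * c) \<in> Z" using chart_line_curve(2)[OF ch ND p c(1,2)] s0 by auto
    from only_nodal_curves_cover[OF only this] obtain I \<gamma> t t1 where g: "nodal_parametrization u D I \<gamma>"
      "t1 \<in> I" "\<gamma> t1 = \<psi> (of_real s0 * c)" "t \<in> I" "\<gamma> t = p" by (metis imageE)
    have "c\<^sup>2 = (sgn (deriv \<phi> p * vector_derivative \<gamma> (at t)))\<^sup>2"
      by (rule line_of_curve[OF ch ND p nodD(1,2)[OF g(1)] g(4,5,2) c(1,2) s0 g(3)])
    hence "R (\<gamma> ` I) w" unfolding R_def using g c(3) by blast
    moreover have "\<gamma> ` I \<in> nodal_curves u D" using g(1) unfolding nodal_curves_def by blast
    ultimately show ?thesis by blast
  qed
  define dir where "dir = (\<lambda>C. SOME w. R C w)"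
  have dir: "R C (dir C)" if "C \<in> nodal_curves u D" for C unfolding dir_def using someI_ex[OF ex1[OF that]] .
  have "bij_betw dir (nodal_curves u D) {w. w ^ m = -1}"
  proof (rule bij_betwI')
    show "(dir C = dir C') = (C = C')" if "C \<in> nodal_curves u D" "C' \<in> nodal_curves u D" for C C'
      using dir[OF that(1)] dir[OF that(2)] R3 by metis
    show "dir C \<in> {w. w ^ m = -1}" if "C \<in> nodal_curves u D" for C using R1[OF dir[OF that]] by simp
    show "\<exists>C\<in>nodal_curves u D. w = dir C" if "w \<in> {w. w ^ m = -1}" for w
      using R4[of w] that dir R2 by blast
  qed
  hence "card (nodal_curves u D) = m" using card_nodal_directions[OF m0] bij_betw_same_card by metis
  thus ?thesis using only unfolding only_nodal_curves_through_def by simp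
qed

end

section \<open>Nodal domains and the sectors at \<open>p\<close>\<close>

lemma cos_sector_nonzero:
  assumes "(real j - 1/2) * pi < x" "x < (real j + 1/2) * pi"
  shows "cos x \<noteq> 0"
proof -
  have "cos (x - real j * pi) > 0" using assms by (intro cos_gt_zero_pi) (auto simp: algebra_simps)
  moreover have "cos (x - real j * pi) = cos x * (-1) ^ j" by (simp add: cos_diff)
  ultimately show ?thesis by auto
qed

text \<open>The \<open>2m\<close> sectors of a disc on which \<open>Re (w\<^sup>m)\<close> has constant sign.\<close>

definition sector :: "nat \<Rightarrow> real \<Rightarrow> nat \<Rightarrow> complex set" where
  "sector m d j = (\<lambda>(r, t). rcis r t) ` ({0<..<d} \<times> {(real j - 1/2) * pi / m <..< (real j + 1/2) * pi / m})"

lemma connected_sector: "connected (sector m d j)"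
  unfolding sector_def
  by (intro connected_continuous_image convex_connected convex_Times)
     (auto simp: rcis_def case_prod_unfold cis_conv_exp intro!: continuous_intros)

lemma sector_subset:
  assumes "w \<in> sector m d j" "m > 0"
  shows "w \<in> ball 0 d" "Re (w ^ m) \<noteq> 0"
proof -
  obtain r t where rt: "0 < r" "r < d" "(real j - 1/2) * pi / m < t" "t < (real j + 1/2) * pi / m" "w = rcis r t"
    using assms by (auto simp: sector_def)
  have "(real j - 1/2) * pi < real m * t" "real m * t < (real j + 1/2) * pi"
    using rt(3,4) assms(2) by (simp_all add: field_simps)
  hence "cos (real m * t) \<noteq> 0" by (rule cos_sector_nonzero)
  thus "Re (w ^ m) \<noteq> 0" using rt by (simp add: DeMoivre2)
  show "w \<in> ball 0 d" using rt by simp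
qed

lemma in_some_sector:
  assumes m: "m > 0" and w: "w \<in> ball 0 d" "Re (w ^ m) \<noteq> 0"
  obtains j where "j < 2 * m" "w \<in> sector m d j"
proof -
  have w0: "w \<noteq> 0" using w(2) m by (auto simp: power_0_left)
  \<comment> \<open>This branch of the argument starts at the lower edge of sector 0. Thus
    \<open>x\<close> below lies between 0 and \<open>2 * m\<close>, and its integer part is the
    index of the sector.\<close>
  define t where "t = (if Arg w < - pi / (2 * m) then Arg w + 2 * pi else Arg w)"
  have "cis t = cis (Arg w)" by (simp add: t_def cis_mult[symmetric])
  hence wt: "w = rcis (cmod w) t" using rcis_cmod_Arg[of w] by (simp add: rcis_def)
  have "pi / (2 * real m) \<le> pi / 2" using m by (intro divide_left_mono) auto
  hence pm: "pi / (2 * real m) < pi" "pi / (2 * real m) > 0" using m pi_gt_zero by (linarith, simp)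
  have t: "- pi / (2 * m) \<le> t" "t < 2 * pi - pi / (2 * m)"
    using Arg_bounded[of w] pm by (auto simp: t_def)
  have cn: "cos (real m * t) \<noteq> 0"
  proof
    assume "cos (real m * t) = 0"
    have "w ^ m = rcis (cmod w ^ m) (real m * t)" by (subst wt) (rule DeMoivre2)
    thus False using w(2) \<open>cos (real m * t) = 0\<close> by simp
  qed
  define x where "x = real m * t / pi + 1/2"
  have x0: "0 \<le> x" using t(1) m by (simp add: x_def field_simps)
  have x1: "x < 2 * m"
  proof -
    have "real m * t < real m * (2 * pi - pi / (2 * m))" using t(2) m by (intro mult_strict_left_mono) auto
    also have "\<dots> = (2 * m - 1/2) * pi" using m by (simp add: field_simps)
    finally have "real m * t / pi < 2 * m - 1/2" by (simp add: field_simps)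
    thus ?thesis by (simp add: x_def)
  qed
  define j where "j = nat \<lfloor>x\<rfloor>"
  have jx: "real j \<le> x" "x < real j + 1" using x0 by (auto simp: j_def)
  \<comment> \<open>An integer \<open>x\<close> would put \<open>w\<close> on a nodal line; the
    sectors are open.\<close>
  have "real j \<noteq> x"
  proof
    assume "real j = x"
    hence "real m * t = real j * pi - pi / 2" by (simp add: x_def field_simps)
    hence "cos (real m * t) = 0" by (simp add: cos_diff)
    thus False using cn by simp
  qed
  hence jx': "real j < x" using jx by simp
  have mt: "real m * t = (x - 1/2) * pi" by (simp add: x_def)
  show ?thesis
  proof (rule that[of j])
    show "j < 2 * m" using jx x1 by linarith
    have "(real j - 1/2) * pi < real m * t" "real m * t < (real j + 1/2) * pi"
      unfolding mt using jx jx' by (intro mult_strict_right_mono, simp, simp)+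
    hence "(real j - 1/2) * pi / m < t" "t < (real j + 1/2) * pi / m" using m by (simp_all add: field_simps)
    thus "w \<in> sector m d j" unfolding sector_def using w0 w(1) wt
      by (intro image_eqI[of _ _ "(cmod w, t)"]) auto
  qed
qed

context nodal
begin

abbreviation "X \<equiv> {z \<in> D. u z \<noteq> 0}"

lemma cont_u: "continuous_on D u"
proof -
  have "continuous_on D (\<lambda>z. Re (f z))" by (intro continuous_intros holomorphic_on_imp_continuous_on hol)
  thus ?thesis using continuous_on_cong[of D D u "\<lambda>z. Re (f z)"] u_eq by auto
qed

lemma open_X: "open X"
proof -
  have "open (D \<inter> u -` (- {0}))" by (rule continuous_open_preimage[OF cont_u open_D]) auto
  moreover have "X = D \<inter> u -` (- {0})" by auto
  ultimately show ?thesis by simp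
qed

text \<open>At a regular zero the nodal set is a diameter of the chart, and \<open>u\<close> has one
  sign on each side. A component that touches \<open>z\<close> contains a whole half-disc, so every
  nodal point near \<open>z\<close> is in its closure.\<close>

lemma closure_component_local:
  assumes z: "z \<in> Z" "deriv f z \<noteq> 0" and \<Omega>: "\<Omega> = connected_component_set X a" and cl: "z \<in> closure \<Omega>"
  obtains N where "open N" "z \<in> N" "N \<inter> Z \<subseteq> closure \<Omega>"
proof -
  obtain k \<phi> \<psi> N d where ch: "power_chart f z k \<phi> \<psi> N d" "N \<subseteq> D" "deriv f z \<noteq> 0 \<longrightarrow> k = 1"
    using chart_ex z(1) by (metis Z_iff)
  have ch1: "power_chart f z 1 \<phi> \<psi> N d" using ch z(2) by simp
  note C = power_chartD[OF ch1]
  have un: "u w = Re (\<phi> w)" if "w \<in> N" for w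
    using C(14)[OF that] u_eq[of w] that ch(2) z(1) by (auto simp: Z_iff)
  have "N \<inter> \<Omega> \<noteq> {}" using open_Int_closure_eq_empty[OF C(3), of \<Omega>] cl C(4) by blast
  then obtain b where b: "b \<in> N" "b \<in> \<Omega>" by blast
  have OX: "\<Omega> \<subseteq> X" unfolding \<Omega> by (rule connected_component_subset)
  have "u b \<noteq> 0" using b OX by auto
  define s where "s = sgn (u b)"
  have s: "s = 1 \<or> s = -1" using \<open>u b \<noteq> 0\<close> by (auto simp: s_def sgn_if)
  define H where "H = ball 0 d \<inter> {w. 0 < s * Re w}"
  have convH: "convex H" unfolding H_def
  proof (intro convex_Int convex_ball)
    show "convex {w. 0 < s * Re w}" using s by (auto simp: convex_halfspace_Re_gt convex_halfspace_Re_lt)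
  qed
  have "connected (\<psi> ` H)"
    by (rule connected_continuous_image[OF _ convex_connected[OF convH]])
       (use holomorphic_on_imp_continuous_on[OF C(6)] in \<open>auto simp: H_def intro: continuous_on_subset\<close>)
  moreover have "\<psi> ` H \<subseteq> X"
  proof
    fix y assume "y \<in> \<psi> ` H"
    then obtain w where w: "w \<in> ball 0 d" "0 < s * Re w" "y = \<psi> w" by (auto simp: H_def)
    have "y \<in> N" "\<phi> y = w" using C(9,11) w by auto
    thus "y \<in> X" using un[of y] w(2) ch(2) by auto
  qed
  moreover have "b \<in> \<psi> ` H"
  proof (rule image_eqI)
    show "b = \<psi> (\<phi> b)" using C(10)[OF b(1)] by simp
    show "\<phi> b \<in> H" unfolding H_def using C(8)[OF b(1)] un[OF b(1)] \<open>u b \<noteq> 0\<close> by (auto simp: s_def sgn_if)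
  qed
  ultimately have HO: "\<psi> ` H \<subseteq> \<Omega>"
    using b(2) connected_component_maximal[of b "\<psi> ` H" X] unfolding \<Omega> by (metis connected_component_eq)
  have "N \<inter> Z \<subseteq> closure \<Omega>"
  proof
    fix y assume y: "y \<in> N \<inter> Z"
    define w where "w = \<phi> y"
    have w: "w \<in> ball 0 d" "Re w = 0" "\<psi> w = y" using y C(8,10) un[of y] by (auto simp: w_def nodal_set_def)
    have "isCont \<psi> w" using holomorphic_on_imp_continuous_on[OF C(6)] w(1) by (simp add: continuous_on_eq_continuous_at)
    show "y \<in> closure \<Omega>"
      unfolding closure_approachable
    proof (intro allI impI)
      fix e :: real assume "e > 0"
      then obtain \<delta> where de: "\<delta> > 0" "\<And>v. dist v w < \<delta> \<Longrightarrow> dist (\<psi> v) y < e"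
        using \<open>isCont \<psi> w\<close> unfolding continuous_at_eps_delta w(3) by blast
      obtain r where r: "r > 0" "ball w r \<subseteq> ball 0 d" using w(1) open_ball openE by blast
      define v where "v = w + of_real (s * (min \<delta> r / 2))"
      have m0: "min \<delta> r / 2 > 0" using de(1) r(1) by simp
      have dv: "dist v w = min \<delta> r / 2" using s m0 by (auto simp: v_def dist_norm)
      have "v \<in> H" unfolding H_def
      proof
        have "v \<in> ball w r" using dv r(1) de(1) by (simp add: dist_commute)
        thus "v \<in> ball 0 d" using r(2) by blast
        show "v \<in> {w. 0 < s * Re w}" using s m0 w(2) by (auto simp: v_def)
      qed
      hence "\<psi> v \<in> \<Omega>" using HO by blast
      moreover have "dist (\<psi> v) y < e" by (rule de(2)) (use dv de(1) m0 in linarith)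
      ultimately show "\<exists>y'\<in>\<Omega>. dist y' y < e" by blast
    qed
  qed
  thus ?thesis using that C(3,4) by blast
qed

text \<open>Any component has a frontier point in \<open>D\<close>, and this is a zero
  \<open>q\<close>. On a nodal arc from \<open>q\<close> to \<open>p\<close> that avoids regularity
  problems only at \<open>p\<close>, the points in the closure of the component form a closed set,
  which would also be open if it did not contain \<open>p\<close>; then it would be the whole arc, a
  contradiction.\<close>

lemma closure_component:
  assumes only: "only_nodal_curves_through u D n p" and p: "p \<in> Z" and a: "a \<in> X"
  shows "p \<in> closure (connected_component_set X a)"
proof (rule ccontr)
  define \<Omega> where "\<Omega> = connected_component_set X a"
  assume "p \<notin> closure (connected_component_set X a)"
  hence np: "p \<notin> closure \<Omega>" by (simp add: \<Omega>_def)
  have nz: "deriv f q \<noteq> 0" if "q \<in> Z" "q \<noteq> p" for q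
    by (rule deriv_nonzero_nodal[OF p _ that]) (use only_nodal_curves_cover[OF only] in blast)
  have aO: "a \<in> \<Omega>" using a by (simp add: \<Omega>_def connected_component_refl_eq)
  have OX: "\<Omega> \<subseteq> X" unfolding \<Omega>_def by (rule connected_component_subset)
  have opO: "open \<Omega>" unfolding \<Omega>_def by (rule open_connected_component[OF open_X])
  have "p \<in> D" "p \<notin> \<Omega>" using p OX by (auto simp: nodal_set_def)
  hence "D \<inter> frontier \<Omega> \<noteq> {}"
    using connected_Int_frontier[OF connected_D, of \<Omega>] aO OX by blast
  then obtain q where q: "q \<in> D" "q \<in> frontier \<Omega>" by blast
  have qcl: "q \<in> closure \<Omega>" and qO: "q \<notin> \<Omega>" using q(2) opO by (auto simp: frontier_def interior_open)
  have qZ: "q \<in> Z"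
  proof (rule ccontr)
    assume "q \<notin> Z"
    hence "q \<in> X" using q(1) by (auto simp: nodal_set_def)
    hence "open (connected_component_set X q)" "q \<in> connected_component_set X q"
      using open_connected_component[OF open_X] by (auto simp: connected_component_refl_eq)
    hence "connected_component_set X q \<inter> \<Omega> \<noteq> {}"
      using open_Int_closure_eq_empty[of "connected_component_set X q" \<Omega>] qcl by blast
    hence "connected_component_set X q = \<Omega>" unfolding \<Omega>_def using connected_component_nonoverlap by blast
    thus False using qO \<open>q \<in> connected_component_set X q\<close> by blast
  qed
  obtain I \<gamma> a' b where g: "regular_analytic_curve I \<gamma>" "\<gamma> ` I \<subseteq> Z" "a' \<in> I" "b \<in> I" "\<gamma> a' = q" "\<gamma> b = p"
    using only_nodal_curves_cover[OF only qZ] by blast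
  note seg = curve_segment[OF g(1-4)]
  define S where "S = \<gamma> ` closed_segment a' b"
  have S: "connected S" "S \<subseteq> Z" "q \<in> S" "p \<in> S" using seg g(5,6) by (auto simp: S_def)
  define E where "E = S \<inter> closure \<Omega>"
  have "closedin (top_of_set S) E" unfolding E_def by (simp add: closedin_closed_Int)
  moreover have "openin (top_of_set S) E"
    unfolding openin_contains_ball
  proof (intro conjI ballI)
    show "E \<subseteq> S" by (simp add: E_def)
    fix z assume z: "z \<in> E"
    hence zZ: "z \<in> Z" "z \<in> closure \<Omega>" "z \<noteq> p" using S(2) np by (auto simp: E_def)
    obtain N where N: "open N" "z \<in> N" "N \<inter> Z \<subseteq> closure \<Omega>"
      by (rule closure_component_local[OF zZ(1) nz[OF zZ(1,3)] \<Omega>_def zZ(2)])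
    obtain e where "e > 0" "ball z e \<subseteq> N" using N openE by blast
    thus "\<exists>e>0. ball z e \<inter> S \<subseteq> E" using N(3) S(2) unfolding E_def by blast
  qed
  moreover have "q \<in> E" using S qcl by (simp add: E_def)
  ultimately have "E = S" using S(1) unfolding connected_clopen by blast
  thus False using S(4) np by (auto simp: E_def)
qed

text \<open>The component comes arbitrarily close to \<open>p\<close>, so it enters the chart, and
  there it contains the full sector of each of its points. This bounds the number of components by
  the number \<open>2 * m\<close> of sectors.\<close>

lemma component_contains_sector:
  assumes only: "only_nodal_curves_through u D n p" and p: "p \<in> Z" and a: "a \<in> X"
    and ch: "power_chart f p m \<phi> \<psi> N d" and ND: "N \<subseteq> D"
  obtains j where "j < 2 * m" "\<psi> ` sector m d j \<subseteq> connected_component_set X a"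
proof -
  note C = power_chartD[OF ch]
  have m0: "m > 0" using C(1) by simp
  define \<Omega> where "\<Omega> = connected_component_set X a"
  have "N \<inter> \<Omega> \<noteq> {}" using closure_component[OF only p a] C(4) open_Int_closure_eq_empty[OF C(3), of \<Omega>]
    unfolding \<Omega>_def by blast
  then obtain b where b: "b \<in> N" "b \<in> \<Omega>" by blast
  have OX: "\<Omega> \<subseteq> X" unfolding \<Omega>_def by (rule connected_component_subset)
  have un: "u w = Re (\<phi> w ^ m)" if "w \<in> N" for w
    using C(14)[OF that] u_eq[of w] that ND p by (auto simp: Z_iff)
  have "Re (\<phi> b ^ m) \<noteq> 0" using un[OF b(1)] b(2) OX by auto
  then obtain j where j: "j < 2 * m" "\<phi> b \<in> sector m d j"
    using in_some_sector[OF m0 C(8)[OF b(1)]] by blast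
  have "connected (\<psi> ` sector m d j)"
    by (rule connected_continuous_image[OF _ connected_sector])
       (use holomorphic_on_imp_continuous_on[OF C(6)] sector_subset(1)[OF _ m0] in \<open>blast intro: continuous_on_subset\<close>)
  moreover have "\<psi> ` sector m d j \<subseteq> X"
  proof
    fix y assume "y \<in> \<psi> ` sector m d j"
    then obtain w where w: "w \<in> sector m d j" "y = \<psi> w" by blast
    have wb: "w \<in> ball 0 d" "Re (w ^ m) \<noteq> 0" using sector_subset[OF w(1) m0] by auto
    have "y \<in> N" "\<phi> y = w" using C(9,11) wb w by auto
    thus "y \<in> X" using un[of y] wb(2) ND by auto
  qed
  moreover have "b \<in> \<psi> ` sector m d j" using C(10)[OF b(1)] j(2) by (metis imageI)
  ultimately have "\<psi> ` sector m d j \<subseteq> \<Omega>"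
    using b(2) connected_component_maximal[of b "\<psi> ` sector m d j" X] unfolding \<Omega>_def by (metis connected_component_eq)
  thus ?thesis using that j(1) by (simp add: \<Omega>_def)
qed

end

subsection \<open>Radial boundary behaviour of Poisson integrals\<close>

lemma integral_symmetric_interval:
  fixes k :: "real \<Rightarrow> real"
  assumes k: "k integrable_on {t - s..t + s}" and s: "0 \<le> s"
  shows "(\<lambda>x. k (t + x) + k (t - x)) integrable_on {0..s}"
    and "integral {0..s} (\<lambda>x. k (t + x) + k (t - x)) = integral {t - s..t + s} k"
proof -
  have 1: "(k has_integral integral {t..t + s} k) {t..t + s}" "(k has_integral integral {t - s..t} k) {t - s..t}"
    using integrable_subinterval_real[OF k] s by (auto simp: integrable_integral)
  have r: "((\<lambda>x. k (t + x)) has_integral integral {t..t + s} k) {0..s}"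
    using has_integral_affinity[of k "integral {t..t + s} k" t "t + s" 1 t] 1(1)
    by (simp add: add.commute image_affinity_atLeastAtMost s)
  have l: "((\<lambda>x. k (t - x)) has_integral integral {t - s..t} k) {0..s}"
    using has_integral_affinity[of k "integral {t - s..t} k" "t - s" t "-1" t] 1(2) image_affinity_atLeastAtMost[of "-1" t "t - s" t]
    by (simp add: s algebra_simps)
  have "integral {t - s..t} k + integral {t..t + s} k = integral {t - s..t + s} k"
    by (rule Henstock_Kurzweil_Integration.integral_combine) (use s k in auto)
  with has_integral_add[OF r l] show "(\<lambda>x. k (t + x) + k (t - x)) integrable_on {0..s}"
    and "integral {0..s} (\<lambda>x. k (t + x) + k (t - x)) = integral {t - s..t + s} k"
    by (auto simp: integral_unique integrable_on_def add.commute)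
qed

text \<open>After folding at \<open>t\<close>, the second mean value theorem expresses the integral
  by two symmetric integrals of \<open>g\<close> with the nonnegative coefficients
  \<open>Q 0 - Q s\<close> and \<open>Q s\<close>.\<close>

lemma integral_even_decreasing_weight:
  fixes g Q :: "real \<Rightarrow> real"
  assumes g: "g integrable_on {t - s..t + s}" and s: "0 \<le> s"
    and Qg: "(\<lambda>x. Q (x - t) * g x) integrable_on {t - s..t + s}"
    and even: "\<And>x. Q (-x) = Q x" and dec: "\<And>x y. 0 \<le> x \<Longrightarrow> x \<le> y \<Longrightarrow> y \<le> s \<Longrightarrow> Q y \<le> Q x" and nn: "0 \<le> Q s"
    and pos: "\<And>x. 0 \<le> x \<Longrightarrow> x \<le> s \<Longrightarrow> 0 \<le> integral {t - x..t + x} g"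
  shows "0 \<le> integral {t - s..t + s} (\<lambda>x. Q (x - t) * g x)"
proof -
  define F where "F = (\<lambda>x. g (t + x) + g (t - x))"
  have F: "F integrable_on {0..s}" unfolding F_def by (rule integral_symmetric_interval[OF g s])
  have G: "integral {0..x} F = integral {t - x..t + x} g" if "0 \<le> x" "x \<le> s" for x
    unfolding F_def by (rule integral_symmetric_interval(2)) (use that g in \<open>auto intro: integrable_subinterval_real\<close>)
  have "integral {t - s..t + s} (\<lambda>x. Q (x - t) * g x) = integral {0..s} (\<lambda>x. Q x * F x)"
    unfolding integral_symmetric_interval(2)[OF Qg s, symmetric] F_def
    by (rule integral_cong) (simp add: even algebra_simps)
  moreover obtain c where c: "c \<in> {0..s}" "integral {0..s} (\<lambda>x. - Q x * F x) = - Q 0 * integral {0..c} F + - Q s * integral {c..s} F"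
    by (rule second_mean_value_theorem[OF F s, of "\<lambda>x. - Q x"]) (use dec in auto)
  moreover have "integral {0..c} F + integral {c..s} F = integral {0..s} F"
    by (rule Henstock_Kurzweil_Integration.integral_combine) (use c F in auto)
  moreover have "integral {0..s} (\<lambda>x. - Q x * F x) = - integral {0..s} (\<lambda>x. Q x * F x)" by simp
  ultimately have "integral {t - s..t + s} (\<lambda>x. Q (x - t) * g x) = Q 0 * integral {0..c} F + Q s * integral {c..s} F"
      and I: "integral {c..s} F = integral {0..s} F - integral {0..c} F" by linarith+
  hence "integral {t - s..t + s} (\<lambda>x. Q (x - t) * g x)
      = (Q 0 - Q s) * integral {0..c} F + Q s * integral {0..s} F"
    unfolding I by (simp add: algebra_simps)
  moreover have "0 \<le> integral {0..c} F" "0 \<le> integral {0..s} F" using G pos c s by auto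
  moreover have "Q s \<le> Q 0" using dec[of 0 s] s by simp
  ultimately show ?thesis using nn by simp
qed

text \<open>Not normalized: the factor \<open>1 / (2 * pi)\<close> is left out.\<close>

definition poisson_kernel :: "real \<Rightarrow> real \<Rightarrow> real" where
  "poisson_kernel \<rho> x = (1 - \<rho>\<^sup>2) / (1 - 2 * \<rho> * cos x + \<rho>\<^sup>2)"

lemma poisson_kernel_denom:
  fixes \<rho> x :: real
  assumes "0 \<le> \<rho>" "\<rho> < 1"
  shows "(1 - \<rho>)\<^sup>2 \<le> 1 - 2 * \<rho> * cos x + \<rho>\<^sup>2" "0 < 1 - 2 * \<rho> * cos x + \<rho>\<^sup>2"
proof -
  have "\<rho> * cos x \<le> \<rho> * 1" using assms(1) by (rule mult_left_mono[OF cos_le_one])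
  thus "(1 - \<rho>)\<^sup>2 \<le> 1 - 2 * \<rho> * cos x + \<rho>\<^sup>2" by (simp add: power2_eq_square algebra_simps)
  moreover have "0 < (1 - \<rho>)\<^sup>2" using assms by simp
  ultimately show "0 < 1 - 2 * \<rho> * cos x + \<rho>\<^sup>2" by linarith
qed

lemma poisson_kernel_pos:
  assumes "0 \<le> \<rho>" "\<rho> < 1"
  shows "0 < poisson_kernel \<rho> x"
  using poisson_kernel_denom[OF assms, of x] assms
  by (auto simp: poisson_kernel_def power_less_one_iff abs_square_less_1 intro!: divide_pos_pos)

lemma poisson_kernel_mono_cos:
  assumes "0 \<le> \<rho>" "\<rho> < 1" "cos x \<le> cos y"
  shows "poisson_kernel \<rho> x \<le> poisson_kernel \<rho> y"
  unfolding poisson_kernel_def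
proof (rule divide_left_mono)
  have "\<rho> * cos x \<le> \<rho> * cos y" using assms by (intro mult_left_mono)
  thus "1 - 2 * \<rho> * cos y + \<rho>\<^sup>2 \<le> 1 - 2 * \<rho> * cos x + \<rho>\<^sup>2" by simp
  show "0 \<le> 1 - \<rho>\<^sup>2" using assms by (simp add: power_le_one)
  show "0 < (1 - 2 * \<rho> * cos x + \<rho>\<^sup>2) * (1 - 2 * \<rho> * cos y + \<rho>\<^sup>2)"
    using poisson_kernel_denom[OF assms(1,2)] by simp
qed

lemma continuous_on_poisson_kernel:
  assumes "0 \<le> \<rho>" "\<rho> < 1"
  shows "continuous_on S (\<lambda>x. poisson_kernel \<rho> (x - t))"
  unfolding poisson_kernel_def
  using poisson_kernel_denom(2)[OF assms] by (intro continuous_intros) (metis less_irrefl)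

text \<open>The interval of half-width \<open>1 - \<rho>\<close> already carries mass 1: there the
  denominator \<open>(1 - \<rho>)^2 + 2 * \<rho> * (1 - cos x)\<close> is at most
  \<open>2 * (1 - \<rho>)^2\<close>, so the kernel is at least
  \<open>1 / (2 * (1 - \<rho>))\<close>.\<close>

lemma poisson_kernel_mass:
  assumes "0 < s" "0 \<le> \<rho>" "\<rho> < 1" "1 - \<rho> \<le> s"
  shows "1 \<le> integral {t - s..t + s} (\<lambda>x. poisson_kernel \<rho> (x - t))"
proof -
  define e where "e = 1 - \<rho>"
  have e: "0 < e" "e \<le> s" using assms by (auto simp: e_def)
  have int: "(\<lambda>x. poisson_kernel \<rho> (x - t)) integrable_on {a..b}" for a b
    by (intro integrable_continuous_real continuous_on_poisson_kernel assms)
  have low: "1 / (2 * e) \<le> poisson_kernel \<rho> (x - t)" if "x \<in> {t - e..t + e}" for x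
  proof -
    have "1 - cos (x - t) \<le> (x - t)\<^sup>2 / 2"
    proof -
      define y where "y = (x - t) / 2"
      have y2: "2 * y = x - t" by (simp add: y_def)
      have "cos (x - t) = 1 - 2 * (sin y)\<^sup>2" using cos_double_sin[of y] unfolding y2 .
      moreover have "(sin y)\<^sup>2 \<le> y\<^sup>2" using abs_sin_x_le_abs_x[of y] by (simp only: abs_le_square_iff)
      ultimately show ?thesis by (simp add: y_def power2_eq_square)
    qed
    also have "\<dots> \<le> e\<^sup>2 / 2" using that by (simp add: abs_le_square_iff[symmetric] abs_le_iff)
    finally have "2 * \<rho> * (1 - cos (x - t)) \<le> 2 * 1 * (e\<^sup>2 / 2)" using assms by (intro mult_mono) auto
    hence "1 - 2 * \<rho> * cos (x - t) + \<rho>\<^sup>2 \<le> 2 * e\<^sup>2" by (simp add: e_def power2_eq_square algebra_simps)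
    hence "(1 - \<rho>\<^sup>2) / (2 * e\<^sup>2) \<le> poisson_kernel \<rho> (x - t)"
      unfolding poisson_kernel_def using poisson_kernel_denom(2)[OF assms(2,3), of "x - t"] assms e
      by (intro divide_left_mono) (auto simp: power_le_one)
    moreover have "1 / (2 * e) \<le> (1 - \<rho>\<^sup>2) / (2 * e\<^sup>2)"
    proof -
      have "1 - \<rho>\<^sup>2 = e * (1 + \<rho>)" by (simp add: e_def power2_eq_square algebra_simps)
      hence "(1 - \<rho>\<^sup>2) / (2 * e\<^sup>2) = (e * (1 + \<rho>)) / (e * (2 * e))" by (simp add: power2_eq_square)
      hence "(1 - \<rho>\<^sup>2) / (2 * e\<^sup>2) = (1 + \<rho>) / (2 * e)" using e by simp
      thus ?thesis using e assms(2) by (simp add: divide_right_mono)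
    qed
    ultimately show ?thesis by linarith
  qed
  have "1 = integral {t - e..t + e} (\<lambda>x. 1 / (2 * e))" using e by simp
  also have "\<dots> \<le> integral {t - e..t + e} (\<lambda>x. poisson_kernel \<rho> (x - t))"
    by (rule integral_le) (use int low in auto)
  also have "\<dots> \<le> integral {t - s..t + s} (\<lambda>x. poisson_kernel \<rho> (x - t))"
    by (rule integral_subset_le) (use e int less_imp_le[OF poisson_kernel_pos[OF assms(2,3)]] in auto)
  finally show ?thesis .
qed

lemma poisson_kernel_norm:
  "(cmod (cis x - of_real \<rho> * cis t))\<^sup>2 = 1 - 2 * \<rho> * cos (x - t) + \<rho>\<^sup>2"
proof -
  have "(cmod (cis x - of_real \<rho> * cis t))\<^sup>2 = (cos x - \<rho> * cos t)\<^sup>2 + (sin x - \<rho> * sin t)\<^sup>2"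
    by (simp add: cmod_power2)
  also have "\<dots> = ((sin x)\<^sup>2 + (cos x)\<^sup>2) - 2 * \<rho> * (cos x * cos t + sin x * sin t) + \<rho>\<^sup>2 * ((sin t)\<^sup>2 + (cos t)\<^sup>2)"
    by algebra
  also have "\<dots> = 1 - 2 * \<rho> * cos (x - t) + \<rho>\<^sup>2" by (simp add: cos_diff)
  finally show ?thesis .
qed

text \<open>A positive lower symmetric density of \<open>h\<close> at \<open>t\<close> is enough for a positive radial limit at \<open>t\<close>;
  no Fatou theorem is needed.\<close>

lemma poisson_radial_positive:
  fixes h :: "real \<Rightarrow> real"
  assumes h: "set_integrable lebesgue {0..2 * pi} h" and c: "c > 0" and s: "s > 0" "{t - s..t + s} \<subseteq> {0<..<2 * pi}"
    and dens: "\<And>x. 0 \<le> x \<Longrightarrow> x \<le> s \<Longrightarrow> c * x \<le> integral {t - x..t + x} h"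
  obtains \<rho>0 where "0 < \<rho>0" "\<rho>0 < 1"
    "\<And>\<rho>. \<rho>0 \<le> \<rho> \<Longrightarrow> \<rho> < 1 \<Longrightarrow> 0 < integral {0..2 * pi} (\<lambda>x. poisson_kernel \<rho> (x - t) * h x)"
proof -
  have ab: "0 < t - s" "t + s < 2 * pi" using s by (auto simp: subset_iff)
  have hi: "h integrable_on {0..2 * pi}" and ahi: "(\<lambda>x. \<bar>h x\<bar>) integrable_on {0..2 * pi}"
    using h by (simp_all add: absolutely_integrable_on_def)
  have hi': "h integrable_on {a..b}" and ahi': "(\<lambda>x. \<bar>h x\<bar>) integrable_on {a..b}" if "0 \<le> a" "b \<le> 2 * pi" for a b
    using integrable_subinterval_real[OF hi, of a b] integrable_subinterval_real[OF ahi, of a b] that by auto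
  define A where "A = integral {0..2 * pi} (\<lambda>x. \<bar>h x\<bar>)"
  have A0: "0 \<le> A" unfolding A_def by (rule integral_nonneg[OF ahi]) auto
  have Ab: "integral {a..b} (\<lambda>x. \<bar>h x\<bar>) \<le> A" if "0 \<le> a" "b \<le> 2 * pi" for a b
    unfolding A_def by (rule integral_subset_le) (use that ahi ahi' in auto)
  have cs: "cos s < 1"
  proof -
    have "cos s < cos 0" using s ab by (intro cos_monotone_0_pi) auto
    thus ?thesis by simp
  qed
  have "((\<lambda>\<rho>. poisson_kernel \<rho> s * (2 * A)) \<longlongrightarrow> 0 / (1 - 2 * 1 * cos s + 1\<^sup>2) * (2 * A)) (at_left 1)"
    unfolding poisson_kernel_def using cs by (auto intro!: tendsto_eq_intros)
  hence "\<forall>\<^sub>F \<rho> in at_left 1. poisson_kernel \<rho> s * (2 * A) < c / 2"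
    using c by (intro order_tendstoD) auto
  then obtain b where b: "b < 1" "\<And>\<rho>. b < \<rho> \<Longrightarrow> \<rho> < 1 \<Longrightarrow> poisson_kernel \<rho> s * (2 * A) < c / 2"
    unfolding eventually_at_left_field by blast
  define \<rho>0 where "\<rho>0 = max ((b + 1) / 2) (max (1/2) (1 - s))"
  have r0: "0 < \<rho>0" "\<rho>0 < 1" "b < \<rho>0" "1 - s \<le> \<rho>0" using b s by (auto simp: \<rho>0_def max_def)
  show ?thesis
  proof (rule that[OF r0(1,2)])
    fix \<rho> assume r: "\<rho>0 \<le> \<rho>" "\<rho> < 1"
    hence r': "0 \<le> \<rho>" "b < \<rho>" "1 - \<rho> \<le> s" using r0 by auto
    define Q where "Q = poisson_kernel \<rho>"
    have Qb: "bounded ((\<lambda>x. Q (x - t)) ` {0..2 * pi})"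
      unfolding Q_def by (intro compact_imp_bounded compact_continuous_image continuous_on_poisson_kernel r r') auto
    have "(\<lambda>x. Q (x - t) * h x) absolutely_integrable_on {0..2 * pi}"
      by (rule absolutely_integrable_bounded_measurable_product_real[OF _ _ Qb h])
         (auto simp: Q_def intro!: continuous_imp_measurable_on_sets_lebesgue continuous_on_poisson_kernel r r')
    hence Qh: "(\<lambda>x. Q (x - t) * h x) integrable_on {0..2 * pi}" by (simp add: absolutely_integrable_on_def)
    have Qh': "(\<lambda>x. Q (x - t) * h x) integrable_on {a..b}" if "0 \<le> a" "b \<le> 2 * pi" for a b
      using integrable_subinterval_real[OF Qh, of a b] that by auto
    have Qi: "(\<lambda>x. Q (x - t)) integrable_on {a..b}" for a b
      unfolding Q_def by (intro integrable_continuous_real continuous_on_poisson_kernel r r')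
    have Q0: "0 < Q x" for x unfolding Q_def by (rule poisson_kernel_pos[OF r'(1) r(2)])
    \<comment> \<open>The constant \<open>c / 2\<close> has integral \<open>c * x\<close> over the
      symmetric interval of half-width \<open>x\<close>, so \<open>h - c / 2\<close> has nonnegative
      integrals over all of them and the weight lemma applies.\<close>
    have near: "c / 2 \<le> integral {t - s..t + s} (\<lambda>x. Q (x - t) * h x)"
    proof -
      have "0 \<le> integral {t - s..t + s} (\<lambda>x. Q (x - t) * (h x - c / 2))"
      proof (rule integral_even_decreasing_weight)
        show "(\<lambda>x. h x - c / 2) integrable_on {t - s..t + s}" by (intro integrable_diff hi') (use ab in auto)
        have "(\<lambda>x. Q (x - t) * h x - Q (x - t) * (c / 2)) integrable_on {t - s..t + s}"
          by (intro integrable_diff Qh' integrable_on_mult_left Qi) (use ab in auto)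
        thus "(\<lambda>x. Q (x - t) * (h x - c / 2)) integrable_on {t - s..t + s}" by (simp add: algebra_simps)
        show "Q (- x) = Q x" for x by (simp add: Q_def poisson_kernel_def)
        show "Q y \<le> Q x" if "0 \<le> x" "x \<le> y" "y \<le> s" for x y
          unfolding Q_def by (rule poisson_kernel_mono_cos[OF r'(1) r(2)]) (use that ab in \<open>auto intro: cos_monotone_0_pi_le\<close>)
        show "0 \<le> integral {t - x..t + x} (\<lambda>x. h x - c / 2)" if "0 \<le> x" "x \<le> s" for x
        proof -
          have "integral {t - x..t + x} (\<lambda>x. h x - c / 2) = integral {t - x..t + x} h - integral {t - x..t + x} (\<lambda>x. c / 2)"
            by (intro integral_diff hi') (use that ab in auto)
          thus ?thesis using dens[OF that] that by (simp add: field_simps)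
        qed
      qed (use s Q0 in \<open>auto intro: less_imp_le\<close>)
      also have "\<dots> = integral {t - s..t + s} (\<lambda>x. Q (x - t) * h x - Q (x - t) * (c / 2))" by (simp add: algebra_simps)
      also have "\<dots> = integral {t - s..t + s} (\<lambda>x. Q (x - t) * h x) - integral {t - s..t + s} (\<lambda>x. Q (x - t)) * (c / 2)"
      proof -
        have Qc: "(\<lambda>x. Q (x - t) * (c / 2)) integrable_on {t - s..t + s}" by (intro integrable_on_mult_left Qi)
        have "(\<lambda>x. Q (x - t) * h x) integrable_on {t - s..t + s}" by (rule Qh') (use ab in auto)
        from integral_diff[OF this Qc] show ?thesis by (simp only: integral_mult_left)
      qed
      finally have "integral {t - s..t + s} (\<lambda>x. Q (x - t)) * (c / 2) \<le> integral {t - s..t + s} (\<lambda>x. Q (x - t) * h x)" by simp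
      moreover have "1 * (c / 2) \<le> integral {t - s..t + s} (\<lambda>x. Q (x - t)) * (c / 2)"
        unfolding Q_def by (rule mult_right_mono[OF poisson_kernel_mass]) (use s r r' c in auto)
      ultimately show ?thesis by simp
    qed
    \<comment> \<open>Away from \<open>t\<close> the kernel is at most its value at
      \<open>s\<close>, which tends to 0 as \<open>\<rho>\<close> tends to 1.\<close>
    have far: "\<bar>integral {a..b} (\<lambda>x. Q (x - t) * h x)\<bar> \<le> Q s * A"
      if "0 \<le> a" "b \<le> 2 * pi" "\<And>x. x \<in> {a..b} \<Longrightarrow> cos (x - t) \<le> cos s" for a b
    proof -
      have "norm (integral {a..b} (\<lambda>x. Q (x - t) * h x)) \<le> integral {a..b} (\<lambda>x. Q s * \<bar>h x\<bar>)"
      proof (rule integral_norm_bound_integral)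
        show "(\<lambda>x. Q (x - t) * h x) integrable_on {a..b}" by (rule Qh'[OF that(1,2)])
        show "(\<lambda>x. Q s * \<bar>h x\<bar>) integrable_on {a..b}" by (intro integrable_on_mult_right ahi' that)
        show "norm (Q (x - t) * h x) \<le> Q s * \<bar>h x\<bar>" if "x \<in> {a..b}" for x
          using poisson_kernel_mono_cos[OF r'(1) r(2) \<open>x \<in> {a..b} \<Longrightarrow> cos (x - t) \<le> cos s\<close>] that Q0[of "x - t"]
          by (auto simp: abs_mult Q_def intro!: mult_right_mono)
      qed
      also have "\<dots> = Q s * integral {a..b} (\<lambda>x. \<bar>h x\<bar>)" by simp
      also have "\<dots> \<le> Q s * A" using Ab[OF that(1,2)] Q0[of s] by (intro mult_left_mono) auto
      finally show ?thesis by simp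
    qed
    have f1: "\<bar>integral {0..t - s} (\<lambda>x. Q (x - t) * h x)\<bar> \<le> Q s * A"
    proof (rule far)
      fix x assume x: "x \<in> {0..t - s}"
      have "cos (t - x) \<le> cos s"
      proof (cases "t - x \<le> pi")
        case True
        thus ?thesis using x s by (intro cos_monotone_0_pi_le) auto
      next
        case False
        have "cos (2 * pi - (t - x)) \<le> cos s" using x s ab False by (intro cos_monotone_0_pi_le) auto
        thus ?thesis by (simp add: cos_diff)
      qed
      thus "cos (x - t) \<le> cos s" by (metis cos_minus minus_diff_eq)
    qed (use ab s in auto)
    have f2: "\<bar>integral {t + s..2 * pi} (\<lambda>x. Q (x - t) * h x)\<bar> \<le> Q s * A"
    proof (rule far)
      fix x assume x: "x \<in> {t + s..2 * pi}"
      show "cos (x - t) \<le> cos s"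
      proof (cases "x - t \<le> pi")
        case True
        thus ?thesis using x s by (intro cos_monotone_0_pi_le) auto
      next
        case False
        have "cos (2 * pi - (x - t)) \<le> cos s" using x s ab False by (intro cos_monotone_0_pi_le) auto
        thus ?thesis by (simp add: cos_diff)
      qed
    qed (use ab s in auto)
    have "integral {0..t - s} (\<lambda>x. Q (x - t) * h x) + integral {t - s..2 * pi} (\<lambda>x. Q (x - t) * h x) = integral {0..2 * pi} (\<lambda>x. Q (x - t) * h x)"
      by (rule Henstock_Kurzweil_Integration.integral_combine) (use ab s Qh in auto)
    moreover have "integral {t - s..t + s} (\<lambda>x. Q (x - t) * h x) + integral {t + s..2 * pi} (\<lambda>x. Q (x - t) * h x) = integral {t - s..2 * pi} (\<lambda>x. Q (x - t) * h x)"
      by (rule Henstock_Kurzweil_Integration.integral_combine) (use ab s Qh' in auto)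
    moreover have "2 * (Q s * A) < c / 2" using b(2)[OF r'(2) r(2)] by (simp add: Q_def)
    ultimately show "0 < integral {0..2 * pi} (\<lambda>x. poisson_kernel \<rho> (x - t) * h x)"
      using near f1 f2 unfolding Q_def[symmetric] by linarith
  qed
qed

subsection \<open>Points of positive symmetric density\<close>

lemma integral_truncation:
  fixes H :: "real \<Rightarrow> real"
  assumes "integrable M H" "e > 0"
  obtains K :: real where "K > 0" "(\<integral>x. (\<bar>H x\<bar> - min \<bar>H x\<bar> K) \<partial>M) < e"
proof -
  have "(\<lambda>n. \<integral>x. (\<bar>H x\<bar> - min \<bar>H x\<bar> (real n)) \<partial>M) \<longlonglongrightarrow> (\<integral>x. 0 \<partial>M)"
  proof (rule integral_dominated_convergence[where w = "\<lambda>x. \<bar>H x\<bar>"])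
    show "AE x in M. (\<lambda>n. \<bar>H x\<bar> - min \<bar>H x\<bar> (real n)) \<longlonglongrightarrow> 0"
    proof (intro AE_I2 tendsto_eventually)
      fix x
      obtain N :: nat where "\<bar>H x\<bar> \<le> real N" using real_arch_simple by blast
      thus "\<forall>\<^sub>F n in sequentially. \<bar>H x\<bar> - min \<bar>H x\<bar> (real n) = 0"
        by (intro eventually_sequentiallyI[of N]) (auto simp: min_def)
    qed
  qed (use assms in auto)
  hence "\<forall>\<^sub>F n in sequentially. (\<integral>x. (\<bar>H x\<bar> - min \<bar>H x\<bar> (real n)) \<partial>M) < e"
    using order_tendstoD(2)[of _ "\<integral>x. 0 \<partial>M" sequentially e] assms(2) by simp
  hence "\<forall>\<^sub>F n in sequentially. (\<integral>x. (\<bar>H x\<bar> - min \<bar>H x\<bar> (real n)) \<partial>M) < e \<and> 0 < n"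
    by (intro eventually_conj eventually_gt_at_top)
  then obtain n where "(\<integral>x. (\<bar>H x\<bar> - min \<bar>H x\<bar> (real n)) \<partial>M) < e" "0 < n"
    using eventually_happens'[OF sequentially_bot] by blast
  thus ?thesis using that[of "real n"] by simp
qed

text \<open>Finite unions are clear by additivity. The balls are enumerated by natural numbers so
  that the union is an increasing limit of finite ones.\<close>

lemma integral_disjoint_balls_nonpos:
  fixes G :: "real \<Rightarrow> real" and r :: "'i \<Rightarrow> real"
  assumes C: "countable C" "pairwise (\<lambda>i j. disjnt (cball (a i) (r i)) (cball (a j) (r j))) C"
    and G: "set_integrable lebesgue (\<Union>i\<in>C. cball (a i) (r i)) G"
    and neg: "\<And>i. i \<in> C \<Longrightarrow> (LINT x:cball (a i) (r i)|lebesgue. G x) \<le> 0"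
  shows "(LINT x:(\<Union>i\<in>C. cball (a i) (r i))|lebesgue. G x) \<le> 0"
proof -
  define A where "A = (\<lambda>n. if n \<in> to_nat_on C ` C then cball (a (from_nat_into C n)) (r (from_nat_into C n)) else {})"
  have A: "A (to_nat_on C i) = cball (a i) (r i)" if "i \<in> C" for i using that C(1) by (simp add: A_def)
  have U: "(\<Union>i\<in>C. cball (a i) (r i)) = (\<Union>n. A n)"
  proof
    show "(\<Union>i\<in>C. cball (a i) (r i)) \<subseteq> (\<Union>n. A n)" using A by blast
    show "(\<Union>n. A n) \<subseteq> (\<Union>i\<in>C. cball (a i) (r i))"
      using C(1) by (auto simp: A_def split: if_splits)
  qed
  have disj: "A i \<inter> A j = {}" if "i \<noteq> j" for i j
  proof (cases "i \<in> to_nat_on C ` C \<and> j \<in> to_nat_on C ` C")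
    case True
    then obtain i' j' where ij: "i' \<in> C" "j' \<in> C" "i = to_nat_on C i'" "j = to_nat_on C j'" by blast
    hence "i' \<noteq> j'" using that by auto
    hence "disjnt (cball (a i') (r i')) (cball (a j') (r j'))" using C(2) ij by (simp add: pairwise_def)
    thus ?thesis using A ij by (simp add: disjnt_def)
  next
    case False
    thus ?thesis by (auto simp: A_def)
  qed
  have Am: "A n \<in> sets lebesgue" for n by (auto simp: A_def)
  have Ai: "set_integrable lebesgue (A n) G" for n
    by (rule set_integrable_subset[OF G Am]) (use U in auto)
  have n: "(LINT x:(A n)|lebesgue. G x) \<le> 0" for n
  proof (cases "n \<in> to_nat_on C ` C")
    case True
    thus ?thesis using A neg by auto
  qed (simp add: A_def set_lebesgue_integral_def)
  have lim: "(\<lambda>k. LINT x:(\<Union>n<k. A n)|lebesgue. G x) \<longlonglongrightarrow> (LINT x:(\<Union>k. \<Union>n<k. A n)|lebesgue. G x)"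
  proof (rule set_integral_cont_up)
    show "(\<Union>n<k. A n) \<in> sets lebesgue" for k using Am by auto
    show "incseq (\<lambda>k. \<Union>n<k. A n)" by (intro incseq_SucI UN_mono) auto
    have "(\<Union>k. \<Union>n<k. A n) = (\<Union>n. A n)" by auto
    thus "set_integrable lebesgue (\<Union>k. \<Union>n<k. A n) G" using G U by simp
  qed
  have "(LINT x:(\<Union>n<k. A n)|lebesgue. G x) \<le> 0" for k
  proof -
    have "(LINT x:(\<Union>n<k. A n)|lebesgue. G x) = (\<Sum>n<k. (LINT x:(A n)|lebesgue. G x))"
      by (rule set_integral_finite_Union) (use disj Am Ai in \<open>auto simp: disjoint_family_on_def\<close>)
    thus ?thesis using n by (simp add: sum_nonpos)
  qed
  hence "(LINT x:(\<Union>k. \<Union>n<k. A n)|lebesgue. G x) \<le> 0" by (intro LIMSEQ_le_const2[OF lim]) blast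
  moreover have "(\<Union>k. \<Union>n<k. A n) = (\<Union>n. A n)" by auto
  ultimately show ?thesis using U by simp
qed

text \<open>A one-sided density theorem by Vitali covering. If it failed, almost all of a set
  \<open>F\<close> on which \<open>h > 2 * \<kappa>\<close> could be covered by disjoint intervals
  in which the mean of \<open>h\<close> is at most \<open>\<kappa> / 2\<close>, all within an open
  set only slightly larger than \<open>F\<close>. Integration over these intervals is
  contradictory.\<close>

lemma exists_positive_symmetric_density:
  fixes h :: "real \<Rightarrow> real"
  assumes h: "set_integrable lebesgue {a..b} h" and lr: "{l<..<r} \<subseteq> {a..b}"
    and npos: "\<not> (AE x in lebesgue. x \<in> {l<..<r} \<longrightarrow> h x \<le> 0)"
  obtains t c s where "c > 0" "s > 0" "t \<in> {l<..<r}" "{t - s..t + s} \<subseteq> {l<..<r}"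
    "\<And>x. 0 \<le> x \<Longrightarrow> x \<le> s \<Longrightarrow> c * x \<le> integral {t - x..t + x} h"
proof (rule ccontr)
  note that' = that
  assume "\<not> thesis"
  hence bad: "\<exists>x. 0 \<le> x \<and> x \<le> s \<and> integral {t - x..t + x} h < c * x"
    if "c > 0" "s > 0" "t \<in> {l<..<r}" "{t - s..t + s} \<subseteq> {l<..<r}" for t c s
    using that that' by (meson not_le)
  define I where "I = {l<..<r}"
  define H where "H = (\<lambda>x. indicat_real I x * h x)"
  have hI: "set_integrable lebesgue I h" unfolding I_def by (rule set_integrable_subset[OF h _ lr]) auto
  hence H: "integrable lebesgue H" unfolding H_def set_integrable_def by simp
  hence Hm [measurable]: "H \<in> borel_measurable lebesgue" by auto
  define E where "E = (\<lambda>n::nat. {x \<in> I. 2 / real (Suc n) < H x})"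
  have Em: "E n \<in> sets lebesgue" for n
  proof -
    have "E n = I \<inter> {x \<in> space lebesgue. 2 / real (Suc n) < H x}" by (auto simp: E_def)
    moreover have "{x \<in> space lebesgue. 2 / real (Suc n) < H x} \<in> sets lebesgue" by measurable
    ultimately show ?thesis by (auto simp: I_def)
  qed
  have "\<exists>n. emeasure lebesgue (E n) \<noteq> 0"
  proof (rule ccontr)
    assume "\<not> ?thesis"
    hence "E n \<in> null_sets lebesgue" for n using Em by (auto simp: null_sets_def)
    hence "(\<Union>n. E n) \<in> null_sets lebesgue" by (intro null_sets_UN) auto
    hence "AE x in lebesgue. x \<notin> (\<Union>n. E n)" by (rule AE_not_in)
    hence "AE x in lebesgue. x \<in> {l<..<r} \<longrightarrow> h x \<le> 0"
    proof (rule AE_mp, intro AE_I2 impI)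
      fix x assume x: "x \<notin> (\<Union>n. E n)" "x \<in> {l<..<r}"
      show "h x \<le> 0"
      proof (rule ccontr)
        assume "\<not> h x \<le> 0"
        then obtain n where "1 / real (Suc n) < h x / 2" using nat_approx_posE[of "h x / 2"] by (metis half_gt_zero not_le)
        hence "x \<in> E n" using x(2) by (simp add: E_def I_def H_def field_simps)
        thus False using x(1) by blast
      qed
    qed
    thus False using npos by simp
  qed
  then obtain n where n: "emeasure lebesgue (E n) \<noteq> 0" by blast
  define \<kappa> where "\<kappa> = 1 / real (Suc n)"
  have k0: "\<kappa> > 0" by (simp add: \<kappa>_def)
  define F where "F = E n"
  have FI: "F \<subseteq> I" and FH: "x \<in> F \<Longrightarrow> 2 * \<kappa> < H x" for x by (auto simp: F_def E_def \<kappa>_def)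
  have Im: "I \<in> lmeasurable" by (simp add: I_def)
  have Fm: "F \<in> lmeasurable" using fmeasurableI2[OF Im FI] Em by (simp add: F_def)
  define \<mu> where "\<mu> = measure lebesgue F"
  have mu0: "\<mu> > 0" using n Fm unfolding \<mu>_def F_def
    by (metis emeasure_eq_measure2 ennreal_0 less_eq_real_def measure_nonneg)
  \<comment> \<open>The part of \<open>H\<close> above the height \<open>K\<close> costs at most a
    quarter of \<open>\<kappa> * \<mu>\<close>. The set \<open>V - F\<close> will have measure at
    most \<open>e\<close> and cost \<open>e * (K + \<kappa>)\<close>, another quarter.\<close>
  obtain K where K: "K > 0" "(\<integral>x. (\<bar>H x\<bar> - min \<bar>H x\<bar> K) \<partial>lebesgue) < \<kappa> * \<mu> / 4"
    by (rule integral_truncation[OF H, of "\<kappa> * \<mu> / 4"]) (use k0 mu0 in auto)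
  define e where "e = \<kappa> * \<mu> / 4 / (K + \<kappa>)"
  have e0: "e > 0" using k0 mu0 K by (simp add: e_def)
  obtain T0 where T0: "open T0" "F \<subseteq> T0" "T0 - F \<in> lmeasurable" "emeasure lebesgue (T0 - F) < ennreal e"
    by (rule sets_lebesgue_outer_open[OF _ e0, of F]) (use Fm in auto)
  define T where "T = T0 \<inter> I"
  have T: "open T" "F \<subseteq> T" "T \<subseteq> I" using T0 FI by (auto simp: T_def I_def)
  define P where "P = {(t, s). s > 0 \<and> cball t s \<subseteq> T \<and> (LINT x:cball t s|lebesgue. H x) \<le> \<kappa> * s}"
  obtain C where C: "countable C" "C \<subseteq> P" "pairwise (\<lambda>i j. disjnt (cball (fst i) (snd i)) (cball (fst j) (snd j))) C"
    "negligible (F - (\<Union>i\<in>C. cball (fst i) (snd i)))"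
  proof (rule Vitali_covering_theorem_cballs[of P snd F fst])
    show "0 < snd i" if "i \<in> P" for i using that by (auto simp: P_def)
    fix x d :: real assume x: "x \<in> F" and d: "0 < d"
    obtain s1 where s1: "s1 > 0" "cball x s1 \<subseteq> T" using T x open_contains_cball by blast
    define s2 where "s2 = min s1 (d/2)"
    have s2: "s2 > 0" "s2 \<le> s1" "s2 < d" using s1 d by (auto simp: s2_def)
    have sub: "{x - s2..x + s2} \<subseteq> {l<..<r}"
      using s1(2) s2(2) T(3) by (auto simp: cball_eq_atLeastAtMost I_def subset_iff)
    have "x \<in> {l<..<r}" using x FI by (auto simp: I_def)
    from bad[OF k0 s2(1) this sub] obtain y where y: "0 \<le> y" "y \<le> s2" "integral {x - y..x + y} h < \<kappa> * y" by blast
    have y0: "y > 0" using y by (cases "y = 0") auto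
    have cb: "cball x y = {x - y..x + y}" by (rule cball_eq_atLeastAtMost)
    have cbT: "cball x y \<subseteq> T" using s1(2) y(2) s2(2) by (auto simp: subset_iff)
    have "(LINT z:cball x y|lebesgue. H z) = (LINT z:cball x y|lebesgue. h z)"
    proof (rule set_lebesgue_integral_cong)
      have "cball x y \<subseteq> I" using cbT T(3) by (rule subset_trans)
      thus "\<forall>z. z \<in> cball x y \<longrightarrow> H z = h z" by (metis H_def indicator_simps(1) mult_1 subsetD)
    qed simp
    also have "\<dots> = integral {x - y..x + y} h"
      unfolding cb by (rule set_lebesgue_integral_eq_integral(2)) (rule set_integrable_subset[OF hI], use cbT T(3) cb in auto)
    finally have "(x, y) \<in> P" using y y0 cbT by (simp add: P_def)
    thus "\<exists>i. i \<in> P \<and> x \<in> cball (fst i) (snd i) \<and> snd i < d" using y0 y(2) s2(3) by (intro exI[of _ "(x, y)"]) auto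
  qed blast
  define V where "V = (\<Union>i\<in>C. cball (fst i) (snd i))"
  have VT: "V \<subseteq> T" unfolding V_def
  proof (rule UN_least)
    fix i assume "i \<in> C"
    hence "i \<in> P" using C(2) by blast
    thus "cball (fst i) (snd i) \<subseteq> T" by (cases i) (simp add: P_def)
  qed
  have Vm: "V \<in> sets lebesgue" unfolding V_def using C(1) by (intro sets.countable_UN'') auto
  have Vl: "V \<in> lmeasurable" by (rule fmeasurableI2[OF Im subset_trans[OF VT T(3)] Vm])
  define G where "G = (\<lambda>x. H x - \<kappa> / 2)"
  have Hs: "set_integrable lebesgue S H" if "S \<in> lmeasurable" for S
    unfolding set_integrable_def using integrable_mult_indicator[OF _ H, of S] that by auto
  have Ks: "set_integrable lebesgue S (\<lambda>x. \<kappa> / 2)" if "S \<in> lmeasurable" for S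
    unfolding set_integrable_def using that by (intro integrable_scaleR_left) (auto simp: fmeasurable_def)
  have Gi: "set_integrable lebesgue S G" if "S \<in> lmeasurable" for S
    unfolding G_def by (rule set_integral_diff(1)[OF Hs[OF that] Ks[OF that]])
  have "(LINT x:V|lebesgue. G x) \<le> 0"
    unfolding V_def
  proof (rule integral_disjoint_balls_nonpos[OF C(1,3)])
    show "set_integrable lebesgue (\<Union>i\<in>C. cball (fst i) (snd i)) G" using Gi[OF Vl] by (simp add: V_def)
    fix i assume "i \<in> C"
    then obtain t s where i: "i = (t, s)" "s > 0" "(LINT x:cball t s|lebesgue. H x) \<le> \<kappa> * s"
      using C(2) by (auto simp: P_def)
    have "(LINT x:cball t s|lebesgue. G x) = (LINT x:cball t s|lebesgue. H x) - (LINT x:cball t s|lebesgue. \<kappa> / 2)"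
      unfolding G_def
      by (rule set_integral_diff(2)[OF Hs Ks]) simp_all
    also have "(LINT x:cball t s|lebesgue. \<kappa> / 2) = \<kappa> * s"
      using i(2) by (simp add: set_lebesgue_integral_def cball_eq_atLeastAtMost)
    finally show "(LINT x:cball (fst i) (snd i)|lebesgue. G x) \<le> 0" using i by simp
  qed
  moreover have "0 < (LINT x:V|lebesgue. G x)"
  proof -
    \<comment> \<open>An integrable minorant of \<open>G\<close> on \<open>V\<close>: on
      \<open>F\<close> the value of \<open>G\<close> exceeds \<open>3/2 * \<kappa>\<close>;
      elsewhere \<open>\<bar>H\<bar>\<close> is split at the height \<open>K\<close>, since only its
      bounded part is controlled by the measure of \<open>V - F\<close>.\<close>
    define L where "L = (\<lambda>x. indicat_real F x * (3/2 * \<kappa>) - indicat_real (V - F) x * (K + \<kappa>) - (\<bar>H x\<bar> - min \<bar>H x\<bar> K))"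
    have "F - V \<in> null_sets lebesgue" using C(4) by (simp add: V_def negligible_iff_null_sets)
    hence ae: "AE x in lebesgue. x \<notin> F - V" by (rule AE_not_in)
    have VF: "V - F \<in> lmeasurable" using Vl Fm by auto
    have iL: "integrable lebesgue L" unfolding L_def
    proof (intro Bochner_Integration.integrable_diff integrable_mult_left integrable_abs H)
      show "integrable lebesgue (\<lambda>x. min \<bar>H x\<bar> K)"
        by (rule Bochner_Integration.integrable_bound[OF H]) (use K(1) in auto)
    qed (use Fm VF in \<open>auto simp: fmeasurable_def\<close>)
    have "measure lebesgue (V - F) \<le> e"
    proof -
      have "V - F \<subseteq> T0 - F" using VT by (auto simp: T_def)
      hence "measure lebesgue (V - F) \<le> measure lebesgue (T0 - F)" by (intro measure_mono_fmeasurable) (use VF T0(3) in auto)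
      also have "\<dots> \<le> e" using T0(3,4) e0 by (simp add: emeasure_eq_measure2 ennreal_less_iff)
      finally show ?thesis .
    qed
    hence "measure lebesgue (V - F) * (K + \<kappa>) \<le> e * (K + \<kappa>)" using K k0 by (intro mult_right_mono) auto
    also have "\<dots> = \<kappa> * \<mu> / 4" unfolding e_def by (rule nonzero_eq_divide_eq[THEN iffD1]) (use K k0 in auto)
    finally have m1: "measure lebesgue (V - F) * (K + \<kappa>) \<le> \<kappa> * \<mu> / 4" .
    have "0 < \<mu> * (3/2 * \<kappa>) - \<kappa> * \<mu> / 4 - \<kappa> * \<mu> / 4" using k0 mu0 by simp
    also have "\<dots> \<le> \<mu> * (3/2 * \<kappa>) - measure lebesgue (V - F) * (K + \<kappa>) - (\<integral>x. (\<bar>H x\<bar> - min \<bar>H x\<bar> K) \<partial>lebesgue)"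
      using m1 K(2) by linarith
    also have "\<dots> = (\<integral>x. L x \<partial>lebesgue)"
    proof -
      have i1: "integrable lebesgue (\<lambda>x. indicat_real F x * (3/2 * \<kappa>))" "integrable lebesgue (\<lambda>x. indicat_real (V - F) x * (K + \<kappa>))"
        using Fm VF by (auto intro!: integrable_mult_left simp: fmeasurable_def)
      have i2: "integrable lebesgue (\<lambda>x. \<bar>H x\<bar> - min \<bar>H x\<bar> K)"
        by (intro Bochner_Integration.integrable_diff integrable_abs H Bochner_Integration.integrable_bound[OF H, of "\<lambda>x. min \<bar>H x\<bar> K"])
           (use K(1) in auto)
      show ?thesis unfolding L_def using i1 i2 Fm VF by (simp add: \<mu>_def)
    qed
    also have "\<dots> \<le> (\<integral>x. indicat_real V x * G x \<partial>lebesgue)"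
    proof (rule integral_mono_AE[OF iL])
      show "integrable lebesgue (\<lambda>x. indicat_real V x * G x)" using Gi[OF Vl] by (simp add: set_integrable_def)
      show "AE x in lebesgue. L x \<le> indicat_real V x * G x"
        using ae
      proof (rule AE_mp, intro AE_I2 impI)
        fix x assume x: "x \<notin> F - V"
        show "L x \<le> indicat_real V x * G x"
        proof (cases "x \<in> F")
          case True
          hence "x \<in> V" using x by blast
          thus ?thesis using True FH[OF True] k0 by (auto simp: L_def G_def)
        next
          case False
          thus ?thesis using k0 K(1) by (cases "x \<in> V") (auto simp: L_def G_def)
        qed
      qed
    qed
    finally show ?thesis by (simp add: set_lebesgue_integral_def)
  qed
  ultimately show False by simp
qed

subsection \<open>Sign changes of the boundary values\<close>

definition nonpos_on :: "(real \<Rightarrow> real) \<Rightarrow> real \<Rightarrow> real \<Rightarrow> real \<Rightarrow> bool" where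
  "nonpos_on h s l r \<longleftrightarrow> (AE x in lebesgue. x \<in> {l<..<r} \<longrightarrow> s * h x \<le> 0)"

text \<open>An essential count of sign changes: there are \<open>k\<close> successive intervals in
  which \<open>s * h\<close>, \<open>- s * h\<close>, \<open>s * h\<close> and so on are positive on
  a set of positive measure. Signs at single points would mean nothing for integrable boundary
  values.\<close>

fun alternates :: "(real \<Rightarrow> real) \<Rightarrow> real \<Rightarrow> nat \<Rightarrow> real \<Rightarrow> real \<Rightarrow> bool" where
  "alternates h s 0 l r \<longleftrightarrow> True"
| "alternates h s (Suc k) l r \<longleftrightarrow> (\<exists>m\<in>{l..r}. \<not> nonpos_on h s l m \<and> alternates h (-s) k m r)"

lemma nonpos_on_empty: "nonpos_on h s l l"
  by (simp add: nonpos_on_def)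

text \<open>Countably many smaller intervals exhaust the given one. Needed because the cut points
  below are suprema.\<close>

lemma nonpos_on_left_limit:
  assumes "\<And>m. l < m \<Longrightarrow> m < c \<Longrightarrow> nonpos_on h s l m"
  shows "nonpos_on h s l c"
proof (cases "l < c")
  case True
  have "AE x in lebesgue. \<forall>n. x \<in> {l<..<c - (c - l) / real (n + 2)} \<longrightarrow> s * h x \<le> 0"
    unfolding AE_all_countable
  proof
    fix n :: nat
    have "(c - l) / real (n + 2) < c - l" "0 < (c - l) / real (n + 2)"
      using divide_strict_left_mono[of 1 "real (n + 2)" "c - l"] True by auto
    thus "AE x in lebesgue. x \<in> {l<..<c - (c - l) / real (n + 2)} \<longrightarrow> s * h x \<le> 0"
      using assms[of "c - (c - l) / real (n + 2)"] by (simp add: nonpos_on_def)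
  qed
  thus ?thesis unfolding nonpos_on_def
  proof (rule AE_mp, intro AE_I2 impI)
    fix x assume x: "\<forall>n. x \<in> {l<..<c - (c - l) / real (n + 2)} \<longrightarrow> s * h x \<le> 0" "x \<in> {l<..<c}"
    obtain n :: nat where "(c - l) / (c - x) < real n" using reals_Archimedean2 by blast
    hence "(c - l) / (c - x) < real (n + 2)" by simp
    hence "(c - l) / real (n + 2) < c - x" using x(2) by (simp add: field_simps)
    thus "s * h x \<le> 0" using x(1)[rule_format, of n] x(2) by auto
  qed
qed (simp add: nonpos_on_def)

lemma nonpos_on_right_limit:
  assumes "\<And>m. c < m \<Longrightarrow> m < r \<Longrightarrow> nonpos_on h s m r"
  shows "nonpos_on h s c r"
proof (cases "c < r")
  case True
  have "AE x in lebesgue. \<forall>n. x \<in> {c + (r - c) / real (n + 2)<..<r} \<longrightarrow> s * h x \<le> 0"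
    unfolding AE_all_countable
  proof
    fix n :: nat
    have "(r - c) / real (n + 2) < r - c" "0 < (r - c) / real (n + 2)"
      using divide_strict_left_mono[of 1 "real (n + 2)" "r - c"] True by auto
    thus "AE x in lebesgue. x \<in> {c + (r - c) / real (n + 2)<..<r} \<longrightarrow> s * h x \<le> 0"
      using assms[of "c + (r - c) / real (n + 2)"] by (simp add: nonpos_on_def)
  qed
  thus ?thesis unfolding nonpos_on_def
  proof (rule AE_mp, intro AE_I2 impI)
    fix x assume x: "\<forall>n. x \<in> {c + (r - c) / real (n + 2)<..<r} \<longrightarrow> s * h x \<le> 0" "x \<in> {c<..<r}"
    obtain n :: nat where "(r - c) / (x - c) < real n" using reals_Archimedean2 by blast
    hence "(r - c) / (x - c) < real (n + 2)" by simp
    hence "(r - c) / real (n + 2) < x - c" using x(2) by (simp add: field_simps)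
    thus "s * h x \<le> 0" using x(1)[rule_format, of n] x(2) by auto
  qed
qed (simp add: nonpos_on_def)

text \<open>\<open>c\<close> is the supremum of the points up to which \<open>s * h \<le> 0\<close>
  almost everywhere. An interval reaching beyond \<open>c\<close> shows the first sign, so from any
  \<open>m > c\<close> on one alternation fewer is possible; \<open>nonpos_on_right_limit\<close>
  carries this over to \<open>c\<close> itself.\<close>

lemma first_sign_change:
  assumes lr: "l \<le> r" and na: "\<not> alternates h s (Suc (Suc N)) l r"
  obtains c where "l \<le> c" "c \<le> r" "nonpos_on h s l c" "\<not> alternates h (-s) (Suc N) c r"
proof -
  define M where "M = {m \<in> {l..r}. nonpos_on h s l m}"
  have lM: "l \<in> M" using lr by (simp add: M_def nonpos_on_empty)
  have bdd: "bdd_above M" unfolding M_def by (rule bdd_aboveI[of _ r]) auto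
  define c where "c = Sup M"
  have c: "l \<le> c" unfolding c_def by (rule cSup_upper[OF lM bdd])
  have c': "c \<le> r" unfolding c_def by (rule cSup_least) (use lM in \<open>auto simp: M_def\<close>)
  note c = c c'
  have nc: "nonpos_on h s l c"
  proof (rule nonpos_on_left_limit)
    fix m assume m: "l < m" "m < c"
    then obtain m' where m': "m' \<in> M" "m < m'" using less_cSup_iff[of M m] lM bdd by (auto simp: c_def)
    hence "nonpos_on h s l m'" by (simp add: M_def)
    thus "nonpos_on h s l m" unfolding nonpos_on_def
      by (rule AE_mp) (intro AE_I2, use m'(2) in auto)
  qed
  have beyond: "\<not> alternates h (-s) (Suc N) m r" if m: "c < m" "m \<le> r" for m
  proof
    assume al: "alternates h (-s) (Suc N) m r"
    have "m \<notin> M" using m(1) cSup_upper[OF _ bdd, of m] by (auto simp: c_def)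
    hence "\<not> nonpos_on h s l m" using m c by (simp add: M_def)
    hence "alternates h s (Suc (Suc N)) l r" using al m c by (subst alternates.simps) auto
    thus False using na by simp
  qed
  have "\<not> alternates h (-s) (Suc N) c r"
  proof
    assume "alternates h (-s) (Suc N) c r"
    then obtain m' where m': "c \<le> m'" "m' \<le> r" "\<not> nonpos_on h (-s) c m'" "alternates h (- (-s)) N m' r" by auto
    obtain m where m: "c < m" "m < m'" "\<not> nonpos_on h (-s) m m'" using nonpos_on_right_limit m'(3) by blast
    have "alternates h (-s) (Suc N) m r" using m m' by (subst alternates.simps) (intro bexI[of _ m'], auto)
    thus False using beyond[of m] m m' by simp
  qed
  with c nc that show ?thesis by blast
qed

lemma sin_half_sign:
  assumes "x \<in> {0..2*pi}" "y \<in> {0..2*pi}"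
  shows "x \<le> y \<Longrightarrow> sin ((x - y) / 2) \<le> 0" "y \<le> x \<Longrightarrow> 0 \<le> sin ((x - y) / 2)"
proof -
  assume "x \<le> y"
  hence "0 \<le> sin ((y - x) / 2)" using assms by (intro sin_ge_zero) auto
  moreover have "(x - y) / 2 = - ((y - x) / 2)" by (simp only: minus_divide_left minus_diff_eq)
  ultimately show "sin ((x - y) / 2) \<le> 0" by (simp only: sin_minus)
next
  assume "y \<le> x"
  thus "0 \<le> sin ((x - y) / 2)" using assms by (intro sin_ge_zero) auto
qed

lemma prod_sin_half_sign:
  assumes "x \<in> {0..2*pi}" "set xs \<subseteq> {c..2*pi}" "0 \<le> c" "x \<le> c"
  shows "0 \<le> (-1) ^ length xs * (\<Prod>y\<leftarrow>xs. sin ((x - y) / 2))"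
  using assms(2)
proof (induction xs)
  case (Cons y ys)
  have "sin ((x - y) / 2) \<le> 0" using Cons.prems assms by (intro sin_half_sign) auto
  hence "0 \<le> - sin ((x - y) / 2)" by simp
  moreover have "0 \<le> (-1) ^ length ys * (\<Prod>y\<leftarrow>ys. sin ((x - y) / 2))" using Cons by auto
  ultimately have "0 \<le> (- sin ((x - y) / 2)) * ((-1) ^ length ys * (\<Prod>y\<leftarrow>ys. sin ((x - y) / 2)))"
    by (rule mult_nonneg_nonneg)
  thus ?case by (simp add: mult_ac)
qed simp

text \<open>Cut greedily at the first sign change. For angles in \<open>[0, 2 * pi]\<close> the
  half-angle sine changes from negative to positive at \<open>y\<close>, so each cut point
  contributes the sign change that \<open>h\<close> may have there.\<close>

lemma sign_change_points:
  assumes "0 \<le> l" "l \<le> r" "r \<le> 2 * pi" "\<not> alternates h s (Suc N) l r"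
  shows "\<exists>xs. length xs = N \<and> set xs \<subseteq> {l..r} \<and>
    (AE x in lebesgue. x \<in> {l<..<r} \<longrightarrow> 0 \<le> - s * (-1) ^ N * (h x * (\<Prod>y\<leftarrow>xs. sin ((x - y) / 2))))"
  using assms
proof (induction N arbitrary: s l)
  case 0
  hence "nonpos_on h s l r" by auto
  thus ?case by (intro exI[of _ "[]"]) (simp add: nonpos_on_def)
next
  case (Suc N)
  obtain c where c: "l \<le> c" "c \<le> r" "nonpos_on h s l c" "\<not> alternates h (-s) (Suc N) c r"
    by (rule first_sign_change[OF Suc.prems(2,4)])
  obtain xs where xs: "length xs = N" "set xs \<subseteq> {c..r}"
    "AE x in lebesgue. x \<in> {c<..<r} \<longrightarrow> 0 \<le> - (-s) * (-1) ^ N * (h x * (\<Prod>y\<leftarrow>xs. sin ((x - y) / 2)))"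
    using Suc.IH[of c "-s"] c Suc.prems by auto
  have "AE x in lebesgue. x \<in> {l<..<r} \<longrightarrow> 0 \<le> - s * (-1) ^ Suc N * (h x * (\<Prod>y\<leftarrow>c # xs. sin ((x - y) / 2)))"
    using xs(3) c(3)[unfolded nonpos_on_def]
  proof eventually_elim
    case (elim x)
    show ?case
    proof
      assume x: "x \<in> {l<..<r}"
      define P where "P = (\<Prod>y\<leftarrow>xs. sin ((x - y) / 2))"
      consider "x < c" | "x = c" | "c < x" by linarith
      thus "0 \<le> - s * (-1) ^ Suc N * (h x * (\<Prod>y\<leftarrow>c # xs. sin ((x - y) / 2)))"
      proof cases
        case 1
        have sub: "set xs \<subseteq> {c..2 * pi}" using xs(2) Suc.prems(3) by auto
        have p1: "0 \<le> (-1) ^ N * P" using prod_sin_half_sign[of x xs c] sub xs(1) 1 x c Suc.prems by (auto simp: P_def)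
        have "sin ((x - c) / 2) \<le> 0" using 1 x c Suc.prems by (intro sin_half_sign) auto
        hence p2: "0 \<le> - sin ((x - c) / 2)" by simp
        have "s * h x \<le> 0" using elim(2) x 1 by auto
        hence p3: "0 \<le> - (s * h x)" by simp
        have "0 \<le> (- (s * h x)) * ((- sin ((x - c) / 2)) * ((-1) ^ N * P))"
          by (rule mult_nonneg_nonneg[OF p3 mult_nonneg_nonneg[OF p2 p1]])
        thus ?thesis by (simp add: P_def mult_ac)
      next
        case 3
        have "0 \<le> sin ((x - c) / 2)" using 3 x c Suc.prems by (intro sin_half_sign) auto
        moreover have "0 \<le> - (-s) * (-1) ^ N * (h x * P)" using elim(1) 3 x by (auto simp: P_def)
        ultimately have "0 \<le> sin ((x - c) / 2) * (- (-s) * (-1) ^ N * (h x * P))" by (rule mult_nonneg_nonneg)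
        thus ?thesis by (simp add: P_def mult_ac)
      qed simp
    qed
  qed
  thus ?case using xs(1,2) c by (intro exI[of _ "c # xs"]) auto
qed

text \<open>On the circle the number of sign changes is even, which saves one point.\<close>

lemma cyclic_sign_change_points:
  assumes "\<not> alternates h 1 (Suc (Suc N)) 0 (2 * pi)" "\<not> alternates h (-1) (Suc (Suc N)) 0 (2 * pi)"
  obtains xs \<epsilon> where "length xs = N" "set xs \<subseteq> {0..2 * pi}" "\<epsilon> = 1 \<or> \<epsilon> = -1"
    "AE x in lebesgue. x \<in> {0<..<2 * pi} \<longrightarrow> 0 \<le> \<epsilon> * (h x * (\<Prod>y\<leftarrow>xs. sin ((x - y) / 2)))"
proof -
  obtain c where c: "0 \<le> c" "c \<le> 2 * pi" "nonpos_on h 1 0 c" "\<not> alternates h (-1) (Suc N) c (2 * pi)"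
    by (rule first_sign_change[OF _ assms(1)]) auto
  \<comment> \<open>Either \<open>h\<close> vanishes almost everywhere before \<open>c\<close>, so
    that only the points beyond \<open>c\<close> matter; or beyond \<open>c\<close> alternations
    starting with a positive sign are excluded as well. In the second case the product already has
    the right sign before \<open>c\<close>, and \<open>c\<close> is not taken as a sign
    change.\<close>
  have "nonpos_on h (-1) 0 c \<or> \<not> alternates h 1 (Suc N) c (2 * pi)"
    using assms(2) c by (subst (asm) alternates.simps) auto
  thus ?thesis
  proof
    assume z: "nonpos_on h (-1) 0 c"
    obtain xs where xs: "length xs = N" "set xs \<subseteq> {c..2 * pi}"
      "AE x in lebesgue. x \<in> {c<..<2 * pi} \<longrightarrow> 0 \<le> - (-1) * (-1) ^ N * (h x * (\<Prod>y\<leftarrow>xs. sin ((x - y) / 2)))"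
      using sign_change_points[OF c(1,2) order_refl c(4)] by blast
    have "AE x in lebesgue. x \<noteq> c" by (rule AE_not_in[of "{c}", simplified]) simp
    hence "AE x in lebesgue. x \<in> {0<..<2 * pi} \<longrightarrow> 0 \<le> (-1) ^ N * (h x * (\<Prod>y\<leftarrow>xs. sin ((x - y) / 2)))"
      using xs(3) c(3)[unfolded nonpos_on_def] z[unfolded nonpos_on_def]
    proof eventually_elim
      case (elim x)
      show ?case using elim by (cases x c rule: linorder_cases) auto
    qed
    thus ?thesis
    proof (rule that[OF xs(1), of "(-1) ^ N", rotated 2])
      show "set xs \<subseteq> {0..2 * pi}" using xs(2) c(1) by auto
      show "(-1) ^ N = (1::real) \<or> (-1) ^ N = (-1::real)" by (cases "even N") auto
    qed
  next
    assume "\<not> alternates h 1 (Suc N) c (2 * pi)"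
    from sign_change_points[OF c(1,2) order_refl this] obtain xs where xs: "length xs = N" "set xs \<subseteq> {c..2 * pi}"
      "AE x in lebesgue. x \<in> {c<..<2 * pi} \<longrightarrow> 0 \<le> - 1 * (-1) ^ N * (h x * (\<Prod>y\<leftarrow>xs. sin ((x - y) / 2)))" by blast
    have "AE x in lebesgue. x \<noteq> c" by (rule AE_not_in[of "{c}", simplified]) simp
    hence "AE x in lebesgue. x \<in> {0<..<2 * pi} \<longrightarrow> 0 \<le> - 1 * (-1) ^ N * (h x * (\<Prod>y\<leftarrow>xs. sin ((x - y) / 2)))"
      using xs(3) c(3)[unfolded nonpos_on_def]
    proof eventually_elim
      case (elim x)
      show ?case
      proof
        assume x: "x \<in> {0<..<2 * pi}"
        show "0 \<le> - 1 * (-1) ^ N * (h x * (\<Prod>y\<leftarrow>xs. sin ((x - y) / 2)))"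
        proof (cases "x < c")
          case True
          have p1: "0 \<le> (-1) ^ N * (\<Prod>y\<leftarrow>xs. sin ((x - y) / 2))"
            using prod_sin_half_sign[of x xs c] xs(1,2) True x c by auto
          have "0 \<le> - h x" using elim(3) x True by auto
          hence "0 \<le> (- h x) * ((-1) ^ N * (\<Prod>y\<leftarrow>xs. sin ((x - y) / 2)))" using p1 by (rule mult_nonneg_nonneg)
          thus ?thesis by (simp add: mult_ac)
        next
          case False
          thus ?thesis using elim(1,2) x by auto
        qed
      qed
    qed
    thus ?thesis
    proof (rule that[OF xs(1), of "- 1 * (-1) ^ N", rotated 2])
      show "set xs \<subseteq> {0..2 * pi}" using xs(2) c(1) by auto
      show "- 1 * (-1) ^ N = (1::real) \<or> - 1 * (-1) ^ N = (-1::real)" by (cases "even N") auto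
    qed
  qed
qed

text \<open>One point is picked in each interval of the alternation. In the application
  \<open>good\<close> is accessibility along a radius.\<close>

lemma alternates_points:
  assumes good: "\<And>s l r. s = 1 \<or> s = -1 \<Longrightarrow> 0 \<le> l \<Longrightarrow> r \<le> 2 * pi \<Longrightarrow> \<not> nonpos_on h s l r \<Longrightarrow> \<exists>t\<in>{l<..<r}. good s t"
    and "alternates h s k l r" "s = 1 \<or> s = -1" "0 \<le> l" "r \<le> 2 * pi"
  shows "\<exists>\<theta>. (\<forall>i<k. l < \<theta> i \<and> \<theta> i < r \<and> good (s * (-1) ^ i) (\<theta> i)) \<and> (\<forall>i j. i < j \<longrightarrow> j < k \<longrightarrow> \<theta> i < \<theta> j)"
  using assms(2-)
proof (induction k arbitrary: s l)
  case (Suc k)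
  then obtain m where m: "m \<in> {l..r}" "\<not> nonpos_on h s l m" "alternates h (-s) k m r" by auto
  obtain t where t: "l < t" "t < m" "good s t" using good[of s l m] m Suc.prems by auto
  obtain \<theta> where th: "\<And>i. i < k \<Longrightarrow> m < \<theta> i \<and> \<theta> i < r \<and> good (-s * (-1) ^ i) (\<theta> i)" "\<And>i j. i < j \<Longrightarrow> j < k \<Longrightarrow> \<theta> i < \<theta> j"
    using Suc.IH[OF m(3)] Suc.prems m(1) by auto
  define \<theta>' where "\<theta>' = (\<lambda>i. case i of 0 \<Rightarrow> t | Suc i \<Rightarrow> \<theta> i)"
  have "l < \<theta>' i \<and> \<theta>' i < r \<and> good (s * (-1) ^ i) (\<theta>' i)" if "i < Suc k" for i
    using that t th(1)[of "i - 1"] m(1) by (cases i) (auto simp: \<theta>'_def)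
  moreover have "\<theta>' i < \<theta>' j" if "i < j" "j < Suc k" for i j
    using that th(2)[of "i - 1" "j - 1"] th(1)[of "j - 1"] t by (cases i; cases j) (auto simp: \<theta>'_def)
  ultimately show ?case by blast
qed simp

subsection \<open>Interlacing accessible boundary points\<close>

text \<open>The Cayley transform opens the circle at the point \<open>r\<close>; the remaining
  points go to the real axis, in the order of their angles by
  \<open>neg_cot_half_mono\<close>.\<close>

lemma cayley_cis:
  assumes "0 < t" "t < 2 * pi" "r > 0"
  shows "\<i> * (of_real r + of_real r * cis t) / (of_real r - of_real r * cis t) = of_real (- cos (t / 2) / sin (t / 2))"
proof -
  define e where "e = cis (t / 2)"
  have e2: "cis t = e * e" by (simp add: e_def cis_mult)
  have e1: "e * cnj e = 1" by (simp add: e_def cis_cnj cis_mult)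
  have s: "sin (t / 2) > 0" using assms by (intro sin_gt_zero) auto
  have e0: "e \<noteq> 0" by (simp add: e_def)
  have ce: "e + cnj e = of_real (2 * cos (t / 2))" "cnj e - e = - 2 * \<i> * of_real (sin (t / 2))"
    by (auto simp: e_def complex_eq_iff)
  have "\<i> * (of_real r + of_real r * cis t) / (of_real r - of_real r * cis t) = \<i> * (1 + cis t) / (1 - cis t)"
  proof -
    have "of_real r + of_real r * cis t = of_real r * (1 + cis t)" "of_real r - of_real r * cis t = of_real r * (1 - cis t)"
      by (simp_all add: algebra_simps)
    thus ?thesis using assms(3) by simp
  qed
  also have "1 + cis t = e * (e + cnj e)" by (simp add: e2 distrib_left e1 add.commute)
  also have "1 - cis t = e * (cnj e - e)" by (simp add: e2 right_diff_distrib e1)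
  also have "\<i> * (e * (e + cnj e)) / (e * (cnj e - e)) = \<i> * (e + cnj e) / (cnj e - e)" using e0 by simp
  also have "\<dots> = of_real (- cos (t / 2) / sin (t / 2))" unfolding ce using s by (simp add: field_simps)
  finally show ?thesis .
qed

lemma neg_cot_half_mono:
  assumes "0 < s" "s < t" "t < 2 * pi"
  shows "- cos (s / 2) / sin (s / 2) < - cos (t / 2) / sin (t / 2)"
proof -
  have p: "sin (s / 2) > 0" "sin (t / 2) > 0" "sin ((t - s) / 2) > 0"
    using assms by (auto intro!: sin_gt_zero)
  have "sin ((t - s) / 2) = sin (t / 2) * cos (s / 2) - cos (t / 2) * sin (s / 2)"
    by (simp add: diff_divide_distrib sin_diff)
  thus ?thesis using p by (simp add: field_simps)
qed

text \<open>The Cayley transform moves the paths into the closed upper half-plane. The four end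
  points then lie in interlaced order on the lower side of a box, where
  \<open>fashoda_interlace\<close> applies.\<close>

lemma disc_paths_interlace:
  fixes P Q :: "real \<Rightarrow> complex"
  assumes r: "r > 0" and t: "0 < t1" "t1 < t2" "t2 < t3" "t3 < t4" "t4 < 2 * pi"
    and P: "path P" "path_image P \<subseteq> ball 0 r \<union> {of_real r * cis t1, of_real r * cis t3}"
      "pathstart P = of_real r * cis t1" "pathfinish P = of_real r * cis t3"
    and Q: "path Q" "path_image Q \<subseteq> ball 0 r \<union> {of_real r * cis t2, of_real r * cis t4}"
      "pathstart Q = of_real r * cis t2" "pathfinish Q = of_real r * cis t4"
  shows "path_image P \<inter> path_image Q \<noteq> {}"
proof -
  define cay where "cay = (\<lambda>z. \<i> * (of_real r + z) / (of_real r - z))"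
  define V where "V = (\<lambda>z. (\<chi> i. if i = 1 then Re (cay z) else Im (cay z)) :: real ^ 2)"
  have V: "V z $ 1 = Re (cay z)" "V z $ 2 = Im (cay z)" for z by (simp_all add: V_def)
  define A where "A = path_image P \<union> path_image Q"
  have cis1: "cis x \<noteq> 1" if "0 < x" "x < 2 * pi" for x
  proof
    assume "cis x = 1"
    hence "cmod (1 - cis x) = 0" by simp
    moreover have "sin (x / 2) > 0" using that by (intro sin_gt_zero) auto
    ultimately show False by (simp add: cmod_one_minus_cis)
  qed
  have A: "z \<noteq> of_real r" "cmod z \<le> r" if "z \<in> A" for z
  proof -
    have "z \<in> ball 0 r \<or> (\<exists>x\<in>{t1,t2,t3,t4}. z = of_real r * cis x)" using that P(2) Q(2) unfolding A_def by blast
    thus "z \<noteq> of_real r" "cmod z \<le> r" using cis1 r t by (auto simp: norm_mult)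
  qed
  have cont: "continuous_on A cay" unfolding cay_def
    by (intro continuous_intros) (use A(1) in auto)
  have contV: "continuous_on A V" unfolding V_def
  proof (rule continuous_on_vec_lambda)
    fix i :: 2
    show "continuous_on A (\<lambda>z. if i = 1 then Re (cay z) else Im (cay z))"
      by (cases "i = 1") (auto intro!: continuous_intros cont)
  qed
  have Im0: "Im (cay z) \<ge> 0" if "z \<in> A" for z
  proof -
    have nz: "of_real r - z \<noteq> 0" using A(1)[OF that] by auto
    have "cay z = (\<i> * (of_real r + z) * cnj (of_real r - z)) / ((of_real r - z) * cnj (of_real r - z))"
      unfolding cay_def by (rule mult_divide_mult_cancel_right[symmetric]) (use nz in \<open>metis complex_cnj_zero_iff\<close>)
    hence "cay z = \<i> * ((of_real r + z) * cnj (of_real r - z)) / of_real ((cmod (of_real r - z))\<^sup>2)"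
      unfolding complex_norm_square by (simp only: mult.assoc)
    hence "Im (cay z) = Re ((of_real r + z) * cnj (of_real r - z)) / (cmod (of_real r - z))\<^sup>2"
      by (simp only: Im_divide_of_real Im_i_times)
    also have "Re ((of_real r + z) * cnj (of_real r - z)) = r\<^sup>2 - (cmod z)\<^sup>2"
      unfolding cmod_power2 by (simp add: power2_eq_square algebra_simps)
    also have "\<dots> \<ge> 0" using A(2)[OF that] r by (simp add: power_mono)
    hence "(r\<^sup>2 - (cmod z)\<^sup>2) / (cmod (of_real r - z))\<^sup>2 \<ge> 0" by simp
    finally show ?thesis .
  qed
  have "compact (cay ` A)" unfolding A_def
    by (rule compact_continuous_image[OF cont[unfolded A_def]]) (use P(1) Q(1) in \<open>auto intro: compact_Un compact_path_image\<close>)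
  then obtain M where M: "\<And>w. w \<in> cay ` A \<Longrightarrow> cmod w \<le> M" using compact_imp_bounded bounded_iff by metis
  define a b where "a = ((\<chi> i. if i = 1 then - M else 0) :: real ^ 2)" and "b = ((\<chi> i. M) :: real ^ 2)"
  have box: "V z \<in> cbox a b" if "z \<in> A" for z
    using M[of "cay z"] that Im0[OF that] abs_Re_le_cmod[of "cay z"] abs_Im_le_cmod[of "cay z"]
    by (auto simp: mem_box_cart forall_2 a_def b_def V)
  have real: "cay (of_real r * cis x) = of_real (- cos (x / 2) / sin (x / 2))" if "0 < x" "x < 2 * pi" for x
    unfolding cay_def by (rule cayley_cis[OF that r])
  have ends: "V (of_real r * cis x) $ 2 = a $ 2" "V (of_real r * cis x) $ 1 = - cos (x / 2) / sin (x / 2)"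
    if "0 < x" "x < 2 * pi" for x using real[OF that] by (simp_all add: V a_def)
  have m: "- cos (t1 / 2) / sin (t1 / 2) < - cos (t2 / 2) / sin (t2 / 2)"
    "- cos (t2 / 2) / sin (t2 / 2) < - cos (t3 / 2) / sin (t3 / 2)"
    "- cos (t3 / 2) / sin (t3 / 2) < - cos (t4 / 2) / sin (t4 / 2)"
    by (rule neg_cot_half_mono; use t in linarith)+
  have tt: "t1 < 2 * pi" "t2 < 2 * pi" "t3 < 2 * pi" "0 < t2" "0 < t3" "0 < t4" using t by auto
  obtain w where w: "w \<in> path_image (V \<circ> P)" "w \<in> path_image (V \<circ> Q)"
  proof (rule fashoda_interlace[of "V \<circ> P" "V \<circ> Q" a b])
    show "path (V \<circ> P)" by (rule path_continuous_image[OF P(1)]) (rule continuous_on_subset[OF contV], simp add: A_def)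
    show "path (V \<circ> Q)" by (rule path_continuous_image[OF Q(1)]) (rule continuous_on_subset[OF contV], simp add: A_def)
    show "path_image (V \<circ> P) \<subseteq> cbox a b" "path_image (V \<circ> Q) \<subseteq> cbox a b"
      using box by (auto simp: path_image_compose A_def)
  qed (simp_all only: pathstart_compose pathfinish_compose P(3,4) Q(3,4) ends t tt m)
  then obtain z1 z2 where z: "z1 \<in> path_image P" "z2 \<in> path_image Q" "V z1 = V z2"
    by (auto simp: path_image_compose)
  have "cay z1 = cay z2" using z(3) V by (metis complex_eq_iff)
  moreover have nz: "of_real r - z1 \<noteq> 0" "of_real r - z2 \<noteq> 0" using A(1)[of z1] A(1)[of z2] z by (auto simp: A_def)
  ultimately have "(of_real r + z1) * (of_real r - z2) = (of_real r + z2) * (of_real r - z1)"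
    unfolding cay_def by (simp add: frac_eq_eq)
  hence "2 * of_real r * (z1 - z2) = 0" by (simp add: algebra_simps)
  hence "z1 = z2" using r by simp
  thus ?thesis using z by auto
qed

section \<open>Accessible boundary points and the bound on sign changes\<close>

locale nodal_disc = nodal f "ball 0 r" u for f r u +
  assumes r_pos: "r > 0"
begin

text \<open>A constant sign on the end of a radius takes the place of a radial limit: it makes the
  boundary point the end of a path inside one nodal domain.\<close>

definition accessible :: "real \<Rightarrow> real \<Rightarrow> bool" where
  "accessible s t \<longleftrightarrow> (\<exists>\<rho>0. 0 < \<rho>0 \<and> \<rho>0 < 1 \<and> (\<forall>\<rho>. \<rho>0 \<le> \<rho> \<longrightarrow> \<rho> < 1 \<longrightarrow> 0 < s * u (of_real (r * \<rho>) * cis t)))"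

lemma component_sign:
  assumes "a \<in> X" "b \<in> connected_component_set X a" "0 < s * u a"
  shows "0 < s * u b"
proof (rule ccontr)
  assume "\<not> ?thesis"
  define \<Omega> where "\<Omega> = connected_component_set X a"
  have OX: "\<Omega> \<subseteq> X" unfolding \<Omega>_def by (rule connected_component_subset)
  have cont: "continuous_on \<Omega> (\<lambda>z. s * u z)"
    by (intro continuous_intros continuous_on_subset[OF cont_u]) (use OX in auto)
  have "connected ((\<lambda>z. s * u z) ` \<Omega>)"
    by (rule connected_continuous_image[OF cont]) (simp add: \<Omega>_def)
  moreover have "a \<in> \<Omega>" "b \<in> \<Omega>" using assms by (auto simp: \<Omega>_def connected_component_refl_eq)
  ultimately have "0 \<in> (\<lambda>z. s * u z) ` \<Omega>"
    using connectedD_interval[of "(\<lambda>z. s * u z) ` \<Omega>" "s * u b" "s * u a" 0] assms(3) \<open>\<not> _\<close> by auto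
  then obtain z where "z \<in> \<Omega>" "s * u z = 0" by auto
  thus False using OX assms(3) by auto
qed

text \<open>The end of the radius, followed by a path within the component of its inner end point;
  \<open>s * u\<close> is positive on both, apart from the boundary point.\<close>

lemma accessible_path:
  assumes "accessible s t"
  obtains a where "a \<in> X" "0 < s * u a" "\<And>b. b \<in> connected_component_set X a \<Longrightarrow>
     \<exists>P. path P \<and> pathstart P = of_real r * cis t \<and> pathfinish P = b \<and>
         path_image P \<subseteq> {of_real r * cis t} \<union> {z \<in> ball 0 r. 0 < s * u z}"
proof -
  obtain \<rho>0 where r0: "0 < \<rho>0" "\<rho>0 < 1" "\<And>\<rho>. \<rho>0 \<le> \<rho> \<Longrightarrow> \<rho> < 1 \<Longrightarrow> 0 < s * u (of_real (r * \<rho>) * cis t)"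
    using assms unfolding accessible_def by blast
  define a where "a = of_real (r * \<rho>0) * cis t"
  have inb: "of_real (r * \<rho>) * cis t \<in> ball 0 r" if "0 \<le> \<rho>" "\<rho> < 1" for \<rho>
    using that r_pos by (simp add: norm_mult)
  have pos: "0 < s * u a" using r0 by (simp add: a_def)
  have "a \<in> ball 0 r" unfolding a_def by (rule inb) (use r0 in auto)
  hence aX: "a \<in> X" using pos by auto
  show ?thesis
  proof (rule that[OF aX pos])
    fix b assume b: "b \<in> connected_component_set X a"
    hence "connected_component X a b" by simp
    hence "path_component X a b" unfolding open_path_connected_component[OF open_X] .
    then obtain g where g: "path g" "path_image g \<subseteq> X" "pathstart g = a" "pathfinish g = b"
      unfolding path_component_def by blast
    have gc: "path_image g \<subseteq> connected_component_set X a"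
      by (rule connected_component_maximal) (use g pathstart_in_path_image[of g] connected_path_image[of g] in auto)
    define P where "P = linepath (of_real r * cis t) a +++ g"
    have seg: "path_image (linepath (of_real r * cis t) a) \<subseteq> {of_real r * cis t} \<union> {z \<in> ball 0 r. 0 < s * u z}"
    proof
      fix z assume "z \<in> path_image (linepath (of_real r * cis t) a)"
      then obtain x where x: "0 \<le> x" "x \<le> 1" "z = (1 - x) *\<^sub>R (of_real r * cis t) + x *\<^sub>R a"
        by (auto simp: in_segment)
      define \<rho> where "\<rho> = (1 - x) + x * \<rho>0"
      have z: "z = of_real (r * \<rho>) * cis t"
        by (simp add: x(3) a_def \<rho>_def scaleR_conv_of_real algebra_simps)
      have rx: "\<rho> = 1 - x * (1 - \<rho>0)" by (simp add: \<rho>_def algebra_simps)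
      have "x * (1 - \<rho>0) \<le> 1 * (1 - \<rho>0)" using x r0 by (intro mult_right_mono) auto
      hence "1 - 1 * (1 - \<rho>0) \<le> \<rho>" unfolding rx by (rule diff_left_mono)
      hence rr1: "\<rho>0 \<le> \<rho>" by simp
      have rr2: "\<rho> < 1" if "x > 0" unfolding rx using that r0 by simp
      note rr = rr1 rr2
      show "z \<in> {of_real r * cis t} \<union> {z \<in> ball 0 r. 0 < s * u z}"
      proof (cases "x = 0")
        case True
        thus ?thesis using x(3) by simp
      next
        case False
        thus ?thesis using rr r0 inb[of \<rho>] x(1) by (auto simp: z)
      qed
    qed
    have "path P" "pathstart P = of_real r * cis t" "pathfinish P = b" using g by (auto simp: P_def)
    moreover have "path_image P \<subseteq> {of_real r * cis t} \<union> {z \<in> ball 0 r. 0 < s * u z}"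
      using seg gc component_sign[OF aX _ pos] g(2) unfolding P_def
      by (subst path_image_join) (use g(3) in auto)
    ultimately show "\<exists>P. path P \<and> pathstart P = of_real r * cis t \<and> pathfinish P = b \<and>
         path_image P \<subseteq> {of_real r * cis t} \<union> {z \<in> ball 0 r. 0 < s * u z}" by blast
  qed
qed

text \<open>Two of \<open>2n + 2\<close> accessible points of alternating sign lie in the same one of the at most \<open>2n\<close>
  nodal domains. A path joining them separates two points of the opposite sign, although
  the nodal domains of those have \<open>p\<close> in their closure.\<close>

theorem no_alternation:
  assumes only: "only_nodal_curves_through u (ball 0 r) n p" and p: "p \<in> Z"
    and ch: "power_chart f p n \<phi> \<psi> N d" and ND: "N \<subseteq> ball 0 r"
    and s: "s = 1 \<or> s = -1"
    and acc: "\<And>i. i < 2 * n + 2 \<Longrightarrow> 0 < \<theta> i \<and> \<theta> i < 2 * pi \<and> accessible (s * (-1) ^ i) (\<theta> i)"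
    and mono: "\<And>i j. i < j \<Longrightarrow> j < 2 * n + 2 \<Longrightarrow> \<theta> i < \<theta> j"
  shows False
proof -
  define \<sigma> where "\<sigma> = (\<lambda>i::nat. s * (-1) ^ i)"
  define e where "e = (\<lambda>i. of_real r * cis (\<theta> i))"
  define good where "good = (\<lambda>i a. a \<in> X \<and> 0 < \<sigma> i * u a \<and> (\<forall>b\<in>connected_component_set X a.
     \<exists>P. path P \<and> pathstart P = e i \<and> pathfinish P = b \<and>
         path_image P \<subseteq> {e i} \<union> {z \<in> ball 0 r. 0 < \<sigma> i * u z}))"
  have "\<exists>a. i < 2 * n + 2 \<longrightarrow> good i a" for i
  proof (cases "i < 2 * n + 2")
    case True
    hence "accessible (\<sigma> i) (\<theta> i)" using acc unfolding \<sigma>_def by blast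
    then obtain a where "a \<in> X" "0 < \<sigma> i * u a" "\<And>b. b \<in> connected_component_set X a \<Longrightarrow>
     \<exists>P. path P \<and> pathstart P = of_real r * cis (\<theta> i) \<and> pathfinish P = b \<and>
         path_image P \<subseteq> {of_real r * cis (\<theta> i)} \<union> {z \<in> ball 0 r. 0 < \<sigma> i * u z}"
      by (rule accessible_path) blast
    hence "good i a" unfolding good_def e_def by blast
    thus ?thesis by blast
  qed blast
  then obtain a where ga: "\<And>i. i < 2 * n + 2 \<Longrightarrow> good i (a i)" by metis
  have a: "a i \<in> X" "0 < \<sigma> i * u (a i)" if "i < 2 * n + 2" for i using ga[OF that] unfolding good_def by blast+
  have aP: "\<exists>P. path P \<and> pathstart P = e i \<and> pathfinish P = b \<and>
         path_image P \<subseteq> {e i} \<union> {z \<in> ball 0 r. 0 < \<sigma> i * u z}"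
    if "i < 2 * n + 2" "b \<in> connected_component_set X (a i)" for i b
    using ga[OF that(1)] that(2) unfolding good_def by blast
  have "\<exists>j. i < 2 * n + 2 \<longrightarrow> j < 2 * n \<and> \<psi> ` sector n d j \<subseteq> connected_component_set X (a i)" for i
  proof (cases "i < 2 * n + 2")
    case True
    obtain j where "j < 2 * n" "\<psi> ` sector n d j \<subseteq> connected_component_set X (a i)"
      by (rule component_contains_sector[OF only p a(1)[OF True] ch ND]) blast
    thus ?thesis by blast
  qed blast
  then obtain j where j: "\<And>i. i < 2 * n + 2 \<Longrightarrow> j i < 2 * n"
    "\<And>i. i < 2 * n + 2 \<Longrightarrow> \<psi> ` sector n d (j i) \<subseteq> connected_component_set X (a i)"
    by metis
  have "\<not> inj_on j {..<2 * n + 2}"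
  proof
    assume "inj_on j {..<2 * n + 2}"
    hence "card {..<2 * n + 2} \<le> card {..<2 * n}"
      by (rule card_inj_on_le) (use j(1) in auto)
    thus False by simp
  qed
  then obtain i i' where ii: "i < i'" "i' < 2 * n + 2" "j i = j i'"
    unfolding inj_on_def by (metis lessThan_iff linorder_neqE_nat)
  have iN: "i < 2 * n + 2" using ii by simp
  have n0: "n > 0" using power_chartD(1)[OF ch] by simp
  have "sector n d (j i) \<noteq> {}"
  proof -
    have "(real (j i) - 1/2) * pi / n < (real (j i) + 1/2) * pi / n"
      using n0 by (intro divide_strict_right_mono mult_strict_right_mono) auto
    thus ?thesis using power_chartD(2)[OF ch] by (simp add: sector_def)
  qed
  then obtain w where w: "w \<in> \<psi> ` sector n d (j i)" by blast
  have "w \<in> connected_component_set X (a i)" "w \<in> connected_component_set X (a i')"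
    using w j(2)[OF iN] j(2)[OF ii(2)] ii(3) by auto
  hence comp: "a i' \<in> connected_component_set X (a i)"
    by (metis connected_component_eq connected_component_refl_eq mem_Collect_eq a(1)[OF ii(2)])
  \<comment> \<open>Points of the same component have the same sign, so \<open>i\<close> and
    \<open>i'\<close> have the same parity and \<open>Suc i\<close> lies strictly between
    them.\<close>
  have "0 < \<sigma> i * u (a i')" by (rule component_sign[OF a(1)[OF iN] comp a(2)[OF iN]])
  hence sig: "\<sigma> i' = \<sigma> i" using a(2)[OF ii(2)] s
    by (cases "even i"; cases "even i'") (auto simp: \<sigma>_def)
  hence par: "even i \<longleftrightarrow> even i'" using s by (cases "even i"; cases "even i'") (auto simp: \<sigma>_def)
  have "i' \<noteq> Suc i" using par by auto
  hence l: "i < Suc i" "Suc i < i'" using ii by auto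
  define l where "l = Suc i"
  \<comment> \<open>A point of the opposite sign outside the range from \<open>i\<close> to
    \<open>i'\<close>: the index before \<open>i\<close>, or for \<open>i = 0\<close> the one after
    \<open>i'\<close>. The latter exists because \<open>i'\<close> is then even and the number of
    points is even.\<close>
  obtain l' where l': "l' < 2 * n + 2" "i' < l' \<or> l' < i" "even l' \<longleftrightarrow> odd i"
  proof (cases "i = 0")
    case True
    hence "Suc i' < 2 * n + 2" using par ii(2) by presburger
    thus ?thesis using that[of "Suc i'"] par by auto
  next
    case False
    thus ?thesis using that[of "i - 1"] iN by (auto simp: even_diff_nat)
  qed
  have sl: "\<sigma> l = - \<sigma> i" "\<sigma> l' = - \<sigma> i" using l'(3) by (auto simp: \<sigma>_def l_def)
  have lN: "l < 2 * n + 2" using l ii by (simp add: l_def)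
  define S where "S = {z \<in> ball 0 r. 0 < \<sigma> i * u z}"
  define S' where "S' = {z \<in> ball 0 r. 0 < - \<sigma> i * u z}"
  obtain P1 P2 where P12: "path P1" "pathstart P1 = e i" "pathfinish P1 = a i'" "path_image P1 \<subseteq> {e i} \<union> S"
     "path P2" "pathstart P2 = e i'" "pathfinish P2 = a i'" "path_image P2 \<subseteq> {e i'} \<union> S"
    using aP[OF iN comp] aP[OF ii(2), of "a i'"] a(1)[OF ii(2)] unfolding sig S_def
    by (auto simp: connected_component_refl_eq)
  define P where "P = P1 +++ reversepath P2"
  have P: "path P" "pathstart P = e i" "pathfinish P = e i'" "path_image P \<subseteq> {e i, e i'} \<union> S"
    using P12 by (auto simp: P_def path_image_join)
  have ne: "cmod (e k) = r" for k using r_pos by (simp add: e_def norm_mult)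
  have pb: "p \<in> ball 0 r" "u p = 0" using p by (auto simp: nodal_set_def)
  have "p \<notin> path_image P" using P(4) pb ne[of i] ne[of i'] by (auto simp: S_def)
  hence "open (ball 0 r - path_image P)" "p \<in> ball 0 r - path_image P"
    using P(1) pb by (auto intro!: open_Diff closed_path_image)
  \<comment> \<open>The path \<open>Q\<close> will run through points of the sign opposite to
    \<open>P\<close>, except for one segment close to \<open>p\<close>. A ball about
    \<open>p\<close> that avoids \<open>P\<close> makes this segment harmless.\<close>
  then obtain \<epsilon> where ep: "\<epsilon> > 0" "ball p \<epsilon> \<subseteq> ball 0 r - path_image P" using openE by blast
  have meets: "\<exists>b\<in>ball p \<epsilon>. b \<in> connected_component_set X (a k)" if "k < 2 * n + 2" for k
    using closure_component[OF only p a(1)[OF that]] ep(1) unfolding closure_approachable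
    by (metis dist_commute mem_ball)
  obtain b b' where b: "b \<in> ball p \<epsilon>" "b \<in> connected_component_set X (a l)" "b' \<in> ball p \<epsilon>" "b' \<in> connected_component_set X (a l')"
    using meets[OF lN] meets[OF l'(1)] by blast
  obtain Q1 Q2 where Q12: "path Q1" "pathstart Q1 = e l" "pathfinish Q1 = b" "path_image Q1 \<subseteq> {e l} \<union> S'"
     "path Q2" "pathstart Q2 = e l'" "pathfinish Q2 = b'" "path_image Q2 \<subseteq> {e l'} \<union> S'"
    using aP[OF lN b(2)] aP[OF l'(1) b(4)] unfolding sl S'_def by blast
  define Q where "Q = Q1 +++ linepath b b' +++ reversepath Q2"
  have seg: "path_image (linepath b b') \<subseteq> ball p \<epsilon>" using b(1,3) by (simp add: closed_segment_subset)
  have Q: "path Q" "pathstart Q = e l" "pathfinish Q = e l'" "path_image Q \<subseteq> {e l, e l'} \<union> S' \<union> ball p \<epsilon>"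
    using Q12 seg by (auto simp: Q_def path_image_join)
  have inj: "e k \<noteq> e k'" if "k < k'" "k' < 2 * n + 2" for k k'
  proof
    assume "e k = e k'"
    hence "of_real (- cos (\<theta> k / 2) / sin (\<theta> k / 2)) = (of_real (- cos (\<theta> k' / 2) / sin (\<theta> k' / 2)) :: complex)"
      using cayley_cis[OF _ _ r_pos, of "\<theta> k"] cayley_cis[OF _ _ r_pos, of "\<theta> k'"] acc[of k] acc[of k'] that
      unfolding e_def by auto
    hence "- cos (\<theta> k / 2) / sin (\<theta> k / 2) = - cos (\<theta> k' / 2) / sin (\<theta> k' / 2)" by (simp only: of_real_eq_iff)
    thus False using neg_cot_half_mono[of "\<theta> k" "\<theta> k'"] mono[OF that] acc[of k] acc[of k'] that by auto
  qed
  have disj: "path_image P \<inter> path_image Q = {}"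
  proof (rule ccontr)
    assume "path_image P \<inter> path_image Q \<noteq> {}"
    then obtain z where z: "z \<in> path_image P" "z \<in> path_image Q" by blast
    have "z \<notin> ball p \<epsilon>" using ep(2) z(1) by blast
    hence z2: "z \<in> {e l, e l'} \<union> S'" using z(2) Q(4) by blast
    have z1: "z \<in> {e i, e i'} \<union> S" using z(1) P(4) by blast
    have eS: "e k \<notin> S" "e k \<notin> S'" for k using ne[of k] by (auto simp: S_def S'_def)
    have "S \<inter> S' = {}" by (auto simp: S_def S'_def)
    hence "\<exists>k\<in>{i,i'}. \<exists>k'\<in>{l,l'}. e k = e k'" using z1 z2 eS by auto
    moreover have "e i \<noteq> e l" "e i' \<noteq> e l" using inj[of i l] inj[of l i'] l ii(2) lN by (auto simp: l_def)
    moreover have "e i \<noteq> e l'" using inj[of i l'] inj[of l' i] l' ii iN by fastforce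
    moreover have "e i' \<noteq> e l'" using inj[of i' l'] inj[of l' i'] l' ii iN by fastforce
    ultimately show False by auto
  qed
  have bQ: "path_image Q \<subseteq> ball 0 r \<union> {e l, e l'}" and bP: "path_image P \<subseteq> ball 0 r \<union> {e i, e i'}"
    using Q(4) P(4) ep(2) by (auto simp: S_def S'_def)
  from l'(2) show False
  proof
    assume "i' < l'"
    have "path_image P \<inter> path_image Q \<noteq> {}"
      by (rule disc_paths_interlace[OF r_pos, of "\<theta> i" "\<theta> l" "\<theta> i'" "\<theta> l'"])
         (use mono l l'(1) \<open>i' < l'\<close> acc[of i] acc[of l'] iN ii P Q bP bQ in \<open>auto simp: e_def l_def\<close>)
    thus False using disj by blast
  next
    assume "l' < i"
    have "path_image (reversepath Q) \<inter> path_image P \<noteq> {}"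
      by (rule disc_paths_interlace[OF r_pos, of "\<theta> l'" "\<theta> i" "\<theta> l" "\<theta> i'"])
         (use mono l l'(1) \<open>l' < i\<close> acc[of l'] acc[of i'] iN ii P Q bP bQ in \<open>auto simp: e_def l_def\<close>)
    thus False using disj by auto
  qed
qed

end

subsection \<open>Moments of the boundary density\<close>

text \<open>Only the top, the constant and the linear coefficient will meet moments that need not
  vanish.\<close>

lemma coeff_prod_linear:
  fixes as :: "complex list"
  assumes "\<And>a. a \<in> set as \<Longrightarrow> a \<noteq> 0"
  defines "q \<equiv> (\<Prod>a\<leftarrow>as. [:-a, 1:])"
  shows "degree q = length as" "coeff q (length as) = 1" "coeff q 0 = (\<Prod>a\<leftarrow>as. -a)"
    "coeff q 1 = - (\<Prod>a\<leftarrow>as. -a) * (\<Sum>a\<leftarrow>as. 1 / a)" "poly q x = (\<Prod>a\<leftarrow>as. x - a)"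
proof -
  have "degree (\<Prod>a\<leftarrow>as. [:-a, 1:]) = length as \<and> coeff (\<Prod>a\<leftarrow>as. [:-a, 1:]) (length as) = 1 \<and>
     coeff (\<Prod>a\<leftarrow>as. [:-a, 1:]) 0 = (\<Prod>a\<leftarrow>as. -a) \<and>
     coeff (\<Prod>a\<leftarrow>as. [:-a, 1:]) 1 = - (\<Prod>a\<leftarrow>as. -a) * (\<Sum>a\<leftarrow>as. 1 / a) \<and>
     poly (\<Prod>a\<leftarrow>as. [:-a, 1:]) x = (\<Prod>a\<leftarrow>as. x - a)"
    using assms(1)
  proof (induction as)
    case (Cons b as)
    define Q where "Q = (\<Prod>a\<leftarrow>as. [:-a, 1:])"
    have IH: "degree Q = length as" "coeff Q (length as) = 1" "coeff Q 0 = (\<Prod>a\<leftarrow>as. -a)"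
      "coeff Q 1 = - (\<Prod>a\<leftarrow>as. -a) * (\<Sum>a\<leftarrow>as. 1 / a)" "poly Q x = (\<Prod>a\<leftarrow>as. x - a)"
      using Cons unfolding Q_def by auto
    have b: "b \<noteq> 0" using Cons.prems by simp
    have Q0: "Q \<noteq> 0" using IH(2) by auto
    have "degree ([:-b, 1:] * Q) = 1 + length as" using Q0 IH(1) by (subst degree_mult_eq) auto
    moreover have "coeff ([:-b, 1:] * Q) (Suc (length as)) = 1"
      using IH(1,2) by (simp add: coeff_eq_0)
    moreover have "coeff ([:-b, 1:] * Q) 0 = -b * (\<Prod>a\<leftarrow>as. -a)" using IH(3) by simp
    moreover have "coeff ([:-b, 1:] * Q) 1 = - (-b * (\<Prod>a\<leftarrow>as. -a)) * (1 / b + (\<Sum>a\<leftarrow>as. 1 / a))"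
      using IH(3,4) b by (simp add: algebra_simps)
    moreover have "poly ([:-b, 1:] * Q) x = (x - b) * (\<Prod>a\<leftarrow>as. x - a)" using IH(5) by (simp add: algebra_simps)
    ultimately show ?case unfolding Q_def by simp
  qed simp
  thus "degree q = length as" "coeff q (length as) = 1" "coeff q 0 = (\<Prod>a\<leftarrow>as. -a)"
    "coeff q 1 = - (\<Prod>a\<leftarrow>as. -a) * (\<Sum>a\<leftarrow>as. 1 / a)" "poly q x = (\<Prod>a\<leftarrow>as. x - a)"
    unfolding q_def by blast+
qed

text \<open>\<open>k * T\<close> has constant sign, so multiplying it by the unimodular
  \<open>cnj \<omega>\<close> cannot increase the modulus of its integral. As
  \<open>\<kappa> * T\<close> is a trigonometric polynomial of degree \<open>n\<close> in
  \<open>\<omega>\<close>, both integrals expand into moments, and those of order below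
  \<open>n\<close> drop out.\<close>

lemma moment_inequality:
  fixes k T :: "'a \<Rightarrow> real" and \<omega> :: "'a \<Rightarrow> complex"
  assumes k: "integrable M k" and \<omega>m: "\<omega> \<in> borel_measurable M" and \<omega>1: "\<And>x. cmod (\<omega> x) = 1"
    and as: "\<And>a. a \<in> set as \<Longrightarrow> cmod a = 1" "length as = 2 * n" and n: "n \<ge> 1"
    and fact: "\<And>x. (\<Prod>a\<leftarrow>as. \<omega> x - a) * cnj (\<omega> x) ^ n = \<kappa> * of_real (T x)" and \<kappa>: "\<kappa> \<noteq> 0"
    and sgn: "\<epsilon> = 1 \<or> \<epsilon> = -1" "AE x in M. 0 \<le> \<epsilon> * (k x * T x)"
    and mom: "\<And>j. j < n \<Longrightarrow> (\<integral>x. of_real (k x) * cnj (\<omega> x) ^ j \<partial>M) = 0"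
  defines "\<mu> \<equiv> \<lambda>j. \<integral>x. of_real (k x) * cnj (\<omega> x) ^ j \<partial>M"
  shows "cmod (\<mu> (Suc n) - (\<Sum>a\<leftarrow>as. cnj a) * \<mu> n) \<le> cmod (cnj (\<mu> n) + prod_list as * \<mu> n)"
proof -
  define q where "q = (\<Prod>a\<leftarrow>as. [:-a, 1:])"
  have a0: "a \<noteq> 0" if "a \<in> set as" for a using as(1)[OF that] by auto
  note Q = coeff_prod_linear[where as = as, OF a0, folded q_def]
  have \<omega>0: "\<omega> x * cnj (\<omega> x) = 1" for x using \<omega>1[of x] complex_norm_square[of "\<omega> x"] by simp
  have inv_a: "1 / a = cnj a" if "a \<in> set as" for a
    using as(1)[OF that] complex_norm_square[of a] a0[OF that] by (simp add: field_simps)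
  define P where "P = prod_list as"
  have P: "(\<Prod>a\<leftarrow>as. -a) = P"
  proof -
    have "(\<Prod>a\<leftarrow>bs. -a) = (-1) ^ length bs * prod_list bs" for bs :: "complex list" by (induction bs) auto
    thus ?thesis using as(2) by (simp add: P_def)
  qed
  have P1: "cmod P = 1"
  proof -
    have "cmod (prod_list bs) = 1" if "\<And>a. a \<in> set bs \<Longrightarrow> cmod a = 1" for bs :: "complex list"
      using that by (induction bs) (auto simp: norm_mult)
    thus ?thesis using as(1) by (simp add: P_def)
  qed
  define S where "S = (\<Sum>a\<leftarrow>as. cnj a)"
  have S: "(\<Sum>a\<leftarrow>as. 1 / a) = S" unfolding S_def using inv_a by (metis (mono_tags, lifting) map_eq_conv)
  have int: "integrable M (\<lambda>x. of_real (k x) * (\<omega> x ^ i * cnj (\<omega> x) ^ j))" for i j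
  proof (rule Bochner_Integration.integrable_bound[OF k])
    show "(\<lambda>x. of_real (k x) * (\<omega> x ^ i * cnj (\<omega> x) ^ j)) \<in> borel_measurable M"
    proof -
      have [measurable]: "(\<lambda>x. cnj (\<omega> x)) \<in> borel_measurable M"
        using measurable_compose[OF \<omega>m borel_measurable_continuous_onI[of cnj]] by (simp add: continuous_on_cnj)
      have [measurable]: "k \<in> borel_measurable M" "\<omega> \<in> borel_measurable M" using k \<omega>m by auto
      show ?thesis by measurable
    qed
    show "AE x in M. norm (of_real (k x) * (\<omega> x ^ i * cnj (\<omega> x) ^ j)) \<le> norm (k x)"
      using \<omega>1 by (simp add: norm_mult norm_power)
  qed
  \<comment> \<open>Since \<open>\<omega>\<close> is unimodular, products of powers reduce to one
    moment; negative orders give conjugates because \<open>k\<close> is real.\<close>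
  have red: "(\<integral>x. of_real (k x) * (\<omega> x ^ i * cnj (\<omega> x) ^ j) \<partial>M) = (if i \<le> j then \<mu> (j - i) else cnj (\<mu> (i - j)))" for i j
  proof (cases "i \<le> j")
    case True
    have "\<omega> x ^ i * cnj (\<omega> x) ^ j = cnj (\<omega> x) ^ (j - i)" for x
    proof -
      have "cnj (\<omega> x) ^ j = cnj (\<omega> x) ^ i * cnj (\<omega> x) ^ (j - i)" using True by (simp flip: power_add)
      moreover have "\<omega> x ^ i * cnj (\<omega> x) ^ i = 1" by (simp only: \<omega>0 power_one flip: power_mult_distrib)
      ultimately show ?thesis by (metis mult.assoc mult_1)
    qed
    thus ?thesis using True by (simp add: \<mu>_def)
  next
    case False
    have e: "\<omega> x ^ i * cnj (\<omega> x) ^ j = cnj (cnj (\<omega> x) ^ (i - j))" for x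
    proof -
      have "\<omega> x ^ i = \<omega> x ^ (i - j) * \<omega> x ^ j" using False by (simp flip: power_add)
      moreover have "\<omega> x ^ j * cnj (\<omega> x) ^ j = 1" by (simp only: \<omega>0 power_one flip: power_mult_distrib)
      ultimately show ?thesis by (simp add: mult.assoc)
    qed
    have "(\<integral>x. of_real (k x) * (\<omega> x ^ i * cnj (\<omega> x) ^ j) \<partial>M) = (\<integral>x. cnj (of_real (k x) * cnj (\<omega> x) ^ (i - j)) \<partial>M)"
      unfolding e by simp
    also have "\<dots> = cnj (\<mu> (i - j))" unfolding \<mu>_def
      by (rule integral_bounded_linear[OF bounded_linear_cnj]) (use int[of 0 "i - j"] in simp)
    finally show ?thesis using False by simp
  qed
  have m0: "\<mu> j = 0" if "j < n" for j using mom[OF that] by (simp add: \<mu>_def)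
  have expand: "(\<integral>x. of_real (k x) * (\<kappa> * of_real (T x) * cnj (\<omega> x) ^ j) \<partial>M)
      = (\<Sum>i\<le>2 * n. coeff q i * (if i \<le> n + j then \<mu> (n + j - i) else cnj (\<mu> (i - (n + j)))))" for j
  proof -
    have "(\<integral>x. of_real (k x) * (\<kappa> * of_real (T x) * cnj (\<omega> x) ^ j) \<partial>M)
       = (\<integral>x. (\<Sum>i\<le>2 * n. coeff q i * (of_real (k x) * (\<omega> x ^ i * cnj (\<omega> x) ^ (n + j)))) \<partial>M)"
    proof (rule Bochner_Integration.integral_cong[OF refl])
      fix x
      have "\<kappa> * of_real (T x) = poly q (\<omega> x) * cnj (\<omega> x) ^ n" using fact[of x] Q(5) by simp
      also have "poly q (\<omega> x) = (\<Sum>i\<le>2 * n. coeff q i * \<omega> x ^ i)" using Q(1) as(2) by (simp add: poly_altdef)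
      finally show "of_real (k x) * (\<kappa> * of_real (T x) * cnj (\<omega> x) ^ j)
          = (\<Sum>i\<le>2 * n. coeff q i * (of_real (k x) * (\<omega> x ^ i * cnj (\<omega> x) ^ (n + j))))"
        by (simp add: sum_distrib_left sum_distrib_right power_add mult_ac)
    qed
    also have "\<dots> = (\<Sum>i\<le>2 * n. coeff q i * (\<integral>x. of_real (k x) * (\<omega> x ^ i * cnj (\<omega> x) ^ (n + j)) \<partial>M))"
      using int by (simp add: Bochner_Integration.integral_sum)
    finally show ?thesis by (simp only: red)
  qed
  \<comment> \<open>The orders \<open>n - i\<close> run from \<open>n\<close> to \<open>-n\<close>,
    and only these two extremes survive.\<close>
  have A: "(\<integral>x. of_real (k x) * (\<kappa> * of_real (T x) * cnj (\<omega> x) ^ 0) \<partial>M) = P * \<mu> n + cnj (\<mu> n)"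
  proof -
    have "(\<Sum>i\<le>2 * n. coeff q i * (if i \<le> n + 0 then \<mu> (n + 0 - i) else cnj (\<mu> (i - (n + 0)))))
       = (\<Sum>i\<in>{0, 2 * n}. coeff q i * (if i \<le> n + 0 then \<mu> (n + 0 - i) else cnj (\<mu> (i - (n + 0)))))"
    proof (rule sum.mono_neutral_right)
      show "\<forall>i\<in>{..2 * n} - {0, 2 * n}. coeff q i * (if i \<le> n + 0 then \<mu> (n + 0 - i) else cnj (\<mu> (i - (n + 0)))) = 0"
        using m0 n by auto
    qed auto
    thus ?thesis unfolding expand using n Q(2,3) as(2) P by (simp add: mult_2)
  qed
  \<comment> \<open>The orders \<open>n + 1 - i\<close> run from \<open>n + 1\<close> to
    \<open>1 - n\<close>, and only \<open>n + 1\<close> and \<open>n\<close> survive.\<close>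
  have B: "(\<integral>x. of_real (k x) * (\<kappa> * of_real (T x) * cnj (\<omega> x) ^ 1) \<partial>M) = P * \<mu> (Suc n) - P * S * \<mu> n"
  proof -
    have "(\<Sum>i\<le>2 * n. coeff q i * (if i \<le> n + 1 then \<mu> (n + 1 - i) else cnj (\<mu> (i - (n + 1)))))
       = (\<Sum>i\<in>{0, 1}. coeff q i * (if i \<le> n + 1 then \<mu> (n + 1 - i) else cnj (\<mu> (i - (n + 1)))))"
    proof (rule sum.mono_neutral_right)
      show "\<forall>i\<in>{..2 * n} - {0, 1}. coeff q i * (if i \<le> n + 1 then \<mu> (n + 1 - i) else cnj (\<mu> (i - (n + 1)))) = 0"
        using m0 n by (auto simp: Suc_le_eq)
    qed (use n in auto)
    thus ?thesis unfolding expand using Q(3,4) P S by (simp add: algebra_simps)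
  qed
  have intT: "integrable M (\<lambda>x. k x * T x)"
  proof -
    have i1: "integrable M (\<lambda>x. of_real (k x) * (poly q (\<omega> x) * cnj (\<omega> x) ^ n))"
    proof -
      have "(\<lambda>x. of_real (k x) * (poly q (\<omega> x) * cnj (\<omega> x) ^ n)) = (\<lambda>x. (\<Sum>i\<le>degree q. coeff q i * (of_real (k x) * (\<omega> x ^ i * cnj (\<omega> x) ^ n))))"
        by (simp add: poly_altdef sum_distrib_left sum_distrib_right mult_ac)
      thus ?thesis using int by simp
    qed
    have "(\<lambda>x. of_real (k x) * (poly q (\<omega> x) * cnj (\<omega> x) ^ n) * (1 / \<kappa>)) = (\<lambda>x. of_real (k x * T x))"
      using fact Q(5) \<kappa> by (auto simp: field_simps)
    hence "integrable M (\<lambda>x. complex_of_real (k x * T x))" using integrable_mult_left[OF i1, of "1 / \<kappa>"] by metis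
    from integrable_Re[OF this] show ?thesis by simp
  qed
  define X where "X = (\<integral>x. of_real (k x * T x) * cnj (\<omega> x) \<partial>M)"
  define Y where "Y = (\<integral>x. k x * T x \<partial>M)"
  have XY: "cmod X \<le> \<bar>Y\<bar>"
  proof -
    have "cmod X \<le> (\<integral>x. cmod (of_real (k x * T x) * cnj (\<omega> x)) \<partial>M)" unfolding X_def by (rule integral_norm_bound)
    also have "\<dots> = (\<integral>x. \<bar>k x * T x\<bar> \<partial>M)" using \<omega>1 by (simp add: norm_mult abs_mult)
    also have "\<dots> = (\<integral>x. \<epsilon> * (k x * T x) \<partial>M)"
    proof (rule integral_cong_AE)
      show "AE x in M. \<bar>k x * T x\<bar> = \<epsilon> * (k x * T x)"
        using sgn(2) by eventually_elim (use sgn(1) in auto)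
    qed (use intT in auto)
    also have "\<dots> = \<epsilon> * Y" by (simp add: Y_def)
    also have "\<dots> \<le> \<bar>Y\<bar>" using sgn(1) by auto
    finally show ?thesis .
  qed
  have "P * \<mu> n + cnj (\<mu> n) = (\<integral>x. \<kappa> * of_real (k x * T x) \<partial>M)"
    unfolding A[symmetric] by (rule Bochner_Integration.integral_cong) (auto simp: mult_ac)
  also have "\<dots> = \<kappa> * (\<integral>x. of_real (k x * T x) \<partial>M)" by (rule integral_mult_right_zero)
  also have "(\<integral>x. of_real (k x * T x) \<partial>M) = complex_of_real Y" unfolding Y_def by (rule integral_complex_of_real)
  finally have "P * \<mu> n + cnj (\<mu> n) = \<kappa> * of_real Y" .
  hence A': "cmod (P * \<mu> n + cnj (\<mu> n)) = cmod \<kappa> * \<bar>Y\<bar>" by (simp add: norm_mult)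
  have "P * \<mu> (Suc n) - P * S * \<mu> n = (\<integral>x. \<kappa> * (of_real (k x * T x) * cnj (\<omega> x)) \<partial>M)"
    unfolding B[symmetric] by (rule Bochner_Integration.integral_cong) (auto simp: mult_ac)
  also have "\<dots> = \<kappa> * X" unfolding X_def by (rule integral_mult_right_zero)
  finally have "P * \<mu> (Suc n) - P * S * \<mu> n = \<kappa> * X" .
  hence "cmod (P * (\<mu> (Suc n) - S * \<mu> n)) = cmod \<kappa> * cmod X" by (simp add: norm_mult right_diff_distrib mult.assoc)
  hence "cmod (\<mu> (Suc n) - S * \<mu> n) = cmod \<kappa> * cmod X" using P1 by (simp add: norm_mult)
  also have "\<dots> \<le> cmod \<kappa> * \<bar>Y\<bar>" using XY by (intro mult_left_mono) auto
  also have "\<dots> = cmod (P * \<mu> n + cnj (\<mu> n))" using A' by simp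
  finally show ?thesis by (simp add: S_def P_def add.commute)
qed

text \<open>The condition on \<open>v\<close> is that of a nodal tangent direction;
  \<open>sq\<close> reads it as a relation between \<open>m\<close> and \<open>cnj m\<close>.
  Turning the points of \<open>as\<close> back by \<open>\<nu>\<close>, which is \<open>v\<close>
  after a quarter turn, then makes the two parts of the estimate the two terms of
  \<open>unit_sum_bound\<close>.\<close>

lemma direction_bound:
  fixes m m' v :: complex
  assumes as: "\<And>a. a \<in> set as \<Longrightarrow> cmod a = 1" "length as = 2 * n" and n: "n \<ge> 1" and m0: "m \<noteq> 0"
    and ineq: "cmod (m' - (\<Sum>a\<leftarrow>as. cnj a) * m) \<le> cmod (cnj m + prod_list as * m)"
    and v: "cmod v = 1" "Re (m * v ^ n) = 0"
  shows "\<bar>Im (m' / m * v)\<bar> \<le> 2 * (real n + 1) * cos (real n * alpha0 n)"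
proof -
  define \<nu> where "\<nu> = - \<i> * v"
  have v\<nu>: "v = \<i> * \<nu>" by (simp add: \<nu>_def)
  have \<nu>1: "cmod \<nu> = 1" using v by (simp add: \<nu>_def norm_mult)
  define y where "y = (\<lambda>i. as ! i * cnj \<nu>)"
  define S where "S = (\<Sum>a\<leftarrow>as. cnj a)"
  have y1: "cmod (y i) = 1" if "i \<in> {..<2 * n}" for i
    using that as nth_mem[of i as] \<nu>1 by (auto simp: y_def norm_mult)
  have Sy: "Re (S * \<nu>) = Re (\<Sum>i<2 * n. y i)"
  proof -
    have "S * \<nu> = (\<Sum>i<2 * n. cnj (as ! i) * \<nu>)" unfolding S_def
      by (simp add: sum_list_sum_nth as(2) atLeast0LessThan sum_distrib_right)
    also have "\<dots> = cnj (\<Sum>i<2 * n. y i)" by (simp add: y_def)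
    finally show ?thesis by simp
  qed
  have Py: "(\<Prod>i<2 * n. y i) = prod_list as * cnj \<nu> ^ (2 * n)"
  proof -
    have "prod_list as = (\<Prod>i<2 * n. as ! i)" using as(2) by (simp add: prod.list_conv_set_nth atLeast0LessThan)
    thus ?thesis by (simp add: y_def prod.distrib)
  qed
  have sq: "m = (-1) ^ Suc n * cnj \<nu> ^ (2 * n) * cnj m"
  proof -
    define c where "c = m * v ^ n"
    have vv: "v * cnj v = 1" using v(1) complex_norm_square[of v] by simp
    have "Re c = 0" using v(2) by (simp only: c_def)
    hence "c = - cnj c" by (simp add: complex_eq_iff)
    hence "m * v ^ n = - (cnj m * cnj v ^ n)" by (simp add: c_def)
    hence "m * v ^ n * cnj v ^ n = - (cnj m * cnj v ^ n * cnj v ^ n)" by simp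
    moreover have "v ^ n * cnj v ^ n = 1" by (simp only: vv power_one flip: power_mult_distrib)
    moreover have "cnj v ^ n * cnj v ^ n = (-1) ^ n * cnj \<nu> ^ (2 * n)"
    proof -
      have "cnj v ^ n * cnj v ^ n = (cnj v * cnj v) ^ n" by (simp add: power_mult_distrib)
      also have "cnj v * cnj v = - (cnj \<nu> * cnj \<nu>)" by (simp add: v\<nu> complex_eq_iff algebra_simps)
      also have "(- (cnj \<nu> * cnj \<nu>)) ^ n = (-1) ^ n * cnj \<nu> ^ (2 * n)"
        by (subst power_minus) (simp add: power_mult power2_eq_square)
      finally show ?thesis .
    qed
    ultimately have "m = - (cnj m * ((-1) ^ n * cnj \<nu> ^ (2 * n)))" by (simp add: mult.assoc)
    thus ?thesis by (simp add: mult_ac)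
  qed
  have "cmod (cnj m + prod_list as * m) = cmod (cnj m * (1 + (-1) ^ Suc n * (\<Prod>i<2 * n. y i)))"
    unfolding Py by (subst (2) sq) (simp add: algebra_simps)
  also have "\<dots> = cmod m * cmod (1 + (-1) ^ Suc n * (\<Prod>i<2 * n. y i))" by (simp only: norm_mult complex_mod_cnj)
  finally have "cmod (m' - S * m) \<le> cmod m * cmod (1 + (-1) ^ Suc n * (\<Prod>i<2 * n. y i))"
    using ineq by (simp only: S_def)
  moreover have "m' - S * m = (m' / m - S) * m" using m0 by (simp add: field_simps)
  ultimately have bd: "cmod (m' / m - S) \<le> cmod (1 + (-1) ^ Suc n * (\<Prod>i<2 * n. y i))"
    using m0 by (simp add: norm_mult mult.commute)
  have "Im (X * v) = Re (X * \<nu>)" for X by (simp add: v\<nu>)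
  hence "Im (m' / m * v) = Re (m' / m * \<nu>)" .
  also have "\<dots> = Re (S * \<nu>) + Re ((m' / m - S) * \<nu>)" by (simp add: left_diff_distrib)
  finally have "\<bar>Im (m' / m * v)\<bar> \<le> \<bar>Re (S * \<nu>)\<bar> + cmod ((m' / m - S) * \<nu>)"
    using abs_Re_le_cmod[of "(m' / m - S) * \<nu>"] by linarith
  also have "\<dots> \<le> \<bar>Re (\<Sum>i<2 * n. y i)\<bar> + cmod (1 + (-1) ^ Suc n * (\<Prod>i<2 * n. y i))"
    using bd Sy \<nu>1 by (simp add: norm_mult)
  also have "\<dots> \<le> 2 * (real n + 1) * cos (real n * alpha0 n)"
    by (rule unit_sum_bound) (use n y1 in auto)
  finally show ?thesis .
qed

subsection \<open>The disc automorphism moving \<open>p\<close> to the centre\<close>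

text \<open>Normalized to map the disc of radius \<open>r\<close> onto the unit disc with positive
  derivative at \<open>p\<close>.\<close>

definition disc_map :: "real \<Rightarrow> complex \<Rightarrow> complex \<Rightarrow> complex" where
  "disc_map r p z = of_real r * (z - p) / (of_real (r\<^sup>2) - cnj p * z)"

context
  fixes r :: real and p :: complex
  assumes p: "cmod p < r"
begin

lemma disc_map_r: "r > 0" "r\<^sup>2 - (cmod p)\<^sup>2 > 0"
proof -
  show r: "r > 0" using p norm_ge_zero[of p] by linarith
  have "(cmod p)\<^sup>2 < r\<^sup>2" using p by (intro power_strict_mono) auto
  thus "r\<^sup>2 - (cmod p)\<^sup>2 > 0" by simp
qed

lemma disc_map_denom:
  assumes "cmod z \<le> r"
  shows "of_real (r\<^sup>2) - cnj p * z \<noteq> 0"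
proof
  assume "of_real (r\<^sup>2) - cnj p * z = 0"
  hence "of_real (r\<^sup>2) = cnj p * z" by simp
  hence "cmod (of_real (r\<^sup>2)) = cmod (cnj p * z)" by simp
  hence "r\<^sup>2 = cmod p * cmod z" by (simp add: norm_mult del: of_real_power)
  also have "\<dots> \<le> cmod p * r" using assms by (intro mult_left_mono) auto
  also have "\<dots> < r * r" using p disc_map_r by (intro mult_strict_right_mono) auto
  finally show False by (simp add: power2_eq_square)
qed

lemma disc_map_norm:
  assumes "cmod z \<le> r"
  shows "1 - (cmod (disc_map r p z))\<^sup>2 = (r\<^sup>2 - (cmod p)\<^sup>2) * (r\<^sup>2 - (cmod z)\<^sup>2) / (cmod (of_real (r\<^sup>2) - cnj p * z))\<^sup>2"
proof -
  define d where "d = of_real (r\<^sup>2) - cnj p * z"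
  have d0: "(cmod d)\<^sup>2 \<noteq> 0" using disc_map_denom[OF assms] by (simp add: d_def)
  have "(cmod (disc_map r p z))\<^sup>2 = r\<^sup>2 * (cmod (z - p))\<^sup>2 / (cmod d)\<^sup>2"
    by (simp add: disc_map_def d_def norm_mult norm_divide power_mult_distrib power_divide)
  hence "1 - (cmod (disc_map r p z))\<^sup>2 = ((cmod d)\<^sup>2 - r\<^sup>2 * (cmod (z - p))\<^sup>2) / (cmod d)\<^sup>2"
    using d0 by (simp add: diff_divide_distrib)
  also have "(cmod d)\<^sup>2 - r\<^sup>2 * (cmod (z - p))\<^sup>2 = (r\<^sup>2 - (cmod p)\<^sup>2) * (r\<^sup>2 - (cmod z)\<^sup>2)"
    unfolding d_def cmod_power2 by (simp add: power2_eq_square algebra_simps)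
  finally show ?thesis by (simp only: d_def)
qed

lemma disc_map_ball:
  assumes "z \<in> ball 0 r"
  shows "disc_map r p z \<in> ball 0 1"
proof -
  have z: "cmod z < r" using assms by simp
  hence "(cmod z)\<^sup>2 < r\<^sup>2" by (intro power_strict_mono) auto
  hence "0 < 1 - (cmod (disc_map r p z))\<^sup>2"
    using disc_map_norm[of z] disc_map_denom[of z] z disc_map_r(2) by simp
  thus ?thesis by (simp add: abs_square_less_1)
qed

lemma disc_map_circle:
  assumes "cmod z = r"
  shows "cmod (disc_map r p z) = 1"
proof -
  have "1 - (cmod (disc_map r p z))\<^sup>2 = 0" using disc_map_norm[of z] assms by simp
  thus ?thesis by (simp add: power2_eq_1_iff) (metis norm_ge_zero not_one_le_zero neg_0_le_iff_le)
qed

lemma disc_map_diff: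
  assumes "cmod z \<le> r" "cmod w \<le> r"
  shows "disc_map r p w - disc_map r p z
    = of_real (r * (r\<^sup>2 - (cmod p)\<^sup>2)) * (w - z) / ((of_real (r\<^sup>2) - cnj p * w) * (of_real (r\<^sup>2) - cnj p * z))"
proof -
  note d = disc_map_denom[OF assms(1)] disc_map_denom[OF assms(2)]
  have pp: "complex_of_real ((cmod p)\<^sup>2) = p * cnj p" by (rule complex_norm_square)
  have "disc_map r p w - disc_map r p z = (of_real r * (w - p) * (of_real (r\<^sup>2) - cnj p * z) - of_real r * (z - p) * (of_real (r\<^sup>2) - cnj p * w))
     / ((of_real (r\<^sup>2) - cnj p * w) * (of_real (r\<^sup>2) - cnj p * z))"
    unfolding disc_map_def by (rule diff_frac_eq[OF d(2) d(1)])
  also have "of_real r * (w - p) * (of_real (r\<^sup>2) - cnj p * z) - of_real r * (z - p) * (of_real (r\<^sup>2) - cnj p * w)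
     = of_real (r * (r\<^sup>2 - (cmod p)\<^sup>2)) * (w - z)"
    unfolding of_real_mult of_real_diff pp by (simp add: algebra_simps)
  finally show ?thesis .
qed

lemma disc_map_denom_circle:
  assumes "cmod w = r"
  shows "of_real (r\<^sup>2) - cnj p * w = w * cnj (w - p)"
proof -
  have "of_real (r\<^sup>2) = w * cnj w" using complex_norm_square[of w] assms by simp
  thus ?thesis by (simp add: algebra_simps)
qed

text \<open>Conformal covariance. The first factor on the right is the kernel at \<open>p\<close>;
  it depends only on the boundary point \<open>w\<close> and can be absorbed into the
  density.\<close>

lemma poisson_kernel_disc_map:
  assumes w: "cmod w = r" and z: "cmod z < r"
  shows "(r\<^sup>2 - (cmod z)\<^sup>2) / (cmod (w - z))\<^sup>2
    = (r\<^sup>2 - (cmod p)\<^sup>2) / (cmod (w - p))\<^sup>2 * ((1 - (cmod (disc_map r p z))\<^sup>2) / (cmod (disc_map r p w - disc_map r p z))\<^sup>2)"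
proof -
  define d where "d = of_real (r\<^sup>2) - cnj p * z"
  have d0: "cmod d \<noteq> 0" using disc_map_denom[of z] z by (simp add: d_def)
  have wp: "cmod (w - p) \<noteq> 0" "cmod (w - z) \<noteq> 0" using w z p by auto
  define q where "q = r\<^sup>2 - (cmod p)\<^sup>2"
  have q0: "q \<noteq> 0" using disc_map_r(2) by (simp add: q_def)
  have n1: "cmod (w * cnj (w - p)) = r * cmod (w - p)" by (simp only: norm_mult complex_mod_cnj w)
  have "0 \<le> r * q" unfolding q_def by (rule less_imp_le[OF mult_pos_pos[OF disc_map_r]])
  hence n2: "cmod (of_real (r * q)) = r * q" unfolding norm_of_real by (rule abs_of_nonneg)
  have "cmod (disc_map r p w - disc_map r p z) = r * q * cmod (w - z) / ((r * cmod (w - p)) * cmod d)"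
    unfolding disc_map_diff[OF less_imp_le[OF z] order_eq_refl[OF w]] disc_map_denom_circle[OF w] norm_divide norm_mult
    by (simp only: n1[unfolded norm_mult] n2[unfolded q_def of_real_mult norm_mult] d_def q_def of_real_mult norm_mult)
  hence "cmod (disc_map r p w - disc_map r p z) = q * cmod (w - z) / (cmod (w - p) * cmod d)"
    using disc_map_r(1) by (simp add: mult.assoc)
  hence e1: "cmod (disc_map r p w - disc_map r p z) = q * cmod (w - z) / (cmod (w - p) * cmod d)" .
  have e2: "1 - (cmod (disc_map r p z))\<^sup>2 = q * (r\<^sup>2 - (cmod z)\<^sup>2) / (cmod d)\<^sup>2"
    using disc_map_norm[of z] z by (simp add: d_def q_def)
  have "x / a\<^sup>2 = q / b\<^sup>2 * ((q * x / c\<^sup>2) / (q * a / (b * c))\<^sup>2)" if "a \<noteq> 0" "b \<noteq> 0" "c \<noteq> 0" for a b c x :: real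
    using that q0 by (simp add: field_simps power2_eq_square)
  from this[OF wp(2,1) d0] show ?thesis unfolding e1 e2 q_def[symmetric] .
qed

lemma disc_map_deriv:
  assumes "cmod z \<le> r"
  shows "(disc_map r p has_field_derivative of_real (r * (r\<^sup>2 - (cmod p)\<^sup>2)) / (of_real (r\<^sup>2) - cnj p * z)\<^sup>2) (at z)"
proof -
  note d = disc_map_denom[OF assms]
  have pp: "complex_of_real ((cmod p)\<^sup>2) = p * cnj p" by (rule complex_norm_square)
  have "(disc_map r p has_field_derivative (of_real r * (of_real (r\<^sup>2) - cnj p * z) - of_real r * (z - p) * (- cnj p)) / ((of_real (r\<^sup>2) - cnj p * z) * (of_real (r\<^sup>2) - cnj p * z))) (at z)"
    unfolding disc_map_def using d by (auto intro!: derivative_eq_intros)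
  also have "of_real r * (of_real (r\<^sup>2) - cnj p * z) - of_real r * (z - p) * (- cnj p) = of_real (r * (r\<^sup>2 - (cmod p)\<^sup>2))"
    unfolding of_real_mult of_real_diff pp by (simp add: algebra_simps)
  finally show ?thesis by (simp only: power2_eq_square)
qed

lemma disc_map_holomorphic: "disc_map r p holomorphic_on ball 0 r"
  using disc_map_deriv unfolding holomorphic_on_def field_differentiable_def
  by (metis has_field_derivative_at_within less_imp_le mem_ball_0)

text \<open>The quotient of the derivatives is the origin of the term
  \<open>2 * cmod p / (r^2 - (cmod p)^2)\<close> in the bound.\<close>

lemma disc_map_at_p:
  "disc_map r p p = 0" "deriv (disc_map r p) p = of_real (r / (r\<^sup>2 - (cmod p)\<^sup>2))"
  "deriv (deriv (disc_map r p)) p / deriv (disc_map r p) p = 2 * cnj p / of_real (r\<^sup>2 - (cmod p)\<^sup>2)"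
proof -
  define q where "q = r\<^sup>2 - (cmod p)\<^sup>2"
  have q0: "q \<noteq> 0" using disc_map_r(2) by (simp add: q_def)
  have qc: "of_real (r\<^sup>2) - cnj p * p = complex_of_real q"
    unfolding q_def of_real_diff complex_norm_square by (simp add: mult.commute)
  show "disc_map r p p = 0" by (simp add: disc_map_def)
  have d1: "deriv (disc_map r p) z = of_real (r * q) / (of_real (r\<^sup>2) - cnj p * z)\<^sup>2" if "z \<in> ball 0 r" for z
    unfolding q_def using disc_map_deriv[of z] that by (intro DERIV_imp_deriv) simp
  have pb: "p \<in> ball 0 r" using p by simp
  show d1p: "deriv (disc_map r p) p = of_real (r / (r\<^sup>2 - (cmod p)\<^sup>2))"
    unfolding d1[OF pb] qc q_def[symmetric] using q0 by (simp add: power2_eq_square)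
  have "((\<lambda>z. of_real (r * q) / (of_real (r\<^sup>2) - cnj p * z)\<^sup>2) has_field_derivative
      of_real (r * q) * (2 * cnj p) / (of_real q) ^ 3) (at p)"
    using q0 qc by (auto intro!: derivative_eq_intros simp: power2_eq_square power3_eq_cube divide_simps)
  hence "(deriv (disc_map r p) has_field_derivative of_real (r * q) * (2 * cnj p) / (of_real q) ^ 3) (at p)"
    by (rule has_field_derivative_transform_within_open[OF _ open_ball pb]) (simp add: d1)
  hence "deriv (deriv (disc_map r p)) p = of_real (r * q) * (2 * cnj p) / (of_real q) ^ 3" by (rule DERIV_imp_deriv)
  thus "deriv (deriv (disc_map r p)) p / deriv (disc_map r p) p = 2 * cnj p / of_real (r\<^sup>2 - (cmod p)\<^sup>2)"
    unfolding d1p q_def[symmetric] using q0 disc_map_r(1) by (simp add: power3_eq_cube field_simps)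
qed

end

subsection \<open>Power series with bounded coefficients\<close>

definition powser :: "(nat \<Rightarrow> complex) \<Rightarrow> complex \<Rightarrow> complex" where
  "powser a w = (\<Sum>j. a j * w ^ j)"

lemma powser_sums:
  assumes "\<And>j. cmod (a j) \<le> B" "cmod w < 1"
  shows "(\<lambda>j. a j * w ^ j) sums powser a w"
proof -
  have "summable (\<lambda>j. B * cmod w ^ j)" using assms(2) by (intro summable_mult summable_geometric) auto
  hence "summable (\<lambda>j. a j * w ^ j)"
    by (rule summable_comparison_test'[where N = 0]) (use assms(1) in \<open>auto simp: norm_mult norm_power intro!: mult_right_mono\<close>)
  thus ?thesis by (simp add: powser_def summable_sums)
qed

lemma powser_holomorphic:
  assumes "\<And>j. cmod (a j) \<le> B"
  shows "powser a holomorphic_on ball 0 1"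
  by (rule power_series_holomorphic[where a = a]) (use powser_sums[OF assms] in auto)

lemma powser_shift:
  assumes "\<And>j. cmod (a j) \<le> B" "cmod w < 1"
  shows "powser a w = a 0 + w * powser (\<lambda>j. a (Suc j)) w"
proof -
  have "(\<lambda>j. a (Suc j) * w ^ j) sums powser (\<lambda>j. a (Suc j)) w" by (rule powser_sums) (use assms in auto)
  hence "(\<lambda>j. w * (a (Suc j) * w ^ j)) sums (w * powser (\<lambda>j. a (Suc j)) w)" by (rule sums_mult)
  hence "(\<lambda>j. a (Suc j) * w ^ Suc j) sums (w * powser (\<lambda>j. a (Suc j)) w)" by (simp add: mult_ac)
  hence "(\<lambda>j. a j * w ^ j) sums (w * powser (\<lambda>j. a (Suc j)) w + a 0 * w ^ 0)" by (rule sums_Suc)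
  hence "w * powser (\<lambda>j. a (Suc j)) w + a 0 * w ^ 0 = powser a w"
    by (rule sums_unique2[OF _ powser_sums[OF assms]])
  from this[symmetric] show ?thesis by (simp add: add.commute)
qed

lemma powser_0: "powser a 0 = a 0"
  by (simp add: powser_def powser_zero)

lemma powser_deriv_0:
  assumes "\<And>j. cmod (a j) \<le> B"
  shows "(powser a has_field_derivative a 1) (at 0)"
proof -
  have "powser (\<lambda>j. a (Suc j)) holomorphic_on ball 0 1" by (rule powser_holomorphic) (use assms in auto)
  hence "(powser (\<lambda>j. a (Suc j)) has_field_derivative deriv (powser (\<lambda>j. a (Suc j))) 0) (at 0)"
    by (rule holomorphic_derivI) auto
  hence "((\<lambda>w. a 0 + w * powser (\<lambda>j. a (Suc j)) w) has_field_derivative a 1) (at 0)"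
    by (auto intro!: derivative_eq_intros simp: powser_0)
  thus ?thesis
  proof (rule has_field_derivative_transform_within_open[OF _ open_ball[of 0 1]])
    show "a 0 + w * powser (\<lambda>j. a (Suc j)) w = powser a w" if "w \<in> ball 0 1" for w
      by (rule powser_shift[OF assms, symmetric]) (use that in simp)
  qed simp
qed

lemma powser_factor:
  assumes "\<And>j. cmod (a j) \<le> B" "cmod w < 1" "\<And>j. j < m \<Longrightarrow> a j = 0"
  shows "powser a w = w ^ m * powser (\<lambda>j. a (j + m)) w"
  using assms
proof (induction m arbitrary: a)
  case (Suc m)
  have "powser a w = w * powser (\<lambda>j. a (Suc j)) w" by (subst powser_shift[OF Suc.prems(1,2)]) (simp add: Suc.prems(3))
  also have "powser (\<lambda>j. a (Suc j)) w = w ^ m * powser (\<lambda>j. a (Suc (j + m))) w"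
    using Suc.IH[of "\<lambda>j. a (Suc j)"] Suc.prems by auto
  finally show ?case by (simp add: mult.assoc)
qed simp

text \<open>A root of \<open>f\<close> in the coordinate \<open>W\<close>: if \<open>f = W\<^sup>m L(W)\<close>, then \<open>W L(W)\<^sup>1\<^sup>/\<^sup>m\<close> is a chart.\<close>

lemma root_chart:
  assumes W: "W holomorphic_on D" "open D" "p \<in> D" "W p = 0" "deriv W p \<noteq> 0" "W ` D \<subseteq> ball 0 1"
    and L: "L holomorphic_on ball 0 1" "L 0 \<noteq> 0" and m: "m \<ge> 1"
    and f: "\<And>z. z \<in> D \<Longrightarrow> f z = W z ^ m * L (W z)"
  obtains \<phi> \<psi> N d where "power_chart f p m \<phi> \<psi> N d" "N \<subseteq> D" "deriv \<phi> p ^ m = deriv W p ^ m * L 0"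
    "deriv (deriv \<phi>) p / deriv \<phi> p = deriv (deriv W) p / deriv W p + 2 / of_nat m * (deriv L 0 / L 0) * deriv W p"
proof -
  have "continuous_on (ball 0 1) L" using L(1) by (rule holomorphic_on_imp_continuous_on)
  hence "open (ball 0 1 \<inter> L -` (- {0}))" by (rule continuous_open_preimage) auto
  moreover have "0 \<in> ball 0 1 \<inter> L -` (- {0})" using L(2) by simp
  ultimately obtain e where e: "e > 0" "ball 0 e \<subseteq> ball 0 1 \<inter> L -` (- {0})" using openE by blast
  have Le: "L holomorphic_on ball 0 e" using L(1) e(2) holomorphic_on_subset by blast
  obtain g where g: "g holomorphic_on ball 0 e" "\<And>z. z \<in> ball 0 e \<Longrightarrow> L z = exp (g z)"
    by (rule contractible_imp_holomorphic_log[OF Le convex_imp_contractible[OF convex_ball]]) (use e(2) in auto)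
  define B where "B = D \<inter> W -` ball 0 e"
  have B: "open B" "p \<in> B" "B \<subseteq> D" unfolding B_def
    using continuous_open_preimage[OF holomorphic_on_imp_continuous_on[OF W(1)] W(2) open_ball] W(3,4) e(1) by auto
  \<comment> \<open>\<open>H\<close> is an \<open>m\<close>-th root of \<open>w ^ m * L w\<close>,
    holomorphic near 0 because \<open>L 0 \<noteq> 0\<close>.\<close>
  define H where "H = (\<lambda>w. w * exp (g w / of_nat m))"
  have H: "H holomorphic_on ball 0 e" unfolding H_def using m by (intro holomorphic_intros g(1)) auto
  define \<phi> where "\<phi> = (\<lambda>z. H (W z))"
  have WB: "W holomorphic_on B" "W ` B \<subseteq> ball 0 e" using W(1) B(3) holomorphic_on_subset by (auto simp: B_def)
  have "(H \<circ> W) holomorphic_on B" by (rule holomorphic_on_compose_gen[OF WB(1) H WB(2)])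
  hence hol: "\<phi> holomorphic_on B" by (simp add: o_def \<phi>_def)
  define E where "E = exp (g 0 / of_nat m)"
  have EL: "E ^ m = L 0" using g(2)[of 0] e(1) m by (simp add: E_def flip: exp_of_nat_mult)
  have g': "(g has_field_derivative deriv g z) (at z)" if "z \<in> ball 0 e" for z
    by (rule holomorphic_derivI[OF g(1) open_ball that])
  have gL: "deriv g 0 = deriv L 0 / L 0"
  proof -
    have "((\<lambda>z. exp (g z)) has_field_derivative exp (g 0) * deriv g 0) (at 0)"
      using g'[of 0] e(1) by (auto intro!: derivative_eq_intros)
    hence "(L has_field_derivative exp (g 0) * deriv g 0) (at 0)"
      by (rule has_field_derivative_transform_within_open[OF _ open_ball[of 0 e]]) (use g(2) e(1) in auto)
    hence "deriv L 0 = L 0 * deriv g 0" using g(2)[of 0] e(1) by (simp add: DERIV_imp_deriv)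
    thus ?thesis using L(2) by simp
  qed
  have H': "(H has_field_derivative exp (g w / of_nat m) * (1 + w * deriv g w / of_nat m)) (at w)" if "w \<in> ball 0 e" for w
    unfolding H_def using m by (auto intro!: derivative_eq_intros g'[OF that] simp: algebra_simps)
  have dH: "deriv H w = exp (g w / of_nat m) * (1 + w * deriv g w / of_nat m)" if "w \<in> ball 0 e" for w
    by (rule DERIV_imp_deriv[OF H'[OF that]])
  have z0: "0 \<in> ball 0 e" using e(1) by simp
  have H0: "deriv H 0 = E" using dH[OF z0] by (simp add: E_def)
  have "(deriv g has_field_derivative deriv (deriv g) 0) (at 0)"
    by (rule holomorphic_derivI[OF holomorphic_deriv[OF g(1)]]) (use e in auto)
  hence "((\<lambda>w. exp (g w / of_nat m) * (1 + w * deriv g w / of_nat m)) has_field_derivative E * (2 * deriv g 0 / of_nat m)) (at 0)"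
    using m by (auto intro!: derivative_eq_intros g'[OF z0] simp: E_def algebra_simps)
  hence H2: "(deriv H has_field_derivative E * (2 * deriv g 0 / of_nat m)) (at 0)"
    by (rule has_field_derivative_transform_within_open[OF _ open_ball z0]) (simp add: dH)
  have W': "(W has_field_derivative deriv W z) (at z)" if "z \<in> B" for z
    by (rule holomorphic_derivI[OF W(1,2)]) (use that B(3) in auto)
  have \<phi>': "(\<phi> has_field_derivative deriv H (W z) * deriv W z) (at z)" if "z \<in> B" for z
    unfolding \<phi>_def by (rule DERIV_chain2[OF holomorphic_derivI[OF H open_ball] W'[OF that]]) (use WB(2) that in auto)
  have d\<phi>: "deriv \<phi> z = deriv H (W z) * deriv W z" if "z \<in> B" for z by (rule DERIV_imp_deriv[OF \<phi>'[OF that]])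
  have d\<phi>p: "deriv \<phi> p = E * deriv W p" using d\<phi>[OF B(2)] by (simp add: W(4) H0)
  have E0: "E \<noteq> 0" by (simp add: E_def)
  have "(deriv W has_field_derivative deriv (deriv W) p) (at p)"
    by (rule holomorphic_derivI[OF holomorphic_deriv[OF W(1,2)] W(2,3)])
  moreover have "((\<lambda>z. deriv H (W z)) has_field_derivative E * (2 * deriv g 0 / of_nat m) * deriv W p) (at p)"
    by (rule DERIV_chain2[OF _ W'[OF B(2)]]) (use H2 W(4) in simp)
  ultimately have "((\<lambda>z. deriv H (W z) * deriv W z) has_field_derivative
      deriv H (W p) * deriv (deriv W) p + E * (2 * deriv g 0 / of_nat m) * deriv W p * deriv W p) (at p)"
    by (auto intro!: derivative_eq_intros)
  hence "(deriv \<phi> has_field_derivative deriv H (W p) * deriv (deriv W) p + E * (2 * deriv g 0 / of_nat m) * deriv W p * deriv W p) (at p)"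
    by (rule has_field_derivative_transform_within_open[OF _ B(1,2)]) (simp add: d\<phi>)
  hence dd: "deriv (deriv \<phi>) p = E * deriv (deriv W) p + E * (2 * deriv g 0 / of_nat m) * deriv W p * deriv W p"
    by (simp add: DERIV_imp_deriv W(4) H0)
  obtain \<psi> N d where ch: "power_chart f p m \<phi> \<psi> N d" "N \<subseteq> B"
  proof (rule power_chartI[OF hol B(1,2) _ _ m])
    show "\<phi> p = 0" by (simp add: \<phi>_def H_def W(4))
    show "deriv \<phi> p \<noteq> 0" using d\<phi>p E0 W(5) by simp
    fix z assume z: "z \<in> B"
    have "\<phi> z ^ m = W z ^ m * exp (g (W z))"
      using m by (simp add: \<phi>_def H_def power_mult_distrib flip: exp_of_nat_mult)
    also have "exp (g (W z)) = L (W z)" by (rule g(2)[symmetric]) (use z WB(2) in auto)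
    also have "W z ^ m * L (W z) = f z" by (rule f[symmetric]) (use z B(3) in auto)
    finally show "f z = f p + \<phi> z ^ m" using f[OF W(3)] W(4) m by (simp add: power_0_left)
  qed blast
  show ?thesis
  proof (rule that[OF ch(1)])
    show "N \<subseteq> D" using ch(2) B(3) by blast
    show "deriv \<phi> p ^ m = deriv W p ^ m * L 0" by (simp add: d\<phi>p power_mult_distrib EL)
    show "deriv (deriv \<phi>) p / deriv \<phi> p = deriv (deriv W) p / deriv W p + 2 / of_nat m * (deriv L 0 / L 0) * deriv W p"
      unfolding dd d\<phi>p gL using E0 W(5) by (simp add: add_divide_distrib mult_ac)
  qed
qed

subsection \<open>The upper bound\<close>

text \<open>With \<open>q = cnj (\<omega> x) * w\<close>, the Poisson kernel is the real part of
  \<open>(1 + q) / (1 - q)\<close>, whose series is 1 plus twice the positive powers of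
  \<open>q\<close>; hence the coefficient of order 0 is not doubled. Absolute summability allows
  termwise integration against \<open>k\<close>.\<close>

lemma boundary_series:
  fixes k :: "'a \<Rightarrow> real" and \<omega> :: "'a \<Rightarrow> complex"
  assumes k: "integrable M k" and \<omega>m: "\<omega> \<in> borel_measurable M" and \<omega>1: "\<And>x. cmod (\<omega> x) = 1"
  defines "a \<equiv> \<lambda>j. (if j = 0 then 1 else 2) * (\<integral>x. of_real (k x) * cnj (\<omega> x) ^ j \<partial>M)"
  shows "cmod (a j) \<le> 2 * (\<integral>x. \<bar>k x\<bar> \<partial>M)"
    and "cmod w < 1 \<Longrightarrow> Re (powser a w) = (\<integral>x. k x * ((1 - (cmod w)\<^sup>2) / (cmod (\<omega> x - w))\<^sup>2) \<partial>M)"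
proof -
  have [measurable]: "(\<lambda>x. cnj (\<omega> x)) \<in> borel_measurable M"
    using measurable_compose[OF \<omega>m borel_measurable_continuous_onI[of cnj]] by (simp add: continuous_on_cnj)
  have [measurable]: "k \<in> borel_measurable M" using k by auto
  have int: "integrable M (\<lambda>x. of_real (k x) * cnj (\<omega> x) ^ j)" for j
    by (rule Bochner_Integration.integrable_bound[OF k]) (use \<omega>1 in \<open>auto simp: norm_mult norm_power\<close>)
  have bd: "cmod (a j) \<le> 2 * (\<integral>x. \<bar>k x\<bar> \<partial>M)" for j
  proof -
    define T where "T = (\<integral>x. of_real (k x) * cnj (\<omega> x) ^ j \<partial>M)"
    have "cmod T \<le> (\<integral>x. cmod (of_real (k x) * cnj (\<omega> x) ^ j) \<partial>M)"
      unfolding T_def by (rule integral_norm_bound)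
    also have "\<dots> = (\<integral>x. \<bar>k x\<bar> \<partial>M)" using \<omega>1 by (simp add: norm_mult norm_power)
    finally have "cmod T \<le> (\<integral>x. \<bar>k x\<bar> \<partial>M)" .
    moreover have "a j = (if j = 0 then 1 else 2) * T" by (simp only: a_def T_def)
    hence "cmod (a j) \<le> 2 * cmod T" by (simp add: norm_mult)
    ultimately show ?thesis by linarith
  qed
  thus "cmod (a j) \<le> 2 * (\<integral>x. \<bar>k x\<bar> \<partial>M)" .
  assume w: "cmod w < 1"
  define c where "c = (\<lambda>j::nat. if j = 0 then 1 else 2 :: real)"
  define F where "F = (\<lambda>j x. of_real (k x) * (of_real (c j) * (cnj (\<omega> x) * w) ^ j))"
  have F_eq: "F j x = of_real (c j) * w ^ j * (of_real (k x) * cnj (\<omega> x) ^ j)" for j x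
    by (simp add: F_def power_mult_distrib mult_ac)
  have Fi: "integrable M (F j)" for j unfolding F_eq by (intro integrable_mult_right int)
  have Fint: "(\<integral>x. F j x \<partial>M) = a j * w ^ j" for j
    unfolding F_eq by (simp add: a_def c_def)
  have Fn: "norm (F j x) = \<bar>k x\<bar> * (c j * cmod w ^ j)" for j x
    using \<omega>1[of x] by (simp add: F_def norm_mult norm_power c_def)
  have sc: "summable (\<lambda>j. c j * cmod w ^ j)"
  proof (rule summable_comparison_test')
    show "summable (\<lambda>j. 2 * cmod w ^ j)" using w by (intro summable_mult summable_geometric) auto
    show "norm (c j * cmod w ^ j) \<le> 2 * cmod w ^ j" if "j \<ge> 0" for j by (simp add: c_def)
  qed
  have qs: "(\<lambda>j. of_real (c j) * q ^ j) sums ((1 + q) / (1 - q))" if "cmod q < 1" for q :: complex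
  proof -
    have "(\<lambda>j. 2 * q ^ j - (if j = 0 then 1 else 0)) sums (2 * (1 / (1 - q)) - 1)"
      by (intro sums_diff sums_mult geometric_sums that sums_single[of 0 "\<lambda>_. 1"])
    moreover have "2 * q ^ j - (if j = 0 then 1 else 0) = of_real (c j) * q ^ j" for j by (simp add: c_def)
    moreover have "2 * (1 / (1 - q)) - 1 = (1 + q) / (1 - q)" using that by (cases "q = 1") (auto simp: field_simps)
    ultimately show ?thesis by simp
  qed
  have "(\<lambda>j. \<integral>x. F j x \<partial>M) sums (\<integral>x. (\<Sum>j. F j x) \<partial>M)"
  proof (rule sums_integral[OF Fi])
    show "AE x in M. summable (\<lambda>j. norm (F j x))" unfolding Fn by (intro AE_I2 summable_mult sc)
    have "summable (\<lambda>j. (\<integral>x. \<bar>k x\<bar> \<partial>M) * (c j * cmod w ^ j))" by (intro summable_mult sc)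
    thus "summable (\<lambda>j. \<integral>x. norm (F j x) \<partial>M)" unfolding Fn by simp
  qed
  hence S: "powser a w = (\<integral>x. (\<Sum>j. F j x) \<partial>M)"
    unfolding Fint powser_def by (simp add: sums_iff)
  have Si: "integrable M (\<lambda>x. \<Sum>j. F j x)"
  proof (rule integrable_suminf[OF Fi])
    show "AE x in M. summable (\<lambda>j. norm (F j x))" unfolding Fn by (intro AE_I2 summable_mult sc)
    have "summable (\<lambda>j. (\<integral>x. \<bar>k x\<bar> \<partial>M) * (c j * cmod w ^ j))" by (intro summable_mult sc)
    thus "summable (\<lambda>j. \<integral>x. norm (F j x) \<partial>M)" unfolding Fn by simp
  qed
  have ReF: "Re (\<Sum>j. F j x) = k x * ((1 - (cmod w)\<^sup>2) / (cmod (\<omega> x - w))\<^sup>2)" for x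
  proof -
    define q where "q = cnj (\<omega> x) * w"
    have q1: "cmod q = cmod w" using \<omega>1[of x] by (simp add: q_def norm_mult)
    have "(\<lambda>j. of_real (k x) * (of_real (c j) * q ^ j)) sums (of_real (k x) * ((1 + q) / (1 - q)))"
      by (intro sums_mult qs) (use q1 w in simp)
    hence "(\<Sum>j. F j x) = of_real (k x) * ((1 + q) / (1 - q))" by (simp add: F_def q_def sums_iff)
    moreover have "Re ((1 + q) / (1 - q)) = (1 - (cmod w)\<^sup>2) / (cmod (\<omega> x - w))\<^sup>2"
    proof -
      have qn: "1 - q \<noteq> 0" using q1 w by auto
      have "(1 + q) / (1 - q) = ((1 + q) * cnj (1 - q)) / ((1 - q) * cnj (1 - q))"
        by (rule mult_divide_mult_cancel_right[symmetric]) (use qn in \<open>metis complex_cnj_zero_iff\<close>)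
      hence "(1 + q) / (1 - q) = ((1 + q) * cnj (1 - q)) / of_real ((cmod (1 - q))\<^sup>2)"
        by (simp only: complex_norm_square)
      hence "Re ((1 + q) / (1 - q)) = Re ((1 + q) * cnj (1 - q)) / (cmod (1 - q))\<^sup>2" by (simp only: Re_divide_of_real)
      also have "Re ((1 + q) * cnj (1 - q)) = 1 - (cmod q)\<^sup>2" unfolding cmod_power2 by (simp add: power2_eq_square algebra_simps)
      also have "cmod (1 - q) = cmod (\<omega> x - w)"
      proof -
        have "\<omega> x * cnj (\<omega> x) = 1" using \<omega>1[of x] complex_norm_square[of "\<omega> x"] by simp
        hence "\<omega> x - w = \<omega> x * (1 - q)" by (simp add: q_def right_diff_distrib flip: mult.assoc)
        thus ?thesis using \<omega>1[of x] by (simp add: norm_mult)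
      qed
      finally show ?thesis by (simp add: q1)
    qed
    ultimately show ?thesis by (simp only: times_complex.sel Re_complex_of_real Im_complex_of_real mult_zero_left diff_zero)
  qed
  have "Re (powser a w) = (\<integral>x. Re (\<Sum>j. F j x) \<partial>M)"
    unfolding S by (rule integral_bounded_linear[OF bounded_linear_Re Si, symmetric])
  thus "Re (powser a w) = (\<integral>x. k x * ((1 - (cmod w)\<^sup>2) / (cmod (\<omega> x - w))\<^sup>2) \<partial>M)" by (simp only: ReF)
qed

lemma poisson_kernel_mult_integrable:
  assumes "set_integrable lebesgue {0..2 * pi} h" "0 \<le> \<rho>" "\<rho> < 1"
  shows "set_integrable lebesgue {0..2 * pi} (\<lambda>x. poisson_kernel \<rho> (x - t) * h x)"
proof -
  have "bounded ((\<lambda>x. poisson_kernel \<rho> (x - t)) ` {0..2 * pi})"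
    by (intro compact_imp_bounded compact_continuous_image continuous_on_poisson_kernel assms) auto
  thus ?thesis
    by (intro absolutely_integrable_bounded_measurable_product_real[OF _ _ _ assms(1)])
       (auto intro!: continuous_imp_measurable_on_sets_lebesgue continuous_on_poisson_kernel assms)
qed

lemma list_product_split:
  fixes A :: "'a \<Rightarrow> complex"
  shows "(\<Prod>y\<leftarrow>xs. A y * of_real (s y) * B) = (\<Prod>y\<leftarrow>xs. A y) * of_real (\<Prod>y\<leftarrow>xs. s y) * B ^ length xs"
  by (induction xs) (auto simp: mult_ac)

lemma cis_diff_half: "cis x - cis y = 2 * \<i> * of_real (sin ((x - y) / 2)) * (cis (x / 2) * cis (y / 2))"
proof -
  have "cis x = cis (x/2) * cis (y/2) * cis ((x - y)/2)" "cis y = cis (x/2) * cis (y/2) * cis (- ((x - y)/2))"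
    by (simp_all add: cis_mult field_simps)
  moreover have "cis ((x - y)/2) - cis (- ((x - y)/2)) = 2 * \<i> * of_real (sin ((x - y) / 2))"
    by (simp add: complex_eq_iff)
  ultimately show ?thesis by (metis mult.commute right_diff_distrib)
qed

text \<open>Up to sign, the curvature is the imaginary part, in the tangent direction, of a sum of
  two terms: the derivative quotient of the automorphism, and \<open>2 / n * (r / q)\<close> times
  the quotient of consecutive moments. They are estimated separately and give the two summands of
  the bound.\<close>

theorem curvature_upper_bound:
  assumes n: "n \<ge> 1" and r: "r > 0" and p: "p \<in> ball 0 r" and adm: "admissible n r p u"
    and nod: "nodal_parametrization u (ball 0 r) I \<gamma>" and t: "t \<in> I" "\<gamma> t = p"
  shows "\<bar>curvature \<gamma> t\<bar> \<le> curvature_bound n r p"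
proof -
  have pr: "cmod p < r" using p by simp
  define q where "q = r\<^sup>2 - (cmod p)\<^sup>2"
  have q0: "q > 0" using disc_map_r(2)[OF pr] by (simp add: q_def)
  obtain g where g: "L1_circle r g" "\<And>z. z \<in> ball 0 r \<Longrightarrow> u z = poisson_integral r g z"
    using adm unfolding admissible_def by blast
  have only: "only_nodal_curves_through u (ball 0 r) n p" and up: "u p = 0" and nc: "\<not> u constant_on ball 0 r"
    using adm unfolding admissible_def by auto
  define e where "e = (\<lambda>x. of_real r * cis x)"
  define h where "h = (\<lambda>x. g (e x))"
  have en: "cmod (e x) = r" for x using r by (simp add: e_def norm_mult)
  have hI: "set_integrable lebesgue {0..2 * pi} h" using g(1) by (simp add: L1_circle_def h_def e_def)
  define M0 where "M0 = restrict_space lebesgue {0..2 * pi :: real}"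
  have hM: "integrable M0 h" using hI unfolding M0_def set_integrable_def by (subst integrable_restrict_space) auto
  have IM: "(\<integral>x. F x \<partial>M0) = (LINT x:{0..2 * pi}|lebesgue. F x)" for F :: "real \<Rightarrow> real"
    unfolding M0_def set_lebesgue_integral_def by (subst integral_restrict_space) auto
  define W where "W = disc_map r p"
  define \<omega> where "\<omega> = (\<lambda>x. W (e x))"
  have \<omega>1: "cmod (\<omega> x) = 1" for x unfolding \<omega>_def W_def by (rule disc_map_circle[OF pr en])
  have meas: "F \<in> borel_measurable M0" if "continuous_on UNIV F" for F :: "real \<Rightarrow> 'b::euclidean_space"
    unfolding M0_def
    by (rule measurable_restrict_space1, rule measurable_completion) (use that borel_measurable_continuous_onI in auto)
  have conte: "continuous_on UNIV e" unfolding e_def by (auto simp: cis_conv_exp intro!: continuous_intros)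
  have cont\<omega>: "continuous_on UNIV \<omega>"
    unfolding \<omega>_def W_def disc_map_def using disc_map_denom[OF pr] en
    by (intro continuous_intros conte) auto
  have \<omega>m: "\<omega> \<in> borel_measurable M0" by (rule meas[OF cont\<omega>])
  \<comment> \<open>The Poisson kernel at \<open>p\<close>, including \<open>1 / (2 * pi)\<close>:
    the factor by which the boundary measure changes under the automorphism.\<close>
  define K where "K = (\<lambda>x. q / (cmod (e x - p))\<^sup>2 / (2 * pi))"
  have ep: "cmod (e x - p) \<ge> r - cmod p" for x using norm_triangle_ineq2[of "e x" p] en[of x] by simp
  have ep0: "cmod (e x - p) > 0" for x using ep[of x] pr by linarith
  have Kpos: "K x > 0" for x unfolding K_def by (intro divide_pos_pos q0 zero_less_power ep0) auto
  define k where "k = (\<lambda>x. h x * K x)"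
  have kI: "integrable M0 k"
  proof (rule Bochner_Integration.integrable_bound)
    define C where "C = q / (r - cmod p)\<^sup>2 / (2 * pi)"
    have Kb: "K x \<le> C" for x unfolding K_def C_def
      by (intro divide_right_mono divide_left_mono power_mono ep mult_pos_pos zero_less_power ep0) (use pr q0 in auto)
    show "integrable M0 (\<lambda>x. C * h x)" by (intro integrable_mult_right hM)
    have [measurable]: "K \<in> borel_measurable M0" unfolding K_def
      by (rule meas) (use ep0 in \<open>auto intro!: continuous_intros conte simp: less_imp_neq[symmetric]\<close>)
    have [measurable]: "h \<in> borel_measurable M0" using hM by auto
    show "k \<in> borel_measurable M0" unfolding k_def by measurable
    have "\<bar>h x\<bar> * K x \<le> \<bar>h x\<bar> * \<bar>C\<bar>" for x using Kb[of x] by (intro mult_left_mono) auto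
    thus "AE x in M0. norm (k x) \<le> norm (C * h x)" using Kpos by (intro AE_I2) (simp add: k_def abs_mult mult.commute less_imp_le)
  qed
  have u_int: "u z = (\<integral>x. k x * ((1 - (cmod (W z))\<^sup>2) / (cmod (\<omega> x - W z))\<^sup>2) \<partial>M0)" if z: "z \<in> ball 0 r" for z
  proof -
    have zr: "cmod z < r" using z by simp
    have "u z = 1 / (2 * pi) * (\<integral>x. (r\<^sup>2 - (cmod z)\<^sup>2) / (cmod (e x - z))\<^sup>2 * h x \<partial>M0)"
      unfolding g(2)[OF z] poisson_integral_def IM by (simp add: e_def h_def)
    also have "\<dots> = (\<integral>x. 1 / (2 * pi) * ((r\<^sup>2 - (cmod z)\<^sup>2) / (cmod (e x - z))\<^sup>2 * h x) \<partial>M0)"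
      by (rule integral_mult_right_zero[symmetric])
    also have "\<dots> = (\<integral>x. k x * ((1 - (cmod (W z))\<^sup>2) / (cmod (\<omega> x - W z))\<^sup>2) \<partial>M0)"
      unfolding poisson_kernel_disc_map[OF pr en zr] k_def K_def q_def \<omega>_def W_def
      by (rule Bochner_Integration.integral_cong) (auto simp: mult_ac)
    finally show ?thesis .
  qed
  define \<mu> where "\<mu> = (\<lambda>j. \<integral>x. of_real (k x) * cnj (\<omega> x) ^ j \<partial>M0)"
  define a where "a = (\<lambda>j::nat. (if j = 0 then 1 else 2) * \<mu> j)"
  define B where "B = 2 * (\<integral>x. \<bar>k x\<bar> \<partial>M0)"
  have aB: "cmod (a j) \<le> B" for j using boundary_series(1)[OF kI \<omega>m \<omega>1, of j] by (simp add: a_def \<mu>_def B_def)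
  define f where "f = (\<lambda>z. powser a (W z))"
  have Wb: "W z \<in> ball 0 1" if "z \<in> ball 0 r" for z unfolding W_def by (rule disc_map_ball[OF pr that])
  have uf: "u z = Re (f z)" if "z \<in> ball 0 r" for z
  proof -
    have "Re (powser a (W z)) = (\<integral>x. k x * ((1 - (cmod (W z))\<^sup>2) / (cmod (\<omega> x - W z))\<^sup>2) \<partial>M0)"
      unfolding a_def \<mu>_def by (rule boundary_series(2)[OF kI \<omega>m \<omega>1]) (use Wb[OF that] in simp)
    thus ?thesis using u_int[OF that] by (simp add: f_def)
  qed
  have Whol: "W holomorphic_on ball 0 r" unfolding W_def by (rule disc_map_holomorphic[OF pr])
  have fhol: "f holomorphic_on ball 0 r"
  proof -
    have "powser a holomorphic_on ball 0 1" by (rule powser_holomorphic) (rule aB)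
    moreover have "W ` ball 0 r \<subseteq> ball 0 1" using Wb by blast
    ultimately show ?thesis using holomorphic_on_compose_gen[OF Whol] by (force simp: f_def o_def)
  qed
  have fnc: "\<not> f constant_on ball 0 r"
  proof
    assume "f constant_on ball 0 r"
    then obtain c where "\<And>z. z \<in> ball 0 r \<Longrightarrow> f z = c" unfolding constant_on_def by blast
    hence "u constant_on ball 0 r" using uf unfolding constant_on_def by (intro exI[of _ "Re c"]) auto
    thus False using nc by simp
  qed
  interpret nodal_disc f r u
    by unfold_locales (use fhol fnc uf r in auto)
  have pZ: "p \<in> Z" using p up by (simp add: nodal_set_def)
  have Wp: "W p = 0" "deriv W p = of_real (r / q)" "deriv (deriv W) p / deriv W p = 2 * cnj p / of_real q"
    unfolding W_def q_def by (rule disc_map_at_p[OF pr])+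
  \<comment> \<open>\<open>a 0\<close> is the integral of \<open>k\<close>, hence real, and its real
    part is \<open>u p = 0\<close>.\<close>
  have a0: "a 0 = 0"
  proof -
    have "a 0 = of_real (\<integral>x. k x \<partial>M0)" by (simp add: a_def \<mu>_def)
    moreover have "Re (a 0) = 0" using uf[OF p] up by (simp add: f_def Wp(1) powser_0)
    ultimately show ?thesis by (metis Re_complex_of_real of_real_0)
  qed
  have ex: "\<exists>j. a j \<noteq> 0"
  proof (rule ccontr)
    assume "\<not> ?thesis"
    hence "f z = 0" for z by (simp add: f_def powser_def)
    thus False using fnc by (auto simp: constant_on_def)
  qed
  \<comment> \<open>For the moment just the order of vanishing; \<open>mn\<close> will identify it
    with the number of nodal curves.\<close>
  define m where "m = (LEAST j. a j \<noteq> 0)"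
  have am: "a m \<noteq> 0" unfolding m_def by (rule LeastI_ex[OF ex])
  have al: "a j = 0" if "j < m" for j using not_less_Least[of j "\<lambda>j. a j \<noteq> 0"] that by (simp add: m_def)
  have m1: "m \<ge> 1" using am a0 by (cases m) auto
  define L where "L = powser (\<lambda>j. a (j + m))"
  have Lb: "\<And>j. cmod (a (j + m)) \<le> B" by (rule aB)
  have L0: "L 0 = a m" and L1: "deriv L 0 = a (Suc m)"
    unfolding L_def using powser_deriv_0[of "\<lambda>j. a (j + m)", OF Lb] by (simp_all add: powser_0 DERIV_imp_deriv)
  obtain \<phi> \<psi> N d where ch: "power_chart f p m \<phi> \<psi> N d" and ND: "N \<subseteq> ball 0 r"
    and d\<phi>: "deriv \<phi> p ^ m = deriv W p ^ m * L 0"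
    and dd\<phi>: "deriv (deriv \<phi>) p / deriv \<phi> p = deriv (deriv W) p / deriv W p + 2 / of_nat m * (deriv L 0 / L 0) * deriv W p"
  proof (rule root_chart[of W "ball 0 r" p L m f])
    show "deriv W p \<noteq> 0" using r q0 by (simp add: Wp(2))
    show "L holomorphic_on ball 0 1" unfolding L_def by (rule powser_holomorphic[OF Lb])
    show "L 0 \<noteq> 0" using am L0 by simp
    show "f z = W z ^ m * L (W z)" if "z \<in> ball 0 r" for z
      unfolding f_def L_def by (rule powser_factor[OF aB _ al]) (use Wb[OF that] in auto)
  qed (use Whol p Wp(1) Wb m1 in auto)
  have mn: "m = n" by (rule order_eq_number_of_nodal_curves[OF only pZ ch ND])
  \<comment> \<open>A sign present on a set of positive measure gives a point of positive symmetric
    density, and this makes the Poisson integral keep the sign along the end of the radius.\<close>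
  have good: "\<exists>t\<in>{l<..<r'}. accessible s t"
    if s: "s = 1 \<or> s = -1" and lr: "0 \<le> l" "r' \<le> 2 * pi" and np: "\<not> nonpos_on h s l r'" for s l r'
  proof -
    have sh: "set_integrable lebesgue {0..2 * pi} (\<lambda>x. s * h x)" using hI by simp
    have sub: "{l<..<r'} \<subseteq> {0..2 * pi}" "{l<..<r'} \<subseteq> {0<..<2 * pi}" using lr by auto
    obtain t' c s0 where d: "c > 0" "s0 > 0" "t' \<in> {l<..<r'}" "{t' - s0..t' + s0} \<subseteq> {l<..<r'}"
      "\<And>x. 0 \<le> x \<Longrightarrow> x \<le> s0 \<Longrightarrow> c * x \<le> integral {t' - x..t' + x} (\<lambda>x. s * h x)"
      by (rule exists_positive_symmetric_density[OF sh sub(1) np[unfolded nonpos_on_def]]) blast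
    obtain \<rho>0 where r0: "0 < \<rho>0" "\<rho>0 < 1"
      "\<And>\<rho>. \<rho>0 \<le> \<rho> \<Longrightarrow> \<rho> < 1 \<Longrightarrow> 0 < integral {0..2 * pi} (\<lambda>x. poisson_kernel \<rho> (x - t') * (s * h x))"
      by (rule poisson_radial_positive[OF sh d(1,2) subset_trans[OF d(4) sub(2)] d(5)]) blast+
    have "0 < s * u (of_real (r * \<rho>) * cis t')" if \<rho>: "\<rho>0 \<le> \<rho>" "\<rho> < 1" for \<rho>
    proof -
      define z where "z = of_real (r * \<rho>) * cis t'"
      have \<rho>0': "0 \<le> \<rho>" using \<rho> r0(1) by simp
      have nz: "cmod z = r * \<rho>" using r \<rho>0' by (simp add: z_def norm_mult)
      have z: "z \<in> ball 0 r" using nz r \<rho> by simp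
      have kern: "(r\<^sup>2 - (cmod z)\<^sup>2) / (cmod (e x - z))\<^sup>2 = poisson_kernel \<rho> (x - t')" for x
      proof -
        have "e x - z = of_real r * (cis x - of_real \<rho> * cis t')" by (simp add: e_def z_def algebra_simps)
        hence "(cmod (e x - z))\<^sup>2 = r\<^sup>2 * (1 - 2 * \<rho> * cos (x - t') + \<rho>\<^sup>2)"
          using r by (simp add: norm_mult power_mult_distrib poisson_kernel_norm)
        moreover have "r\<^sup>2 - (cmod z)\<^sup>2 = r\<^sup>2 * (1 - \<rho>\<^sup>2)" by (simp add: nz power_mult_distrib algebra_simps)
        ultimately show ?thesis using r by (simp add: poisson_kernel_def)
      qed
      have "u z = 1 / (2 * pi) * (LINT x:{0..2 * pi}|lebesgue. poisson_kernel \<rho> (x - t') * h x)"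
        unfolding kern[symmetric] by (simp only: g(2)[OF z] poisson_integral_def e_def h_def)
      also have "(LINT x:{0..2 * pi}|lebesgue. poisson_kernel \<rho> (x - t') * h x) = integral {0..2 * pi} (\<lambda>x. poisson_kernel \<rho> (x - t') * h x)"
        by (rule set_lebesgue_integral_eq_integral(2)[OF poisson_kernel_mult_integrable[OF hI \<rho>0' \<rho>(2)]])
      finally have "s * u z = 1 / (2 * pi) * integral {0..2 * pi} (\<lambda>x. s * (poisson_kernel \<rho> (x - t') * h x))"
        by simp
      also have "(\<lambda>x. s * (poisson_kernel \<rho> (x - t') * h x)) = (\<lambda>x. poisson_kernel \<rho> (x - t') * (s * h x))"
        by (simp add: mult_ac)
      finally show ?thesis using r0(3)[OF \<rho>] by (simp add: z_def)
    qed
    hence "accessible s t'" unfolding accessible_def using r0(1,2) by blast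
    thus ?thesis using d(3) by blast
  qed
  have nalt: "\<not> alternates h s (Suc (Suc (2 * n))) 0 (2 * pi)" if s: "s = 1 \<or> s = -1" for s
  proof
    assume "alternates h s (Suc (Suc (2 * n))) 0 (2 * pi)"
    from alternates_points[of h accessible, OF good this s] obtain \<theta> where
      "\<And>i. i < Suc (Suc (2 * n)) \<Longrightarrow> 0 < \<theta> i \<and> \<theta> i < 2 * pi \<and> accessible (s * (-1) ^ i) (\<theta> i)"
      "\<And>i j. i < j \<Longrightarrow> j < Suc (Suc (2 * n)) \<Longrightarrow> \<theta> i < \<theta> j" by auto
    thus False using no_alternation[OF only pZ ch[unfolded mn] ND s, of \<theta>] by simp
  qed
  obtain xs \<epsilon> where xs: "length xs = 2 * n" "set xs \<subseteq> {0..2 * pi}" "\<epsilon> = 1 \<or> \<epsilon> = -1"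
    "AE x in lebesgue. x \<in> {0<..<2 * pi} \<longrightarrow> 0 \<le> \<epsilon> * (h x * (\<Prod>y\<leftarrow>xs. sin ((x - y) / 2)))"
    by (rule cyclic_sign_change_points[OF nalt nalt]) auto
  define as where "as = map \<omega> xs"
  define dn where "dn = (\<lambda>x. of_real (r\<^sup>2) - cnj p * e x)"
  have dn0: "dn x \<noteq> 0" for x unfolding dn_def by (rule disc_map_denom[OF pr]) (simp add: en)
  \<comment> \<open>\<open>\<omega> x - \<omega> y\<close> splits into a factor \<open>A y\<close>,
    the half-angle sine and a factor \<open>Bx\<close> depending on \<open>x\<close>. Since
    \<open>Bx ^ 2 * cnj (\<omega> x)\<close> is positive, the automorphism changes the product of
    sines only by a constant and by the nonnegative function \<open>\<tau>\<close>.\<close>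
  define A where "A = (\<lambda>y. of_real (r * q) * of_real r * 2 * \<i> * cis (y / 2) / dn y)"
  define \<kappa> where "\<kappa> = (\<Prod>y\<leftarrow>xs. A y)"
  define \<tau> where "\<tau> = (\<lambda>x. (1 / (r\<^sup>2 * (cmod (e x - p))\<^sup>2)) ^ n)"
  define T where "T = (\<lambda>x. (\<Prod>y\<leftarrow>xs. sin ((x - y) / 2)) * \<tau> x)"
  have \<tau>0: "\<tau> x \<ge> 0" for x by (simp add: \<tau>_def)
  have A0: "A y \<noteq> 0" for y using r q0 dn0 by (simp add: A_def)
  have \<kappa>0: "\<kappa> \<noteq> 0" unfolding \<kappa>_def using A0 by (induction xs) auto
  have fact: "(\<Prod>b\<leftarrow>as. \<omega> x - b) * cnj (\<omega> x) ^ n = \<kappa> * of_real (T x)" for x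
  proof -
    define Bx where "Bx = cis (x / 2) / dn x"
    have one: "\<omega> x - \<omega> y = A y * of_real (sin ((x - y) / 2)) * Bx" for y
    proof -
      have "\<omega> x - \<omega> y = of_real (r * q) * (e x - e y) / (dn x * dn y)"
        unfolding \<omega>_def W_def dn_def q_def by (rule disc_map_diff[OF pr]) (simp_all add: en)
      also have "e x - e y = of_real r * (2 * \<i> * of_real (sin ((x - y) / 2)) * (cis (x / 2) * cis (y / 2)))"
        unfolding e_def cis_diff_half[symmetric] by (simp add: algebra_simps)
      finally show ?thesis by (simp add: A_def Bx_def mult_ac)
    qed
    have B2: "Bx ^ 2 * cnj (\<omega> x) = of_real (1 / (r\<^sup>2 * (cmod (e x - p))\<^sup>2))"
    proof -
      have ex0: "e x \<noteq> 0" "e x - p \<noteq> 0" using r ep0[of x] by (auto simp: e_def)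
      have dx: "dn x = e x * cnj (e x - p)" unfolding dn_def by (rule disc_map_denom_circle[OF pr en])
      have c2: "cis (x / 2) ^ 2 = e x / of_real r" using r by (simp add: e_def power2_eq_square cis_mult)
      have wx: "cnj (\<omega> x) = of_real r * cnj (e x - p) / (cnj (e x) * (e x - p))"
      proof -
        have "\<omega> x = of_real r * (e x - p) / (e x * cnj (e x - p))"
          unfolding \<omega>_def W_def disc_map_def disc_map_denom_circle[OF pr en] ..
        thus ?thesis by simp
      qed
      have "Bx ^ 2 * cnj (\<omega> x) = (e x / of_real r) / (e x * cnj (e x - p)) ^ 2 * (of_real r * cnj (e x - p) / (cnj (e x) * (e x - p)))"
        unfolding Bx_def power_divide c2 wx dx ..
      also have "\<dots> = 1 / ((e x * cnj (e x)) * ((e x - p) * cnj (e x - p)))"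
      proof -
        have "cnj (e x) \<noteq> 0" "cnj (e x - p) \<noteq> 0" using ex0 by (metis complex_cnj_zero_iff)+
        thus ?thesis using ex0 r by (simp add: power2_eq_square del: complex_cnj_diff)
      qed
      also have "\<dots> = of_real (1 / (r\<^sup>2 * (cmod (e x - p))\<^sup>2))"
        using en[of x] by (simp only: complex_norm_square[symmetric] of_real_mult of_real_divide of_real_1)
      finally show ?thesis .
    qed
    have "(\<Prod>b\<leftarrow>as. \<omega> x - b) = (\<Prod>y\<leftarrow>xs. A y * of_real (sin ((x - y) / 2)) * Bx)"
      unfolding as_def by (simp add: o_def one)
    also have "\<dots> = \<kappa> * of_real (\<Prod>y\<leftarrow>xs. sin ((x - y) / 2)) * Bx ^ (2 * n)"
      unfolding list_product_split xs(1) \<kappa>_def ..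
    finally have "(\<Prod>b\<leftarrow>as. \<omega> x - b) * cnj (\<omega> x) ^ n = \<kappa> * of_real (\<Prod>y\<leftarrow>xs. sin ((x - y) / 2)) * (Bx ^ 2 * cnj (\<omega> x)) ^ n"
      by (simp add: power_mult power_mult_distrib mult.assoc)
    also have "(Bx ^ 2 * cnj (\<omega> x)) ^ n = of_real (\<tau> x)" unfolding B2 \<tau>_def of_real_power ..
    finally show ?thesis by (simp add: T_def mult.assoc)
  qed
  have sgn: "AE x in M0. 0 \<le> \<epsilon> * (k x * T x)"
  proof -
    have "AE x in lebesgue. x \<noteq> (0::real)" "AE x in lebesgue. x \<noteq> 2 * pi"
      by (rule AE_not_in[of "{0}", simplified] AE_not_in[of "{2 * pi}", simplified], simp)+
    hence "AE x in lebesgue. x \<in> {0..2 * pi} \<longrightarrow> 0 \<le> \<epsilon> * (k x * T x)"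
      using xs(4)
    proof eventually_elim
      case (elim x)
      show ?case
      proof
        assume "x \<in> {0..2 * pi}"
        hence "0 \<le> \<epsilon> * (h x * (\<Prod>y\<leftarrow>xs. sin ((x - y) / 2)))" using elim by auto
        from mult_nonneg_nonneg[OF this mult_nonneg_nonneg[OF less_imp_le[OF Kpos] \<tau>0]]
        have "0 \<le> (\<epsilon> * (h x * (\<Prod>y\<leftarrow>xs. sin ((x - y) / 2)))) * (K x * \<tau> x)" .
        thus "0 \<le> \<epsilon> * (k x * T x)" by (simp add: k_def T_def mult_ac)
      qed
    qed
    thus ?thesis unfolding M0_def by (subst AE_restrict_space_iff) auto
  qed
  have mom: "\<mu> j = 0" if "j < n" for j using al[of j] that mn by (auto simp: a_def split: if_splits)
  have a_n: "a n = 2 * \<mu> n" "a (Suc n) = 2 * \<mu> (Suc n)" using n by (auto simp: a_def)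
  have \<mu>n0: "\<mu> n \<noteq> 0" using am mn a_n by auto
  have as1: "cmod b = 1" if "b \<in> set as" for b using that \<omega>1 by (auto simp: as_def)
  have las: "length as = 2 * n" by (simp add: as_def xs(1))
  have ineq: "cmod (\<mu> (Suc n) - (\<Sum>b\<leftarrow>as. cnj b) * \<mu> n) \<le> cmod (cnj (\<mu> n) + prod_list as * \<mu> n)"
    unfolding \<mu>_def
    by (rule moment_inequality[OF kI \<omega>m \<omega>1 as1 las n fact \<kappa>0 xs(3) sgn]) (use mom in \<open>simp_all add: \<mu>_def\<close>)
  have reg: "regular_analytic_curve I \<gamma>" and im: "\<gamma> ` I \<subseteq> Z" using nod unfolding nodal_parametrization_def by auto
  obtain c \<delta> \<rho> where c: "cmod c = 1" "Re (c ^ m) = 0" "\<delta> > 0" "\<And>s. s \<in> ball t \<delta> \<Longrightarrow> \<phi> (\<gamma> s) = of_real (\<rho> s) * c"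
    "c = sgn (deriv \<phi> p * vector_derivative \<gamma> (at t))"
    by (rule curve_in_chart_line[OF reg t(1) ch[folded t(2)]]) (use im Z_iff t(2) in auto)
  note PC = power_chartD[OF ch]
  define v where "v = vector_derivative \<gamma> (at t)"
  have lvl: "v \<noteq> 0" "curvature \<gamma> t = - Im (deriv (deriv \<phi>) p / deriv \<phi> p * sgn v)"
  proof -
    have "Im (cnj c * \<phi> (\<gamma> s)) = 0" if "\<bar>s - t\<bar> < \<delta>" for s
    proof -
      have "s \<in> ball t \<delta>" using that by (simp add: dist_real_def abs_minus_commute)
      thus ?thesis using c(4)[of s] by simp
    qed
    note cl = curvature_level_line[OF reg t(1) PC(3) _ PC(5) _ c(3) this, unfolded t(2)]
    have "c \<noteq> 0" using c(1) by auto
    from cl[OF PC(4) PC(12)[OF PC(4)] _ this] show "v \<noteq> 0" "curvature \<gamma> t = - Im (deriv (deriv \<phi>) p / deriv \<phi> p * sgn v)"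
      unfolding v_def by auto
  qed
  define vh where "vh = sgn v"
  have vh1: "cmod vh = 1" using lvl(1) by (simp add: vh_def norm_sgn)
  \<comment> \<open>In the chart the tangent direction \<open>c\<close> has an imaginary
    \<open>n\<close>-th power. By \<open>d\<phi>\<close>, which gives the \<open>n\<close>-th power
    of the derivative of the chart, this becomes a condition on \<open>\<mu> n\<close> and the
    tangent.\<close>
  have dir: "Re (\<mu> n * vh ^ n) = 0"
  proof -
    define R where "R = (r / q) ^ n * 2 * (cmod v) ^ n / cmod (deriv \<phi> p * v) ^ n"
    have x0: "deriv \<phi> p * v \<noteq> 0" using PC(12)[OF PC(4)] lvl(1) by simp
    have R0: "R \<noteq> 0" using r q0 lvl(1) x0 by (simp add: R_def)
    have vv: "v = of_real (cmod v) * vh" using lvl(1) by (simp add: vh_def sgn_eq)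
    have "c ^ n = (deriv \<phi> p ^ n * v ^ n) / of_real (cmod (deriv \<phi> p * v) ^ n)"
      unfolding c(5) v_def[symmetric] sgn_eq by (simp add: power_divide power_mult_distrib)
    also have "deriv \<phi> p ^ n = of_real ((r / q) ^ n) * (2 * \<mu> n)"
      using d\<phi> mn L0 a_n Wp(2) by simp
    also have "v ^ n = of_real (cmod v ^ n) * vh ^ n" by (subst vv) (simp add: power_mult_distrib)
    finally have "c ^ n = of_real R * (\<mu> n * vh ^ n)" by (simp add: R_def)
    hence "R * Re (\<mu> n * vh ^ n) = 0" using c(2) mn by simp
    thus ?thesis using R0 by simp
  qed
  have bound: "\<bar>Im (\<mu> (Suc n) / \<mu> n * vh)\<bar> \<le> 2 * (real n + 1) * cos (real n * alpha0 n)"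
    by (rule direction_bound[OF as1 las n \<mu>n0 ineq vh1 dir])
  \<comment> \<open>The factors 2 in \<open>a n\<close> and \<open>a (Suc n)\<close> cancel in the
    quotient, as \<open>n \<ge> 1\<close> keeps clear of the coefficient of order 0.\<close>
  have "deriv (deriv \<phi>) p / deriv \<phi> p * vh
      = of_real (2 / q) * (cnj p * vh) + of_real (2 / real n * (r / q)) * (\<mu> (Suc n) / \<mu> n * vh)"
    unfolding dd\<phi> Wp(3) unfolding Wp(2) mn[symmetric, THEN arg_cong[where f = "of_nat :: nat \<Rightarrow> complex"]] L0 L1
    using mn a_n by (simp add: algebra_simps)
  moreover have "Im (of_real a * X + of_real b * Y) = a * Im X + b * Im Y" for a b X Y by simp
  ultimately have "curvature \<gamma> t = - (2 / q * Im (cnj p * vh) + 2 / real n * (r / q) * Im (\<mu> (Suc n) / \<mu> n * vh))"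
    unfolding lvl(2) vh_def[symmetric] by (simp only:)
  moreover have pos: "0 \<le> 2 / q" "0 \<le> 2 / real n * (r / q)" using q0 r by auto
  ultimately have "\<bar>curvature \<gamma> t\<bar> \<le> \<bar>2 / q * Im (cnj p * vh)\<bar> + \<bar>2 / real n * (r / q) * Im (\<mu> (Suc n) / \<mu> n * vh)\<bar>"
    by linarith
  also have "\<dots> = 2 / q * \<bar>Im (cnj p * vh)\<bar> + 2 / real n * (r / q) * \<bar>Im (\<mu> (Suc n) / \<mu> n * vh)\<bar>"
    unfolding abs_mult[of "2 / q"] abs_mult[of "2 / real n * (r / q)"] abs_of_nonneg[OF pos(1)] abs_of_nonneg[OF pos(2)] ..
  also have "\<dots> \<le> 2 / q * cmod p + 2 / real n * (r / q) * (2 * (real n + 1) * cos (real n * alpha0 n))"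
  proof (intro add_mono mult_left_mono bound)
    show "\<bar>Im (cnj p * vh)\<bar> \<le> cmod p" using abs_Im_le_cmod[of "cnj p * vh"] vh1 by (simp add: norm_mult)
  qed (use q0 r in auto)
  also have "\<dots> = curvature_bound n r p"
    using q0 n by (simp add: curvature_bound_def q_def[symmetric] field_simps)
  finally show ?thesis .
qed

subsection \<open>Real parts of holomorphic functions\<close>

text \<open>By the Cauchy-Riemann equations the partial derivatives are \<open>Re\<close> and
  \<open>- Im\<close> of \<open>deriv f\<close>; the same rule for \<open>deriv f\<close> gives
  those of second order.\<close>

lemma harmonic_on_Re_holomorphic:
  assumes f: "f holomorphic_on S" "open S"
  shows "harmonic_on (\<lambda>z. Re (f z)) S"
proof -
  have D: "((\<lambda>z. Re (g z)) has_derivative (\<lambda>h. Re (deriv g z) * Re h + (- Im (deriv g z)) * Im h)) (at z)"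
    "((\<lambda>z. - Im (g z)) has_derivative (\<lambda>h. (- Im (deriv g z)) * Re h + (- Re (deriv g z)) * Im h)) (at z)"
    if "g holomorphic_on S" "z \<in> S" for g z
  proof -
    have d: "(g has_derivative (*) (deriv g z)) (at z)"
      using holomorphic_derivI[OF that(1) f(2) that(2), of UNIV] by (simp add: has_field_derivative_def)
    show "((\<lambda>z. Re (g z)) has_derivative (\<lambda>h. Re (deriv g z) * Re h + (- Im (deriv g z)) * Im h)) (at z)"
      using bounded_linear.has_derivative[OF bounded_linear_Re d] by (simp add: algebra_simps)
    show "((\<lambda>z. - Im (g z)) has_derivative (\<lambda>h. (- Im (deriv g z)) * Re h + (- Re (deriv g z)) * Im h)) (at z)"
      using has_derivative_minus[OF bounded_linear.has_derivative[OF bounded_linear_Im d]] by (simp add: algebra_simps)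
  qed
  have f1: "deriv f holomorphic_on S" by (rule holomorphic_deriv[OF f])
  have c2: "continuous_on S (deriv (deriv f))"
    by (rule holomorphic_on_imp_continuous_on[OF holomorphic_deriv[OF f1 f(2)]])
  show ?thesis unfolding harmonic_on_def
    by (rule conjI[OF f(2)], rule exI[of _ "\<lambda>z. Re (deriv f z)"], rule exI[of _ "\<lambda>z. - Im (deriv f z)"],
        rule exI[of _ "\<lambda>z. Re (deriv (deriv f) z)"], rule exI[of _ "\<lambda>z. - Im (deriv (deriv f) z)"],
        rule exI[of _ "\<lambda>z. - Im (deriv (deriv f) z)"], rule exI[of _ "\<lambda>z. - Re (deriv (deriv f) z)"])
       (use D[OF f(1)] D[OF f1] c2 in \<open>auto intro!: continuous_intros\<close>)
qed

text \<open>Poisson's formula is Cauchy's formula for \<open>f(w) (r\<^sup>2 - |z|\<^sup>2) / (r\<^sup>2 - cnj z w)\<close>.\<close>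

lemma poisson_formula:
  assumes r: "r > 0" and f: "continuous_on (cball 0 r) f" "f holomorphic_on ball 0 r"
  shows "L1_circle r (\<lambda>z. Re (f z))"
    and "z \<in> ball 0 r \<Longrightarrow> Re (f z) = poisson_integral r (\<lambda>z. Re (f z)) z"
proof -
  define e where "e = (\<lambda>t. complex_of_real r * cis t)"
  have en: "cmod (e t) = r" for t using r by (simp add: e_def norm_mult)
  have ce: "continuous_on {0..2 * pi} e" unfolding e_def by (auto simp: cis_conv_exp intro!: continuous_intros)
  have cfe: "continuous_on {0..2 * pi} (\<lambda>t. f (e t))"
    by (rule continuous_on_compose2[OF f(1) ce]) (use en in auto)
  have "set_integrable lebesgue {0..2 * pi} (\<lambda>t. Re (f (e t)))"
    by (rule absolutely_integrable_continuous_real) (intro continuous_intros cfe)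
  thus "L1_circle r (\<lambda>z. Re (f z))" by (simp add: L1_circle_def e_def)
  assume "z \<in> ball 0 r"
  hence z: "cmod z < r" by simp
  define q where "q = r\<^sup>2 - (cmod z)\<^sup>2"
  define d where "d = (\<lambda>w. of_real (r\<^sup>2) - cnj z * w)"
  have d0: "d w \<noteq> 0" if "cmod w \<le> r" for w unfolding d_def by (rule disc_map_denom[OF z that])
  define K where "K = (\<lambda>t. q / (cmod (e t - z))\<^sup>2)"
  have ez: "e t \<noteq> z" for t using en[of t] z by auto
  have cK: "continuous_on {0..2 * pi} K" unfolding K_def using ez by (intro continuous_intros ce) auto
  \<comment> \<open>The factor \<open>q / d w\<close> is 1 at \<open>z\<close>. On the circle
    \<open>d w = w * cnj (w - z)\<close>, and so it turns the Cauchy kernel into the Poisson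
    kernel.\<close>
  define F where "F = (\<lambda>w. f w * (of_real q / d w))"
  have "continuous_on (cball 0 r) F" unfolding F_def d_def
    by (intro continuous_intros f(1)) (use d0 in \<open>auto simp: d_def\<close>)
  moreover have "F holomorphic_on ball 0 r" unfolding F_def d_def
    by (intro holomorphic_intros f(2)) (use d0 in \<open>auto simp: d_def\<close>)
  ultimately have "((\<lambda>w. F w / (w - z)) has_contour_integral (2 * of_real pi * \<i> * F z)) (circlepath 0 r)"
    by (rule Cauchy_integral_circlepath) (use z in simp)
  hence "((\<lambda>t. F (e t) / (e t - z) * r * \<i> * cis t) has_integral 2 * of_real pi * \<i> * F z) {0..2 * pi}"
    unfolding circlepath_def by (subst (asm) has_contour_integral_part_circlepath_iff) (simp_all add: e_def)
  hence "((\<lambda>t. - \<i> * (F (e t) / (e t - z) * r * \<i> * cis t)) has_integral - \<i> * (2 * of_real pi * \<i> * F z)) {0..2 * pi}"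
    by (rule has_integral_mult_right)
  moreover have "- \<i> * (F (e t) / (e t - z) * r * \<i> * cis t) = of_real (K t) * f (e t)" for t
  proof -
    have e0: "e t \<noteq> 0" "e t - z \<noteq> 0" using en[of t] r ez[of t] by auto
    have "F (e t) = f (e t) * (of_real q / (e t * cnj (e t - z)))"
      unfolding F_def d_def disc_map_denom_circle[OF z en] ..
    hence "F (e t) / (e t - z) * e t = f (e t) * (of_real q / ((e t - z) * cnj (e t - z)))"
      using e0 by (simp add: field_simps del: complex_cnj_diff)
    also have "of_real q / ((e t - z) * cnj (e t - z)) = of_real (K t)"
      unfolding complex_norm_square[symmetric] K_def of_real_divide ..
    finally have "F (e t) / (e t - z) * e t = f (e t) * of_real (K t)" .
    moreover have "- \<i> * (F (e t) / (e t - z) * r * \<i> * cis t) = F (e t) / (e t - z) * e t"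
      by (simp add: e_def mult_ac)
    ultimately show ?thesis by (simp add: mult.commute)
  qed
  moreover have "F z = f z"
  proof -
    have "d z = of_real q" unfolding d_def q_def of_real_diff complex_norm_square by (simp add: mult.commute)
    thus ?thesis using d0[of z] z by (simp add: F_def)
  qed
  ultimately have "((\<lambda>t. of_real (K t) * f (e t)) has_integral 2 * of_real pi * f z) {0..2 * pi}"
    by (simp add: algebra_simps)
  from has_integral_linear[OF this bounded_linear_Re]
  have hi: "((\<lambda>t. K t * Re (f (e t))) has_integral 2 * pi * Re (f z)) {0..2 * pi}" by (simp add: o_def)
  have "set_integrable lebesgue {0..2 * pi} (\<lambda>t. K t * Re (f (e t)))"
    by (rule absolutely_integrable_continuous_real) (intro continuous_intros cK cfe)
  hence "(LINT t:{0..2 * pi}|lebesgue. K t * Re (f (e t))) = 2 * pi * Re (f z)"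
    using integral_unique[OF hi] set_lebesgue_integral_eq_integral(2) by metis
  thus "Re (f z) = poisson_integral r (\<lambda>z. Re (f z)) z"
    unfolding poisson_integral_def by (simp add: K_def q_def e_def)
qed

subsection \<open>Level curves that cross all circles upwards\<close>

text \<open>Just after \<open>a\<close> the function is above the level. The first return to the
  level would be reached from above, against the upward crossing there.\<close>

lemma above_of_upward_crossings:
  fixes f :: "real \<Rightarrow> real"
  assumes cont: "continuous_on {a..b} f" and ab: "a < b"
    and up: "\<And>t. t \<in> {a..b} \<Longrightarrow> f t = f a \<Longrightarrow> \<exists>d>0. \<forall>s. s \<noteq> t \<and> \<bar>s - t\<bar> < d \<longrightarrow> 0 < (f s - f a) * (s - t)"
  shows "f a < f b"
proof (rule ccontr)
  assume "\<not> ?thesis"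
  hence fb: "f b \<le> f a" by simp
  obtain d where d: "d > 0" "\<And>s. s \<noteq> a \<Longrightarrow> \<bar>s - a\<bar> < d \<Longrightarrow> 0 < (f s - f a) * (s - a)"
    using up[of a] ab by auto
  define c where "c = min (a + d / 2) b"
  have c: "a < c" "c \<le> b" using d(1) ab by (auto simp: c_def)
  have "0 < (f c - f a) * (c - a)" by (rule d(2)) (use c(1) d(1) in \<open>auto simp: c_def\<close>)
  hence fc: "f a < f c" using c(1) by (simp add: zero_less_mult_iff)
  define S where "S = {s \<in> {c..b}. f s \<le> f a}"
  have cs: "continuous_on {c..b} f" by (rule continuous_on_subset[OF cont]) (use c in auto)
  have "compact S"
  proof -
    have "closed S" unfolding S_def using continuous_closed_preimage[OF cs, of "{..f a}"]
      by (simp add: vimage_def Int_def)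
    thus ?thesis unfolding S_def by (rule compact_eq_bounded_closed[THEN iffD2, OF conjI, rotated])
       (rule bounded_subset[OF bounded_closed_interval], auto)
  qed
  moreover have "S \<noteq> {}" using fb c(2) by (auto simp: S_def)
  ultimately obtain t where t: "t \<in> S" "\<And>s. s \<in> S \<Longrightarrow> t \<le> s" by (rule compact_attains_inf[THEN bexE]) auto
  have tc: "c \<le> t" "t \<le> b" "f t \<le> f a" using t(1) by (auto simp: S_def)
  obtain s where s: "c \<le> s" "s \<le> t" "f s = f a"
    using IVT2'[of f t "f a" c] tc fc continuous_on_subset[OF cs, of "{c..t}"] by auto
  have "s = t" using t(2)[of s] s tc by (auto simp: S_def)
  hence ft: "f t = f a" using s by simp
  hence ct: "c < t" using fc tc by (cases "c = t") auto
  obtain d' where d': "d' > 0" "\<And>s. s \<noteq> t \<Longrightarrow> \<bar>s - t\<bar> < d' \<Longrightarrow> 0 < (f s - f a) * (s - t)"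
    using up[of t] ft c tc by auto
  define x where "x = max c (t - d' / 2)"
  have x: "x < t" "c \<le> x" "\<bar>x - t\<bar> < d'" using ct d'(1) by (auto simp: x_def)
  have "x \<notin> S" using t(2)[of x] x(1) by auto
  hence "f a < f x" using x tc by (auto simp: S_def)
  moreover have "0 < (f x - f a) * (x - t)" by (rule d'(2)) (use x in auto)
  ultimately show False using x(1) by (simp add: zero_less_mult_iff)
qed

text \<open>Off 0, \<open>1 + w * deriv h w\<close> is \<open>w * deriv g w / g w\<close>. Positive
  real part means that at nodal points the modulus of \<open>g\<close> grows in the radial direction
  and its argument with the angle.\<close>

locale radial_map =
  fixes h g :: "complex \<Rightarrow> complex" and n :: nat
  assumes h: "h holomorphic_on ball 0 1" and g: "\<And>w. g w = w * exp (h w)" and n: "n \<ge> 1"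
    and radial: "\<And>w. w \<in> ball 0 1 \<Longrightarrow> w \<noteq> 0 \<Longrightarrow> Re (g w ^ n) = 0 \<Longrightarrow> Re (1 + w * deriv h w) > 0"
begin

definition E :: "real \<Rightarrow> real \<Rightarrow> complex" where "E x \<theta> = exp (Complex x \<theta>)"

text \<open>The lifts of \<open>arg g\<close> and \<open>ln |g|\<close> to logarithmic coordinates.\<close>

definition A :: "real \<Rightarrow> real \<Rightarrow> real" where "A x \<theta> = \<theta> + Im (h (E x \<theta>))"
definition L :: "real \<Rightarrow> real \<Rightarrow> real" where "L x \<theta> = x + Re (h (E x \<theta>))"

lemma E_ball: "x < 0 \<Longrightarrow> E x \<theta> \<in> ball 0 1" and E_nonzero: "E x \<theta> \<noteq> 0" and norm_E: "cmod (E x \<theta>) = exp x"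
  by (auto simp: E_def)

lemma E_shift: "E x (\<theta> + 2 * pi * of_int k) = E x \<theta>"
proof -
  have "Complex x (\<theta> + 2 * pi * of_int k) = Complex x \<theta> + 2 * of_int k * of_real pi * \<i>" by (simp add: complex_eq_iff)
  moreover have "exp (2 * of_int k * of_real pi * \<i>) = 1" using exp_integer_2pi[of "of_int k"] by (simp add: mult_ac)
  ultimately show ?thesis unfolding E_def by (simp only: exp_add mult_1_right)
qed

lemma A_shift: "A x (\<theta> + 2 * pi * of_int k) = A x \<theta> + 2 * pi * of_int k"
  by (simp add: A_def E_shift)

lemma g_E: "g (E x \<theta>) = exp (Complex (L x \<theta>) (A x \<theta>))"
proof -
  have "Complex (L x \<theta>) (A x \<theta>) = Complex x \<theta> + h (E x \<theta>)" by (simp add: complex_eq_iff A_def L_def)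
  thus ?thesis by (simp add: g E_def exp_add)
qed

lemma Re_g_E: "Re (g (E x \<theta>) ^ n) = exp (n * L x \<theta>) * cos (n * A x \<theta>)"
proof -
  have "g (E x \<theta>) ^ n = exp (of_nat n * Complex (L x \<theta>) (A x \<theta>))" by (simp add: g_E exp_of_nat_mult)
  thus ?thesis by (simp add: Re_exp)
qed

lemma h_deriv: "w \<in> ball 0 1 \<Longrightarrow> (h has_field_derivative deriv h w) (at w)"
  by (rule holomorphic_derivI[OF h open_ball])

lemma E_continuous: "continuous_on S (\<lambda>y. E (fst y) (snd y))"
proof -
  have "E (fst y) (snd y) = exp (of_real (fst y) + \<i> * of_real (snd y))" for y
    by (simp add: E_def complex_eq_iff Re_exp Im_exp)
  thus ?thesis by (auto intro!: continuous_intros)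
qed

lemma hE_continuous: "continuous_on ({..<0} \<times> UNIV) (\<lambda>y. h (E (fst y) (snd y)))"
  by (rule continuous_on_compose2[OF holomorphic_on_imp_continuous_on[OF h] E_continuous])
     (use E_ball in force)

lemma hE_continuous_snd:
  assumes "x < 0"
  shows "continuous_on S (\<lambda>\<theta>. h (E x \<theta>))"
proof -
  have "continuous_on S (\<lambda>\<theta>. (x, \<theta>))" by (intro continuous_intros)
  from continuous_on_compose2[OF hE_continuous this] show ?thesis using assms by (simp add: image_subset_iff)
qed

lemma hE_continuous_fst:
  assumes "S \<subseteq> {..<0}" "continuous_on S th"
  shows "continuous_on S (\<lambda>x. h (E x (th x)))"
proof -
  have "continuous_on S (\<lambda>x. (x, th x))" by (intro continuous_intros assms(2))
  moreover have "(\<lambda>x. (x, th x)) ` S \<subseteq> {..<0} \<times> UNIV" using assms(1) by auto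
  ultimately show ?thesis using continuous_on_compose2[OF hE_continuous] by fastforce
qed

lemma log_deriv: "x < 0 \<Longrightarrow> ((\<lambda>z. z + h (exp z)) has_field_derivative 1 + E x \<theta> * deriv h (E x \<theta>)) (at (Complex x \<theta>))"
  using h_deriv[OF E_ball[of x \<theta>]] unfolding E_def
  by (auto intro!: derivative_eq_intros DERIV_chain2[of h])

lemma A_deriv: "x < 0 \<Longrightarrow> (A x has_real_derivative Re (1 + E x \<theta> * deriv h (E x \<theta>))) (at \<theta>)"
proof -
  assume x: "x < 0"
  have "((\<lambda>\<theta>. Complex x \<theta>) has_vector_derivative \<i>) (at \<theta>)"
  proof -
    have "(\<lambda>\<theta>. Complex x \<theta>) = (\<lambda>\<theta>. of_real x + of_real \<theta> * \<i>)" by (auto simp: complex_eq_iff)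
    thus ?thesis by (auto intro!: derivative_eq_intros)
  qed
  from field_vector_diff_chain_at[OF this log_deriv[OF x, of \<theta>]]
  have "((\<lambda>\<theta>. Complex x \<theta> + h (E x \<theta>)) has_vector_derivative \<i> * (1 + E x \<theta> * deriv h (E x \<theta>))) (at \<theta>)"
    by (simp add: o_def E_def)
  from bounded_linear.has_vector_derivative[OF bounded_linear_Im this]
  show ?thesis by (simp add: has_real_derivative_iff_has_vector_derivative A_def[abs_def])
qed

text \<open>When \<open>cos (n * a) = 0\<close>, all points with \<open>A x \<theta> = a\<close> are
  nodal points, so the argument crosses the level \<open>a\<close> only upwards on each
  circle.\<close>

lemma A_above:
  assumes a: "cos (real n * a) = 0" and x: "x < 0" and "A x \<theta> = a" "\<theta> < \<theta>'"
  shows "a < A x \<theta>'"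
proof -
  have "A x \<theta> < A x \<theta>'"
  proof (rule above_of_upward_crossings[OF _ assms(4)])
    show "continuous_on {\<theta>..\<theta>'} (A x)"
      unfolding A_def[abs_def] using hE_continuous_snd[OF x] by (intro continuous_intros)
    fix t assume t: "t \<in> {\<theta>..\<theta>'}" "A x t = A x \<theta>"
    have D: "(A x has_real_derivative Re (1 + E x t * deriv h (E x t))) (at t)" by (rule A_deriv[OF x])
    have pos: "0 < Re (1 + E x t * deriv h (E x t))"
      by (rule radial[OF E_ball[OF x] E_nonzero]) (use t(2) assms(3) a in \<open>simp add: Re_g_E\<close>)
    obtain d1 where d1: "d1 > 0" "\<And>k. k > 0 \<Longrightarrow> k < d1 \<Longrightarrow> A x t < A x (t + k)"
      using DERIV_pos_inc_right[OF D pos] by blast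
    obtain d2 where d2: "d2 > 0" "\<And>k. k > 0 \<Longrightarrow> k < d2 \<Longrightarrow> A x (t - k) < A x t"
      using DERIV_pos_inc_left[OF D pos] by blast
    have "0 < (A x s - A x \<theta>) * (s - t)" if s: "s \<noteq> t" "\<bar>s - t\<bar> < min d1 d2" for s
    proof (cases "t < s")
      case True
      hence "A x t < A x s" using d1(2)[of "s - t"] s by simp
      thus ?thesis using True t(2) by simp
    next
      case False
      hence "A x s < A x t" using d2(2)[of "t - s"] s by simp
      thus ?thesis using False s(1) t(2) by (intro mult_neg_neg) auto
    qed
    thus "\<exists>d>0. \<forall>s. s \<noteq> t \<and> \<bar>s - t\<bar> < d \<longrightarrow> 0 < (A x s - A x \<theta>) * (s - t)"
      using d1(1) d2(1) by (intro exI[of _ "min d1 d2"]) auto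
  qed
  thus ?thesis using assms(3) by simp
qed

text \<open>Turning back by full circles lowers \<open>A x\<close> without bound, so the
  intermediate value theorem applies.\<close>

lemma A_solution_below:
  assumes x: "x < 0" and "a \<le> A x \<theta>"
  obtains \<theta>' where "\<theta>' \<le> \<theta>" "A x \<theta>' = a"
proof -
  obtain k :: nat where "A x \<theta> - a < real k" using reals_Archimedean2 by blast
  moreover have "real k \<le> 2 * pi * real k" using pi_gt3 by (intro mult_le_cancel_right1[THEN iffD2]) auto
  ultimately have "A x (\<theta> + 2 * pi * of_int (- int k)) \<le> a" unfolding A_shift by simp
  moreover have "continuous_on {\<theta> + 2 * pi * of_int (- int k)..\<theta>} (A x)"
    unfolding A_def[abs_def] using hE_continuous_snd[OF x] by (intro continuous_intros)
  ultimately show ?thesis using IVT'[of "A x" "\<theta> + 2 * pi * of_int (- int k)" a \<theta>] assms(2) that by auto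
qed

lemma A_below:
  assumes a: "cos (real n * a) = 0" and x: "x < 0" and "A x \<theta> = a" "\<theta>' < \<theta>"
  shows "A x \<theta>' < a"
proof (rule ccontr)
  assume "\<not> ?thesis"
  then obtain \<theta>0 where "\<theta>0 \<le> \<theta>'" "A x \<theta>0 = a" using A_solution_below[OF x, of a \<theta>'] by auto
  thus False using A_above[OF a x, of \<theta>0 \<theta>] assms(3,4) by simp
qed

lemma A_solution:
  assumes x: "x < 0"
  shows "\<exists>\<theta>. A x \<theta> = a"
proof -
  obtain k :: nat where "a - A x 0 < real k" using reals_Archimedean2 by blast
  moreover have "real k \<le> 2 * pi * real k" using pi_gt3 by (intro mult_le_cancel_right1[THEN iffD2]) auto
  ultimately have "a \<le> A x (0 + 2 * pi * of_int (int k))" unfolding A_shift by simp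
  thus ?thesis using A_solution_below[OF x] by metis
qed

text \<open>Each circle meets the level exactly once, so the level set is a graph over the radius,
  and squeezing between nearby angles shows that it is continuous. In logarithmic coordinates the
  image of the graph has constant imaginary part. Hence the real part of the difference quotient
  along it has the sign of \<open>(m x - m t) * (x - t)\<close>, and it tends to
  \<open>Re D > 0\<close>.\<close>

lemma level_curve:
  assumes a: "cos (real n * a) = 0"
  obtains th where "\<And>x. x < 0 \<Longrightarrow> A x (th x) = a" "\<And>x \<theta>. x < 0 \<Longrightarrow> A x \<theta> = a \<Longrightarrow> \<theta> = th x"
    "continuous_on {..<0} (\<lambda>x. L x (th x))" "\<And>x y. x < y \<Longrightarrow> y < 0 \<Longrightarrow> L x (th x) < L y (th y)"
proof -
  define th where "th = (\<lambda>x. SOME \<theta>. A x \<theta> = a)"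
  have th: "A x (th x) = a" if "x < 0" for x unfolding th_def by (rule someI_ex[OF A_solution[OF that]])
  have uniq: "\<theta> = th x" if "x < 0" "A x \<theta> = a" for x \<theta>
    using A_above[OF a that, of "th x"] A_below[OF a that, of "th x"] th[OF that(1)] by force
  have cth: "isCont th x0" if x0: "x0 < 0" for x0
  proof -
    have ev: "\<forall>\<^sub>F x in at x0. \<bar>th x - th x0\<bar> < e" if e: "e > 0" for e
    proof -
      have cA: "(\<lambda>x. A x \<theta>) \<midarrow>x0\<rightarrow> A x0 \<theta>" for \<theta>
      proof -
        have "continuous_on {..<0} (\<lambda>x. A x \<theta>)" unfolding A_def
          by (intro continuous_intros hE_continuous_fst) auto
        thus ?thesis using x0 by (simp add: continuous_on_eq_continuous_at isCont_def)
      qed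
      have "A x0 (th x0 - e) < a" using A_below[OF a x0 th[OF x0], of "th x0 - e"] e by simp
      hence 1: "\<forall>\<^sub>F x in at x0. A x (th x0 - e) < a" by (rule order_tendstoD(2)[OF cA])
      have "a < A x0 (th x0 + e)" using A_above[OF a x0 th[OF x0], of "th x0 + e"] e by simp
      hence 2: "\<forall>\<^sub>F x in at x0. a < A x (th x0 + e)" by (rule order_tendstoD(1)[OF cA])
      have 3: "\<forall>\<^sub>F x in at x0. x < 0" using x0 by (intro order_tendstoD(2)[OF tendsto_ident_at])
      show ?thesis using 1 2 3
      proof eventually_elim
        case (elim x)
        have "\<not> th x \<le> th x0 - e" using A_above[OF a elim(3) th[OF elim(3)], of "th x0 - e"] th[OF elim(3)] elim(1)
          by (cases "th x = th x0 - e") auto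
        moreover have "\<not> th x0 + e \<le> th x" using A_below[OF a elim(3) th[OF elim(3)], of "th x0 + e"] th[OF elim(3)] elim(2)
          by (cases "th x = th x0 + e") auto
        ultimately show ?case by (simp add: abs_less_iff)
      qed
    qed
    thus ?thesis by (simp add: isCont_def tendsto_iff dist_real_def)
  qed
  hence cth': "continuous_on {..<0} th" by (simp add: continuous_on_eq_continuous_at)
  define m where "m = (\<lambda>x. L x (th x))"
  have cm: "continuous_on {..<0} m" unfolding m_def L_def by (intro continuous_intros hE_continuous_fst cth') auto
  have loc: "\<exists>d>0. \<forall>s. s \<noteq> t \<and> \<bar>s - t\<bar> < d \<longrightarrow> 0 < (m s - m t) * (s - t)" if t: "t < 0" for t
  proof -
    define \<Omega> where "\<Omega> = (\<lambda>x. Complex x (th x))"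
    define D where "D = 1 + E t (th t) * deriv h (E t (th t))"
    have D: "0 < Re D" unfolding D_def
      by (rule radial[OF E_ball[OF t] E_nonzero]) (use th[OF t] a in \<open>simp add: Re_g_E\<close>)
    have \<Phi>: "\<Omega> x + h (exp (\<Omega> x)) = Complex (m x) a" if "x < 0" for x
      using th[OF that] by (simp add: complex_eq_iff \<Omega>_def m_def L_def A_def E_def)
    have "((\<lambda>z. (z + h (exp z) - (\<Omega> t + h (exp (\<Omega> t)))) / (z - \<Omega> t)) \<longlongrightarrow> D) (at (\<Omega> t))"
      using log_deriv[OF t, of "th t"] by (simp add: has_field_derivative_iff D_def \<Omega>_def)
    moreover have "filterlim \<Omega> (at (\<Omega> t)) (at t)"
      unfolding filterlim_at
    proof
      show "\<forall>\<^sub>F x in at t. \<Omega> x \<in> UNIV \<and> \<Omega> x \<noteq> \<Omega> t" by (auto simp: eventually_at_filter \<Omega>_def)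
      show "(\<Omega> \<longlongrightarrow> \<Omega> t) (at t)" unfolding \<Omega>_def
        using cth[OF t] by (intro tendsto_Complex tendsto_ident_at) (simp add: isCont_def)
    qed
    ultimately have "((\<lambda>x. (\<Omega> x + h (exp (\<Omega> x)) - (\<Omega> t + h (exp (\<Omega> t)))) / (\<Omega> x - \<Omega> t)) \<longlongrightarrow> D) (at t)"
      by (rule filterlim_compose)
    hence "\<forall>\<^sub>F x in at t. 0 < Re ((\<Omega> x + h (exp (\<Omega> x)) - (\<Omega> t + h (exp (\<Omega> t)))) / (\<Omega> x - \<Omega> t))"
      by (rule order_tendstoD(1)[OF tendsto_Re D])
    moreover have "\<forall>\<^sub>F x in at t. x < 0" using t by (intro order_tendstoD(2)[OF tendsto_ident_at])
    ultimately have "\<forall>\<^sub>F x in at t. 0 < (m x - m t) * (x - t)"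
    proof eventually_elim
      case (elim x)
      have "Re (Complex (m x - m t) 0 / (\<Omega> x - \<Omega> t)) > 0"
        using elim(1) unfolding \<Phi>[OF elim(2)] \<Phi>[OF t] by (simp add: complex_diff)
      hence "0 < ((m x - m t) * (x - t)) / (cmod (\<Omega> x - \<Omega> t))\<^sup>2"
        by (simp add: Re_divide cmod_power2 \<Omega>_def)
      thus ?case by (simp add: zero_less_divide_iff)
    qed
    thus ?thesis unfolding eventually_at by (auto simp: dist_real_def)
  qed
  have "m x < m y" if "x < y" "y < 0" for x y
  proof (rule above_of_upward_crossings[OF _ that(1)])
    show "continuous_on {x..y} m" by (rule continuous_on_subset[OF cm]) (use that in auto)
    fix t assume "t \<in> {x..y}" "m t = m x"
    thus "\<exists>d>0. \<forall>s. s \<noteq> t \<and> \<bar>s - t\<bar> < d \<longrightarrow> 0 < (m s - m x) * (s - t)" using loc[of t] that by simp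
  qed
  thus ?thesis using that[OF th uniq] cm unfolding m_def by blast
qed

lemma polar:
  assumes "w \<in> ball 0 1" "w \<noteq> 0"
  obtains x \<theta> where "x < 0" "w = E x \<theta>"
proof
  show "ln (cmod w) < 0" using assms by simp
  have "w = exp (Ln w)" using assms(2) by simp
  also have "Ln w = Complex (ln (cmod w)) (Im (Ln w))" using assms(2) by (simp add: complex_eq_iff)
  finally show "w = E (ln (cmod w)) (Im (Ln w))" by (simp add: E_def)
qed

text \<open>After a shift of the angle by a multiple of \<open>2 * pi\<close>, points with equal
  values lie on the same level curve, along which \<open>L\<close> is strictly increasing.\<close>

lemma g_inj:
  assumes w: "w1 \<in> ball 0 1" "w2 \<in> ball 0 1" and eq: "g w1 = g w2" and Z: "Re (g w1 ^ n) = 0"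
  shows "w1 = w2"
proof (cases "w1 = 0 \<or> w2 = 0")
  case True
  thus ?thesis using eq by (auto simp: g)
next
  case False
  obtain x \<theta> where x: "x < 0" "w1 = E x \<theta>" using polar[OF w(1)] False by auto
  obtain y \<phi>0 where y: "y < 0" "w2 = E y \<phi>0" using polar[OF w(2)] False by auto
  have "exp (Complex (L x \<theta>) (A x \<theta>)) = exp (Complex (L y \<phi>0) (A y \<phi>0))"
    using eq unfolding x y g_E .
  then obtain k :: int where k: "Complex (L x \<theta>) (A x \<theta>) = Complex (L y \<phi>0) (A y \<phi>0) + of_int (2 * k) * of_real pi * \<i>"
    unfolding exp_eq by auto
  define \<phi> where "\<phi> = \<phi>0 + 2 * pi * of_int k"
  have LA: "L x \<theta> = L y \<phi>" "A x \<theta> = A y \<phi>"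
    using k unfolding \<phi>_def A_shift L_def E_shift by (auto simp: complex_eq_iff L_def)
  have a: "cos (n * A x \<theta>) = 0" using Z unfolding x Re_g_E by simp
  obtain th where th: "\<And>x' \<theta>'. x' < 0 \<Longrightarrow> A x' \<theta>' = A x \<theta> \<Longrightarrow> \<theta>' = th x'"
    "\<And>x y. x < y \<Longrightarrow> y < 0 \<Longrightarrow> L x (th x) < L y (th y)"
    using level_curve[OF a] by metis
  have e: "\<theta> = th x" "\<phi> = th y" using th(1)[OF x(1), of \<theta>] th(1)[OF y(1), of \<phi>] LA by auto
  have "x = y" using th(2)[of x y] th(2)[of y x] x(1) y(1) LA(1) e by (cases x y rule: linorder_cases) auto
  thus ?thesis using e x(2) y(2) E_shift[of y \<phi>0 k] by (simp add: \<phi>_def)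
qed

text \<open>Moving inwards along the level curve through \<open>w\<close>, the function
  \<open>L\<close> falls below every bound and so takes every value below the one at
  \<open>w\<close>.\<close>

lemma g_radial_range:
  assumes w: "w \<in> ball 0 1" and Z: "Re (g w ^ n) = 0" and s: "0 \<le> s" "s \<le> 1"
  obtains w' where "cmod w' \<le> cmod w" "g w' = of_real s * g w"
proof (cases "w = 0 \<or> s = 0")
  case True
  thus ?thesis using that[of 0] by (auto simp: g)
next
  case False
  obtain x \<theta> where x: "x < 0" "w = E x \<theta>" using polar[OF w] False by auto
  have a: "cos (n * A x \<theta>) = 0" using Z unfolding x Re_g_E by simp
  obtain th where th: "\<And>x'. x' < 0 \<Longrightarrow> A x' (th x') = A x \<theta>" "\<And>x' \<theta>'. x' < 0 \<Longrightarrow> A x' \<theta>' = A x \<theta> \<Longrightarrow> \<theta>' = th x'"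
    "continuous_on {..<0} (\<lambda>x. L x (th x))"
    using level_curve[OF a] by metis
  have e: "\<theta> = th x" by (rule th(2)[OF x(1) refl])
  have "compact (h ` cball 0 (cmod w))"
    by (intro compact_continuous_image continuous_on_subset[OF holomorphic_on_imp_continuous_on[OF h]]) (use w in auto)
  hence "bounded (h ` cball 0 (cmod w))" by (rule compact_imp_bounded)
  then obtain B where "\<forall>y\<in>h ` cball 0 (cmod w). cmod y \<le> B" unfolding bounded_iff by blast
  hence B: "cmod (h z) \<le> B" if "cmod z \<le> cmod w" for z using that by simp
  define \<tau> where "\<tau> = L x \<theta> + ln s"
  \<comment> \<open>On the closed disc of radius \<open>cmod w\<close> the function \<open>h\<close>
    is bounded by \<open>B\<close>, which makes \<open>L\<close> at most \<open>\<tau>\<close> at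
    this depth.\<close>
  define y where "y = min x (\<tau> - B)"
  have y: "y \<le> x" "y \<le> \<tau> - B" "y < 0" using x(1) by (auto simp: y_def)
  have "cmod (h (E y (th y))) \<le> B" by (rule B) (use y(1) x(2) in \<open>simp add: norm_E\<close>)
  hence "L y (th y) \<le> \<tau>" using y(2) complex_Re_le_cmod[of "h (E y (th y))"] unfolding L_def by linarith
  moreover have "\<tau> \<le> L x (th x)" using s False e by (simp add: \<tau>_def)
  moreover have "continuous_on {y..x} (\<lambda>x. L x (th x))" by (rule continuous_on_subset[OF th(3)]) (use x(1) in auto)
  ultimately obtain x' where x': "y \<le> x'" "x' \<le> x" "L x' (th x') = \<tau>"
    using IVT'[of "\<lambda>x. L x (th x)" y \<tau> x] y(1) by auto
  show ?thesis
  proof (rule that)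
    show "cmod (E x' (th x')) \<le> cmod w" using x' x(2) by (simp add: norm_E)
    have "Complex \<tau> (A x \<theta>) = of_real (ln s) + Complex (L x \<theta>) (A x \<theta>)" by (simp add: complex_eq_iff \<tau>_def)
    moreover have "exp (complex_of_real (ln s)) = of_real s" using s False exp_of_real[of "ln s", where 'a = complex] by simp
    ultimately show "g (E x' (th x')) = of_real s * g w"
      unfolding x(2) g_E x'(3) using th(1)[of x'] x'(2) x(1) by (simp add: exp_add)
  qed
qed

end

subsection \<open>Nodal sets of powers of injective functions\<close>

text \<open>\<open>g\<close> identifies the nodal set with a part of the \<open>n\<close> lines
  \<open>Re (w ^ n) = 0\<close> that is star-shaped about 0, and \<open>regular\<close> makes the
  inverse along each line analytic.\<close>

locale nodal_power =
  fixes g :: "complex \<Rightarrow> complex" and D :: "complex set" and n :: nat and p :: complex and u :: "complex \<Rightarrow> real"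
  assumes g: "g holomorphic_on D" and D: "open D" "p \<in> D" and gp: "g p = 0" "deriv g p \<noteq> 0" and n: "n \<ge> 1"
    and u: "\<And>z. z \<in> D \<Longrightarrow> u z = Re (g z ^ n)"
    and regular: "\<And>z. z \<in> nodal_set u D \<Longrightarrow> deriv g z \<noteq> 0" and inj: "inj_on g (nodal_set u D)"
    and star: "\<And>z s. z \<in> nodal_set u D \<Longrightarrow> 0 \<le> s \<Longrightarrow> s \<le> 1 \<Longrightarrow> \<exists>z'\<in>nodal_set u D. g z' = of_real s * g z"
begin

abbreviation "Z \<equiv> nodal_set u D"

lemma Z_iff: "z \<in> Z \<longleftrightarrow> z \<in> D \<and> Re (g z ^ n) = 0"
  using u by (auto simp: nodal_set_def)

lemma p_in_Z: "p \<in> Z"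
  using D(2) gp(1) n by (simp add: Z_iff power_0_left)

text \<open>\<open>w\<close> stands for the square of a direction, so this is the preimage of both
  rays of a line.\<close>

definition branch :: "complex \<Rightarrow> complex set" where
  "branch w = {z \<in> Z. \<exists>s::real. (g z)\<^sup>2 = of_real (s\<^sup>2) * w}"

definition params :: "complex \<Rightarrow> real set" where
  "params c = {s. \<exists>z\<in>Z. g z = of_real s * c}"

definition branch_param :: "complex \<Rightarrow> real \<Rightarrow> complex" where
  "branch_param c s = inv_into Z g (of_real s * c)"

lemma branch_param:
  assumes "s \<in> params c"
  shows "branch_param c s \<in> Z" "g (branch_param c s) = of_real s * c"
proof -
  have "of_real s * c \<in> g ` Z" using assms by (force simp: params_def)
  thus "branch_param c s \<in> Z" "g (branch_param c s) = of_real s * c"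
    unfolding branch_param_def by (auto intro: inv_into_into f_inv_into_f)
qed

lemma branch_param_eq: "z \<in> Z \<Longrightarrow> g z = of_real s * c \<Longrightarrow> s \<in> params c \<and> branch_param c s = z"
  using inv_into_f_f[OF inj, of z] by (auto simp: branch_param_def params_def)

lemma branch_param_0: "0 \<in> params c" "branch_param c 0 = p"
  using branch_param_eq[OF p_in_Z, of 0 c] gp(1) by auto

text \<open>\<open>g\<close> is locally invertible at nodal points. The local inverse along the line
  stays in the nodal set because \<open>of_real s * c\<close> has an imaginary \<open>n\<close>-th
  power, and injectivity of \<open>g\<close> identifies it with \<open>branch_param\<close>.\<close>

lemma branch_param_local:
  assumes c: "Re (c ^ n) = 0" and s0: "s0 \<in> params c"
  obtains F e where "e > 0" "F holomorphic_on ball (of_real s0) e" "c \<noteq> 0 \<Longrightarrow> deriv F (of_real s0) \<noteq> 0"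
    "\<And>s. \<bar>s - s0\<bar> < e \<Longrightarrow> s \<in> params c \<and> branch_param c s = F (of_real s)"
proof -
  define z0 where "z0 = branch_param c s0"
  have z0: "z0 \<in> Z" "g z0 = of_real s0 * c" "z0 \<in> D" using branch_param[OF s0] by (auto simp: z0_def Z_iff)
  define \<phi> where "\<phi> = (\<lambda>z. g z - g z0)"
  have "(\<phi> has_field_derivative deriv g z0) (at z0)"
    unfolding \<phi>_def using holomorphic_derivI[OF g D(1) z0(3)] by (auto intro!: derivative_eq_intros)
  hence d\<phi>: "deriv \<phi> z0 \<noteq> 0" using regular[OF z0(1)] by (simp add: DERIV_imp_deriv)
  have \<phi>: "\<phi> holomorphic_on D" "\<phi> z0 = 0" "\<And>z. z \<in> D \<Longrightarrow> g z = g z0 + \<phi> z ^ 1"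
    unfolding \<phi>_def by (auto intro!: holomorphic_intros g)
  obtain \<psi> N d where ch: "power_chart g z0 1 \<phi> \<psi> N d" "N \<subseteq> D"
    by (rule power_chartI[OF \<phi>(1) D(1) z0(3) \<phi>(2) d\<phi> order_refl \<phi>(3)]) blast
  note C = power_chartD[OF ch(1)]
  define e where "e = d / (1 + cmod c)"
  have e: "e > 0" using C(2) by (simp add: e_def add_pos_nonneg)
  define F where "F = (\<lambda>\<zeta>. \<psi> ((\<zeta> - of_real s0) * c))"
  have inb: "(\<zeta> - of_real s0) * c \<in> ball 0 d" if "\<zeta> \<in> ball (of_real s0) e" for \<zeta>
  proof -
    have "cmod (\<zeta> - of_real s0) < e" using that by (simp add: dist_norm norm_minus_commute)
    hence "cmod (\<zeta> - of_real s0) * cmod c \<le> cmod (\<zeta> - of_real s0) * (1 + cmod c)" by (intro mult_left_mono) auto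
    also have "\<dots> < e * (1 + cmod c)" using \<open>cmod (\<zeta> - of_real s0) < e\<close> by (intro mult_strict_right_mono add_pos_nonneg) auto
    also have "\<dots> = d" by (simp add: e_def add_pos_nonneg pos_add_strict less_imp_neq[symmetric])
    finally show ?thesis by (simp add: norm_mult)
  qed
  show ?thesis
  proof (rule that[OF e, of F])
    have "(\<psi> \<circ> (\<lambda>\<zeta>. (\<zeta> - of_real s0) * c)) holomorphic_on ball (of_real s0) e"
      by (rule holomorphic_on_compose_gen[OF _ C(6)]) (use inb in \<open>auto intro!: holomorphic_intros\<close>)
    thus "F holomorphic_on ball (of_real s0) e" by (simp add: F_def o_def)
    have lin: "((\<lambda>\<zeta>. (\<zeta> - of_real s0) * c) has_field_derivative c) (at (of_real s0))"
      by (auto intro!: derivative_eq_intros)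
    have "(F has_field_derivative deriv \<psi> 0 * c) (at (of_real s0))" unfolding F_def
      by (rule DERIV_chain2[where g = "\<lambda>\<zeta>. (\<zeta> - of_real s0) * c", OF _ lin])
         (use holomorphic_derivI[OF C(6) open_ball, of 0] C(2) in simp)
    thus "deriv F (of_real s0) \<noteq> 0" if "c \<noteq> 0" using C(13)[of 0] C(2) that by (simp add: DERIV_imp_deriv)
    fix s assume s: "\<bar>s - s0\<bar> < e"
    have "of_real s \<in> ball (complex_of_real s0) e"
      using s by (simp add: dist_norm abs_minus_commute flip: of_real_diff)
    note b = inb[OF this]
    define z where "z = F (of_real s)"
    have zN: "z \<in> N" using C(9)[OF b] by (simp add: z_def F_def)
    have "\<phi> z = (of_real s - of_real s0) * c" using C(11)[OF b] by (simp add: z_def F_def)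
    hence gz: "g z = of_real s * c" using z0(2) by (simp add: \<phi>_def algebra_simps)
    have "g z ^ n = of_real (s ^ n) * c ^ n" by (simp add: gz power_mult_distrib)
    hence "Re (g z ^ n) = 0" using c by (simp del: of_real_power)
    hence "z \<in> Z" using zN ch(2) by (auto simp: Z_iff)
    thus "s \<in> params c \<and> branch_param c s = F (of_real s)" using branch_param_eq[OF _ gz] by (simp add: z_def)
  qed
qed

lemma params_interval: "is_interval (params c)"
proof -
  have st: "k * s \<in> params c" if s: "s \<in> params c" and k: "0 \<le> k" "k \<le> 1" for k s
  proof -
    obtain z where z: "z \<in> Z" "g z = of_real s * c" using s by (auto simp: params_def)
    obtain z' where "z' \<in> Z" "g z' = of_real k * g z" using star[OF z(1) k] by blast
    thus ?thesis using z(2) by (auto simp: params_def intro!: bexI[of _ z'])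
  qed
  show ?thesis unfolding is_interval_1
  proof (intro ballI allI impI)
    fix a b x assume ab: "a \<in> params c" "b \<in> params c" and x: "a \<le> x \<and> x \<le> b"
    consider "x = 0" | "x > 0" | "x < 0" by linarith
    thus "x \<in> params c"
    proof cases
      case 2
      thus ?thesis using st[OF ab(2), of "x / b"] x by (simp add: divide_le_eq)
    next
      case 3
      thus ?thesis using st[OF ab(1), of "x / a"] x by (simp add: divide_le_eq zero_le_divide_iff)
    qed (use branch_param_0 in simp)
  qed
qed

lemma branch_param_regular:
  assumes c: "Re (c ^ n) = 0" "c \<noteq> 0"
  shows "regular_analytic_curve (params c) (branch_param c)"
proof (rule regular_analytic_curveI)
  show "open (params c)" unfolding open_dist
  proof
    fix s0 assume "s0 \<in> params c"
    then obtain e where "e > 0" "\<And>s. \<bar>s - s0\<bar> < e \<Longrightarrow> s \<in> params c"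
      using branch_param_local[OF c(1)] by metis
    thus "\<exists>e>0. \<forall>s. dist s s0 < e \<longrightarrow> s \<in> params c" by (auto simp: dist_real_def)
  qed
  fix s0 assume s0: "s0 \<in> params c"
  obtain F e where "e > 0" "F holomorphic_on ball (of_real s0) e" "c \<noteq> 0 \<Longrightarrow> deriv F (of_real s0) \<noteq> 0"
    "\<And>s. \<bar>s - s0\<bar> < e \<Longrightarrow> s \<in> params c \<and> branch_param c s = F (of_real s)"
    by (rule branch_param_local[OF c(1) s0]) blast
  thus "\<exists>F e. e > 0 \<and> F holomorphic_on ball (of_real s0) e \<and> deriv F (of_real s0) \<noteq> 0 \<and>
           (\<forall>s\<in>params c. \<bar>s - s0\<bar> < e \<longrightarrow> branch_param c s = F (of_real s))"
    using c(2) by blast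
qed (use params_interval branch_param_0 in auto)

lemma branch_param_image:
  assumes c: "cmod c = 1"
  shows "branch_param c ` params c = branch (c\<^sup>2)"
proof
  show "branch_param c ` params c \<subseteq> branch (c\<^sup>2)"
    using branch_param by (auto simp: branch_def power_mult_distrib)
  show "branch (c\<^sup>2) \<subseteq> branch_param c ` params c"
  proof
    fix z assume "z \<in> branch (c\<^sup>2)"
    then obtain s :: real where z: "z \<in> Z" "(g z)\<^sup>2 = of_real (s\<^sup>2) * c\<^sup>2" by (auto simp: branch_def)
    have "(g z)\<^sup>2 = (of_real s * c)\<^sup>2" using z(2) by (simp add: power_mult_distrib)
    hence "g z = of_real s * c \<or> g z = of_real (-s) * c" by (simp add: power2_eq_iff)
    thus "z \<in> branch_param c ` params c" using branch_param_eq[OF z(1)] by (metis imageI)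
  qed
qed

lemma branch_Int:
  assumes "cmod w1 = 1" "cmod w2 = 1" "w1 \<noteq> w2"
  shows "branch w1 \<inter> branch w2 \<subseteq> {p}"
proof
  fix z assume "z \<in> branch w1 \<inter> branch w2"
  then obtain s1 s2 :: real where z: "z \<in> Z" "(g z)\<^sup>2 = of_real (s1\<^sup>2) * w1" "(g z)\<^sup>2 = of_real (s2\<^sup>2) * w2"
    by (auto simp: branch_def)
  have "cmod ((g z)\<^sup>2) = s1\<^sup>2" unfolding z(2) norm_mult assms(1) norm_of_real by simp
  moreover have "cmod ((g z)\<^sup>2) = s2\<^sup>2" unfolding z(3) norm_mult assms(2) norm_of_real by simp
  ultimately have "s1\<^sup>2 = s2\<^sup>2" by simp
  hence "of_real (s1\<^sup>2) * w1 = of_real (s1\<^sup>2) * w2" using z(2,3) by metis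
  hence "s1 = 0" using assms(3) by simp
  hence "g z = g p" using z(2) gp(1) by simp
  thus "z \<in> {p}" using inj_onD[OF inj _ z(1) p_in_Z] by simp
qed

text \<open>At \<open>p\<close> the map \<open>g\<close> is a chart, and a regular curve follows one
  of its lines. Elsewhere \<open>g (\<delta> s) / b\<close> is near 1 with real \<open>n\<close>-th
  power, so it is real and \<open>g (\<delta> s)\<close> stays on the line of
  \<open>b\<close>.\<close>

lemma curve_near_in_branch:
  assumes reg: "regular_analytic_curve J \<delta>" and im: "\<delta> ` J \<subseteq> Z" and t: "t \<in> J"
  obtains w e where "w ^ n = -1" "cmod w = 1" "e > 0" "ball t e \<subseteq> J" "\<And>s. s \<in> ball t e \<Longrightarrow> \<delta> s \<in> branch w"
proof (cases "\<delta> t = p")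
  case True
  obtain \<psi> N d where ch: "power_chart (\<lambda>z. g z ^ n) p n g \<psi> N d" "N \<subseteq> D"
    by (rule power_chartI[OF g D gp n, of "\<lambda>z. g z ^ n"]) (use gp(1) n in \<open>auto simp: power_0_left\<close>)
  obtain c e \<rho> where c: "cmod c = 1" "Re (c ^ n) = 0" "e > 0" "ball t e \<subseteq> J"
    "\<And>s. s \<in> ball t e \<Longrightarrow> g (\<delta> s) = of_real (\<rho> s) * c"
    by (rule curve_in_chart_line[OF reg t ch(1)[folded True]]) (use im Z_iff in auto)
  show ?thesis
  proof (rule that[OF sq_direction[OF c(1,2)] _ c(3,4)])
    show "cmod (c\<^sup>2) = 1" by (simp add: norm_power c(1))
    show "\<delta> s \<in> branch (c\<^sup>2)" if "s \<in> ball t e" for s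
    proof -
      have "\<delta> s \<in> Z" using im c(4) that by blast
      thus ?thesis using c(5)[OF that] by (auto simp: branch_def power_mult_distrib intro!: exI[of _ "\<rho> s"])
    qed
  qed
next
  case False
  have dZ: "\<delta> s \<in> Z" if "s \<in> J" for s using im that by auto
  define b where "b = g (\<delta> t)"
  have b: "b \<noteq> 0" using inj_onD[OF inj _ dZ[OF t] p_in_Z] False gp(1) by (auto simp: b_def)
  define c where "c = sgn b"
  have c: "cmod c = 1" "b = of_real (cmod b) * c" using b by (simp add: c_def norm_sgn) (simp add: c_def sgn_eq b)
  have "b ^ n = of_real (cmod b ^ n) * c ^ n" by (subst c(2)) (simp add: power_mult_distrib)
  moreover have Reb: "Re (b ^ n) = 0" using dZ[OF t] by (simp add: Z_iff b_def)
  ultimately have Rc: "Re (c ^ n) = 0" using b by (simp del: of_real_power)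
  obtain dl where dl: "dl > 0" "\<And>x. cmod (x - 1) < dl \<Longrightarrow> Im (x ^ n) = 0 \<Longrightarrow> Im x = 0 \<and> Re x > 0"
    using real_powers_near_1[OF n] by blast
  have cg: "continuous_on J (\<lambda>s. g (\<delta> s) / b)"
    by (intro continuous_intros b continuous_on_compose2[OF holomorphic_on_imp_continuous_on[OF g] regular_analytic_curve_continuous[OF reg]])
       (use dZ Z_iff b in auto)
  have oJ: "open J" using reg by (simp add: regular_analytic_curve_def)
  have "isCont (\<lambda>s. g (\<delta> s) / b) t" using cg oJ t by (simp add: continuous_on_eq_continuous_at)
  then obtain e1 where e1: "e1 > 0" "\<And>s. dist s t < e1 \<Longrightarrow> dist (g (\<delta> s) / b) (g (\<delta> t) / b) < dl"
    unfolding continuous_at_eps_delta using dl(1) by blast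
  obtain e2 where e2: "e2 > 0" "ball t e2 \<subseteq> J" using oJ t openE by blast
  show ?thesis
  proof (rule that[OF sq_direction[OF c(1) Rc]])
    show "cmod (c\<^sup>2) = 1" by (simp add: norm_power c(1))
    show "min e1 e2 > 0" "ball t (min e1 e2) \<subseteq> J" using e1(1) e2 by auto
    fix s assume s: "s \<in> ball t (min e1 e2)"
    hence sJ: "s \<in> J" using e2(2) by auto
    define x where "x = g (\<delta> s) / b"
    have "dist s t < e1" using s by (simp add: dist_commute)
    from e1(2)[OF this] have x1: "cmod (x - 1) < dl" using b by (simp add: x_def b_def dist_norm)
    have "Im (x ^ n) = 0"
    proof -
      have "x ^ n = (g (\<delta> s)) ^ n / b ^ n" by (simp add: x_def power_divide)
      moreover have "Re ((g (\<delta> s)) ^ n) = 0" using dZ[OF sJ] by (simp add: Z_iff)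
      ultimately show ?thesis using Reb by (simp add: Im_divide)
    qed
    hence "Im x = 0" using dl(2)[OF x1] by simp
    hence "x = of_real (Re x)" by (simp add: complex_eq_iff)
    hence "g (\<delta> s) = of_real (Re x) * b" using b by (simp add: x_def field_simps)
    hence "g (\<delta> s) = of_real (Re x * cmod b) * c" using c(2) by simp
    thus "\<delta> s \<in> branch (c\<^sup>2)" using dZ[OF sJ]
      by (auto simp: branch_def power_mult_distrib intro!: exI[of _ "Re x * cmod b"])
  qed
qed

text \<open>For each unit \<open>w\<close>, the parameters near which the curve runs in
  \<open>branch w\<close> form an open set. These sets are disjoint, since different branches share
  at most \<open>p\<close> and a regular curve is nowhere locally constant. Connectedness leaves a
  single \<open>w\<close>.\<close>

lemma curve_in_branch:
  assumes reg: "regular_analytic_curve J \<delta>" and im: "\<delta> ` J \<subseteq> Z"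
  obtains w where "w ^ n = -1" "cmod w = 1" "\<delta> ` J \<subseteq> branch w"
proof -
  have J: "connected J" "J \<noteq> {}" using reg by (auto simp: regular_analytic_curve_def is_interval_connected)
  then obtain t0 where t0: "t0 \<in> J" by blast
  obtain w0 e0 where w0: "w0 ^ n = -1" "cmod w0 = 1" "e0 > 0" "\<And>s. s \<in> ball t0 e0 \<Longrightarrow> \<delta> s \<in> branch w0"
    by (rule curve_near_in_branch[OF reg im t0]) blast
  define P where "P = (\<lambda>w. {t. \<exists>e>0. ball t e \<subseteq> J \<and> \<delta> ` ball t e \<subseteq> branch w})"
  have oP: "open (P w)" for w unfolding open_contains_ball
  proof
    fix t assume "t \<in> P w"
    then obtain e where e: "e > 0" "ball t e \<subseteq> J" "\<delta> ` ball t e \<subseteq> branch w" by (auto simp: P_def)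
    have "s \<in> P w" if s: "s \<in> ball t e" for s
    proof -
      obtain e' where "e' > 0" "ball s e' \<subseteq> ball t e" using openE[OF open_ball s] by blast
      thus ?thesis unfolding P_def using e(2,3) by blast
    qed
    thus "\<exists>e>0. ball t e \<subseteq> P w" using e(1) by blast
  qed
  have disj: "w1 = w2" if w: "cmod w1 = 1" "cmod w2 = 1" and t: "t \<in> P w1" "t \<in> P w2" for w1 w2 t
  proof (rule ccontr)
    assume ne: "w1 \<noteq> w2"
    obtain e1 e2 where e: "e1 > 0" "e2 > 0" "ball t e1 \<subseteq> J" "\<delta> ` ball t e1 \<subseteq> branch w1" "\<delta> ` ball t e2 \<subseteq> branch w2"
      using t by (auto simp: P_def)
    define e where "e = min e1 e2"
    have eq: "p = \<delta> s" if "s \<in> ball t e" for s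
    proof -
      have "\<delta> s \<in> branch w1" "\<delta> s \<in> branch w2" using e(4,5) that by (auto simp: e_def)
      thus ?thesis using branch_Int[OF w ne] by blast
    qed
    have "(\<delta> has_vector_derivative 0) (at t)"
      by (rule has_vector_derivative_transform_within_open[OF has_vector_derivative_const open_ball[of t e] _ eq]) (use e(1,2) in \<open>simp_all add: e_def\<close>)
    hence "vector_derivative \<delta> (at t) = 0" by (rule vector_derivative_at)
    moreover have "t \<in> J" using e(1,3) by auto
    ultimately show False using reg by (simp add: regular_analytic_curve_def)
  qed
  define V where "V = (\<Union>w\<in>{w. cmod w = 1 \<and> w \<noteq> w0}. P w)"
  have "P w0 \<inter> J = {} \<or> V \<inter> J = {}"
  proof (rule connectedD[OF J(1) oP])
    show "open V" unfolding V_def using oP by blast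
    show "P w0 \<inter> V \<inter> J = {}" unfolding V_def using disj[OF w0(2)] by blast
    show "J \<subseteq> P w0 \<union> V"
    proof
      fix t assume "t \<in> J"
      then obtain w e where w: "cmod w = 1" "e > 0" "ball t e \<subseteq> J" "\<And>s. s \<in> ball t e \<Longrightarrow> \<delta> s \<in> branch w"
        using curve_near_in_branch[OF reg im] by metis
      hence "t \<in> P w" by (auto simp: P_def)
      thus "t \<in> P w0 \<union> V" using w(1) by (auto simp: V_def)
    qed
  qed
  moreover have "t0 \<in> P w0"
  proof -
    obtain e' where "e' > 0" "ball t0 e' \<subseteq> J" using reg t0 openE unfolding regular_analytic_curve_def by metis
    thus ?thesis using w0(3,4) by (auto simp: P_def intro!: exI[of _ "min e' e0"])
  qed
  ultimately have V: "V \<inter> J = {}" using t0 by blast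
  have "\<delta> t \<in> branch w0" if t: "t \<in> J" for t
  proof -
    obtain w e where w: "cmod w = 1" "e > 0" "ball t e \<subseteq> J" "\<And>s. s \<in> ball t e \<Longrightarrow> \<delta> s \<in> branch w"
      using curve_near_in_branch[OF reg im t] by metis
    hence "t \<in> P w" by (auto simp: P_def)
    hence "w = w0" using V t w(1) by (auto simp: V_def)
    thus ?thesis using w(4)[of t] w(2) by simp
  qed
  thus ?thesis using that[OF w0(1,2)] by blast
qed

text \<open>A branch has points other than \<open>p\<close>, whereas different branches share at
  most \<open>p\<close>.\<close>

lemma branch_subset:
  assumes c: "cmod c = 1" "Re (c ^ n) = 0" and w: "cmod w = 1" and sub: "branch (c\<^sup>2) \<subseteq> branch w"
  shows "w = c\<^sup>2"
proof (rule ccontr)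
  assume ne: "w \<noteq> c\<^sup>2"
  have "c \<noteq> 0" using c(1) by auto
  hence "open (params c)" using branch_param_regular[OF c(2)] by (simp add: regular_analytic_curve_def)
  then obtain e where e: "e > 0" "ball 0 e \<subseteq> params c" using branch_param_0(1) openE by blast
  have s: "e / 2 \<in> params c" using e by auto
  have "branch_param c (e / 2) \<in> branch (c\<^sup>2)" using s branch_param_image[OF c(1)] by auto
  hence "branch_param c (e / 2) = p"
    using branch_Int[of "c\<^sup>2" w] w ne sub c(1) by (auto simp: norm_power)
  hence "of_real (e / 2) * c = 0" using branch_param(2)[OF s] gp(1) by simp
  thus False using e(1) \<open>c \<noteq> 0\<close> by simp
qed

text \<open>For maximality: a regular nodal curve containing the branch lies in a single branch,
  which must be the given one.\<close>

lemma branch_param_nodal: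
  assumes c: "cmod c = 1" "Re (c ^ n) = 0"
  shows "nodal_parametrization u D (params c) (branch_param c)"
  unfolding nodal_parametrization_def
proof (intro conjI allI impI)
  show "regular_analytic_curve (params c) (branch_param c)" by (rule branch_param_regular[OF c(2)]) (use c(1) in auto)
  show "branch_param c ` params c \<subseteq> Z" using branch_param by auto
  fix J \<delta>
  assume a: "regular_analytic_curve J \<delta> \<and> \<delta> ` J \<subseteq> Z \<and> branch_param c ` params c \<subseteq> \<delta> ` J"
  obtain w where w: "cmod w = 1" "\<delta> ` J \<subseteq> branch w" using curve_in_branch a by metis
  have "w = c\<^sup>2" by (rule branch_subset[OF c w(1)]) (use a w(2) branch_param_image[OF c(1)] in auto)
  thus "\<delta> ` J = branch_param c ` params c" using a w(2) branch_param_image[OF c(1)] by auto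
qed

lemma nodal_curves_eq: "nodal_curves u D = branch ` {w. w ^ n = -1}"
proof (intro subset_antisym subsetI)
  fix C assume "C \<in> nodal_curves u D"
  then obtain J \<delta> where J: "C = \<delta> ` J" "nodal_parametrization u D J \<delta>" by (auto simp: nodal_curves_def)
  have J': "regular_analytic_curve J \<delta>" "\<delta> ` J \<subseteq> Z" using J(2) by (auto simp: nodal_parametrization_def)
  obtain w where w: "w ^ n = -1" "cmod w = 1" "\<delta> ` J \<subseteq> branch w" using curve_in_branch[OF J'] by metis
  obtain c where c: "cmod c = 1" "Re (c ^ n) = 0" "c\<^sup>2 = w" using direction_of_sq[OF w(1)] n by auto
  have max: "\<forall>J' \<delta>'. regular_analytic_curve J' \<delta>' \<and> \<delta>' ` J' \<subseteq> Z \<and> \<delta> ` J \<subseteq> \<delta>' ` J' \<longrightarrow> \<delta>' ` J' = \<delta> ` J"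
    using J(2) unfolding nodal_parametrization_def by (elim conjE)
  have "branch_param c ` params c = \<delta> ` J"
  proof (rule max[rule_format], intro conjI)
    show "regular_analytic_curve (params c) (branch_param c)" by (rule branch_param_regular[OF c(2)]) (use c(1) in auto)
    show "branch_param c ` params c \<subseteq> Z" using branch_param by auto
    show "\<delta> ` J \<subseteq> branch_param c ` params c" using w(3) unfolding branch_param_image[OF c(1)] c(3) .
  qed
  thus "C \<in> branch ` {w. w ^ n = -1}" using J(1) w(1) branch_param_image[OF c(1)] c(3) by auto
next
  fix C assume "C \<in> branch ` {w. w ^ n = -1}"
  then obtain w where w: "w ^ n = -1" "C = branch w" by blast
  obtain c where c: "cmod c = 1" "Re (c ^ n) = 0" "c\<^sup>2 = w" using direction_of_sq[OF w(1)] n by auto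
  show "C \<in> nodal_curves u D"
    unfolding nodal_curves_def using branch_param_nodal[OF c(1,2)] branch_param_image[OF c(1)] c(3) w(2) by auto
qed

lemma only_nodal_curves: "only_nodal_curves_through u D n p"
  unfolding only_nodal_curves_through_def nodal_curves_eq
proof (intro conjI)
  have n0: "n > 0" using n by simp
  have ex: "\<exists>c. cmod c = 1 \<and> Re (c ^ n) = 0 \<and> c\<^sup>2 = w" if "w ^ n = -1" for w :: complex
    using direction_of_sq[OF that n0] by metis
  have inj: "inj_on branch {w. w ^ n = -1}"
  proof
    fix w1 w2 :: complex assume w: "w1 \<in> {w. w ^ n = -1}" "w2 \<in> {w. w ^ n = -1}" "branch w1 = branch w2"
    obtain c where c: "cmod c = 1" "Re (c ^ n) = 0" "c\<^sup>2 = w1" using ex w(1) by blast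
    obtain c2 where c2: "cmod c2 = 1" "c2\<^sup>2 = w2" using ex w(2) by blast
    show "w1 = w2" using branch_subset[OF c(1,2), of w2] c(3) c2 w(3) by (auto simp: norm_power)
  qed
  have card: "card {w::complex. w ^ n = -1} = n" by (rule card_nodal_directions[OF n0])
  show "finite (branch ` {w. w ^ n = -1})" using card n0 by (intro finite_imageI) (metis card.infinite less_numeral_extra(3))
  show "card (branch ` {w. w ^ n = -1}) = n" using card_image[OF inj] card by simp
  show "\<forall>C\<in>branch ` {w. w ^ n = -1}. p \<in> C" using p_in_Z gp(1) by (auto simp: branch_def intro!: exI[of _ 0])
  show "Z = \<Union> (branch ` {w. w ^ n = -1})"
  proof
    show "\<Union> (branch ` {w. w ^ n = -1}) \<subseteq> Z" by (auto simp: branch_def)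
    show "Z \<subseteq> \<Union> (branch ` {w. w ^ n = -1})"
    proof
      fix z assume z: "z \<in> Z"
      show "z \<in> \<Union> (branch ` {w. w ^ n = -1})"
      proof (cases "g z = 0")
        case True
        have "{w::complex. w ^ n = -1} \<noteq> {}" using card n0 by (metis card.empty less_numeral_extra(3))
        then obtain w :: complex where "w ^ n = -1" by blast
        moreover have "z \<in> branch w" using z True by (auto simp: branch_def intro!: exI[of _ 0])
        ultimately show ?thesis by blast
      next
        case False
        define c where "c = sgn (g z)"
        have c: "cmod c = 1" "g z = of_real (cmod (g z)) * c"
          using False by (simp add: c_def norm_sgn) (simp add: c_def sgn_eq False)
        have "g z ^ n = of_real (cmod (g z) ^ n) * c ^ n" by (subst c(2)) (simp add: power_mult_distrib)
        hence "Re (c ^ n) = 0" using z False by (simp add: Z_iff del: of_real_power)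
        hence "(c\<^sup>2) ^ n = -1" by (rule sq_direction[OF c(1)])
        moreover have "z \<in> branch (c\<^sup>2)" unfolding branch_def
          using z c(2) by (auto intro!: exI[of _ "cmod (g z)"]) (metis power_mult_distrib)
        ultimately show ?thesis by blast
      qed
    qed
  qed
qed

end

subsection \<open>The extremal functions\<close>

text \<open>The inverse is explicit, \<open>r * (r * w + p) / (r + cnj p * w)\<close>, and the
  identity for the moduli shows that its values lie in the disc.\<close>

lemma disc_map_surj:
  assumes p: "cmod p < r" and w: "w \<in> ball 0 1"
  obtains z where "z \<in> ball 0 r" "disc_map r p z = w"
proof
  have r: "r > 0" "r\<^sup>2 - (cmod p)\<^sup>2 > 0" using disc_map_r[OF p] by auto
  define d where "d = of_real r + cnj p * w"
  have w1: "cmod w < 1" using w by simp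
  have "(cmod d)\<^sup>2 - (cmod (of_real r * w + p))\<^sup>2 = (r\<^sup>2 - (cmod p)\<^sup>2) * (1 - (cmod w)\<^sup>2)"
    unfolding d_def cmod_power2 by (simp add: power2_eq_square algebra_simps)
  moreover have "0 < 1 - (cmod w)\<^sup>2" using w1 by (simp add: abs_square_less_1)
  ultimately have lt: "(cmod (of_real r * w + p))\<^sup>2 < (cmod d)\<^sup>2" using mult_pos_pos[OF r(2)] by (metis diff_gt_0_iff_gt)
  hence lt': "cmod (of_real r * w + p) < cmod d" by (rule power2_less_imp_less) simp
  hence d0: "d \<noteq> 0" by auto
  define z where "z = of_real r * (of_real r * w + p) / d"
  have "cmod z = r * (cmod (of_real r * w + p) / cmod d)" using r(1) by (simp add: z_def norm_mult norm_divide)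
  also have "\<dots> < r * 1" using lt' r(1) d0 by (intro mult_strict_left_mono) (simp_all add: divide_less_eq)
  finally show z: "z \<in> ball 0 r" by simp
  have q0: "complex_of_real (r\<^sup>2 - (cmod p)\<^sup>2) \<noteq> 0" using r(2) by (metis less_irrefl of_real_eq_0_iff)
  have pp: "complex_of_real (r\<^sup>2 - (cmod p)\<^sup>2) = of_real r * of_real r - p * cnj p"
    unfolding of_real_diff complex_norm_square by (simp add: power2_eq_square)
  have "of_real r * (z - p) = of_real r * w * of_real (r\<^sup>2 - (cmod p)\<^sup>2) / d"
    unfolding pp z_def using d0 by (simp add: d_def field_simps)
  moreover have "of_real (r\<^sup>2) - cnj p * z = of_real r * of_real (r\<^sup>2 - (cmod p)\<^sup>2) / d"
    unfolding pp z_def using d0 by (simp add: d_def field_simps power2_eq_square)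
  ultimately show "disc_map r p z = w" unfolding disc_map_def using d0 q0 r(1) by simp
qed

text \<open>With \<open>\<zeta> = (1 + w) / (1 - w)\<close> and \<open>s = tan (n \<alpha>\<^sub>0)\<close>, the \<open>n\<close>-th power of \<open>w exp (extremal_log n w)\<close>
  is \<open>((\<zeta>\<^sup>2 - 1) / 4)\<^sup>n (\<zeta> - \<i> s)\<close>.\<close>

definition extremal_log :: "nat \<Rightarrow> complex \<Rightarrow> complex" where
  "extremal_log n w = Ln ((1 + w) / (1 - w) - \<i> * of_real (tan (real n * alpha0 n))) / of_nat n - 2 * Ln (1 - w)"

context
  fixes n :: nat
  assumes n: "n \<ge> 1"
begin

lemma extremal_log_aux:
  assumes "w \<in> ball 0 1"
  defines "\<xi> \<equiv> (1 + w) / (1 - w) - \<i> * of_real (tan (real n * alpha0 n))"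
  shows "1 - w \<noteq> 0" "Re ((1 + w) / (1 - w)) > 0" "\<xi> \<noteq> 0" "Re \<xi> > 0"
    "(extremal_log n has_field_derivative 2 / (1 - w)\<^sup>2 / \<xi> / of_nat n + 2 / (1 - w)) (at w)"
    "exp (extremal_log n w) ^ n = \<xi> / ((1 - w)\<^sup>2) ^ n"
proof -
  have w: "cmod w < 1" using assms(1) by simp
  show w1: "1 - w \<noteq> 0" using w by auto
  have "Re ((1 + w) * cnj (1 - w)) = 1 - (cmod w)\<^sup>2" unfolding cmod_power2 by (simp add: power2_eq_square algebra_simps)
  also have "\<dots> > 0" using w by (simp add: abs_square_less_1)
  finally show pos: "Re ((1 + w) / (1 - w)) > 0" by (simp only: Re_complex_div_gt_0)
  thus \<xi>: "Re \<xi> > 0" by (simp add: \<xi>_def)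
  thus \<xi>0: "\<xi> \<noteq> 0" by auto
  \<comment> \<open>Both arguments of \<open>Ln\<close> have positive real part and thus avoid the
    branch cut.\<close>
  have nn: "\<xi> \<notin> \<real>\<^sub>\<le>\<^sub>0" "1 - w \<notin> \<real>\<^sub>\<le>\<^sub>0"
    using \<xi> complex_Re_le_cmod[of w] w by (auto simp: complex_nonpos_Reals_iff)
  have d\<xi>: "((\<lambda>w. (1 + w) / (1 - w) - \<i> * of_real (tan (real n * alpha0 n))) has_field_derivative 2 / (1 - w)\<^sup>2) (at w)"
    using w1 by (auto intro!: derivative_eq_intros simp: power2_eq_square algebra_simps)
  have "((\<lambda>w. Ln ((1 + w) / (1 - w) - \<i> * of_real (tan (real n * alpha0 n)))) has_field_derivative 1 / \<xi> * (2 / (1 - w)\<^sup>2)) (at w)"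
    by (rule DERIV_chain2[OF _ d\<xi>]) (use has_field_derivative_Ln[OF nn(1)] in \<open>simp add: \<xi>_def inverse_eq_divide\<close>)
  moreover have "((\<lambda>w. Ln (1 - w)) has_field_derivative 1 / (1 - w) * (- 1)) (at w)"
    by (rule DERIV_chain2[where g = "\<lambda>w. 1 - w"]) (use has_field_derivative_Ln[OF nn(2)] in \<open>auto intro!: derivative_eq_intros simp: inverse_eq_divide\<close>)
  ultimately have "((\<lambda>w. Ln ((1 + w) / (1 - w) - \<i> * of_real (tan (real n * alpha0 n))) / of_nat n - 2 * Ln (1 - w))
      has_field_derivative 1 / \<xi> * (2 / (1 - w)\<^sup>2) / of_nat n - 2 * (1 / (1 - w) * (- 1))) (at w)"
    by (intro DERIV_diff DERIV_cdivide DERIV_cmult)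
  thus "(extremal_log n has_field_derivative 2 / (1 - w)\<^sup>2 / \<xi> / of_nat n + 2 / (1 - w)) (at w)"
    unfolding extremal_log_def[abs_def] by (simp add: field_simps)
  have "exp (extremal_log n w) ^ n = exp (of_nat n * extremal_log n w)" by (rule exp_of_nat_mult[symmetric])
  also have "of_nat n * extremal_log n w = Ln \<xi> - of_nat (2 * n) * Ln (1 - w)"
    using n by (simp add: extremal_log_def \<xi>_def algebra_simps)
  also have "exp \<dots> = exp (Ln \<xi>) / exp (Ln (1 - w)) ^ (2 * n)" unfolding exp_diff exp_of_nat_mult ..
  also have "\<dots> = \<xi> / ((1 - w)\<^sup>2) ^ n" using \<xi>0 w1 by (simp add: power_mult)
  finally show "exp (extremal_log n w) ^ n = \<xi> / ((1 - w)\<^sup>2) ^ n" .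
qed

lemma extremal_log_deriv:
  "w \<in> ball 0 1 \<Longrightarrow> deriv (extremal_log n) w
     = 2 / (1 - w)\<^sup>2 / ((1 + w) / (1 - w) - \<i> * of_real (tan (real n * alpha0 n))) / of_nat n + 2 / (1 - w)"
  by (rule DERIV_imp_deriv[OF extremal_log_aux(5)])

text \<open>The real part in question is a positive multiple of
  \<open>(2 * n + 1) * (cmod \<xi>)^2 - (1 + s^2)\<close>, and the nodal set avoids the half-disc
  where this is not positive.\<close>

lemma extremal_radial_map: "radial_map (extremal_log n) (\<lambda>w. w * exp (extremal_log n w)) n"
proof
  show "extremal_log n holomorphic_on ball 0 1"
    unfolding holomorphic_on_def field_differentiable_def
    using extremal_log_aux(5) has_field_derivative_at_within by blast
  fix w :: complex assume w: "w \<in> ball 0 1" "w \<noteq> 0" and Z: "Re ((w * exp (extremal_log n w)) ^ n) = 0"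
  define s where "s = tan (real n * alpha0 n)"
  define \<zeta> where "\<zeta> = (1 + w) / (1 - w)"
  define \<xi> where "\<xi> = \<zeta> - \<i> * of_real s"
  note a = extremal_log_aux[OF w(1), folded s_def, folded \<zeta>_def, folded \<xi>_def]
  have \<zeta>w: "4 * w / (1 - w)\<^sup>2 = \<zeta>\<^sup>2 - 1"
  proof -
    have "\<zeta>\<^sup>2 - 1 = ((1 + w)\<^sup>2 - (1 - w)\<^sup>2) / (1 - w)\<^sup>2"
      using a(1) by (simp add: \<zeta>_def power_divide diff_divide_distrib)
    also have "(1 + w)\<^sup>2 - (1 - w)\<^sup>2 = 4 * w" by (simp add: power2_eq_square algebra_simps)
    finally show ?thesis ..
  qed
  have "(w * exp (extremal_log n w)) ^ n = (w / (1 - w)\<^sup>2) ^ n * \<xi>"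
    unfolding power_mult_distrib a(6) by (simp add: power_divide)
  also have "w / (1 - w)\<^sup>2 = (\<zeta>\<^sup>2 - 1) / of_real 4" unfolding \<zeta>w[symmetric] by simp
  also have "((\<zeta>\<^sup>2 - 1) / of_real 4) ^ n * \<xi> = ((\<zeta>\<^sup>2 - 1) ^ n * \<xi>) / of_real (4 ^ n)" by (simp add: power_divide)
  finally have "Re ((\<zeta>\<^sup>2 - 1) ^ n * \<xi>) = 0" using Z by (simp only: Re_divide_of_real) simp
  hence key: "1 + s\<^sup>2 < (2 * real n + 1) * (cmod \<xi>)\<^sup>2"
    using extremal_nodal_set_avoids_halfdisc[OF n a(2)] unfolding s_def \<xi>_def by simp
  have "1 + w * deriv (extremal_log n) w = (1 + 2 * w / (1 - w)) + 4 * w / (1 - w)\<^sup>2 / (2 * \<xi>) / of_nat n"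
    unfolding extremal_log_deriv[OF w(1), folded s_def, folded \<zeta>_def, folded \<xi>_def] by (simp add: algebra_simps)
  also have "1 + 2 * w / (1 - w) = \<zeta>" using a(1) by (simp add: \<zeta>_def field_simps)
  also have "4 * w / (1 - w)\<^sup>2 / (2 * \<xi>) = \<xi> / 2 + \<i> * of_real s - of_real ((1 + s\<^sup>2) / 2) / \<xi>"
  proof -
    have "\<zeta> = \<xi> + \<i> * of_real s" by (simp add: \<xi>_def)
    hence "\<zeta>\<^sup>2 - 1 = \<xi>\<^sup>2 + 2 * \<i> * of_real s * \<xi> - of_real (1 + s\<^sup>2)" by (simp add: power2_eq_square algebra_simps)
    moreover have "(\<xi>\<^sup>2 + 2 * \<i> * of_real s * \<xi> - k) / (2 * \<xi>) = \<xi> / 2 + \<i> * of_real s - k / 2 / \<xi>" for k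
      using a(3) by (simp add: field_simps power2_eq_square)
    ultimately show ?thesis by (simp only: \<zeta>w of_real_divide of_real_numeral)
  qed
  finally have e: "1 + w * deriv (extremal_log n) w
      = \<zeta> + (\<xi> / 2 + \<i> * of_real s - of_real ((1 + s\<^sup>2) / 2) / \<xi>) / of_real (real n)" by simp
  have R: "Re \<zeta> = Re \<xi>" by (simp add: \<xi>_def)
  have D: "Re (of_real k / \<xi>) = k * Re \<xi> / (cmod \<xi>)\<^sup>2" for k by (simp add: Re_divide cmod_power2)
  have "Re (1 + w * deriv (extremal_log n) w) = Re \<xi> + (Re \<xi> / 2 - (1 + s\<^sup>2) / 2 * Re \<xi> / (cmod \<xi>)\<^sup>2) / real n"
    unfolding e by (simp only: plus_complex.sel minus_complex.sel Re_divide_of_real R D) simp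
  also have "\<dots> = Re \<xi> / (2 * real n * (cmod \<xi>)\<^sup>2) * ((2 * real n + 1) * (cmod \<xi>)\<^sup>2 - (1 + s\<^sup>2))"
    using n a(3) by (simp add: field_simps)
  also have "\<dots> > 0" using key n a(3,4) by (intro mult_pos_pos divide_pos_pos) auto
  finally show "Re (1 + w * deriv (extremal_log n) w) > 0" .
qed (use n in auto)

text \<open>One direction is both nodal and extremal: \<open>n * (pi / 2 - x) - x\<close> is an odd
  multiple of \<open>pi / 2\<close>, since \<open>x = 0\<close> for odd \<open>n\<close> and
  \<open>(n + 1) * x = pi / 2\<close> for even \<open>n\<close>.\<close>

lemma extremal_direction:
  defines "x \<equiv> real n * alpha0 n"
  shows "Re (exp (extremal_log n 0) ^ n * cis (pi / 2 - x) ^ n) = 0"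
    and "Im (2 * deriv (extremal_log n) 0 * cis (pi / 2 - x)) = 4 * (real n + 1) / real n * cos x"
proof -
  have x: "0 \<le> x" "x < pi / 2" using alpha0_range[OF n] by (auto simp: x_def)
  hence cx: "cos x > 0" by (intro cos_gt_zero_pi) linarith+
  have tan: "1 - \<i> * of_real (tan x) = cis (- x) / of_real (cos x)"
    using cx by (simp add: complex_eq_iff tan_def)
  have odd_cos: "cos (real m * pi + pi / 2) = 0" for m by (simp add: cos_add)
  have "cos (real n * (pi / 2 - x) - x) = 0"
  proof (cases "odd n")
    case True
    then obtain m where "n = 2 * m + 1" by (elim oddE)
    hence "real n * (pi / 2 - x) - x = real m * pi + pi / 2" using True by (simp add: x_def alpha0_def field_simps)
    thus ?thesis using odd_cos by simp
  next
    case False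
    hence "even n" by simp
    then obtain m where "n = 2 * m" by (elim evenE)
    then obtain m' where m: "n = 2 * Suc m'" using n by (cases m) auto
    have "x = pi / (2 * (real n + 1))" using False n by (simp add: x_def alpha0_def)
    hence "real n * (pi / 2 - x) - x = real n * pi / 2 - pi / 2" by (simp add: field_simps)
    also have "\<dots> = real m' * pi + pi / 2" unfolding m by (simp add: field_simps)
    finally show ?thesis using odd_cos by simp
  qed
  moreover have "exp (extremal_log n 0) ^ n * cis (pi / 2 - x) ^ n = cis (real n * (pi / 2 - x) - x) / of_real (cos x)"
  proof -
    have "exp (extremal_log n 0) ^ n = 1 - \<i> * of_real (tan x)" using extremal_log_aux(6)[of 0] by (simp add: x_def)
    hence "exp (extremal_log n 0) ^ n * cis (pi / 2 - x) ^ n = cis (- x) * cis (real n * (pi / 2 - x)) / of_real (cos x)"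
      by (simp only: tan Complex.DeMoivre times_divide_eq_left)
    also have "cis (- x) * cis (real n * (pi / 2 - x)) = cis (real n * (pi / 2 - x) - x)"
      unfolding cis_mult by (rule arg_cong[where f = cis]) simp
    finally show ?thesis .
  qed
  ultimately show "Re (exp (extremal_log n 0) ^ n * cis (pi / 2 - x) ^ n) = 0" by simp
  have "deriv (extremal_log n) 0 = 2 / (1 - \<i> * of_real (tan x)) / of_nat n + 2"
    using extremal_log_deriv[of 0] by (simp add: x_def)
  also have "2 / (1 - \<i> * of_real (tan x)) = 2 * of_real (cos x) * cis x"
    unfolding tan using cx by (simp add: cis_inverse[symmetric] field_simps flip: cis_inverse)
  finally have "2 * deriv (extremal_log n) 0 * cis (pi / 2 - x)
      = of_real (4 * cos x / real n) * (cis x * cis (pi / 2 - x)) + 4 * cis (pi / 2 - x)"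
    by (simp add: algebra_simps)
  also have "cis x * cis (pi / 2 - x) = \<i>" by (simp add: cis_mult)
  finally have "Im (2 * deriv (extremal_log n) 0 * cis (pi / 2 - x)) = 4 * cos x / real n + 4 * sin (pi / 2 - x)"
    by simp
  also have "sin (pi / 2 - x) = cos x" by (simp add: sin_diff)
  also have "4 * cos x / real n + 4 * cos x = 4 * (real n + 1) / real n * cos x" using n by (simp add: field_simps)
  finally show "Im (2 * deriv (extremal_log n) 0 * cis (pi / 2 - x)) = 4 * (real n + 1) / real n * cos x" .
qed

end

text \<open>The factor \<open>lam\<close> keeps the singularity of the extremal function at
  \<open>w = 1\<close> away from the closed disc, so that the boundary values are continuous. Its
  price is the factor \<open>lam\<close> in the first summand; the second one is attained.\<close>

theorem curvature_bound_approached: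
  assumes n: "n \<ge> 1" and p: "p \<in> ball 0 r" and lam: "0 < lam" "lam < 1"
  obtains u I \<gamma> t where "admissible n r p u" "nodal_parametrization u (ball 0 r) I \<gamma>" "t \<in> I" "\<gamma> t = p"
    "\<bar>curvature \<gamma> t\<bar> = lam * (4 * (real n + 1) / ((r\<^sup>2 - (cmod p)\<^sup>2) * real n) * r * cos (real n * alpha0 n))
       + 2 * cmod p / (r\<^sup>2 - (cmod p)\<^sup>2)"
proof -
  have pr: "cmod p < r" using p by simp
  define q where "q = r\<^sup>2 - (cmod p)\<^sup>2"
  have r: "r > 0" and q0: "q > 0" using disc_map_r[OF pr] by (auto simp: q_def)
  define x where "x = real n * alpha0 n"
  have x: "0 \<le> x" "x < pi / 2" using alpha0_range[OF n] by (auto simp: x_def)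
  hence cx: "cos x > 0" by (intro cos_gt_zero_pi) linarith+
  define h where "h = extremal_log n"
  define g where "g = (\<lambda>w. w * exp (h w))"
  interpret R: radial_map h g n unfolding h_def g_def by (rule extremal_radial_map[OF n])
  define vh where "vh = cis (pi / 2 - x)"
  have vh1: "cmod vh = 1" by (simp add: vh_def)
  hence vhc: "vh * cnj vh = 1" using complex_norm_square[of vh] by simp
  \<comment> \<open>The rotation is chosen so that \<open>cnj p * (cnj \<eta> * vh)\<close> equals
    \<open>\<i> * cmod p\<close>. The contribution of the automorphism is then as large as possible
    and has the sign of the other summand.\<close>
  define \<eta> where "\<eta> = (if p = 0 then 1 else - \<i> * cnj p * vh / of_real (cmod p))"
  have \<eta>1: "cmod \<eta> = 1" by (simp add: \<eta>_def norm_mult norm_divide vh1)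
  have \<eta>c: "\<eta> * cnj \<eta> = 1" using \<eta>1 complex_norm_square[of \<eta>] by simp
  have \<eta>p: "cnj p * (cnj \<eta> * vh) = \<i> * of_real (cmod p)"
  proof (cases "p = 0")
    case False
    have "cnj p * (cnj \<eta> * vh) = \<i> * (p * cnj p) * (vh * cnj vh) / of_real (cmod p)"
      using False by (simp add: \<eta>_def mult_ac)
    also have "p * cnj p = of_real (cmod p) * of_real (cmod p)" by (simp add: complex_norm_square[symmetric] power2_eq_square)
    finally show ?thesis using False vhc by simp
  qed simp
  define \<sigma> where "\<sigma> = of_real lam * \<eta>"
  have \<sigma>: "cmod \<sigma> = lam" "\<sigma> \<noteq> 0" using lam \<eta>1 by (auto simp: \<sigma>_def norm_mult)
  define W where "W = disc_map r p"
  define V where "V = (\<lambda>z. \<sigma> * W z)"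
  define G where "G = (\<lambda>z. g (V z))"
  define u where "u = (\<lambda>z. Re (G z ^ n))"
  have W1: "cmod (W z) \<le> 1" if "cmod z \<le> r" for z
    using disc_map_ball[OF pr, of z] disc_map_circle[OF pr, of z] that unfolding W_def by (cases "cmod z = r") auto
  have Vb: "V z \<in> ball 0 1" if "cmod z \<le> r" for z
  proof -
    have "cmod (V z) \<le> lam * 1" unfolding V_def norm_mult \<sigma>(1) using W1[OF that] lam by (intro mult_left_mono) auto
    thus ?thesis using lam(2) by simp
  qed
  have W': "(W has_field_derivative deriv W z) (at z)" "deriv W z \<noteq> 0" if "cmod z \<le> r" for z
  proof -
    note d = disc_map_deriv[OF pr that, folded W_def]
    show "(W has_field_derivative deriv W z) (at z)" using d DERIV_imp_deriv[OF d] by simp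
    show "deriv W z \<noteq> 0"
      unfolding DERIV_imp_deriv[OF d] q_def[symmetric] using disc_map_denom[OF pr that] r q0 by simp
  qed
  have V': "(V has_field_derivative \<sigma> * deriv W z) (at z)" if "cmod z \<le> r" for z
    unfolding V_def by (rule DERIV_cmult[OF W'(1)[OF that]])
  define g' where "g' = (\<lambda>w. exp (h w) * (1 + w * deriv h w))"
  have dg: "(g has_field_derivative g' w) (at w)" if "w \<in> ball 0 1" for w
    unfolding g_def g'_def by (auto intro!: derivative_eq_intros R.h_deriv[OF that] simp: algebra_simps)
  have G': "(G has_field_derivative g' (V z) * (\<sigma> * deriv W z)) (at z)" if "cmod z \<le> r" for z
    unfolding G_def by (rule DERIV_chain2[OF dg[OF Vb[OF that]] V'[OF that]])
  have dG: "deriv G z = g' (V z) * (\<sigma> * deriv W z)" if "cmod z \<le> r" for z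
    by (rule DERIV_imp_deriv[OF G'[OF that]])
  have Ghol: "G holomorphic_on ball 0 r"
    unfolding holomorphic_on_def field_differentiable_def
    using G' has_field_derivative_at_within by (metis less_imp_le mem_ball_0)
  have Gcont: "continuous_on (cball 0 r) G"
  proof (rule continuous_at_imp_continuous_on, rule ballI)
    show "isCont G z" if "z \<in> cball 0 r" for z using DERIV_isCont[OF G'[of z]] that by simp
  qed
  have Wp: "W p = 0" "deriv W p = of_real (r / q)" "deriv (deriv W) p / deriv W p = 2 * cnj p / of_real q"
    unfolding W_def q_def by (rule disc_map_at_p[OF pr])+
  have Vp: "V p = 0" by (simp add: V_def Wp)
  have g'0: "g' 0 = exp (h 0)" by (simp add: g'_def)
  have Gp: "G p = 0" "deriv G p \<noteq> 0"
  proof -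
    show "G p = 0" by (simp add: G_def Vp g_def)
    show "deriv G p \<noteq> 0" using dG[of p] pr W'(2)[of p] \<sigma>(2) by (simp add: Vp g'0)
  qed
  have Zb: "cmod z < r" "Re (g (V z) ^ n) = 0" if "z \<in> nodal_set u (ball 0 r)" for z
    using that by (auto simp: nodal_set_def u_def G_def)
  \<comment> \<open>Regularity, injectivity and star shape are inherited from \<open>g\<close>,
    since \<open>V\<close> is injective with nonvanishing derivative. For \<open>star\<close>, the
    bound on \<open>cmod w'\<close> keeps \<open>w'\<close> in the range of
    \<open>V\<close>.\<close>
  interpret N: nodal_power G "ball 0 r" n p u
  proof
    show "deriv G z \<noteq> 0" if "z \<in> nodal_set u (ball 0 r)" for z
    proof -
      note z = Zb[OF that]
      have "1 + V z * deriv h (V z) \<noteq> 0"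
      proof (cases "V z = 0")
        case False
        have "0 < Re (1 + V z * deriv h (V z))" by (rule R.radial[OF Vb False z(2)]) (use z in simp)
        thus ?thesis by (metis less_irrefl zero_complex.sel(1))
      qed simp
      thus ?thesis using dG[of z] z(1) W'(2)[of z] \<sigma>(2) by (simp add: g'_def)
    qed
    show "inj_on G (nodal_set u (ball 0 r))"
    proof
      fix z1 z2 assume z: "z1 \<in> nodal_set u (ball 0 r)" "z2 \<in> nodal_set u (ball 0 r)" "G z1 = G z2"
      note b = Zb(1)[OF z(1), THEN less_imp_le] Zb(1)[OF z(2), THEN less_imp_le]
      have "V z1 = V z2" by (rule R.g_inj[OF Vb[OF b(1)] Vb[OF b(2)] _ Zb(2)[OF z(1)]]) (use z(3) in \<open>simp add: G_def\<close>)
      hence "W z1 - W z2 = 0" using \<sigma>(2) by (simp add: V_def)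
      hence "of_real (r * q) * (z1 - z2) = 0"
        unfolding W_def disc_map_diff[OF pr b(2) b(1)] q_def using disc_map_denom[OF pr b(1)] disc_map_denom[OF pr b(2)]
        by (simp del: of_real_mult of_real_diff of_real_power)
      thus "z1 = z2" using r q0 by simp
    qed
    show "\<exists>z'\<in>nodal_set u (ball 0 r). G z' = of_real s * G z" if z: "z \<in> nodal_set u (ball 0 r)" and s: "0 \<le> s" "s \<le> 1" for z s
    proof -
      obtain w' where w': "cmod w' \<le> cmod (V z)" "g w' = of_real s * g (V z)"
        by (rule R.g_radial_range[OF Vb Zb(2)[OF z] s]) (use Zb(1)[OF z] in auto)
      have "cmod (w' / \<sigma>) \<le> cmod (W z)"
        using w'(1) lam \<sigma> unfolding norm_divide V_def norm_mult by (simp add: divide_le_eq mult.commute)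
      also have "\<dots> < 1" using disc_map_ball[OF pr, of z] Zb(1)[OF z] by (simp add: W_def)
      finally have "w' / \<sigma> \<in> ball 0 1" by simp
      then obtain z' where z': "z' \<in> ball 0 r" "W z' = w' / \<sigma>" unfolding W_def by (rule disc_map_surj[OF pr])
      have "V z' = w'" using z'(2) \<sigma>(2) by (simp add: V_def)
      hence Gz': "G z' = of_real s * G z" by (simp add: G_def w'(2))
      have "G z' ^ n = of_real (s ^ n) * G z ^ n" by (simp add: Gz' power_mult_distrib)
      hence "u z' = s ^ n * u z" unfolding u_def by (simp del: of_real_power)
      hence "u z' = 0" using z by (simp add: nodal_set_def)
      thus ?thesis using z'(1) Gz' by (auto simp: nodal_set_def)
    qed
  qed (use Ghol p Gp n u_def in auto)
  have "\<not> u constant_on ball 0 r"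
  proof
    assume "u constant_on ball 0 r"
    then obtain k where k: "\<And>z. z \<in> ball 0 r \<Longrightarrow> u z = k" unfolding constant_on_def by blast
    have "k = 0" using k[OF p] Gp(1) n by (simp add: u_def power_0_left)
    obtain \<psi> N d where ch: "power_chart G p 1 G \<psi> N d" "N \<subseteq> ball 0 r"
      by (rule power_chartI[OF Ghol open_ball p Gp order_refl, of G]) (use Gp(1) in auto)
    note C = power_chartD[OF ch(1)]
    have b: "of_real (d / 2) \<in> ball (0 :: complex) d" using C(2) by simp
    have "u (\<psi> (of_real (d / 2))) = (d / 2) ^ n" unfolding u_def C(11)[OF b] of_real_power[symmetric] by simp
    moreover have "u (\<psi> (of_real (d / 2))) = k" by (rule k) (use C(9)[OF b] ch(2) in auto)
    ultimately show False using \<open>k = 0\<close> C(2) by simp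
  qed
  moreover have "harmonic_on u (ball 0 r)"
    unfolding u_def by (intro harmonic_on_Re_holomorphic holomorphic_intros Ghol) simp
  moreover have "\<exists>g. L1_circle r g \<and> (\<forall>z\<in>ball 0 r. u z = poisson_integral r g z)"
  proof -
    have "continuous_on (cball 0 r) (\<lambda>z. G z ^ n)" "(\<lambda>z. G z ^ n) holomorphic_on ball 0 r"
      by (intro continuous_intros holomorphic_intros Gcont Ghol)+
    from poisson_formula[OF r this] show ?thesis unfolding u_def by blast
  qed
  ultimately have adm: "admissible n r p u"
    unfolding admissible_def using N.only_nodal_curves Gp(1) n by (simp add: u_def power_0_left)
  define v where "v = cnj \<eta> * vh"
  have v1: "cmod v = 1" "v * cnj v = 1"
    using \<eta>1 vh1 complex_norm_square[of v] by (auto simp: v_def norm_mult)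
  have pb: "cmod p \<le> r" using pr by simp
  have Gv: "deriv G p * v = of_real (lam * (r / q)) * (exp (h 0) * vh)"
  proof -
    have "deriv G p * v = of_real (lam * (r / q)) * (exp (h 0) * vh) * (\<eta> * cnj \<eta>)"
      unfolding dG[OF pb] Vp g'0 Wp(2) v_def \<sigma>_def by (simp add: mult_ac)
    thus ?thesis by (simp add: \<eta>c)
  qed
  have Gv0: "deriv G p * v \<noteq> 0" using Gp(2) v1(1) by auto
  define c where "c = sgn (deriv G p * v)"
  have c1: "cmod c = 1" using Gv0 by (simp add: c_def norm_sgn)
  hence c0: "c \<noteq> 0" by auto
  have cn: "Re (c ^ n) = 0"
  proof -
    have "c ^ n = (deriv G p * v) ^ n / of_real (cmod (deriv G p * v) ^ n)"
      by (simp add: c_def sgn_eq power_divide)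
    also have "(deriv G p * v) ^ n = of_real ((lam * (r / q)) ^ n) * (exp (h 0) ^ n * vh ^ n)"
      unfolding Gv of_real_power power_mult_distrib[of "of_real (lam * (r / q))"] power_mult_distrib[of "exp (h 0)"] ..
    finally have "Re (c ^ n) = Re (of_real ((lam * (r / q)) ^ n) * (exp (h 0) ^ n * vh ^ n)) / cmod (deriv G p * v) ^ n"
      by (simp only: Re_divide_of_real)
    also have "Re (of_real ((lam * (r / q)) ^ n) * (exp (h 0) ^ n * vh ^ n)) = (lam * (r / q)) ^ n * Re (exp (h 0) ^ n * vh ^ n)"
      by (simp del: of_real_power)
    also have "Re (exp (h 0) ^ n * vh ^ n) = 0"
      unfolding h_def vh_def x_def by (rule extremal_direction(1)[OF n])
    finally show ?thesis by simp
  qed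
  define I where "I = N.params c"
  define \<gamma> where "\<gamma> = N.branch_param c"
  have nod: "nodal_parametrization u (ball 0 r) I \<gamma>" unfolding I_def \<gamma>_def by (rule N.branch_param_nodal[OF c1 cn])
  have t: "0 \<in> I" "\<gamma> 0 = p" unfolding I_def \<gamma>_def by (rule N.branch_param_0)+
  have reg: "regular_analytic_curve I \<gamma>" using nod by (simp add: nodal_parametrization_def)
  then obtain e where e: "e > 0" "ball 0 e \<subseteq> I" using t(1) openE unfolding regular_analytic_curve_def by metis
  have line: "Im (cnj c * G (\<gamma> s)) = 0" if "\<bar>s - 0\<bar> < e" for s
  proof -
    have "s \<in> I" using that e(2) by (auto simp: subset_iff)
    hence "G (\<gamma> s) = of_real s * c" unfolding I_def \<gamma>_def by (rule N.branch_param)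
    thus ?thesis by (simp add: mult.left_commute)
  qed
  define vel where "vel = vector_derivative \<gamma> (at 0)"
  have lvl: "vel \<noteq> 0" "Im (cnj c * deriv G p * vel) = 0" "curvature \<gamma> 0 = - Im (deriv (deriv G) p / deriv G p * sgn vel)"
    using curvature_level_line[OF reg t(1) open_ball[of 0 r], of G e c] t(2) p Ghol Gp(2) e(1) line c0
    unfolding vel_def by auto
  \<comment> \<open>The velocity is parallel to \<open>v\<close>, possibly reversed, which only
    changes the sign of the curvature.\<close>
  have par: "sgn vel = v \<or> sgn vel = - v"
  proof -
    define k where "k = (cmod (deriv G p))\<^sup>2 / cmod (deriv G p * v)"
    have k0: "k \<noteq> 0" using Gv0 Gp(2) by (simp add: k_def)
    have eq: "cnj c * deriv G p * vel = of_real k * (cnj v * vel)"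
      unfolding c_def sgn_eq k_def using complex_norm_square[of "deriv G p"] by (simp add: mult_ac)
    have "Im (of_real k * X) = k * Im X" for X by simp
    hence "k * Im (cnj v * vel) = 0" using lvl(2) unfolding eq by (simp only:)
    hence "Im (cnj v * vel) = 0" using k0 by (simp only: mult_eq_0_iff) simp
    hence "cnj v * vel \<in> \<real>" by (simp only: complex_is_Real_iff)
    then obtain b where b: "cnj v * vel = of_real b" by (rule Reals_cases)
    have "vel = (v * cnj v) * vel" using v1(2) by simp
    also have "\<dots> = (cnj v * vel) * v" by (simp only: mult_ac)
    also have "\<dots> = of_real b * v" by (simp only: b)
    finally have vb: "vel = of_real b * v" .
    hence b0: "b \<noteq> 0" using lvl(1) by auto
    have "sgn vel = of_real (sgn b) * v" unfolding vb sgn_eq using b0 by (simp add: norm_mult v1(1) sgn_if)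
    thus ?thesis using b0 by (cases "b > 0") (simp_all add: sgn_if)
  qed
  have ratio: "deriv (deriv G) p / deriv G p = 2 * deriv h 0 * (\<sigma> * deriv W p) + deriv (deriv W) p / deriv W p"
  proof -
    have z0: "(0::complex) \<in> ball 0 1" by simp
    have h2: "(deriv h has_field_derivative deriv (deriv h) 0) (at 0)"
      by (rule holomorphic_derivI[OF holomorphic_deriv[OF R.h open_ball] open_ball z0])
    have "(g' has_field_derivative exp (h 0) * (2 * deriv h 0)) (at 0)" unfolding g'_def
      by (auto intro!: derivative_eq_intros R.h_deriv[OF z0] h2 simp: algebra_simps)
    hence 1: "((\<lambda>z. g' (V z)) has_field_derivative exp (h 0) * (2 * deriv h 0) * (\<sigma> * deriv W p)) (at p)"
      by (intro DERIV_chain2[OF _ V'[OF pb]]) (simp add: Vp)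
    have "W holomorphic_on ball 0 r" unfolding W_def by (rule disc_map_holomorphic[OF pr])
    hence 2: "(deriv W has_field_derivative deriv (deriv W) p) (at p)"
      by (intro holomorphic_derivI[OF holomorphic_deriv open_ball p]) auto
    have "((\<lambda>z. g' (V z) * (\<sigma> * deriv W z)) has_field_derivative
        exp (h 0) * (2 * deriv h 0) * (\<sigma> * deriv W p) * (\<sigma> * deriv W p) + \<sigma> * deriv (deriv W) p * g' (V p)) (at p)"
      by (rule DERIV_mult[OF 1 DERIV_cmult[OF 2]])
    hence "(deriv G has_field_derivative
        exp (h 0) * (2 * deriv h 0) * (\<sigma> * deriv W p) * (\<sigma> * deriv W p) + \<sigma> * deriv (deriv W) p * g' (V p)) (at p)"
      by (rule has_field_derivative_transform_within_open[OF _ open_ball p]) (simp add: dG)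
    hence "deriv (deriv G) p = exp (h 0) * (2 * deriv h 0) * (\<sigma> * deriv W p) * (\<sigma> * deriv W p) + \<sigma> * deriv (deriv W) p * exp (h 0)"
      by (simp add: DERIV_imp_deriv Vp g'0)
    thus ?thesis unfolding dG[OF pb] Vp g'0 using \<sigma>(2) W'(2)[OF pb] by (simp add: field_simps)
  qed
  define K where "K = lam * (4 * (real n + 1) / (q * real n) * r * cos x) + 2 * cmod p / q"
  have "deriv (deriv G) p / deriv G p * v
      = of_real (lam * (r / q)) * (2 * deriv h 0 * vh) * (\<eta> * cnj \<eta>) + of_real (2 / q) * (cnj p * (cnj \<eta> * vh))"
    unfolding ratio Wp(3) unfolding Wp(2) v_def \<sigma>_def by (simp add: algebra_simps)
  moreover have "Im (of_real a * X * 1 + of_real b * (\<i> * of_real y)) = a * Im X + b * y" for a b y X by simp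
  ultimately have "Im (deriv (deriv G) p / deriv G p * v) = lam * (r / q) * Im (2 * deriv h 0 * vh) + 2 / q * cmod p"
    unfolding \<eta>c \<eta>p by (simp only:)
  also have "Im (2 * deriv h 0 * vh) = 4 * (real n + 1) / real n * cos x"
    unfolding h_def vh_def x_def by (rule extremal_direction(2)[OF n])
  also have "lam * (r / q) * (4 * (real n + 1) / real n * cos x) + 2 / q * cmod p = K"
    by (simp add: K_def)
  finally have ImK: "Im (deriv (deriv G) p / deriv G p * v) = K" .
  have "K \<ge> 0" unfolding K_def using lam q0 r cx by (intro add_nonneg_nonneg mult_nonneg_nonneg divide_nonneg_nonneg) auto
  hence "\<bar>curvature \<gamma> 0\<bar> = K" using par ImK unfolding lvl(3) by (elim disjE) auto
  thus ?thesis using that[OF adm nod t] unfolding K_def q_def x_def by simp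
qed

theorem theorem14:
  fixes n :: nat and r0 :: real and p :: complex
  assumes "n \<ge> 1" and "r0 > 0" and "p \<in> ball 0 r0"
  shows "(\<forall>u I \<gamma> t. admissible n r0 p u \<and> nodal_parametrization u (ball 0 r0) I \<gamma> \<and>
            t \<in> I \<and> \<gamma> t = p \<longrightarrow> \<bar>curvature \<gamma> t\<bar> \<le> curvature_bound n r0 p) \<and>
         (\<forall>C < curvature_bound n r0 p.
            \<exists>u I \<gamma> t. admissible n r0 p u \<and> nodal_parametrization u (ball 0 r0) I \<gamma> \<and>
              t \<in> I \<and> \<gamma> t = p \<and> \<bar>curvature \<gamma> t\<bar> > C)"
proof (intro conjI allI impI)
  fix u I \<gamma> t
  assume "admissible n r0 p u \<and> nodal_parametrization u (ball 0 r0) I \<gamma> \<and> t \<in> I \<and> \<gamma> t = p"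
  thus "\<bar>curvature \<gamma> t\<bar> \<le> curvature_bound n r0 p" using curvature_upper_bound[OF assms] by blast
next
  fix C assume C: "C < curvature_bound n r0 p"
  define B1 where "B1 = 4 * (real n + 1) / ((r0\<^sup>2 - (norm p)\<^sup>2) * real n) * r0 * cos (real n * alpha0 n)"
  define B2 where "B2 = 2 * norm p / (r0\<^sup>2 - (norm p)\<^sup>2)"
  have B: "curvature_bound n r0 p = B1 + B2" by (simp add: curvature_bound_def B1_def B2_def)
  have "cos (real n * alpha0 n) > 0" using alpha0_range[OF assms(1)] by (intro cos_gt_zero_pi) linarith+
  hence B1: "B1 > 0" unfolding B1_def using disc_map_r[of p r0] assms by (intro mult_pos_pos divide_pos_pos) auto
  \<comment> \<open>So close to 1 that the first summand loses at most half of the gap between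
    \<open>C\<close> and the bound; the maximum with \<open>1 / 2\<close> keeps it positive.\<close>
  define lam where "lam = max (1 / 2) (1 - (B1 + B2 - C) / (2 * B1))"
  have lam: "0 < lam" "lam < 1" using C B B1 by (auto simp: lam_def)
  have "B1 - (B1 + B2 - C) / 2 = (1 - (B1 + B2 - C) / (2 * B1)) * B1" using B1 by (simp add: field_simps)
  also have "\<dots> \<le> lam * B1" using B1 by (intro mult_right_mono) (auto simp: lam_def)
  finally have le: "B1 - (B1 + B2 - C) / 2 \<le> lam * B1" .
  have "C < y + B2" if "B1 - (B1 + B2 - C) / 2 \<le> y" for y
  proof -
    have "C < B1 + B2" using C unfolding B .
    moreover have "2 * (B1 - (B1 + B2 - C) / 2) \<le> 2 * y" using that by (rule mult_left_mono) simp
    ultimately show ?thesis by (simp add: field_simps)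
  qed
  from this[OF le] have gt: "C < lam * B1 + B2" .
  obtain u I \<gamma> t where "admissible n r0 p u" "nodal_parametrization u (ball 0 r0) I \<gamma>" "t \<in> I" "\<gamma> t = p"
    "\<bar>curvature \<gamma> t\<bar> = lam * B1 + B2"
    using curvature_bound_approached[OF assms(1,3) lam] unfolding B1_def B2_def by blast
  thus "\<exists>u I \<gamma> t. admissible n r0 p u \<and> nodal_parametrization u (ball 0 r0) I \<gamma> \<and>
              t \<in> I \<and> \<gamma> t = p \<and> \<bar>curvature \<gamma> t\<bar> > C" using gt by metis
qed

end
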